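(* Let $F\colon\mathcal C\to\mathcal D$ be a finite étale morphism of rigidly-compactly generated tensor-triangulated categories. Assume that both $\mathrm{Spc}(\mathcal C^c)$ and $\mathrm{Spc}(\mathcal D^c)$ are noetherian, and let $\varphi\colon\mathrm{Spc}(\mathcal D^c)\to\mathrm{Spc}(\mathcal C^c)$ denote the induced map. If $\mathcal P\in\mathrm{Spc}(\mathcal D^c)$ is a point such that $\varphi^{-1}(\{\varphi(\mathcal P)\})=\{\mathcal P\}$, then minimality at $\mathcal P$ in $\mathcal D$ implies minimality at $\varphi(\mathcal P)$ in $\mathcal C$.
   Context: A tensor-triangulated category is a triangulated category with a compatible closed symmetric monoidal structure $(\otimes,\mathbb 1)$; a tensor-triangulated functor is a triangulated strong symmetric monoidal functor. $\mathcal T$ is rigidly-compactly generated if it is compactly generated as a triangulated category (in particular has all small coproducts) and its compact objects coincide with its rigid (dualizable) objects. $\mathcal T^c$ is the full subcategory of compact objects. A coproduct-preserving tensor-triangulated functor $F\colon\mathcal C\to\mathcal D$ between rigidly-compactly generated tensor-triangulated categories is finite étale if there is a commutative separable algebra $A$ in $\mathcal C$ (separable: the multiplication $A\otimes A\to A$ admits a section of $A$-bimodules) whose underlying object is compact, and an equivalence of tensor-triangulated categories $\mathcal D\cong A\text{-}\mathrm{Mod}_{\mathcal C}$ (modules over $A$ in $\mathcal C$) under which $F$ becomes the extension-of-scalars functor $A\otimes-\colon\mathcal C\to A\text{-}\mathrm{Mod}_{\mathcal C}$. Such $F$ preserves compact objects, and $\varphi(\mathcal P)=\{x\in\mathcal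 C^c:F(x)\in\mathcal P\}$. $\mathrm{Spc}(\mathcal T^c)$ is the Balmer spectrum: the set of prime thick $\otimes$-ideals of $\mathcal T^c$, with the sets $\mathrm{supp}(x)=\{\mathcal P : x\notin\mathcal P\}$, $x\in\mathcal T^c$, as a basis of closed sets. A subset is Thomason if it is a union of closed subsets each with quasi-compact complement. For $Y$ Thomason put $\mathcal T^c_Y=\{x\in\mathcal T^c:\mathrm{supp}(x)\subseteq Y\}$; there is an (essentially unique) exact triangle $e_Y\to\mathbb 1\to f_Y\to\Sigma e_Y$ with $e_Y\otimes f_Y=0$ and $\mathrm{Ker}(f_Y\otimes-)=\mathrm{Loc}\langle\mathcal T^c_Y\rangle=e_Y\otimes\mathcal T$. If $\{\mathcal P\}=Y_1\cap Y_2^c$ with $Y_1,Y_2$ Thomason (always possible when the spectrum is noetherian), put $g(\mathcal P)=e_{Y_1}\otimes f_{Y_2}$ (independent of choices up to isomorphism). A localizing $\otimes$-ideal is a triangulated subcategory closed under coproducts and under tensoring with arbitrary objects. $\mathcal T$ has minimality at $\mathcal P$ if the localizing $\otimes$-ideal $\mathrm{Loc}_\otimes\langle g(\mathcal P)\rangle$ generated by $g(\mathcal P)$ is minimal, i.e. nonzero and containing no localizing $\otimes$-ideals other than $0$ and itself. *)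

theory Defs
  imports "HOL-Algebra.Free_Abelian_Groups" "HOL-Analysis.Abstract_Topology"
begin

section \<open>Universes\<close>

text \<open>
  A universe is a set \<open>U\<close> of uncountable strongly inaccessible cardinality; a set is small if its
  cardinality is below that of \<open>U\<close>. Every small family can be indexed by a small subset of \<open>U\<close>.
\<close>

definition inaccessible :: "'u set \<Rightarrow> bool" where
  "inaccessible U \<longleftrightarrow> natLeq <o |U| \<and> regularCard |U| \<and>
     (\<forall>A \<subseteq> U. |A| <o |U| \<longrightarrow> |Pow A| <o |U| )"

definition small :: "'u set \<Rightarrow> 'a set \<Rightarrow> bool" where
  "small U A \<longleftrightarrow> |A| <o |U|"


section \<open>Categories\<close>

record ('o, 'm) cat =
  Obj :: "'o set"
  Arr :: "'m set"
  Dom :: "'m \<Rightarrow> 'o"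
  Cod :: "'m \<Rightarrow> 'o"
  Ide :: "'o \<Rightarrow> 'm"
  Comp :: "'m \<Rightarrow> 'm \<Rightarrow> 'm" (infixr \<open>\<cdot>\<index>\<close> 75)

definition Hom :: "('o, 'm, 'z) cat_scheme \<Rightarrow> 'o \<Rightarrow> 'o \<Rightarrow> 'm set" where
  "Hom C X Y = {f \<in> Arr C. Dom C f = X \<and> Cod C f = Y}"

locale category =
  fixes C :: "('o, 'm, 'z) cat_scheme" (structure)
  assumes Dom_Obj: "f \<in> Arr C \<Longrightarrow> Dom C f \<in> Obj C"
    and Cod_Obj: "f \<in> Arr C \<Longrightarrow> Cod C f \<in> Obj C"
    and Ide_Hom: "X \<in> Obj C \<Longrightarrow> Ide C X \<in> Hom C X X"
    and Comp_Hom: "\<lbrakk>f \<in> Hom C X Y; g \<in> Hom C Y Z\<rbrakk> \<Longrightarrow> g \<cdot> f \<in> Hom C X Z"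
    and Comp_Ide: "f \<in> Hom C X Y \<Longrightarrow> f \<cdot> Ide C X = f"
    and Ide_Comp: "f \<in> Hom C X Y \<Longrightarrow> Ide C Y \<cdot> f = f"
    and Comp_assoc: "\<lbrakk>f \<in> Hom C W X; g \<in> Hom C X Y; h \<in> Hom C Y Z\<rbrakk>
                      \<Longrightarrow> h \<cdot> (g \<cdot> f) = (h \<cdot> g) \<cdot> f"

definition Iso :: "('o, 'm, 'z) cat_scheme \<Rightarrow> 'o \<Rightarrow> 'o \<Rightarrow> 'm set" where
  "Iso C X Y = {f \<in> Hom C X Y. \<exists>g \<in> Hom C Y X. g \<cdot> f = Ide C X \<and> f \<cdot> g = Ide C Y}"
  for C (structure)

definition Inv :: "('o, 'm, 'z) cat_scheme \<Rightarrow> 'm \<Rightarrow> 'm" where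
  "Inv C f = (THE g. g \<in> Hom C (Cod C f) (Dom C f) \<and>
                     g \<cdot> f = Ide C (Dom C f) \<and> f \<cdot> g = Ide C (Cod C f))"
  for C (structure)

definition isomorphic :: "('o, 'm, 'z) cat_scheme \<Rightarrow> 'o \<Rightarrow> 'o \<Rightarrow> bool" where
  "isomorphic C X Y \<longleftrightarrow> Iso C X Y \<noteq> {}"

definition zero_object :: "('o, 'm, 'z) cat_scheme \<Rightarrow> 'o \<Rightarrow> bool" where
  "zero_object C Z \<longleftrightarrow> Z \<in> Obj C \<and>
     (\<forall>X \<in> Obj C. (\<exists>!f. f \<in> Hom C X Z) \<and> (\<exists>!f. f \<in> Hom C Z X))"

definition is_coproduct ::
  "('o, 'm, 'z) cat_scheme \<Rightarrow> 'i set \<Rightarrow> ('i \<Rightarrow> 'o) \<Rightarrow> 'o \<Rightarrow> ('i \<Rightarrow> 'm) \<Rightarrow> bool" where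
  "is_coproduct C I X S inc \<longleftrightarrow> S \<in> Obj C \<and> (\<forall>i\<in>I. inc i \<in> Hom C (X i) S) \<and>
     (\<forall>Y \<in> Obj C. \<forall>f. (\<forall>i\<in>I. f i \<in> Hom C (X i) Y) \<longrightarrow>
        (\<exists>!h. h \<in> Hom C S Y \<and> (\<forall>i\<in>I. h \<cdot> inc i = f i)))"
  for C (structure)

definition is_binary_coproduct ::
  "('o, 'm, 'z) cat_scheme \<Rightarrow> 'o \<Rightarrow> 'o \<Rightarrow> 'o \<Rightarrow> bool" where
  "is_binary_coproduct C X Y S \<longleftrightarrow>
     (\<exists>inc. is_coproduct C (UNIV :: bool set) (\<lambda>b. if b then X else Y) S inc)"

definition is_functor ::
  "('o, 'm, 'z) cat_scheme \<Rightarrow> ('p, 'n, 'y) cat_scheme \<Rightarrow> ('o \<Rightarrow> 'p) \<Rightarrow> ('m \<Rightarrow> 'n) \<Rightarrow> bool" where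
  "is_functor C D Fo Fa \<longleftrightarrow>
     (\<forall>X \<in> Obj C. Fo X \<in> Obj D \<and> Fa (Ide C X) = Ide D (Fo X)) \<and>
     (\<forall>X Y. \<forall>f \<in> Hom C X Y. Fa f \<in> Hom D (Fo X) (Fo Y)) \<and>
     (\<forall>X Y Z. \<forall>f \<in> Hom C X Y. \<forall>g \<in> Hom C Y Z. Fa (g \<cdot>\<^bsub>C\<^esub> f) = Fa g \<cdot>\<^bsub>D\<^esub> Fa f)"

definition is_equivalence ::
  "('o, 'm, 'z) cat_scheme \<Rightarrow> ('p, 'n, 'y) cat_scheme \<Rightarrow> ('o \<Rightarrow> 'p) \<Rightarrow> ('m \<Rightarrow> 'n) \<Rightarrow> bool" where
  "is_equivalence C D Fo Fa \<longleftrightarrow> is_functor C D Fo Fa \<and>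
     (\<forall>X \<in> Obj C. \<forall>Y \<in> Obj C. bij_betw Fa (Hom C X Y) (Hom D (Fo X) (Fo Y))) \<and>
     (\<forall>Z \<in> Obj D. \<exists>X \<in> Obj C. isomorphic D (Fo X) Z)"


section \<open>Triangulated categories\<close>

record ('o, 'm) tricat = "('o, 'm) cat" +
  Add :: "'m \<Rightarrow> 'm \<Rightarrow> 'm"
  Zer :: "'o \<Rightarrow> 'o \<Rightarrow> 'm"
  ShO :: "'o \<Rightarrow> 'o"
  ShA :: "'m \<Rightarrow> 'm"
  Tri :: "('m \<times> 'm \<times> 'm) set"

definition hom_group :: "('o, 'm, 'z) tricat_scheme \<Rightarrow> 'o \<Rightarrow> 'o \<Rightarrow> 'm monoid" where
  "hom_group C X Y = \<lparr>carrier = Hom C X Y, monoid.mult = Add C, one = Zer C X Y\<rparr>"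

definition Neg :: "('o, 'm, 'z) tricat_scheme \<Rightarrow> 'm \<Rightarrow> 'm" where
  "Neg C f = inv\<^bsub>hom_group C (Dom C f) (Cod C f)\<^esub> f"

definition is_additive_functor ::
  "('o, 'm, 'z) tricat_scheme \<Rightarrow> ('p, 'n, 'y) tricat_scheme \<Rightarrow> ('o \<Rightarrow> 'p) \<Rightarrow> ('m \<Rightarrow> 'n) \<Rightarrow> bool" where
  "is_additive_functor C D Fo Fa \<longleftrightarrow> is_functor C D Fo Fa \<and>
     (\<forall>X \<in> Obj C. \<forall>Y \<in> Obj C. Fa \<in> hom (hom_group C X Y) (hom_group D (Fo X) (Fo Y)))"

locale additive_category = category C
  for C :: "('o, 'm, 'z) tricat_scheme" (structure) +
  assumes hom_comm_group: "\<lbrakk>X \<in> Obj C; Y \<in> Obj C\<rbrakk> \<Longrightarrow> comm_group (hom_group C X Y)"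
    and Comp_Add: "\<lbrakk>f \<in> Hom C X Y; f' \<in> Hom C X Y; g \<in> Hom C Y Z\<rbrakk>
                    \<Longrightarrow> g \<cdot> Add C f f' = Add C (g \<cdot> f) (g \<cdot> f')"
    and Add_Comp: "\<lbrakk>f \<in> Hom C X Y; g \<in> Hom C Y Z; g' \<in> Hom C Y Z\<rbrakk>
                    \<Longrightarrow> Add C g g' \<cdot> f = Add C (g \<cdot> f) (g' \<cdot> f)"
    and ex_zero_object: "\<exists>Z. zero_object C Z"
    and ex_binary_coproduct: "\<lbrakk>X \<in> Obj C; Y \<in> Obj C\<rbrakk> \<Longrightarrow> \<exists>S. is_binary_coproduct C X Y S"

text \<open>
  The shift is an auto-equivalence, not necessarily invertible on the nose; \<open>Tri_rotate\<close> is
  therefore stated as an equivalence, so that no inverse of the shift is needed.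
\<close>

locale triangulated_category = additive_category C
  for C :: "('o, 'm, 'z) tricat_scheme" (structure) +
  assumes Sh_additive: "is_additive_functor C C (ShO C) (ShA C)"
    and Sh_equivalence: "is_equivalence C C (ShO C) (ShA C)"
    and Tri_Hom: "(f, g, h) \<in> Tri C \<Longrightarrow>
          \<exists>X Y Z. f \<in> Hom C X Y \<and> g \<in> Hom C Y Z \<and> h \<in> Hom C Z (ShO C X)"
    and Tri_iso: "\<lbrakk>(f, g, h) \<in> Tri C;
          f \<in> Hom C X Y; g \<in> Hom C Y Z; h \<in> Hom C Z (ShO C X);
          f' \<in> Hom C X' Y'; g' \<in> Hom C Y' Z'; h' \<in> Hom C Z' (ShO C X');
          a \<in> Iso C X X'; b \<in> Iso C Y Y'; c \<in> Iso C Z Z';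
          b \<cdot> f = f' \<cdot> a; c \<cdot> g = g' \<cdot> b; ShA C a \<cdot> h = h' \<cdot> c\<rbrakk>
          \<Longrightarrow> (f', g', h') \<in> Tri C"
    and Tri_Ide: "\<lbrakk>X \<in> Obj C; zero_object C Z\<rbrakk>
          \<Longrightarrow> (Ide C X, Zer C X Z, Zer C Z (ShO C X)) \<in> Tri C"
    and Tri_cone: "f \<in> Arr C \<Longrightarrow> \<exists>g h. (f, g, h) \<in> Tri C"
    and Tri_rotate: "\<lbrakk>f \<in> Hom C X Y; g \<in> Hom C Y Z; h \<in> Hom C Z (ShO C X)\<rbrakk>
          \<Longrightarrow> (f, g, h) \<in> Tri C \<longleftrightarrow> (g, h, Neg C (ShA C f)) \<in> Tri C"
    and Tri_fill: "\<lbrakk>(f, g, h) \<in> Tri C; (f', g', h') \<in> Tri C;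
          f \<in> Hom C X Y; g \<in> Hom C Y Z; f' \<in> Hom C X' Y'; g' \<in> Hom C Y' Z';
          a \<in> Hom C X X'; b \<in> Hom C Y Y'; b \<cdot> f = f' \<cdot> a\<rbrakk>
          \<Longrightarrow> \<exists>c \<in> Hom C Z Z'. c \<cdot> g = g' \<cdot> b \<and> ShA C a \<cdot> h = h' \<cdot> c"
    and Tri_octahedral: "\<lbrakk>f \<in> Hom C X Y; g \<in> Hom C Y Z;
          (f, i, i') \<in> Tri C; i \<in> Hom C Y Z';
          (g, j, j') \<in> Tri C; j \<in> Hom C Z X';
          (g \<cdot> f, k, k') \<in> Tri C; k \<in> Hom C Z Y'\<rbrakk>
          \<Longrightarrow> \<exists>u \<in> Hom C Z' Y'. \<exists>v \<in> Hom C Y' X'.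
                (u, v, ShA C i \<cdot> j') \<in> Tri C \<and>
                u \<cdot> i = k \<cdot> g \<and> k' \<cdot> u = i' \<and> v \<cdot> k = j \<and> j' \<cdot> v = ShA C f \<cdot> k'"


section \<open>Tensor-triangulated categories\<close>

text \<open>
  \<open>Slf C X Y\<close> is the isomorphism from \<open>\<Sigma>X \<otimes> Y\<close> to \<open>\<Sigma>(X \<otimes> Y)\<close>.
\<close>

record ('o, 'm) ttcat = "('o, 'm) tricat" +
  TenO :: "'o \<Rightarrow> 'o \<Rightarrow> 'o" (infixr \<open>\<boxtimes>\<index>\<close> 80)
  TenA :: "'m \<Rightarrow> 'm \<Rightarrow> 'm" (infixr \<open>\<star>\<index>\<close> 80)
  Uni :: 'o
  Asc :: "'o \<Rightarrow> 'o \<Rightarrow> 'o \<Rightarrow> 'm"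
  Lun :: "'o \<Rightarrow> 'm"
  Run :: "'o \<Rightarrow> 'm"
  Swp :: "'o \<Rightarrow> 'o \<Rightarrow> 'm"
  Slf :: "'o \<Rightarrow> 'o \<Rightarrow> 'm"

locale closed_symmetric_monoidal_category = category C
  for C :: "('o, 'm, 'z) ttcat_scheme" (structure) +
  assumes TenO_Obj: "\<lbrakk>X \<in> Obj C; Y \<in> Obj C\<rbrakk> \<Longrightarrow> X \<boxtimes> Y \<in> Obj C"
    and TenA_Hom: "\<lbrakk>f \<in> Hom C X X'; g \<in> Hom C Y Y'\<rbrakk> \<Longrightarrow> f \<star> g \<in> Hom C (X \<boxtimes> Y) (X' \<boxtimes> Y')"
    and TenA_Ide: "\<lbrakk>X \<in> Obj C; Y \<in> Obj C\<rbrakk> \<Longrightarrow> Ide C X \<star> Ide C Y = Ide C (X \<boxtimes> Y)"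
    and TenA_Comp: "\<lbrakk>f \<in> Hom C X X'; f' \<in> Hom C X' X''; g \<in> Hom C Y Y'; g' \<in> Hom C Y' Y''\<rbrakk>
          \<Longrightarrow> (f' \<cdot> f) \<star> (g' \<cdot> g) = (f' \<star> g') \<cdot> (f \<star> g)"
    and Uni_Obj: "Uni C \<in> Obj C"
    and Asc_Iso: "\<lbrakk>X \<in> Obj C; Y \<in> Obj C; Z \<in> Obj C\<rbrakk>
          \<Longrightarrow> Asc C X Y Z \<in> Iso C ((X \<boxtimes> Y) \<boxtimes> Z) (X \<boxtimes> (Y \<boxtimes> Z))"
    and Lun_Iso: "X \<in> Obj C \<Longrightarrow> Lun C X \<in> Iso C (Uni C \<boxtimes> X) X"
    and Run_Iso: "X \<in> Obj C \<Longrightarrow> Run C X \<in> Iso C (X \<boxtimes> Uni C) X"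
    and Swp_Hom: "\<lbrakk>X \<in> Obj C; Y \<in> Obj C\<rbrakk> \<Longrightarrow> Swp C X Y \<in> Hom C (X \<boxtimes> Y) (Y \<boxtimes> X)"
    and Swp_Swp: "\<lbrakk>X \<in> Obj C; Y \<in> Obj C\<rbrakk> \<Longrightarrow> Swp C Y X \<cdot> Swp C X Y = Ide C (X \<boxtimes> Y)"
    and Asc_natural: "\<lbrakk>f \<in> Hom C X X'; g \<in> Hom C Y Y'; h \<in> Hom C Z Z'\<rbrakk>
          \<Longrightarrow> Asc C X' Y' Z' \<cdot> ((f \<star> g) \<star> h) = (f \<star> (g \<star> h)) \<cdot> Asc C X Y Z"
    and Lun_natural: "f \<in> Hom C X Y \<Longrightarrow> Lun C Y \<cdot> (Ide C (Uni C) \<star> f) = f \<cdot> Lun C X"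
    and Run_natural: "f \<in> Hom C X Y \<Longrightarrow> Run C Y \<cdot> (f \<star> Ide C (Uni C)) = f \<cdot> Run C X"
    and Swp_natural: "\<lbrakk>f \<in> Hom C X X'; g \<in> Hom C Y Y'\<rbrakk>
          \<Longrightarrow> Swp C X' Y' \<cdot> (f \<star> g) = (g \<star> f) \<cdot> Swp C X Y"
    and pentagon: "\<lbrakk>W \<in> Obj C; X \<in> Obj C; Y \<in> Obj C; Z \<in> Obj C\<rbrakk>
          \<Longrightarrow> Asc C W X (Y \<boxtimes> Z) \<cdot> Asc C (W \<boxtimes> X) Y Z
            = (Ide C W \<star> Asc C X Y Z) \<cdot> Asc C W (X \<boxtimes> Y) Z \<cdot> (Asc C W X Y \<star> Ide C Z)"
    and triangle: "\<lbrakk>X \<in> Obj C; Y \<in> Obj C\<rbrakk>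
          \<Longrightarrow> (Ide C X \<star> Lun C Y) \<cdot> Asc C X (Uni C) Y = Run C X \<star> Ide C Y"
    and hexagon: "\<lbrakk>X \<in> Obj C; Y \<in> Obj C; Z \<in> Obj C\<rbrakk>
          \<Longrightarrow> Asc C Y Z X \<cdot> Swp C X (Y \<boxtimes> Z) \<cdot> Asc C X Y Z
            = (Ide C Y \<star> Swp C X Z) \<cdot> Asc C Y X Z \<cdot> (Swp C X Y \<star> Ide C Z)"
    and closed: "\<lbrakk>X \<in> Obj C; Y \<in> Obj C\<rbrakk>
          \<Longrightarrow> \<exists>H \<in> Obj C. \<exists>ev \<in> Hom C (H \<boxtimes> X) Y. \<forall>W \<in> Obj C. \<forall>f \<in> Hom C (W \<boxtimes> X) Y.
                \<exists>!h. h \<in> Hom C W H \<and> ev \<cdot> (h \<star> Ide C X) = f"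

text \<open>
  Compatibility follows Hovey, Palmieri and Strickland, Axiomatic stable homotopy theory, A.2:
  the tensor product commutes coherently with the shift, is exact in each variable, and the
  symmetry on \<open>\<Sigma>\<one> \<otimes> \<Sigma>\<one>\<close> is \<open>-1\<close>. Exactness in the second variable follows by symmetry,
  and exactness of the internal hom in its second variable by adjunction; exactness of the internal
  hom in its first variable is not required.
\<close>

locale tensor_triangulated_category =
  triangulated_category C + closed_symmetric_monoidal_category C
  for C :: "('o, 'm, 'z) ttcat_scheme" (structure) +
  assumes TenA_Add: "\<lbrakk>f \<in> Hom C X Y; f' \<in> Hom C X Y; W \<in> Obj C\<rbrakk>
          \<Longrightarrow> Add C f f' \<star> Ide C W = Add C (f \<star> Ide C W) (f' \<star> Ide C W)"
    and Slf_Iso: "\<lbrakk>X \<in> Obj C; Y \<in> Obj C\<rbrakk>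
          \<Longrightarrow> Slf C X Y \<in> Iso C (ShO C X \<boxtimes> Y) (ShO C (X \<boxtimes> Y))"
    and Slf_natural: "\<lbrakk>f \<in> Hom C X X'; g \<in> Hom C Y Y'\<rbrakk>
          \<Longrightarrow> Slf C X' Y' \<cdot> (ShA C f \<star> g) = ShA C (f \<star> g) \<cdot> Slf C X Y"
    and Slf_Run: "X \<in> Obj C \<Longrightarrow> ShA C (Run C X) \<cdot> Slf C X (Uni C) = Run C (ShO C X)"
    and Slf_Asc: "\<lbrakk>X \<in> Obj C; Y \<in> Obj C; Z \<in> Obj C\<rbrakk>
          \<Longrightarrow> ShA C (Asc C X Y Z) \<cdot> Slf C (X \<boxtimes> Y) Z \<cdot> (Slf C X Y \<star> Ide C Z)
            = Slf C X (Y \<boxtimes> Z) \<cdot> Asc C (ShO C X) Y Z"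
    and TenA_Tri: "\<lbrakk>(f, g, h) \<in> Tri C; f \<in> Hom C X Y; W \<in> Obj C\<rbrakk>
          \<Longrightarrow> (f \<star> Ide C W, g \<star> Ide C W, Slf C X W \<cdot> (h \<star> Ide C W)) \<in> Tri C"
    and Swp_sign: "Swp C (ShO C (Uni C)) (ShO C (Uni C))
          = Neg C (Ide C (ShO C (Uni C) \<boxtimes> ShO C (Uni C)))"

text \<open>The induced isomorphism from \<open>X \<otimes> \<Sigma>Y\<close> to \<open>\<Sigma>(X \<otimes> Y)\<close>.\<close>

definition Srt :: "('o, 'm, 'z) ttcat_scheme \<Rightarrow> 'o \<Rightarrow> 'o \<Rightarrow> 'm" where
  "Srt C X Y = ShA C (Swp C Y X) \<cdot> Slf C Y X \<cdot> Swp C X (ShO C Y)"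
  for C (structure)

record ('o, 'm, 'p, 'n) ttfun =
  FunO :: "'o \<Rightarrow> 'p"
  FunA :: "'m \<Rightarrow> 'n"
  FunSh :: "'o \<Rightarrow> 'n"
  FunTen :: "'o \<Rightarrow> 'o \<Rightarrow> 'n"
  FunUni :: 'n

text \<open>
  The comparison isomorphisms of a functor \<open>F\<close> go from \<open>F(\<Sigma>X)\<close> to \<open>\<Sigma>(F X)\<close>, from \<open>F X \<otimes> F Y\<close> to
  \<open>F (X \<otimes> Y)\<close> and from \<open>\<one>\<close> to \<open>F \<one>\<close>.
\<close>

locale tensor_triangulated_functor =
  fixes C :: "('o, 'm, 'z) ttcat_scheme"
    and D :: "('p, 'n, 'y) ttcat_scheme" (structure)
    and F :: "('o, 'm, 'p, 'n) ttfun"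
  assumes Fun_additive: "is_additive_functor C D (FunO F) (FunA F)"
    and FunSh_Iso: "X \<in> Obj C \<Longrightarrow> FunSh F X \<in> Iso D (FunO F (ShO C X)) (ShO D (FunO F X))"
    and FunSh_natural: "f \<in> Hom C X Y
          \<Longrightarrow> FunSh F Y \<cdot> FunA F (ShA C f) = ShA D (FunA F f) \<cdot> FunSh F X"
    and Fun_Tri: "\<lbrakk>(f, g, h) \<in> Tri C; f \<in> Hom C X Y\<rbrakk>
          \<Longrightarrow> (FunA F f, FunA F g, FunSh F X \<cdot> FunA F h) \<in> Tri D"
    and FunTen_Iso: "\<lbrakk>X \<in> Obj C; Y \<in> Obj C\<rbrakk>
          \<Longrightarrow> FunTen F X Y \<in> Iso D (FunO F X \<boxtimes> FunO F Y) (FunO F (X \<boxtimes>\<^bsub>C\<^esub> Y))"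
    and FunTen_natural: "\<lbrakk>f \<in> Hom C X X'; g \<in> Hom C Y Y'\<rbrakk>
          \<Longrightarrow> FunTen F X' Y' \<cdot> (FunA F f \<star> FunA F g) = FunA F (f \<star>\<^bsub>C\<^esub> g) \<cdot> FunTen F X Y"
    and FunUni_Iso: "FunUni F \<in> Iso D (Uni D) (FunO F (Uni C))"
    and Fun_Asc: "\<lbrakk>X \<in> Obj C; Y \<in> Obj C; Z \<in> Obj C\<rbrakk>
          \<Longrightarrow> FunA F (Asc C X Y Z) \<cdot> FunTen F (X \<boxtimes>\<^bsub>C\<^esub> Y) Z \<cdot> (FunTen F X Y \<star> Ide D (FunO F Z))
            = FunTen F X (Y \<boxtimes>\<^bsub>C\<^esub> Z) \<cdot> (Ide D (FunO F X) \<star> FunTen F Y Z)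
                \<cdot> Asc D (FunO F X) (FunO F Y) (FunO F Z)"
    and Fun_Lun: "X \<in> Obj C \<Longrightarrow>
          FunA F (Lun C X) \<cdot> FunTen F (Uni C) X \<cdot> (FunUni F \<star> Ide D (FunO F X)) = Lun D (FunO F X)"
    and Fun_Run: "X \<in> Obj C \<Longrightarrow>
          FunA F (Run C X) \<cdot> FunTen F X (Uni C) \<cdot> (Ide D (FunO F X) \<star> FunUni F) = Run D (FunO F X)"
    and Fun_Swp: "\<lbrakk>X \<in> Obj C; Y \<in> Obj C\<rbrakk>
          \<Longrightarrow> FunA F (Swp C X Y) \<cdot> FunTen F X Y = FunTen F Y X \<cdot> Swp D (FunO F X) (FunO F Y)"

definition ttfun_comp ::
  "('q, 'l, 'x) ttcat_scheme \<Rightarrow> ('p, 'n, 'q, 'l) ttfun \<Rightarrow> ('o, 'm, 'p, 'n) ttfun \<Rightarrow> ('o, 'm, 'q, 'l) ttfun"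
where
  "ttfun_comp E G F =
     \<lparr>FunO = FunO G \<circ> FunO F,
      FunA = FunA G \<circ> FunA F,
      FunSh = (\<lambda>X. FunSh G (FunO F X) \<cdot> FunA G (FunSh F X)),
      FunTen = (\<lambda>X Y. FunA G (FunTen F X Y) \<cdot> FunTen G (FunO F X) (FunO F Y)),
      FunUni = FunA G (FunUni F) \<cdot> FunUni G\<rparr>"
  for E (structure)

definition ttfun_isomorphic ::
  "('o, 'm, 'z) ttcat_scheme \<Rightarrow> ('p, 'n, 'y) ttcat_scheme \<Rightarrow>
     ('o, 'm, 'p, 'n) ttfun \<Rightarrow> ('o, 'm, 'p, 'n) ttfun \<Rightarrow> bool" where
  "ttfun_isomorphic C D F G \<longleftrightarrow> (\<exists>t.
     (\<forall>X \<in> Obj C. t X \<in> Iso D (FunO F X) (FunO G X)) \<and>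
     (\<forall>X Y. \<forall>f \<in> Hom C X Y. t Y \<cdot> FunA F f = FunA G f \<cdot> t X) \<and>
     (\<forall>X \<in> Obj C. ShA D (t X) \<cdot> FunSh F X = FunSh G X \<cdot> t (ShO C X)) \<and>
     (\<forall>X \<in> Obj C. \<forall>Y \<in> Obj C. t (X \<boxtimes>\<^bsub>C\<^esub> Y) \<cdot> FunTen F X Y = FunTen G X Y \<cdot> (t X \<star> t Y)) \<and>
     t (Uni C) \<cdot> FunUni F = FunUni G)"
  for D (structure)

definition tensor_triangulated_equivalence ::
  "('o, 'm, 'z) ttcat_scheme \<Rightarrow> ('p, 'n, 'y) ttcat_scheme \<Rightarrow> ('o, 'm, 'p, 'n) ttfun \<Rightarrow> bool" where
  "tensor_triangulated_equivalence C D F \<longleftrightarrow>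
     tensor_triangulated_functor C D F \<and> is_equivalence C D (FunO F) (FunA F)"


section \<open>Rigidly-compactly generated categories\<close>

text \<open>
  An object is compact if, for every small coproduct, the canonical map from the direct sum of the
  groups of arrows into the summands to the group of arrows into the coproduct is bijective.
\<close>

definition compact_objects :: "'u set \<Rightarrow> ('o, 'm, 'z) tricat_scheme \<Rightarrow> 'o set" where
  "compact_objects U C = {X \<in> Obj C. \<forall>I Y S inc.
     I \<subseteq> U \<and> small U I \<and> (\<forall>i\<in>I. Y i \<in> Obj C) \<and> is_coproduct C I Y S inc \<longrightarrow>
     (\<lambda>p. gfinprod (hom_group C X S) (\<lambda>i. inc i \<cdot> p i) I)
       \<in> iso (sum_group I (\<lambda>i. hom_group C X (Y i))) (hom_group C X S)}"
  for C (structure)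

definition rigid_objects :: "('o, 'm, 'z) ttcat_scheme \<Rightarrow> 'o set" where
  "rigid_objects C = {X \<in> Obj C. \<exists>Y \<in> Obj C.
     \<exists>ev \<in> Hom C (Y \<boxtimes> X) (Uni C). \<exists>coev \<in> Hom C (Uni C) (X \<boxtimes> Y).
       Run C X \<cdot> (Ide C X \<star> ev) \<cdot> Asc C X Y X \<cdot> (coev \<star> Ide C X) = Lun C X \<and>
       Lun C Y \<cdot> (ev \<star> Ide C Y) \<cdot> Inv C (Asc C Y X Y) \<cdot> (Ide C Y \<star> coev) = Run C Y}"
  for C (structure)

text \<open>
  Generation: an object receiving no nonzero arrow from any shift (of either sign) of a generator
  is zero.
\<close>

locale compactly_generated = triangulated_category C
  for U :: "'u set" and C :: "('o, 'm, 'z) tricat_scheme" (structure) +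
  assumes small_Hom: "\<lbrakk>X \<in> Obj C; Y \<in> Obj C\<rbrakk> \<Longrightarrow> small U (Hom C X Y)"
    and ex_small_coproduct: "\<lbrakk>I \<subseteq> U; small U I; \<forall>i\<in>I. Xs i \<in> Obj C\<rbrakk>
          \<Longrightarrow> \<exists>S inc. is_coproduct C I Xs S inc"
    and ex_generators: "\<exists>G \<subseteq> compact_objects U C. small U G \<and>
          (\<forall>X \<in> Obj C. (\<forall>g\<in>G. \<forall>n::nat.
               Hom C ((ShO C ^^ n) g) X = {Zer C ((ShO C ^^ n) g) X} \<and>
               Hom C g ((ShO C ^^ n) X) = {Zer C g ((ShO C ^^ n) X)})
             \<longrightarrow> zero_object C X)"

locale rigidly_compactly_generated =
  tensor_triangulated_category C + compactly_generated U C
  for U :: "'u set" and C :: "('o, 'm, 'z) ttcat_scheme" (structure) +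
  assumes compact_eq_rigid: "compact_objects U C = rigid_objects C"


section \<open>Separable algebras and their modules\<close>

record ('o, 'm) alg =
  Und :: 'o
  Mul :: 'm
  Unt :: 'm

locale commutative_algebra =
  fixes C :: "('o, 'm, 'z) ttcat_scheme" (structure) and A :: "('o, 'm) alg"
  assumes Und_Obj: "Und A \<in> Obj C"
    and Mul_Hom: "Mul A \<in> Hom C (Und A \<boxtimes> Und A) (Und A)"
    and Unt_Hom: "Unt A \<in> Hom C (Uni C) (Und A)"
    and Mul_assoc: "Mul A \<cdot> (Mul A \<star> Ide C (Und A))
          = Mul A \<cdot> (Ide C (Und A) \<star> Mul A) \<cdot> Asc C (Und A) (Und A) (Und A)"
    and Mul_Unt_left: "Mul A \<cdot> (Unt A \<star> Ide C (Und A)) = Lun C (Und A)"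
    and Mul_Unt_right: "Mul A \<cdot> (Ide C (Und A) \<star> Unt A) = Run C (Und A)"
    and Mul_commute: "Mul A \<cdot> Swp C (Und A) (Und A) = Mul A"

definition separable :: "('o, 'm, 'z) ttcat_scheme \<Rightarrow> ('o, 'm) alg \<Rightarrow> bool" where
  "separable C A \<longleftrightarrow> (\<exists>s \<in> Hom C (Und A) (Und A \<boxtimes> Und A).
     Mul A \<cdot> s = Ide C (Und A) \<and>
     (Mul A \<star> Ide C (Und A)) \<cdot> Inv C (Asc C (Und A) (Und A) (Und A)) \<cdot> (Ide C (Und A) \<star> s)
       = s \<cdot> Mul A \<and>
     (Ide C (Und A) \<star> Mul A) \<cdot> Asc C (Und A) (Und A) (Und A) \<cdot> (s \<star> Ide C (Und A))
       = s \<cdot> Mul A)"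
  for C (structure)

text \<open>A module is a pair of an object \<open>X\<close> and an action, an arrow from \<open>A \<otimes> X\<close> to \<open>X\<close>.\<close>

definition modules :: "('o, 'm, 'z) ttcat_scheme \<Rightarrow> ('o, 'm) alg \<Rightarrow> ('o \<times> 'm) set" where
  "modules C A = {(X, a). X \<in> Obj C \<and> a \<in> Hom C (Und A \<boxtimes> X) X \<and>
     a \<cdot> (Mul A \<star> Ide C X) = a \<cdot> (Ide C (Und A) \<star> a) \<cdot> Asc C (Und A) (Und A) X \<and>
     a \<cdot> (Unt A \<star> Ide C X) = Lun C X}"
  for C (structure)

text \<open>Arrows between modules record their source and target, so that hom-sets are disjoint.\<close>

type_synonym ('o, 'm) module_arrow = "('o \<times> 'm) \<times> 'm \<times> ('o \<times> 'm)"

definition und :: "('o, 'm) module_arrow \<Rightarrow> 'm" where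
  "und f = fst (snd f)"

definition module_Hom ::
  "('o, 'm, 'z) ttcat_scheme \<Rightarrow> ('o, 'm) alg \<Rightarrow> 'o \<times> 'm \<Rightarrow> 'o \<times> 'm \<Rightarrow> ('o, 'm) module_arrow set" where
  "module_Hom C A M N = {(M, f, N) | f.
     f \<in> Hom C (fst M) (fst N) \<and> f \<cdot> snd M = snd N \<cdot> (Ide C (Und A) \<star> f)}"
  for C (structure)

text \<open>
  \<open>is_module_tensor C A M N T q\<close>: the module \<open>T\<close> together with \<open>q\<close> is the tensor product of \<open>M\<close> and
  \<open>N\<close> over \<open>A\<close>, the coequalizer of the two maps from \<open>(M \<otimes> A) \<otimes> N\<close> to \<open>M \<otimes> N\<close> given by the actions
  on \<open>M\<close> (turned into a right action by the symmetry) and on \<open>N\<close>, with the action induced from \<open>M\<close>.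
\<close>

definition is_module_tensor ::
  "('o, 'm, 'z) ttcat_scheme \<Rightarrow> ('o, 'm) alg \<Rightarrow> 'o \<times> 'm \<Rightarrow> 'o \<times> 'm \<Rightarrow> 'o \<times> 'm \<Rightarrow> 'm \<Rightarrow> bool" where
  "is_module_tensor C A M N T q \<longleftrightarrow> (case (M, N, T) of ((X, a), (Y, b), (Z, c)) \<Rightarrow>
     let l = (a \<cdot> Swp C X (Und A)) \<star> Ide C Y;
         r = (Ide C X \<star> b) \<cdot> Asc C X (Und A) Y
     in T \<in> modules C A \<and> q \<in> Hom C (X \<boxtimes> Y) Z \<and> q \<cdot> l = q \<cdot> r \<and>
        (\<forall>W \<in> Obj C. \<forall>f \<in> Hom C (X \<boxtimes> Y) W. f \<cdot> l = f \<cdot> r \<longrightarrow>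
           (\<exists>!h. h \<in> Hom C Z W \<and> h \<cdot> q = f)) \<and>
        c \<cdot> (Ide C (Und A) \<star> q) = q \<cdot> (a \<star> Ide C Y) \<cdot> Inv C (Asc C (Und A) X Y))"
  for C (structure)

definition module_tensor ::
  "('o, 'm, 'z) ttcat_scheme \<Rightarrow> ('o, 'm) alg \<Rightarrow> 'o \<times> 'm \<Rightarrow> 'o \<times> 'm \<Rightarrow> ('o \<times> 'm) \<times> 'm" where
  "module_tensor C A M N = (SOME Tq. is_module_tensor C A M N (fst Tq) (snd Tq))"

definition ModTen ::
  "('o, 'm, 'z) ttcat_scheme \<Rightarrow> ('o, 'm) alg \<Rightarrow> 'o \<times> 'm \<Rightarrow> 'o \<times> 'm \<Rightarrow> 'o \<times> 'm" where
  "ModTen C A M N = fst (module_tensor C A M N)"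

definition ModQuo ::
  "('o, 'm, 'z) ttcat_scheme \<Rightarrow> ('o, 'm) alg \<Rightarrow> 'o \<times> 'm \<Rightarrow> 'o \<times> 'm \<Rightarrow> 'm" where
  "ModQuo C A M N = snd (module_tensor C A M N)"

text \<open>The arrow from \<open>M\<close> to \<open>N\<close> whose composite with \<open>q\<close> (always an epimorphism) is \<open>f\<close>.\<close>

definition descend ::
  "('o, 'm, 'z) ttcat_scheme \<Rightarrow> ('o, 'm) alg \<Rightarrow> 'o \<times> 'm \<Rightarrow> 'o \<times> 'm \<Rightarrow> 'm \<Rightarrow> 'm \<Rightarrow>
     ('o, 'm) module_arrow" where
  "descend C A M N q f = (THE h. h \<in> module_Hom C A M N \<and> und h \<cdot> q = f)"
  for C (structure)

definition ModSh :: "('o, 'm, 'z) ttcat_scheme \<Rightarrow> ('o, 'm) alg \<Rightarrow> 'o \<times> 'm \<Rightarrow> 'o \<times> 'm" where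
  "ModSh C A M = (ShO C (fst M), ShA C (snd M) \<cdot> Srt C (Und A) (fst M))"
  for C (structure)

text \<open>
  The tensor-triangulated category of modules. A triangle of modules is distinguished if and only
  if the underlying triangle is; for separable \<open>A\<close> this is the unique triangulation for which
  extension of scalars and restriction of scalars are exact.
\<close>

definition Modules ::
  "('o, 'm, 'z) ttcat_scheme \<Rightarrow> ('o, 'm) alg \<Rightarrow> ('o \<times> 'm, ('o, 'm) module_arrow) ttcat" where
  "Modules C A =
     \<lparr>Obj = modules C A,
      Arr = (\<Union>M \<in> modules C A. \<Union>N \<in> modules C A. module_Hom C A M N),
      Dom = (\<lambda>f. fst f),
      Cod = (\<lambda>f. snd (snd f)),
      Ide = (\<lambda>M. (M, Ide C (fst M), M)),
      Comp = (\<lambda>g f. (fst f, und g \<cdot> und f, snd (snd g))),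
      Add = (\<lambda>f g. (fst f, Add C (und f) (und g), snd (snd f))),
      Zer = (\<lambda>M N. (M, Zer C (fst M) (fst N), N)),
      ShO = ModSh C A,
      ShA = (\<lambda>f. (ModSh C A (fst f), ShA C (und f), ModSh C A (snd (snd f)))),
      Tri = {(f, g, h) | f g h. \<exists>L \<in> modules C A. \<exists>M \<in> modules C A. \<exists>N \<in> modules C A.
               f \<in> module_Hom C A L M \<and> g \<in> module_Hom C A M N \<and>
               h \<in> module_Hom C A N (ModSh C A L) \<and> (und f, und g, und h) \<in> Tri C},
      TenO = ModTen C A,
      TenA = (\<lambda>f g. descend C A (ModTen C A (fst f) (fst g)) (ModTen C A (snd (snd f)) (snd (snd g)))
                (ModQuo C A (fst f) (fst g))
                (ModQuo C A (snd (snd f)) (snd (snd g)) \<cdot> (und f \<star> und g))),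
      Uni = (Und A, Mul A),
      Asc = (\<lambda>L M N. descend C A (ModTen C A (ModTen C A L M) N) (ModTen C A L (ModTen C A M N))
                (ModQuo C A (ModTen C A L M) N \<cdot> (ModQuo C A L M \<star> Ide C (fst N)))
                (ModQuo C A L (ModTen C A M N) \<cdot> (Ide C (fst L) \<star> ModQuo C A M N)
                   \<cdot> Asc C (fst L) (fst M) (fst N))),
      Lun = (\<lambda>M. descend C A (ModTen C A (Und A, Mul A) M) M (ModQuo C A (Und A, Mul A) M) (snd M)),
      Run = (\<lambda>M. descend C A (ModTen C A M (Und A, Mul A)) M (ModQuo C A M (Und A, Mul A))
                (snd M \<cdot> Swp C (fst M) (Und A))),
      Swp = (\<lambda>M N. descend C A (ModTen C A M N) (ModTen C A N M) (ModQuo C A M N)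
                (ModQuo C A N M \<cdot> Swp C (fst M) (fst N))),
      Slf = (\<lambda>M N. descend C A (ModTen C A (ModSh C A M) N) (ModSh C A (ModTen C A M N))
                (ModQuo C A (ModSh C A M) N)
                (ShA C (ModQuo C A M N) \<cdot> Slf C (fst M) (fst N)))\<rparr>"
  for C (structure)

definition free_module ::
  "('o, 'm, 'z) ttcat_scheme \<Rightarrow> ('o, 'm) alg \<Rightarrow> 'o \<Rightarrow> 'o \<times> 'm" where
  "free_module C A X =
     (Und A \<boxtimes> X, (Mul A \<star> Ide C X) \<cdot> Inv C (Asc C (Und A) (Und A) X))"
  for C (structure)

text \<open>The interchange isomorphism from \<open>(V \<otimes> W) \<otimes> (X \<otimes> Y)\<close> to \<open>(V \<otimes> X) \<otimes> (W \<otimes> Y)\<close>.\<close>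

definition interchange :: "('o, 'm, 'z) ttcat_scheme \<Rightarrow> 'o \<Rightarrow> 'o \<Rightarrow> 'o \<Rightarrow> 'o \<Rightarrow> 'm" where
  "interchange C V W X Y =
     Inv C (Asc C V X (W \<boxtimes> Y)) \<cdot> (Ide C V \<star> Asc C X W Y)
       \<cdot> (Ide C V \<star> (Swp C W X \<star> Ide C Y))
       \<cdot> (Ide C V \<star> Inv C (Asc C W X Y)) \<cdot> Asc C V W (X \<boxtimes> Y)"
  for C (structure)

definition extension_of_scalars ::
  "('o, 'm, 'z) ttcat_scheme \<Rightarrow> ('o, 'm) alg \<Rightarrow> ('o, 'm, 'o \<times> 'm, ('o, 'm) module_arrow) ttfun" where
  "extension_of_scalars C A =
     \<lparr>FunO = free_module C A,
      FunA = (\<lambda>f. (free_module C A (Dom C f), Ide C (Und A) \<star> f, free_module C A (Cod C f))),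
      FunSh = (\<lambda>X. (free_module C A (ShO C X), Srt C (Und A) X, ModSh C A (free_module C A X))),
      FunTen = (\<lambda>X Y. descend C A (ModTen C A (free_module C A X) (free_module C A Y))
                  (free_module C A (X \<boxtimes> Y))
                  (ModQuo C A (free_module C A X) (free_module C A Y))
                  ((Mul A \<star> Ide C (X \<boxtimes> Y)) \<cdot> interchange C (Und A) X (Und A) Y)),
      FunUni = ((Und A, Mul A), Inv C (Run C (Und A)), free_module C A (Uni C))\<rparr>"
  for C (structure)

definition preserves_small_coproducts ::
  "'u set \<Rightarrow> ('o, 'm, 'z) ttcat_scheme \<Rightarrow> ('p, 'n, 'y) ttcat_scheme \<Rightarrow> ('o, 'm, 'p, 'n) ttfun \<Rightarrow> bool" where
  "preserves_small_coproducts U C D F \<longleftrightarrow> (\<forall>I X S inc.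
     I \<subseteq> U \<and> small U I \<and> (\<forall>i\<in>I. X i \<in> Obj C) \<and> is_coproduct C I X S inc \<longrightarrow>
     is_coproduct D I (FunO F \<circ> X) (FunO F S) (FunA F \<circ> inc))"

definition finite_etale ::
  "'u set \<Rightarrow> ('o, 'm) ttcat \<Rightarrow> ('p, 'n) ttcat \<Rightarrow> ('o, 'm, 'p, 'n) ttfun \<Rightarrow> bool" where
  "finite_etale U C D F \<longleftrightarrow>
     rigidly_compactly_generated U C \<and> rigidly_compactly_generated U D \<and>
     tensor_triangulated_functor C D F \<and> preserves_small_coproducts U C D F \<and>
     (\<exists>A E. commutative_algebra C A \<and> separable C A \<and> Und A \<in> compact_objects U C \<and>
        tensor_triangulated_equivalence D (Modules C A) E \<and>
        ttfun_isomorphic C (Modules C A) (ttfun_comp (Modules C A) E F) (extension_of_scalars C A))"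


section \<open>The Balmer spectrum\<close>

text \<open>Full replete subcategories are represented by their sets of objects.\<close>

definition triangulated_subcategory :: "('o, 'm, 'z) tricat_scheme \<Rightarrow> 'o set \<Rightarrow> bool" where
  "triangulated_subcategory C S \<longleftrightarrow> S \<subseteq> Obj C \<and> {Z. zero_object C Z} \<subseteq> S \<and>
     (\<forall>X \<in> S. \<forall>Y \<in> Obj C. isomorphic C X Y \<longrightarrow> Y \<in> S) \<and>
     (\<forall>X \<in> Obj C. ShO C X \<in> S \<longleftrightarrow> X \<in> S) \<and>
     (\<forall>f g h. (f, g, h) \<in> Tri C \<and> Dom C f \<in> S \<and> Cod C f \<in> S \<longrightarrow> Cod C g \<in> S)"

definition thick_tensor_ideal :: "'u set \<Rightarrow> ('o, 'm, 'z) ttcat_scheme \<Rightarrow> 'o set \<Rightarrow> bool" where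
  "thick_tensor_ideal U C P \<longleftrightarrow> P \<subseteq> compact_objects U C \<and> triangulated_subcategory C P \<and>
     (\<forall>X \<in> Obj C. \<forall>Y \<in> Obj C. \<forall>S \<in> P. is_binary_coproduct C X Y S \<longrightarrow> X \<in> P) \<and>
     (\<forall>X \<in> compact_objects U C. \<forall>Y \<in> P. X \<boxtimes> Y \<in> P)"
  for C (structure)

definition Spc :: "'u set \<Rightarrow> ('o, 'm, 'z) ttcat_scheme \<Rightarrow> 'o set set" where
  "Spc U C = {P. thick_tensor_ideal U C P \<and> P \<noteq> compact_objects U C \<and>
     (\<forall>X \<in> compact_objects U C. \<forall>Y \<in> compact_objects U C. X \<boxtimes> Y \<in> P \<longrightarrow> X \<in> P \<or> Y \<in> P)}"
  for C (structure)

definition supp :: "'u set \<Rightarrow> ('o, 'm, 'z) ttcat_scheme \<Rightarrow> 'o \<Rightarrow> 'o set set" where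
  "supp U C X = {P \<in> Spc U C. X \<notin> P}"

definition Spc_topology :: "'u set \<Rightarrow> ('o, 'm, 'z) ttcat_scheme \<Rightarrow> 'o set topology" where
  "Spc_topology U C = topology_generated_by {Spc U C - supp U C X | X. X \<in> compact_objects U C}"

definition Spc_map ::
  "'u set \<Rightarrow> ('o, 'm, 'z) ttcat_scheme \<Rightarrow> ('o, 'm, 'p, 'n) ttfun \<Rightarrow> 'p set \<Rightarrow> 'o set" where
  "Spc_map U C F P = {X \<in> compact_objects U C. FunO F X \<in> P}"

definition noetherian_space :: "'a topology \<Rightarrow> bool" where
  "noetherian_space T \<longleftrightarrow>
     (\<forall>Z :: nat \<Rightarrow> 'a set. (\<forall>n. closedin T (Z n)) \<and> decseq Z \<longrightarrow> (\<exists>N. \<forall>n\<ge>N. Z n = Z N))"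

definition Thomason :: "'a topology \<Rightarrow> 'a set \<Rightarrow> bool" where
  "Thomason T Y \<longleftrightarrow>
     (\<exists>K. (\<forall>Z\<in>K. closedin T Z \<and> compactin T (topspace T - Z)) \<and> Y = \<Union>K)"


section \<open>Localizing ideals and minimality\<close>

definition localizing_subcategory :: "'u set \<Rightarrow> ('o, 'm, 'z) tricat_scheme \<Rightarrow> 'o set \<Rightarrow> bool" where
  "localizing_subcategory U C L \<longleftrightarrow> triangulated_subcategory C L \<and>
     (\<forall>I X S inc. I \<subseteq> U \<and> small U I \<and> (\<forall>i\<in>I. X i \<in> L) \<and> is_coproduct C I X S inc \<longrightarrow> S \<in> L)"

definition localizing_ideal :: "'u set \<Rightarrow> ('o, 'm, 'z) ttcat_scheme \<Rightarrow> 'o set \<Rightarrow> bool" where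
  "localizing_ideal U C L \<longleftrightarrow> localizing_subcategory U C L \<and> (\<forall>X \<in> Obj C. \<forall>Y \<in> L. X \<boxtimes> Y \<in> L)"
  for C (structure)

definition Loc :: "'u set \<Rightarrow> ('o, 'm, 'z) tricat_scheme \<Rightarrow> 'o set \<Rightarrow> 'o set" where
  "Loc U C S = \<Inter>{L. localizing_subcategory U C L \<and> S \<subseteq> L}"

definition Loc_tensor :: "'u set \<Rightarrow> ('o, 'm, 'z) ttcat_scheme \<Rightarrow> 'o set \<Rightarrow> 'o set" where
  "Loc_tensor U C S = \<Inter>{L. localizing_ideal U C L \<and> S \<subseteq> L}"

definition compact_supported ::
  "'u set \<Rightarrow> ('o, 'm, 'z) ttcat_scheme \<Rightarrow> 'o set set \<Rightarrow> 'o set" where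
  "compact_supported U C Y = {X \<in> compact_objects U C. supp U C X \<subseteq> Y}"

definition is_idempotent_triangle ::
  "'u set \<Rightarrow> ('o, 'm, 'z) ttcat_scheme \<Rightarrow> 'o set set \<Rightarrow> 'o \<Rightarrow> 'o \<Rightarrow> bool" where
  "is_idempotent_triangle U C Y e f \<longleftrightarrow>
     (\<exists>a \<in> Hom C e (Uni C). \<exists>b \<in> Hom C (Uni C) f. \<exists>c \<in> Hom C f (ShO C e). (a, b, c) \<in> Tri C) \<and>
     zero_object C (e \<boxtimes> f) \<and>
     {X \<in> Obj C. zero_object C (f \<boxtimes> X)} = Loc U C (compact_supported U C Y) \<and>
     Loc U C (compact_supported U C Y) = {X \<in> Obj C. \<exists>Z \<in> Obj C. isomorphic C X (e \<boxtimes> Z)}"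
  for C (structure)

text \<open>\<open>is_gamma U C P g\<close>: the object \<open>g\<close> is (a representative of) \<open>g(P)\<close>.\<close>

definition is_gamma :: "'u set \<Rightarrow> ('o, 'm, 'z) ttcat_scheme \<Rightarrow> 'o set \<Rightarrow> 'o \<Rightarrow> bool" where
  "is_gamma U C P g \<longleftrightarrow> (\<exists>Y1 Y2 e1 f1 e2 f2.
     Thomason (Spc_topology U C) Y1 \<and> Thomason (Spc_topology U C) Y2 \<and>
     {P} = Y1 \<inter> (Spc U C - Y2) \<and>
     is_idempotent_triangle U C Y1 e1 f1 \<and> is_idempotent_triangle U C Y2 e2 f2 \<and>
     g = e1 \<boxtimes> f2)"
  for C (structure)

definition minimal_localizing_ideal :: "'u set \<Rightarrow> ('o, 'm, 'z) ttcat_scheme \<Rightarrow> 'o set \<Rightarrow> bool" where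
  "minimal_localizing_ideal U C L \<longleftrightarrow> localizing_ideal U C L \<and> L \<noteq> {Z. zero_object C Z} \<and>
     (\<forall>M. localizing_ideal U C M \<and> M \<subseteq> L \<longrightarrow> M = {Z. zero_object C Z} \<or> M = L)"

text \<open>
  As \<open>g(P)\<close> is determined up to isomorphism, \<open>Loc_tensor U C {g}\<close> does not depend on the chosen
  representative \<open>g\<close>.
\<close>

definition minimality_at :: "'u set \<Rightarrow> ('o, 'm, 'z) ttcat_scheme \<Rightarrow> 'o set \<Rightarrow> bool" where
  "minimality_at U C P \<longleftrightarrow>
     (\<exists>g. is_gamma U C P g \<and> minimal_localizing_ideal U C (Loc_tensor U C {g}))"

end

theory Submission
  imports Defs
begin

text \<open>
  Let \<open>G\<close> be the right adjoint of \<open>F\<close>, restriction of scalars along the separable algebra \<open>A\<close>. It is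
  exact, preserves coproducts and satisfies \<open>G (d \<otimes> F c) = G d \<otimes> c\<close>, hence \<open>G (F c) = A \<otimes> c\<close>; and
  the unit is a retract of \<open>F A\<close> because \<open>A\<close> is separable. Put \<open>Q = \<phi>(P)\<close> and \<open>g = g(Q)\<close>, and let \<open>x\<close>
  be a compact object whose support is the closure of \<open>Q\<close>; then \<open>A\<close> does not lie in \<open>Q\<close>.

  The main device is that the annihilator \<open>{y. y \<otimes> T \<in> L}\<close> of an arbitrary object \<open>T\<close> modulo a
  localizing ideal \<open>L\<close> is a radical thick ideal of the compact objects, so it is contained in a prime
  that avoids any given compact object outside it. Applied in \<open>\<D>\<close>, where \<open>P\<close> is the only prime over \<open>Q\<close>,
  it shows that \<open>F g\<close> lies in the localizing ideal generated by \<open>g(P)\<close>. Applied in \<open>\<C>\<close>, it shows for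
  \<open>T\<close> in the ideal generated by \<open>g\<close> that \<open>A \<otimes> T \<in> L\<close> implies \<open>x \<otimes> T \<in> L\<close>, and then \<open>T \<in> L\<close>.

  Now let \<open>L\<close> be a localizing ideal inside the one generated by \<open>g\<close>, containing some \<open>t \<noteq> 0\<close>. Then
  \<open>A \<otimes> t \<noteq> 0\<close>, so \<open>F t \<noteq> 0\<close>; by minimality at \<open>P\<close> the object \<open>F g\<close> lies in the ideal generated by
  \<open>F t\<close>. Applying \<open>G\<close> gives \<open>A \<otimes> g \<in> L\<close>, hence \<open>g \<in> L\<close>.
\<close>

section \<open>Small sets\<close>

text \<open>The hypothesis at \<open>P\<close> speaks of an arbitrary representative of g(P), cut
  out by Thomason sets of which nothing else is known. So F g has to be absorbed by both idempotents
  of that representative without computing them. The fibre condition enters exactly here: a prime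
  that avoids F x and contains the image of Q can only be \<open>P\<close>.

  Passing from x \<otimes> T in L to T in L uses the left idempotent e of g. The objects whose
  product with T lies in L form a localizing ideal; it contains x, hence everything generated by
  compact objects supported on the closure of Q, hence e; and e \<otimes> T is T on the ideal
  generated by g. Annihilators are radical because compact objects are rigid: z is a retract of its
  product with its dual and z.

  The tensor product of modules is merely a chosen coequalizer. It is evaluated only with one factor
  free, where the coequalizer splits; all other structure is carried over by the equivalence, so no
  monoidal or triangulated axiom has to be proved for modules.

  The idempotent triangles of g(Q) are constructed, by localizing the unit at compact objects; the
  set-theoretic lemmas keep that construction small.\<close>

lemma small_subset: "small U B \<Longrightarrow> A \<subseteq> B \<Longrightarrow> small U A"
  unfolding small_def using card_of_mono1 ordLeq_ordLess_trans by blast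

lemma small_image: "small U A \<Longrightarrow> small U (f ` A)"
  unfolding small_def using card_of_image ordLeq_ordLess_trans by blast

lemma inaccessible_Cinfinite: "inaccessible U \<Longrightarrow> Cinfinite |U|"
  unfolding inaccessible_def cinfinite_def
  by (metis card_of_Card_order card_of_ordLeq_infinite Field_card_of Field_natLeq
      card_of_nat card_of_ordLeq_finite infinite_UNIV_nat ordIso_ordLeq_trans ordLess_imp_ordLeq)

text \<open>This is where regularity of \<open>|U|\<close> is used; it bounds the cells and the
  closures that are built later as small unions of small sets.\<close>

lemma small_UN:
  assumes "inaccessible U" "small U I" "\<And>i. i \<in> I \<Longrightarrow> small U (A i)"
  shows "small U (\<Union>i\<in>I. A i)"
  using assms inaccessible_Cinfinite regularCard_UNION_bound[of "|U|" I A]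
  unfolding small_def inaccessible_def by blast

lemma small_countable:
  assumes "inaccessible U" shows "small U (A :: nat set)"
proof -
  have "|A| \<le>o |UNIV :: nat set|" by simp
  also have "|UNIV :: nat set| =o natLeq" by (rule card_of_nat)
  finally show ?thesis
    using assms ordLeq_ordLess_trans unfolding small_def inaccessible_def by blast
qed

lemma small_finite:
  assumes "inaccessible U" "finite (A :: 'b set)" shows "small U A"
proof -
  obtain f :: "nat \<Rightarrow> 'b" and n where "A = f ` {i. i < n}"
    using assms(2) finite_imp_nat_seg_image_inj_on by metis
  then show ?thesis using small_image small_countable assms(1) by blast
qed

lemma small_Un:
  assumes "inaccessible U" "small U A" "small U B" shows "small U (A \<union> B)"
proof -
  have "small U (\<Union>b\<in>(UNIV::bool set). if b then A else B)"
    by (rule small_UN[OF assms(1) small_finite]) (use assms in auto)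
  moreover have "(\<Union>b\<in>(UNIV::bool set). if b then A else B) = A \<union> B"
    by (auto split: if_splits)
  ultimately show ?thesis by simp
qed

lemma small_Sigma:
  assumes "inaccessible U" "small U I" "\<And>i. i \<in> I \<Longrightarrow> small U (A i)"
  shows "small U (Sigma I A)"
proof -
  have "Sigma I A = (\<Union>i\<in>I. Pair i ` A i)" by auto
  moreover have "small U (\<Union>i\<in>I. Pair i ` A i)"
    by (rule small_UN[OF assms(1,2)]) (rule small_image[OF assms(3)])
  ultimately show ?thesis by simp
qed

text \<open>Coproducts and compactness are postulated only for index sets inside \<open>U\<close>.
  Reindexing along \<open>b\<close> extends them to index sets of any type, such as sets of pairs of
  a generator and an arrow.\<close>

lemma small_index:
  assumes "small U J" obtains I b where "I \<subseteq> U" "small U I" "bij_betw b I J"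
proof -
  obtain f where f: "inj_on f J" "f ` J \<subseteq> U"
    using assms card_of_ordLeq[of J U] ordLess_imp_ordLeq unfolding small_def by metis
  have "bij_betw (inv_into J f) (f ` J) J"
    using f(1) by (simp add: bij_betw_inv_into inj_on_imp_bij_betw)
  then show ?thesis using that[OF f(2) small_image[OF assms]] by blast
qed

section \<open>Categories\<close>

lemma Hom_iff: "f \<in> Hom C X Y \<longleftrightarrow> f \<in> Arr C \<and> Dom C f = X \<and> Cod C f = Y"
  by (simp add: Hom_def)

lemma HomD:
  assumes "f \<in> Hom C X Y" shows "f \<in> Arr C" "Dom C f = X" "Cod C f = Y"
  using assms by (auto simp: Hom_iff)

lemma IsoD:
  assumes "f \<in> Iso C X Y" shows "f \<in> Arr C" "Dom C f = X" "Cod C f = Y"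
  using assms by (auto simp: Iso_def Hom_iff)

lemma Iso_Hom: "f \<in> Iso C X Y \<Longrightarrow> f \<in> Hom C X Y"
  by (simp add: Iso_def)

lemma IsoI:
  fixes C (structure)
  assumes "f \<in> Hom C X Y" "g \<in> Hom C Y X" "g \<cdot> f = Ide C X" "f \<cdot> g = Ide C Y"
  shows "f \<in> Iso C X Y"
  using assms by (auto simp: Iso_def)

lemma isomorphicI: "f \<in> Iso C X Y \<Longrightarrow> isomorphic C X Y"
  by (auto simp: isomorphic_def)

context category
begin

text \<open>The rules of this group speak of \<open>Arr\<close>, \<open>Dom\<close> and
  \<open>Cod\<close> instead of \<open>Hom\<close>: their side conditions then contain no objects
  that rewriting would have to guess, and composability is decided by comparing a domain with a
  codomain.\<close>

lemma Dom_Obj'[simp]: "f \<in> Arr C \<Longrightarrow> Dom C f \<in> Obj C"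
  and Cod_Obj'[simp]: "f \<in> Arr C \<Longrightarrow> Cod C f \<in> Obj C"
  by (rule Dom_Obj Cod_Obj; assumption)+

lemma Hom_Obj: "f \<in> Hom C X Y \<Longrightarrow> X \<in> Obj C" "f \<in> Hom C X Y \<Longrightarrow> Y \<in> Obj C"
  by (auto simp: Hom_iff)

lemma Ide_typ[simp]:
  assumes "X \<in> Obj C"
  shows "Ide C X \<in> Arr C" "Dom C (Ide C X) = X" "Cod C (Ide C X) = X"
  using Ide_Hom[OF assms] by (auto simp: Hom_iff)

lemma Comp_typ[simp]:
  assumes "f \<in> Arr C" "g \<in> Arr C" "Cod C f = Dom C g"
  shows "g \<cdot> f \<in> Arr C" "Dom C (g \<cdot> f) = Dom C f" "Cod C (g \<cdot> f) = Cod C g"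
  using Comp_Hom[of f "Dom C f" "Cod C f" g "Cod C g"] assms by (auto simp: Hom_iff)

lemma Comp_Ide'[simp]: "f \<in> Arr C \<Longrightarrow> X = Dom C f \<Longrightarrow> f \<cdot> Ide C X = f"
  using Comp_Ide by (auto simp: Hom_iff)

lemma Ide_Comp'[simp]: "f \<in> Arr C \<Longrightarrow> X = Cod C f \<Longrightarrow> Ide C X \<cdot> f = f"
  using Ide_Comp by (auto simp: Hom_iff)

lemma Comp_assoc'[simp]:
  "\<lbrakk>f \<in> Arr C; g \<in> Arr C; h \<in> Arr C; Cod C f = Dom C g; Cod C g = Dom C h\<rbrakk>
    \<Longrightarrow> (h \<cdot> g) \<cdot> f = h \<cdot> (g \<cdot> f)"
  using Comp_assoc[of f "Dom C f" "Cod C f" g "Cod C g" h "Cod C h"] by (auto simp: Hom_iff)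

text \<open>Extends an equation \<open>a \<cdot> b = c\<close> to the right-nested composites that the simplifier produces.\<close>

lemma comp_red:
  "\<lbrakk>a \<cdot> b = c; a \<in> Arr C; b \<in> Arr C; Dom C a = Cod C b; k \<in> Arr C; Cod C k = Dom C b\<rbrakk>
    \<Longrightarrow> a \<cdot> (b \<cdot> k) = c \<cdot> k"
  using Comp_assoc' by metis

lemma Iso_unique:
  assumes "f \<in> Hom C X Y" "g \<in> Hom C Y X" "g \<cdot> f = Ide C X" "h \<in> Hom C Y X" "f \<cdot> h = Ide C Y"
  shows "h = g"
proof -
  have "h = (g \<cdot> f) \<cdot> h" using assms by (simp add: Hom_iff)
  also have "\<dots> = g \<cdot> (f \<cdot> h)" using assms by (intro Comp_assoc') (auto simp: Hom_iff)
  also have "\<dots> = g" using assms by (simp add: Hom_iff)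
  finally show ?thesis .
qed

lemma Inv_props:
  assumes "f \<in> Iso C X Y"
  shows "Inv C f \<in> Hom C Y X" "Inv C f \<cdot> f = Ide C X" "f \<cdot> Inv C f = Ide C Y"
proof -
  obtain g where g: "f \<in> Hom C X Y" "g \<in> Hom C Y X" "g \<cdot> f = Ide C X" "f \<cdot> g = Ide C Y"
    using assms by (auto simp: Iso_def)
  have "Inv C f = g" unfolding Inv_def
  proof (rule the_equality)
    show "g \<in> Hom C (Cod C f) (Dom C f) \<and> g \<cdot> f = Ide C (Dom C f) \<and> f \<cdot> g = Ide C (Cod C f)"
      using g by (simp add: Hom_iff)
    show "h = g" if "h \<in> Hom C (Cod C f) (Dom C f) \<and> h \<cdot> f = Ide C (Dom C f) \<and>
      f \<cdot> h = Ide C (Cod C f)" for h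
      using that HomD[OF g(1)] by (intro Iso_unique[OF g(1-3)]) auto
  qed
  then show "Inv C f \<in> Hom C Y X" "Inv C f \<cdot> f = Ide C X" "f \<cdot> Inv C f = Ide C Y"
    using g by auto
qed

lemma Inv_typ:
  assumes "f \<in> Iso C X Y"
  shows "Inv C f \<in> Arr C" "Dom C (Inv C f) = Y" "Cod C (Inv C f) = X"
  using Inv_props(1)[OF assms] by (auto simp: Hom_iff)

lemma Inv_cancel:
  assumes "f \<in> Iso C X Y"
  shows "k \<in> Arr C \<Longrightarrow> Cod C k = X \<Longrightarrow> Inv C f \<cdot> (f \<cdot> k) = k"
    "k \<in> Arr C \<Longrightarrow> Cod C k = Y \<Longrightarrow> f \<cdot> (Inv C f \<cdot> k) = k"
  using comp_red[OF Inv_props(2)[OF assms], of k] comp_red[OF Inv_props(3)[OF assms], of k]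
    Inv_typ[OF assms] IsoD[OF assms] by auto

lemma Inv_Iso: "f \<in> Iso C X Y \<Longrightarrow> Inv C f \<in> Iso C Y X"
  using Inv_props[of f X Y] IsoI[of "Inv C f"] Iso_Hom by metis

lemma Ide_Iso: "X \<in> Obj C \<Longrightarrow> Ide C X \<in> Iso C X X"
  by (rule IsoI[of _ _ _ _ "Ide C X"]) (auto simp: Hom_iff)

lemma Comp_Iso:
  assumes "f \<in> Iso C X Y" "g \<in> Iso C Y Z" shows "g \<cdot> f \<in> Iso C X Z"
  using IsoD[OF assms(1)] IsoD[OF assms(2)] Inv_cancel[OF assms(1)] Inv_cancel[OF assms(2)] Inv_props[OF assms(1)] Inv_props[OF assms(2)]
  by (intro IsoI[of _ _ _ _ "Inv C f \<cdot> Inv C g"]) (auto simp: Hom_iff)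

lemma isomorphic_refl: "X \<in> Obj C \<Longrightarrow> isomorphic C X X"
  and isomorphic_sym: "isomorphic C X Y \<Longrightarrow> isomorphic C Y X"
  and isomorphic_trans: "isomorphic C X Y \<Longrightarrow> isomorphic C Y Z \<Longrightarrow> isomorphic C X Z"
  using Ide_Iso Inv_Iso Comp_Iso unfolding isomorphic_def by blast+

lemma isomorphic_Obj: "isomorphic C X Y \<Longrightarrow> X \<in> Obj C \<and> Y \<in> Obj C"
  unfolding isomorphic_def Iso_def by (auto simp: Hom_iff)

lemma Iso_left_cancel:
  assumes "f \<in> Iso C X Y" "f \<cdot> a = f \<cdot> b" "a \<in> Arr C" "b \<in> Arr C" "Cod C a = X" "Cod C b = X"
  shows "a = b"
  using Inv_cancel(1)[OF assms(1)] assms by metis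

lemma Iso_right_cancel:
  assumes "f \<in> Iso C X Y" "a \<cdot> f = b \<cdot> f" "a \<in> Arr C" "b \<in> Arr C" "Dom C a = Y" "Dom C b = Y"
  shows "a = b"
proof -
  have "(x \<cdot> f) \<cdot> Inv C f = x" if "x \<in> Arr C" "Dom C x = Y" for x
    using that IsoD[OF assms(1)] Inv_typ[OF assms(1)] Inv_props[OF assms(1)] by simp
  then show ?thesis using assms by metis
qed

section \<open>Coproducts, and their transport along isomorphisms and reindexing\<close>

lemma coproduct_universal:
  assumes "is_coproduct C I X S inc" "Y \<in> Obj C" "\<And>i. i \<in> I \<Longrightarrow> f i \<in> Hom C (X i) Y"
  shows "\<exists>!h. h \<in> Hom C S Y \<and> (\<forall>i\<in>I. h \<cdot> inc i = f i)"
proof -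
  have "\<forall>Y \<in> Obj C. \<forall>f. (\<forall>i\<in>I. f i \<in> Hom C (X i) Y) \<longrightarrow>
        (\<exists>!h. h \<in> Hom C S Y \<and> (\<forall>i\<in>I. h \<cdot> inc i = f i))"
    using assms(1) unfolding is_coproduct_def by (elim conjE)
  from this[rule_format, OF assms(2), of f, OF assms(3)] show ?thesis .
qed

lemma coproduct_ext:
  assumes "is_coproduct C I X S inc" "h \<in> Hom C S Y" "k \<in> Hom C S Y"
    "\<And>i. i \<in> I \<Longrightarrow> h \<cdot> inc i = k \<cdot> inc i"
  shows "h = k"
proof -
  have inc: "\<And>i. i \<in> I \<Longrightarrow> inc i \<in> Hom C (X i) S" using assms(1) by (auto simp: is_coproduct_def)
  have Y: "Y \<in> Obj C" using assms(2) by (auto simp: Hom_iff)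
  have "\<exists>!l. l \<in> Hom C S Y \<and> (\<forall>i\<in>I. l \<cdot> inc i = h \<cdot> inc i)"
    by (rule coproduct_universal[OF assms(1) Y]) (rule Comp_Hom[OF inc assms(2)])
  then obtain l where "\<And>m. m \<in> Hom C S Y \<Longrightarrow> \<forall>i\<in>I. m \<cdot> inc i = h \<cdot> inc i \<Longrightarrow> m = l" by auto
  from this[of h] this[of k] show ?thesis using assms(2-4) by simp
qed

lemma coproduct_map:
  assumes "is_coproduct C I X S inc" "Y \<in> Obj C" "\<And>i. i \<in> I \<Longrightarrow> f i \<in> Hom C (X i) Y"
  obtains h where "h \<in> Hom C S Y" "\<And>i. i \<in> I \<Longrightarrow> h \<cdot> inc i = f i"
proof -
  have "\<exists>!h. h \<in> Hom C S Y \<and> (\<forall>i\<in>I. h \<cdot> inc i = f i)"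
    by (rule coproduct_universal[OF assms])
  then show ?thesis using that by auto
qed

lemma coproduct_inc:
  assumes "is_coproduct C I X S inc" "i \<in> I"
  shows "inc i \<in> Hom C (X i) S"
  using assms by (auto simp: is_coproduct_def)

lemma coproduct_Obj: "is_coproduct C I X S inc \<Longrightarrow> S \<in> Obj C"
  by (auto simp: is_coproduct_def)

lemma coproductI:
  assumes "S \<in> Obj C" "\<And>i. i \<in> I \<Longrightarrow> inc i \<in> Hom C (X i) S"
    "\<And>Y f. Y \<in> Obj C \<Longrightarrow> (\<And>i. i \<in> I \<Longrightarrow> f i \<in> Hom C (X i) Y) \<Longrightarrow>
      \<exists>h. h \<in> Hom C S Y \<and> (\<forall>i\<in>I. h \<cdot> inc i = f i)"
    "\<And>Y h k. h \<in> Hom C S Y \<Longrightarrow> k \<in> Hom C S Y \<Longrightarrow> (\<And>i. i \<in> I \<Longrightarrow> h \<cdot> inc i = k \<cdot> inc i)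
      \<Longrightarrow> h = k"
  shows "is_coproduct C I X S inc"
  unfolding is_coproduct_def
proof (intro conjI ballI allI impI)
  fix Y f assume Y: "Y \<in> Obj C" and f: "\<forall>i\<in>I. f i \<in> Hom C (X i) Y"
  from assms(3)[OF Y] f obtain h where "h \<in> Hom C S Y" "\<forall>i\<in>I. h \<cdot> inc i = f i" by blast
  then show "\<exists>!h. h \<in> Hom C S Y \<and> (\<forall>i\<in>I. h \<cdot> inc i = f i)"
    using assms(4)[of h Y] by (metis (no_types, lifting))
qed (use assms in auto)

lemma coproduct_reindex:
  assumes "bij_betw b I J" "is_coproduct C J X S inc"
  shows "is_coproduct C I (X \<circ> b) S (inc \<circ> b)"
proof (rule coproductI)
  show "S \<in> Obj C" using assms(2) by (rule coproduct_Obj)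
  show "(inc \<circ> b) i \<in> Hom C ((X \<circ> b) i) S" if "i \<in> I" for i
    using that assms coproduct_inc bij_betwE by fastforce
next
  fix Y f assume Y: "Y \<in> Obj C" and f: "\<And>i. i \<in> I \<Longrightarrow> f i \<in> Hom C ((X \<circ> b) i) Y"
  have "f (inv_into I b j) \<in> Hom C (X j) Y" if "j \<in> J" for j
    using f[of "inv_into I b j"] that assms(1)
    by (metis bij_betw_inv_into_right bij_betw_imp_surj_on comp_apply inv_into_into)
  then obtain h where h: "h \<in> Hom C S Y" "\<And>j. j \<in> J \<Longrightarrow> h \<cdot> inc j = f (inv_into I b j)"
    using coproduct_map[OF assms(2) Y, of "\<lambda>j. f (inv_into I b j)"] by blast
  then show "\<exists>h. h \<in> Hom C S Y \<and> (\<forall>i\<in>I. h \<cdot> (inc \<circ> b) i = f i)"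
    using assms(1) by (metis bij_betwE bij_betw_inv_into_left comp_apply)
next
  fix Y h k assume hk: "h \<in> Hom C S Y" "k \<in> Hom C S Y"
    and eq: "\<And>i. i \<in> I \<Longrightarrow> h \<cdot> (inc \<circ> b) i = k \<cdot> (inc \<circ> b) i"
  show "h = k"
  proof (rule coproduct_ext[OF assms(2) hk])
    fix j assume "j \<in> J"
    then obtain i where "i \<in> I" "j = b i" using bij_betw_imp_surj_on[OF assms(1)] by blast
    then show "h \<cdot> inc j = k \<cdot> inc j" using eq[of i] by simp
  qed
qed

lemma coproduct_iso_transport:
  assumes "is_coproduct C I X S inc" "t \<in> Iso C S S'"
  shows "is_coproduct C I X S' (\<lambda>i. t \<cdot> inc i)"
proof (rule coproductI)
  note t = IsoD[OF assms(2)] Inv_typ[OF assms(2)] Inv_props(2,3)[OF assms(2)] Inv_cancel[OF assms(2)]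
  have inc: "inc i \<in> Arr C" "Dom C (inc i) = X i" "Cod C (inc i) = S" if "i \<in> I" for i
    using coproduct_inc[OF assms(1) that] by (auto simp: Hom_iff)
  show "S' \<in> Obj C" using t by auto
  show "t \<cdot> inc i \<in> Hom C (X i) S'" if "i \<in> I" for i using inc[OF that] t by (auto simp: Hom_iff)
  show "\<exists>h. h \<in> Hom C S' Y \<and> (\<forall>i\<in>I. h \<cdot> t \<cdot> inc i = f i)"
    if Y: "Y \<in> Obj C" and f: "\<And>i. i \<in> I \<Longrightarrow> f i \<in> Hom C (X i) Y" for Y f
  proof -
    obtain h where "h \<in> Hom C S Y" "\<And>i. i \<in> I \<Longrightarrow> h \<cdot> inc i = f i"
      using coproduct_map[OF assms(1) Y f] by blast
    then show ?thesis using t inc by (intro exI[of _ "h \<cdot> Inv C t"]) (auto simp: Hom_iff)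
  qed
  show "h = k" if hk: "h \<in> Hom C S' Y" "k \<in> Hom C S' Y"
    and eq: "\<And>i. i \<in> I \<Longrightarrow> h \<cdot> t \<cdot> inc i = k \<cdot> t \<cdot> inc i" for Y h k
  proof -
    have "h \<cdot> t = k \<cdot> t"
      by (rule coproduct_ext[OF assms(1), of _ Y]) (use hk t inc eq in \<open>auto simp: Hom_iff\<close>)
    then show ?thesis using Iso_right_cancel[OF assms(2)] hk by (auto simp: Hom_iff)
  qed
qed

lemma coproduct_iso_objects:
  assumes S: "is_coproduct C I Z S inc" and t: "\<And>i. i \<in> I \<Longrightarrow> t i \<in> Iso C (Z' i) (Z i)"
  shows "is_coproduct C I Z' S (\<lambda>i. inc i \<cdot> t i)"
proof (rule coproductI)
  note inc = coproduct_inc[OF S]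
  show "S \<in> Obj C" using coproduct_Obj[OF S] .
  show "inc i \<cdot> t i \<in> Hom C (Z' i) S" if "i \<in> I" for i
    using Comp_Hom[OF Iso_Hom[OF t[OF that]] inc[OF that]] .
  show "\<exists>h. h \<in> Hom C S Y \<and> (\<forall>i\<in>I. h \<cdot> inc i \<cdot> t i = f i)"
    if Y: "Y \<in> Obj C" and f: "\<And>i. i \<in> I \<Longrightarrow> f i \<in> Hom C (Z' i) Y" for Y f
  proof -
    obtain h where h: "h \<in> Hom C S Y" "\<And>i. i \<in> I \<Longrightarrow> h \<cdot> inc i = f i \<cdot> Inv C (t i)"
      by (rule coproduct_map[OF S Y, of "\<lambda>i. f i \<cdot> Inv C (t i)"])
        (use Comp_Hom[OF Inv_props(1)[OF t] f] in auto)
    have "h \<cdot> inc i \<cdot> t i = f i" if i: "i \<in> I" for i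
    proof -
      have "h \<cdot> inc i \<cdot> t i = (h \<cdot> inc i) \<cdot> t i"
        using HomD[OF h(1)] HomD[OF inc[OF i]] IsoD[OF t[OF i]] by simp
      also have "\<dots> = f i \<cdot> (Inv C (t i) \<cdot> t i)" unfolding h(2)[OF i]
        using HomD[OF f[OF i]] Inv_typ[OF t[OF i]] IsoD[OF t[OF i]] by simp
      also have "\<dots> = f i" using Inv_props(2)[OF t[OF i]] HomD[OF f[OF i]] by simp
      finally show ?thesis .
    qed
    then show ?thesis using h(1) by blast
  qed
  show "h = k" if hk: "h \<in> Hom C S Y" "k \<in> Hom C S Y"
    and eq: "\<And>i. i \<in> I \<Longrightarrow> h \<cdot> inc i \<cdot> t i = k \<cdot> inc i \<cdot> t i" for Y h k
  proof (rule coproduct_ext[OF S hk])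
    fix i assume i: "i \<in> I"
    show "h \<cdot> inc i = k \<cdot> inc i"
      by (rule Iso_right_cancel[OF t[OF i]])
        (use eq[OF i] HomD[OF hk(1)] HomD[OF hk(2)] HomD[OF inc[OF i]] IsoD[OF t[OF i]] in auto)
  qed
qed

lemma coproduct_unique:
  assumes "is_coproduct C I X S inc" "is_coproduct C I X S' inc'"
  obtains t where "t \<in> Iso C S S'" "\<And>i. i \<in> I \<Longrightarrow> t \<cdot> inc i = inc' i"
proof -
  note i = coproduct_inc[OF assms(1)] and i' = coproduct_inc[OF assms(2)]
  obtain t where t: "t \<in> Hom C S S'" "\<And>i. i \<in> I \<Longrightarrow> t \<cdot> inc i = inc' i"
    using coproduct_map[OF assms(1) coproduct_Obj[OF assms(2)]] i' by blast
  obtain s where s: "s \<in> Hom C S' S" "\<And>i. i \<in> I \<Longrightarrow> s \<cdot> inc' i = inc i"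
    using coproduct_map[OF assms(2) coproduct_Obj[OF assms(1)]] i by blast
  have "s \<cdot> t = Ide C S" by (rule coproduct_ext[OF assms(1), of _ S])
    (use s t i in \<open>auto simp: Hom_iff\<close>)
  moreover have "t \<cdot> s = Ide C S'" by (rule coproduct_ext[OF assms(2), of _ S'])
    (use s t i' in \<open>auto simp: Hom_iff\<close>)
  ultimately have "t \<in> Iso C S S'" using IsoI s(1) t(1) by metis
  then show ?thesis using that t(2) by blast
qed

lemma coproduct_cong:
  assumes "is_coproduct C I X S inc" "\<And>i. i \<in> I \<Longrightarrow> X' i = X i" "\<And>i. i \<in> I \<Longrightarrow> inc' i = inc i"
  shows "is_coproduct C I X' S inc'"
  using assms unfolding is_coproduct_def by simp

end

section \<open>Functors and equivalences\<close>

lemma functorD: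
  assumes "is_functor C D Fo Fa"
  shows "X \<in> Obj C \<Longrightarrow> Fo X \<in> Obj D" "X \<in> Obj C \<Longrightarrow> Fa (Ide C X) = Ide D (Fo X)"
    "f \<in> Hom C X Y \<Longrightarrow> Fa f \<in> Hom D (Fo X) (Fo Y)"
    "f \<in> Arr C \<Longrightarrow> Fa f \<in> Arr D" "f \<in> Arr C \<Longrightarrow> Dom D (Fa f) = Fo (Dom C f)"
    "f \<in> Arr C \<Longrightarrow> Cod D (Fa f) = Fo (Cod C f)"
    "\<lbrakk>f \<in> Arr C; g \<in> Arr C; Cod C f = Dom C g\<rbrakk> \<Longrightarrow> Fa (g \<cdot>\<^bsub>C\<^esub> f) = Fa g \<cdot>\<^bsub>D\<^esub> Fa f"
proof -
  have *: "\<And>X Y f. f \<in> Hom C X Y \<Longrightarrow> Fa f \<in> Hom D (Fo X) (Fo Y)"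
    using assms unfolding is_functor_def by blast
  show "f \<in> Hom C X Y \<Longrightarrow> Fa f \<in> Hom D (Fo X) (Fo Y)" by (rule *)
  show "f \<in> Arr C \<Longrightarrow> Fa f \<in> Arr D" "f \<in> Arr C \<Longrightarrow> Dom D (Fa f) = Fo (Dom C f)"
    "f \<in> Arr C \<Longrightarrow> Cod D (Fa f) = Fo (Cod C f)"
    using *[of f "Dom C f" "Cod C f"] by (auto simp: Hom_iff)
  show "\<lbrakk>f \<in> Arr C; g \<in> Arr C; Cod C f = Dom C g\<rbrakk> \<Longrightarrow> Fa (g \<cdot>\<^bsub>C\<^esub> f) = Fa g \<cdot>\<^bsub>D\<^esub> Fa f"
    using assms Hom_iff unfolding is_functor_def by metis
qed (use assms in \<open>auto simp: is_functor_def\<close>)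

lemma functor_Iso:
  assumes "is_functor C D Fo Fa" "f \<in> Iso C X Y" "category C"
  shows "Fa f \<in> Iso D (Fo X) (Fo Y)"
proof -
  obtain g where g: "f \<in> Hom C X Y" "g \<in> Hom C Y X" "g \<cdot>\<^bsub>C\<^esub> f = Ide C X" "f \<cdot>\<^bsub>C\<^esub> g = Ide C Y"
    using assms by (auto simp: Iso_def)
  have "X \<in> Obj C" "Y \<in> Obj C" using category.Hom_Obj[OF assms(3) g(1)] by auto
  then show ?thesis
    using g functorD[OF assms(1)] functorD(7)[OF assms(1), of f g] functorD(7)[OF assms(1), of g f]
    by (intro IsoI[of _ _ _ _ "Fa g"]) (auto simp: Hom_iff)
qed

lemma functor_isomorphic:
  assumes "is_functor C D Fo Fa" "isomorphic C X Y" "category C"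
  shows "isomorphic D (Fo X) (Fo Y)"
  using functor_Iso[OF assms(1) _ assms(3)] assms(2) unfolding isomorphic_def by blast

lemma equivalence_lift:
  assumes "is_equivalence C D Fo Fa" "X \<in> Obj C" "Y \<in> Obj C" "g \<in> Hom D (Fo X) (Fo Y)"
  obtains f where "f \<in> Hom C X Y" "Fa f = g"
  using assms unfolding is_equivalence_def bij_betw_def by (metis imageE)

lemma equivalence_faithful:
  assumes "is_equivalence C D Fo Fa" "f \<in> Hom C X Y" "g \<in> Hom C X Y" "Fa f = Fa g" "category C"
  shows "f = g"
  using assms category.Hom_Obj[OF assms(5,2)]
  unfolding is_equivalence_def bij_betw_def by (metis inj_onD)

lemma equivalence_isomorphicD:
  assumes "is_equivalence C D Fo Fa" "X \<in> Obj C" "Y \<in> Obj C" "isomorphic D (Fo X) (Fo Y)"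
    "category C" "category D"
  shows "isomorphic C X Y"
proof -
  interpret C: category C by fact
  interpret D: category D by fact
  have F: "is_functor C D Fo Fa" using assms(1) by (simp add: is_equivalence_def)
  note FD = functorD[OF F]
  obtain u v where u: "u \<in> Hom D (Fo X) (Fo Y)" "v \<in> Hom D (Fo Y) (Fo X)"
    "v \<cdot>\<^bsub>D\<^esub> u = Ide D (Fo X)" "u \<cdot>\<^bsub>D\<^esub> v = Ide D (Fo Y)"
    using assms(4) by (auto simp: isomorphic_def Iso_def)
  obtain f where f: "f \<in> Hom C X Y" "Fa f = u" using equivalence_lift[OF assms(1-3) u(1)] by blast
  obtain g where g: "g \<in> Hom C Y X" "Fa g = v" using equivalence_lift[OF assms(1,3,2) u(2)] by blast
  have "g \<cdot>\<^bsub>C\<^esub> f = Ide C X"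
    by (rule equivalence_faithful[OF assms(1), of _ X X])
      (use f g u FD(2,7) assms in \<open>auto simp: Hom_iff\<close>)
  moreover have "f \<cdot>\<^bsub>C\<^esub> g = Ide C Y"
    by (rule equivalence_faithful[OF assms(1), of _ Y Y])
      (use f g u FD(2,7) assms in \<open>auto simp: Hom_iff\<close>)
  ultimately show ?thesis using IsoI[OF f(1) g(1)] isomorphicI by metis
qed

lemma equivalence_coproduct_reflect:
  assumes E: "is_equivalence C D Fo Fa" and "category C" "category D"
    and S: "is_coproduct D I (Fo \<circ> X) (Fo S) (Fa \<circ> inc)" and SO: "S \<in> Obj C"
    and inc: "\<And>i. i \<in> I \<Longrightarrow> inc i \<in> Hom C (X i) S"
  shows "is_coproduct C I X S inc"
proof -
  interpret C: category C by fact
  interpret D: category D by fact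
  have F: "is_functor C D Fo Fa" using E by (simp add: is_equivalence_def)
  note FD = functorD[OF F]
  have Fc: "Fa (h \<cdot>\<^bsub>C\<^esub> inc i) = Fa h \<cdot>\<^bsub>D\<^esub> (Fa \<circ> inc) i" if "h \<in> Hom C S Y" "i \<in> I" for h Y i
    using FD(7)[of "inc i" h] HomD[OF inc[OF that(2)]] HomD[OF that(1)] by simp
  show ?thesis
  proof (rule C.coproductI[OF SO inc])
    fix Y f assume Y: "Y \<in> Obj C" and f: "\<And>i. i \<in> I \<Longrightarrow> f i \<in> Hom C (X i) Y"
    obtain k where k: "k \<in> Hom D (Fo S) (Fo Y)" "\<And>i. i \<in> I \<Longrightarrow> k \<cdot>\<^bsub>D\<^esub> (Fa \<circ> inc) i = Fa (f i)"
      by (rule D.coproduct_map[OF S FD(1)[OF Y], of "\<lambda>i. Fa (f i)"]) (use FD(3)[OF f] in auto)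
    obtain h where h: "h \<in> Hom C S Y" "Fa h = k" by (rule equivalence_lift[OF E SO Y k(1)])
    have "h \<cdot>\<^bsub>C\<^esub> inc i = f i" if i: "i \<in> I" for i
      by (rule equivalence_faithful[OF E C.Comp_Hom[OF inc[OF i] h(1)] f[OF i] _ assms(2)])
        (use Fc[OF h(1) i] h(2) k(2)[OF i] in simp)
    then show "\<exists>h. h \<in> Hom C S Y \<and> (\<forall>i\<in>I. h \<cdot>\<^bsub>C\<^esub> inc i = f i)" using h(1) by blast
  next
    fix Y h k assume hk: "h \<in> Hom C S Y" "k \<in> Hom C S Y" and eq: "\<And>i. i \<in> I \<Longrightarrow> h \<cdot>\<^bsub>C\<^esub> inc i = k \<cdot>\<^bsub>C\<^esub> inc i"
    have "Fa h = Fa k"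
      by (rule D.coproduct_ext[OF S FD(3)[OF hk(1)] FD(3)[OF hk(2)]]) (use Fc[OF hk(1)] Fc[OF hk(2)] eq in auto)
    then show "h = k" by (rule equivalence_faithful[OF E hk _ assms(2)])
  qed
qed

text \<open>By essential surjectivity a target \<open>Z\<close> is isomorphic to some
  \<open>Fo Y\<close>; through that isomorphism cocones to \<open>Z\<close> come from cocones to
  \<open>Y\<close> in the source category, and so do their mediating arrows.\<close>

lemma equivalence_coproduct:
  assumes "is_equivalence C D Fo Fa" "category C" "category D"
    "is_coproduct C I X S inc" "\<And>i. i \<in> I \<Longrightarrow> X i \<in> Obj C"
  shows "is_coproduct D I (Fo \<circ> X) (Fo S) (Fa \<circ> inc)"
proof -
  interpret C: category C by fact
  interpret D: category D by fact
  have F: "is_functor C D Fo Fa" using assms(1) by (simp add: is_equivalence_def)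
  note FD = functorD[OF F]
  have S: "S \<in> Obj C" using C.coproduct_Obj[OF assms(4)] .
  note inc = C.coproduct_inc[OF assms(4)]
  have ess: "\<exists>Y t. Y \<in> Obj C \<and> t \<in> Iso D (Fo Y) Z" if "Z \<in> Obj D" for Z
    using assms(1) that unfolding is_equivalence_def isomorphic_def by blast
  show ?thesis
  proof (rule D.coproductI)
    show "Fo S \<in> Obj D" using FD(1)[OF S] .
    show "(Fa \<circ> inc) i \<in> Hom D ((Fo \<circ> X) i) (Fo S)" if "i \<in> I" for i using FD(3) inc[OF that] by simp
  next
    fix Z f assume Z: "Z \<in> Obj D" and f: "\<And>i. i \<in> I \<Longrightarrow> f i \<in> Hom D ((Fo \<circ> X) i) Z"
    obtain Y t where Y: "Y \<in> Obj C" and t: "t \<in> Iso D (Fo Y) Z" using ess[OF Z] by blast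
    note tt = IsoD[OF t] D.Inv_typ[OF t] D.Inv_props(2,3)[OF t] D.Inv_cancel[OF t]
    have "\<exists>g. g \<in> Hom C (X i) Y \<and> Fa g = Inv D t \<cdot>\<^bsub>D\<^esub> f i" if i: "i \<in> I" for i
      using equivalence_lift[OF assms(1) assms(5)[OF i] Y, of "Inv D t \<cdot>\<^bsub>D\<^esub> f i"]
        f[OF i] tt by (auto simp: Hom_iff)
    then obtain g where g: "\<And>i. i \<in> I \<Longrightarrow> g i \<in> Hom C (X i) Y \<and> Fa (g i) = Inv D t \<cdot>\<^bsub>D\<^esub> f i" by metis
    obtain h where h: "h \<in> Hom C S Y" "\<And>i. i \<in> I \<Longrightarrow> h \<cdot>\<^bsub>C\<^esub> inc i = g i"
      using C.coproduct_map[OF assms(4) Y, of g] g by blast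
    have "(t \<cdot>\<^bsub>D\<^esub> Fa h) \<cdot>\<^bsub>D\<^esub> (Fa \<circ> inc) i = f i" if i: "i \<in> I" for i
    proof -
      have "Fa h \<cdot>\<^bsub>D\<^esub> Fa (inc i) = Inv D t \<cdot>\<^bsub>D\<^esub> f i"
        using FD(7)[of "inc i" h] h inc[OF i] g[OF i] i by (simp add: Hom_iff)
      then show ?thesis using h tt f[OF i] inc[OF i] FD by (simp add: Hom_iff)
    qed
    then show "\<exists>h. h \<in> Hom D (Fo S) Z \<and> (\<forall>i\<in>I. h \<cdot>\<^bsub>D\<^esub> (Fa \<circ> inc) i = f i)"
      using h tt FD by (intro exI[of _ "t \<cdot>\<^bsub>D\<^esub> Fa h"]) (auto simp: Hom_iff)
  next
    fix Z h k assume hk: "h \<in> Hom D (Fo S) Z" "k \<in> Hom D (Fo S) Z"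
      and eq: "\<And>i. i \<in> I \<Longrightarrow> h \<cdot>\<^bsub>D\<^esub> (Fa \<circ> inc) i = k \<cdot>\<^bsub>D\<^esub> (Fa \<circ> inc) i"
    obtain Y t where Y: "Y \<in> Obj C" and t: "t \<in> Iso D (Fo Y) Z"
      using ess[of Z] hk(1) by (auto simp: Hom_iff)
    note tt = IsoD[OF t] D.Inv_typ[OF t] D.Inv_props(2,3)[OF t] D.Inv_cancel[OF t]
    obtain h' where h': "h' \<in> Hom C S Y" "Fa h' = Inv D t \<cdot>\<^bsub>D\<^esub> h"
      using equivalence_lift[OF assms(1) S Y, of "Inv D t \<cdot>\<^bsub>D\<^esub> h"] hk tt by (auto simp: Hom_iff)
    obtain k' where k': "k' \<in> Hom C S Y" "Fa k' = Inv D t \<cdot>\<^bsub>D\<^esub> k"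
      using equivalence_lift[OF assms(1) S Y, of "Inv D t \<cdot>\<^bsub>D\<^esub> k"] hk tt by (auto simp: Hom_iff)
    have "h' = k'"
    proof (rule C.coproduct_ext[OF assms(4) h'(1) k'(1)])
      fix i assume i: "i \<in> I"
      have "Fa (h' \<cdot>\<^bsub>C\<^esub> inc i) = Fa (k' \<cdot>\<^bsub>C\<^esub> inc i)"
        using FD(7)[of "inc i" h'] FD(7)[of "inc i" k'] FD(4-6) h' k' inc[OF i] eq[OF i] hk tt
        by (simp add: Hom_iff)
      then show "h' \<cdot>\<^bsub>C\<^esub> inc i = k' \<cdot>\<^bsub>C\<^esub> inc i"
        using equivalence_faithful[OF assms(1), of "h' \<cdot>\<^bsub>C\<^esub> inc i" "X i" Y "k' \<cdot>\<^bsub>C\<^esub> inc i"]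
          inc[OF i] h' k' assms(2) by (auto simp: Hom_iff)
    qed
    then have "Inv D t \<cdot>\<^bsub>D\<^esub> h = Inv D t \<cdot>\<^bsub>D\<^esub> k" using h' k' by simp
    then show "h = k" using D.Iso_left_cancel[OF D.Inv_Iso[OF t]] hk by (auto simp: Hom_iff)
  qed
qed

section \<open>Additive categories\<close>

text \<open>The idempotent of the coproduct that projects onto the summands indexed by
  \<open>F\<close>. An arrow factors through finitely many summands exactly if the idempotent of
  some finite \<open>F\<close> fixes it, so compactness can be stated without choosing partial
  coproducts.\<close>

definition coproduct_part :: "('o, 'm, 'z) tricat_scheme \<Rightarrow> 'i set \<Rightarrow> ('i \<Rightarrow> 'o) \<Rightarrow> 'o \<Rightarrow> ('i \<Rightarrow> 'm) \<Rightarrow> 'i set \<Rightarrow> 'm" where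
  "coproduct_part C I X S inc F = (THE h. h \<in> Hom C S S \<and>
     (\<forall>i\<in>I. h \<cdot> inc i = (if i \<in> F then inc i else Zer C (X i) S)))"
  for C (structure)

definition coproduct_proj :: "('o, 'm, 'z) tricat_scheme \<Rightarrow> 'i set \<Rightarrow> ('i \<Rightarrow> 'o) \<Rightarrow> 'o \<Rightarrow> ('i \<Rightarrow> 'm) \<Rightarrow> 'i \<Rightarrow> 'm" where
  "coproduct_proj C I X S inc j = (THE h. h \<in> Hom C S (X j) \<and>
     (\<forall>i\<in>I. h \<cdot> inc i = (if i = j then Ide C (X i) else Zer C (X i) (X j))))"
  for C (structure)

text \<open>Retracts rather than direct summands: the notion is equational, so every functor
  preserves it. In a triangulated category \<open>retract_summand\<close> recovers a
  complement.\<close>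

definition retract :: "('o, 'm, 'z) cat_scheme \<Rightarrow> 'o \<Rightarrow> 'o \<Rightarrow> bool" where
  "retract C X Y \<longleftrightarrow> (\<exists>i \<in> Hom C X Y. \<exists>p \<in> Hom C Y X. p \<cdot> i = Ide C X)"
  for C (structure)

context category
begin

lemma retract_trans: "retract C X Y \<Longrightarrow> retract C Y Z \<Longrightarrow> retract C X Z"
proof -
  assume "retract C X Y" "retract C Y Z"
  then obtain i p j q where "i \<in> Hom C X Y" "p \<in> Hom C Y X" "p \<cdot> i = Ide C X"
    "j \<in> Hom C Y Z" "q \<in> Hom C Z Y" "q \<cdot> j = Ide C Y" by (auto simp: retract_def)
  then show ?thesis unfolding retract_def
    using comp_red[of q j "Ide C Y" i]
    by (intro bexI[of _ "j \<cdot> i"] bexI[of _ "p \<cdot> q"]) (auto simp: Hom_iff)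
qed

lemma isomorphic_retract: "isomorphic C X Y \<Longrightarrow> retract C X Y"
  unfolding isomorphic_def retract_def Iso_def by blast

lemma retract_iso_right: "retract C X Y \<Longrightarrow> isomorphic C Y Z \<Longrightarrow> retract C X Z"
  using isomorphic_retract retract_trans by blast

end

context additive_category
begin

lemma Zer_typ[simp]:
  assumes "X \<in> Obj C" "Y \<in> Obj C"
  shows "Zer C X Y \<in> Arr C" "Dom C (Zer C X Y) = X" "Cod C (Zer C X Y) = Y"
proof -
  interpret comm_group "hom_group C X Y" by (rule hom_comm_group[OF assms])
  have "Zer C X Y \<in> Hom C X Y" using one_closed by (simp add: hom_group_def)
  then show "Zer C X Y \<in> Arr C" "Dom C (Zer C X Y) = X" "Cod C (Zer C X Y) = Y"
    by (auto simp: Hom_iff)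
qed

lemma Add_typ[simp]:
  assumes "f \<in> Arr C" "g \<in> Arr C" "Dom C f = Dom C g" "Cod C f = Cod C g"
  shows "Add C f g \<in> Arr C" "Dom C (Add C f g) = Dom C g" "Cod C (Add C f g) = Cod C g"
proof -
  interpret comm_group "hom_group C (Dom C g) (Cod C g)" using assms by (intro hom_comm_group) auto
  have "Add C f g \<in> Hom C (Dom C g) (Cod C g)"
    using m_closed[of f g] assms by (simp add: hom_group_def Hom_iff)
  then show "Add C f g \<in> Arr C" "Dom C (Add C f g) = Dom C g" "Cod C (Add C f g) = Cod C g"
    by (auto simp: Hom_iff)
qed

lemma Neg_typ[simp]:
  assumes "f \<in> Arr C"
  shows "Neg C f \<in> Arr C" "Dom C (Neg C f) = Dom C f" "Cod C (Neg C f) = Cod C f"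
    "Add C f (Neg C f) = Zer C (Dom C f) (Cod C f)" "Add C (Neg C f) f = Zer C (Dom C f) (Cod C f)"
proof -
  interpret comm_group "hom_group C (Dom C f) (Cod C f)" using assms by (intro hom_comm_group) auto
  have f: "f \<in> carrier (hom_group C (Dom C f) (Cod C f))"
    using assms by (simp add: hom_group_def Hom_iff)
  have "Neg C f \<in> Hom C (Dom C f) (Cod C f)"
    using inv_closed[OF f] by (simp add: Neg_def) (simp add: hom_group_def)
  then show "Neg C f \<in> Arr C" "Dom C (Neg C f) = Dom C f" "Cod C (Neg C f) = Cod C f"
    by (auto simp: Hom_iff)
  show "Add C f (Neg C f) = Zer C (Dom C f) (Cod C f)" "Add C (Neg C f) f = Zer C (Dom C f) (Cod C f)"
    using r_inv[OF f] l_inv[OF f] unfolding Neg_def by (simp_all add: hom_group_def)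
qed

lemma Add_ac:
  assumes "f \<in> Arr C" "g \<in> Arr C" "Dom C f = Dom C g" "Cod C f = Cod C g"
  shows Add_commute: "Add C f g = Add C g f"
    and Add_assoc: "\<lbrakk>h \<in> Arr C; Dom C g = Dom C h; Cod C g = Cod C h\<rbrakk>
      \<Longrightarrow> Add C (Add C f g) h = Add C f (Add C g h)"
    and Add_left_commute: "\<lbrakk>h \<in> Arr C; Dom C g = Dom C h; Cod C g = Cod C h\<rbrakk>
      \<Longrightarrow> Add C f (Add C g h) = Add C g (Add C f h)"
proof -
  interpret comm_group "hom_group C (Dom C g) (Cod C g)" using assms by (intro hom_comm_group) auto
  show "Add C f g = Add C g f"
    using m_comm[of f g] assms by (simp add: hom_group_def Hom_iff)
  show "Add C (Add C f g) h = Add C f (Add C g h)" "Add C f (Add C g h) = Add C g (Add C f h)"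
    if "h \<in> Arr C" "Dom C g = Dom C h" "Cod C g = Cod C h"
    using m_assoc[of f g h] m_lcomm[of f g h] assms that by (simp_all add: hom_group_def Hom_iff)
qed

lemma Add_Zer[simp]:
  assumes "f \<in> Arr C" "X = Dom C f" "Y = Cod C f"
  shows "Add C f (Zer C X Y) = f" "Add C (Zer C X Y) f = f"
proof -
  interpret comm_group "hom_group C (Dom C f) (Cod C f)" using assms by (intro hom_comm_group) auto
  show "Add C f (Zer C X Y) = f" "Add C (Zer C X Y) f = f"
    using r_one[of f] l_one[of f] assms by (simp_all add: hom_group_def Hom_iff)
qed

lemma Comp_Add'[simp]:
  "\<lbrakk>f \<in> Arr C; f' \<in> Arr C; g \<in> Arr C; Dom C f = Dom C f'; Cod C f = Dom C g; Cod C f' = Dom C g\<rbrakk>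
    \<Longrightarrow> g \<cdot> Add C f f' = Add C (g \<cdot> f) (g \<cdot> f')"
  using Comp_Add by (auto simp: Hom_iff)

lemma Add_Comp'[simp]:
  "\<lbrakk>f \<in> Arr C; g \<in> Arr C; g' \<in> Arr C; Cod C g = Cod C g'; Cod C f = Dom C g; Cod C f = Dom C g'\<rbrakk>
    \<Longrightarrow> Add C g g' \<cdot> f = Add C (g \<cdot> f) (g' \<cdot> f)"
  using Add_Comp by (auto simp: Hom_iff)

lemma Add_cancel:
  assumes "f \<in> Arr C" "g \<in> Arr C" "h \<in> Arr C" "Dom C f = Dom C h" "Cod C f = Cod C h"
    "Dom C g = Dom C h" "Cod C g = Cod C h" "Add C f h = Add C g h"
  shows "f = g"
proof -
  have *: "Add C (Add C k h) (Neg C h) = k" if "k \<in> Arr C" "Dom C k = Dom C h" "Cod C k = Cod C h" for k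
    using that assms by (simp add: Add_assoc)
  then show ?thesis using assms by metis
qed

lemma Add_self_Zer:
  assumes "f \<in> Arr C" "Add C f f = f" shows "f = Zer C (Dom C f) (Cod C f)"
  by (rule Add_cancel[of _ _ f]) (use assms in auto)

lemma Comp_Zer[simp]:
  assumes "g \<in> Arr C" "X \<in> Obj C" "Y = Dom C g" shows "g \<cdot> Zer C X Y = Zer C X (Cod C g)"
proof -
  have "Add C (g \<cdot> Zer C X Y) (g \<cdot> Zer C X Y) = g \<cdot> Zer C X Y"
    by (subst Comp_Add'[symmetric]) (use assms in simp_all)
  from Add_self_Zer[OF _ this] show ?thesis using assms by simp
qed

lemma Zer_Comp[simp]:
  assumes "f \<in> Arr C" "Y \<in> Obj C" "X = Cod C f" shows "Zer C X Y \<cdot> f = Zer C (Dom C f) Y"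
proof -
  have "Add C (Zer C X Y \<cdot> f) (Zer C X Y \<cdot> f) = Zer C X Y \<cdot> f"
    by (subst Add_Comp'[symmetric]) (use assms in simp_all)
  from Add_self_Zer[OF _ this] show ?thesis using assms by simp
qed

lemma Neg_unique:
  assumes "f \<in> Arr C" "g \<in> Arr C" "Dom C g = Dom C f" "Cod C g = Cod C f"
    "Add C g f = Zer C (Dom C f) (Cod C f)"
  shows "g = Neg C f"
  by (rule Add_cancel[of _ _ f]) (use assms in auto)

lemma Comp_Neg[simp]:
  assumes "f \<in> Arr C" "g \<in> Arr C" "Cod C f = Dom C g" shows "g \<cdot> Neg C f = Neg C (g \<cdot> f)"
  using assms Comp_Add'[of "Neg C f" f g, symmetric] by (intro Neg_unique) (auto simp del: Comp_Add')

lemma Neg_Comp[simp]: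
  assumes "f \<in> Arr C" "g \<in> Arr C" "Cod C f = Dom C g" shows "Neg C g \<cdot> f = Neg C (g \<cdot> f)"
  using assms Add_Comp'[of f "Neg C g" g, symmetric] by (intro Neg_unique) (auto simp del: Add_Comp')

lemma Neg_Neg[simp]: "f \<in> Arr C \<Longrightarrow> Neg C (Neg C f) = f"
  using Neg_unique[of "Neg C f" f] by simp

lemma Neg_Zer[simp]: "X \<in> Obj C \<Longrightarrow> Y \<in> Obj C \<Longrightarrow> Neg C (Zer C X Y) = Zer C X Y"
  using Neg_unique[of "Zer C X Y" "Zer C X Y"] by simp

lemma Neg_eq_Zer:
  assumes "f \<in> Arr C" "Neg C f = Zer C (Dom C f) (Cod C f)" shows "f = Zer C (Dom C f) (Cod C f)"
proof -
  have "Neg C (Neg C f) = Neg C (Zer C (Dom C f) (Cod C f))" using assms(2) by (rule arg_cong)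
  then show ?thesis using assms(1) by simp
qed

lemma diff_eq_Zer:
  assumes "f \<in> Arr C" "g \<in> Arr C" "Dom C f = Dom C g" "Cod C f = Cod C g"
    "Add C f (Neg C g) = Zer C (Dom C g) (Cod C g)"
  shows "f = g"
  using Neg_unique[of "Neg C g" f] assms by simp

lemma diff_add:
  assumes "f \<in> Arr C" "g \<in> Arr C" "Dom C f = Dom C g" "Cod C f = Cod C g"
  shows "Add C (Add C f (Neg C g)) g = f"
  using assms by (simp add: Add_assoc)

lemma add_diff:
  assumes "f \<in> Arr C" "g \<in> Arr C" "Dom C f = Dom C g" "Cod C f = Cod C g"
  shows "Add C f (Add C g (Neg C f)) = g"
  using assms by (subst Add_left_commute) simp_all

lemma zero_ide_arr:
  assumes Z: "Z \<in> Obj C" "Ide C Z = Zer C Z Z" and f: "f \<in> Arr C"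
  shows "Cod C f = Z \<Longrightarrow> f = Zer C (Dom C f) Z" "Dom C f = Z \<Longrightarrow> f = Zer C Z (Cod C f)"
proof -
  assume "Cod C f = Z"
  then have "f = Ide C Z \<cdot> f" using f by simp
  also have "\<dots> = Zer C Z Z \<cdot> f" by (simp only: Z)
  also have "\<dots> = Zer C (Dom C f) Z" using f Z(1) \<open>Cod C f = Z\<close> by simp
  finally show "f = Zer C (Dom C f) Z" .
next
  assume "Dom C f = Z"
  then have "f = f \<cdot> Ide C Z" using f by simp
  also have "\<dots> = f \<cdot> Zer C Z Z" by (simp only: Z)
  also have "\<dots> = Zer C Z (Cod C f)" using f Z(1) \<open>Dom C f = Z\<close> by simp
  finally show "f = Zer C Z (Cod C f)" .
qed

lemma zero_object_iff: "zero_object C Z \<longleftrightarrow> Z \<in> Obj C \<and> Ide C Z = Zer C Z Z"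
proof
  assume *: "zero_object C Z"
  then have "Z \<in> Obj C" "\<exists>!f. f \<in> Hom C Z Z" by (auto simp: zero_object_def)
  then show "Z \<in> Obj C \<and> Ide C Z = Zer C Z Z" by (auto simp: Hom_iff)
next
  assume *: "Z \<in> Obj C \<and> Ide C Z = Zer C Z Z"
  have "f = Zer C X Z" if "f \<in> Hom C X Z" for f X
    using HomD[OF that] zero_ide_arr(1)[of Z f] * by metis
  moreover have "f = Zer C Z X" if "f \<in> Hom C Z X" for f X
    using HomD[OF that] zero_ide_arr(2)[of Z f] * by metis
  moreover have "Zer C X Z \<in> Hom C X Z" "Zer C Z X \<in> Hom C Z X" if "X \<in> Obj C" for X
    using that * by (auto simp: Hom_iff)
  ultimately show "zero_object C Z" unfolding zero_object_def using * by metis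
qed

lemma zero_object_arr:
  assumes "zero_object C Z" "f \<in> Arr C"
  shows "Cod C f = Z \<Longrightarrow> f = Zer C (Dom C f) Z" "Dom C f = Z \<Longrightarrow> f = Zer C Z (Cod C f)"
  using zero_ide_arr assms by (auto simp only: zero_object_iff)

lemma zero_object_iso: "zero_object C X \<Longrightarrow> isomorphic C X Y \<Longrightarrow> zero_object C Y"
proof -
  assume X: "zero_object C X" and "isomorphic C X Y"
  then obtain f where f: "f \<in> Iso C X Y" by (auto simp: isomorphic_def)
  have "f = Zer C X Y" using zero_object_arr(2)[OF X] IsoD[OF f] by auto
  then have "Ide C Y = Zer C X Y \<cdot> Inv C f" using Inv_props(3)[OF f] by simp
  then show ?thesis using Inv_typ[OF f] by (auto simp: zero_object_iff)
qed

lemma zero_objects_isomorphic: "zero_object C X \<Longrightarrow> zero_object C Y \<Longrightarrow> isomorphic C X Y"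
  by (intro isomorphicI[of "Zer C X Y"] IsoI[of _ _ _ _ "Zer C Y X"])
    (auto simp: zero_object_iff Hom_iff)

lemma zero_object_retract:
  assumes "retract C X Y" "zero_object C Y" shows "zero_object C X"
proof -
  obtain i p where ip: "i \<in> Hom C X Y" "p \<in> Hom C Y X" "p \<cdot> i = Ide C X"
    using assms(1) by (auto simp: retract_def)
  have X: "X \<in> Obj C" using ip by (auto simp: Hom_iff)
  have "i = Zer C X Y" using zero_object_arr(1)[OF assms(2)] ip(1) by (auto simp: Hom_iff)
  then have "Ide C X = p \<cdot> Zer C X Y" using ip by simp
  then show ?thesis using ip by (auto simp: zero_object_iff Hom_iff)
qed

section \<open>Finite parts of a coproduct, and compactness in terms of them\<close>

lemma coproduct_part:
  assumes "is_coproduct C I X S inc"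
  shows "coproduct_part C I X S inc F \<in> Hom C S S"
    "i \<in> I \<Longrightarrow> coproduct_part C I X S inc F \<cdot> inc i = (if i \<in> F then inc i else Zer C (X i) S)"
proof -
  note inc = coproduct_inc[OF assms]
  have "\<exists>!h. h \<in> Hom C S S \<and> (\<forall>i\<in>I. h \<cdot> inc i = (if i \<in> F then inc i else Zer C (X i) S))"
    by (rule coproduct_universal[OF assms coproduct_Obj[OF assms]])
      (use inc Hom_Obj[OF inc] in \<open>auto simp: Hom_iff\<close>)
  from theI'[OF this] show "coproduct_part C I X S inc F \<in> Hom C S S"
    "i \<in> I \<Longrightarrow> coproduct_part C I X S inc F \<cdot> inc i = (if i \<in> F then inc i else Zer C (X i) S)"
    unfolding coproduct_part_def by auto
qed

lemma coproduct_part_typ: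
  assumes "is_coproduct C I X S inc"
  shows "coproduct_part C I X S inc F \<in> Arr C" "Dom C (coproduct_part C I X S inc F) = S" "Cod C (coproduct_part C I X S inc F) = S"
  using coproduct_part(1)[OF assms] by (auto simp: Hom_iff)

lemma coproduct_part_unique:
  assumes "is_coproduct C I X S inc" "h \<in> Hom C S S"
    "\<And>i. i \<in> I \<Longrightarrow> h \<cdot> inc i = (if i \<in> F then inc i else Zer C (X i) S)"
  shows "h = coproduct_part C I X S inc F"
  by (rule coproduct_ext[OF assms(1,2) coproduct_part(1)[OF assms(1)]])
    (use assms(3) coproduct_part(2)[OF assms(1)] in auto)

lemma coproduct_part_mono:
  assumes "is_coproduct C I X S inc" "F \<subseteq> G"
  shows "coproduct_part C I X S inc G \<cdot> coproduct_part C I X S inc F = coproduct_part C I X S inc F"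
  by (rule coproduct_part_unique[OF assms(1)])
    (use coproduct_part_typ[OF assms(1)] coproduct_part(2)[OF assms(1)] coproduct_inc[OF assms(1)] assms(2)
      Hom_Obj[OF coproduct_inc[OF assms(1)]] in \<open>auto simp: Hom_iff\<close>)

lemma coproduct_proj:
  assumes "is_coproduct C I X S inc" "j \<in> I"
  shows "coproduct_proj C I X S inc j \<in> Hom C S (X j)"
    "i \<in> I \<Longrightarrow> coproduct_proj C I X S inc j \<cdot> inc i = (if i = j then Ide C (X i) else Zer C (X i) (X j))"
proof -
  note inc = coproduct_inc[OF assms(1)]
  have "\<exists>!h. h \<in> Hom C S (X j) \<and>
     (\<forall>i\<in>I. h \<cdot> inc i = (if i = j then Ide C (X i) else Zer C (X i) (X j)))"
    by (rule coproduct_universal[OF assms(1) Hom_Obj(1)[OF inc[OF assms(2)]]])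
      (use Hom_Obj[OF inc] assms in \<open>auto simp: Hom_iff\<close>)
  from theI'[OF this] show "coproduct_proj C I X S inc j \<in> Hom C S (X j)"
    "i \<in> I \<Longrightarrow> coproduct_proj C I X S inc j \<cdot> inc i = (if i = j then Ide C (X i) else Zer C (X i) (X j))"
    unfolding coproduct_proj_def by auto
qed

lemma hom_group_simps[simp]:
  "carrier (hom_group C X Y) = Hom C X Y" "mult (hom_group C X Y) = Add C"
  "one (hom_group C X Y) = Zer C X Y"
  by (simp_all add: hom_group_def)

text \<open>\<open>hom_group\<close> is multiplicative in notation, so \<open>finprod\<close> stands
  for a finite sum of arrows and its unit for the zero arrow.\<close>

lemma comp_finprod:
  assumes "k \<in> Hom C Y Z" "X \<in> Obj C" "finite F" "\<And>i. i \<in> F \<Longrightarrow> f i \<in> Hom C X Y"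
  shows "k \<cdot> finprod (hom_group C X Y) f F = finprod (hom_group C X Z) (\<lambda>i. k \<cdot> f i) F"
  using assms(3,4)
proof (induction F rule: finite_induct)
  case empty
  interpret Y: comm_group "hom_group C X Y" using assms by (intro hom_comm_group) (auto simp: Hom_iff)
  interpret Z: comm_group "hom_group C X Z" using assms by (intro hom_comm_group) (auto simp: Hom_iff)
  show ?case using assms by (auto simp: Hom_iff)
next
  case (insert i F)
  interpret Y: comm_group "hom_group C X Y" using assms by (intro hom_comm_group) (auto simp: Hom_iff)
  interpret Z: comm_group "hom_group C X Z" using assms by (intro hom_comm_group) (auto simp: Hom_iff)
  have "finprod (hom_group C X Y) f F \<in> Hom C X Y"
    using Y.finprod_closed[of f F] insert.prems by auto
  moreover have "f i \<in> Hom C X Y" "f \<in> F \<rightarrow> Hom C X Y" using insert.prems by auto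
  moreover have "(\<lambda>i. k \<cdot> f i) \<in> F \<rightarrow> Hom C X Z" "k \<cdot> f i \<in> Hom C X Z"
    using assms(1) insert.prems Comp_Hom by blast+
  ultimately show ?case using insert assms(1) by (simp add: Hom_iff)
qed

lemma finprod_comp:
  assumes "k \<in> Hom C W X" "Y \<in> Obj C" "finite F" "\<And>i. i \<in> F \<Longrightarrow> f i \<in> Hom C X Y"
  shows "finprod (hom_group C X Y) f F \<cdot> k = finprod (hom_group C W Y) (\<lambda>i. f i \<cdot> k) F"
  using assms(3,4)
proof (induction F rule: finite_induct)
  case empty
  interpret Y: comm_group "hom_group C X Y" using assms by (intro hom_comm_group) (auto simp: Hom_iff)
  interpret Z: comm_group "hom_group C W Y" using assms by (intro hom_comm_group) (auto simp: Hom_iff)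
  show ?case using assms by (auto simp: Hom_iff)
next
  case (insert i F)
  interpret Y: comm_group "hom_group C X Y" using assms by (intro hom_comm_group) (auto simp: Hom_iff)
  interpret Z: comm_group "hom_group C W Y" using assms by (intro hom_comm_group) (auto simp: Hom_iff)
  have "finprod (hom_group C X Y) f F \<in> Hom C X Y"
    using Y.finprod_closed[of f F] insert.prems by auto
  moreover have "f i \<in> Hom C X Y" "f \<in> F \<rightarrow> Hom C X Y" using insert.prems by auto
  moreover have "(\<lambda>i. f i \<cdot> k) \<in> F \<rightarrow> Hom C W Y" "f i \<cdot> k \<in> Hom C W Y"
    using assms(1) insert.prems Comp_Hom by blast+
  ultimately show ?case using insert assms(1) by (simp add: Hom_iff)
qed

text \<open>Both sides are compared on each inclusion. There the projections act as a Kronecker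
  delta, so at most one term of the sum survives.\<close>

lemma coproduct_part_eq_finprod:
  assumes S: "is_coproduct C I X S inc" and F: "finite F" "F \<subseteq> I"
  shows "coproduct_part C I X S inc F = finprod (hom_group C S S) (\<lambda>i. inc i \<cdot> coproduct_proj C I X S inc i) F"
proof (rule coproduct_part_unique[OF S, symmetric])
  have SO: "S \<in> Obj C" using coproduct_Obj[OF S] .
  interpret G: comm_group "hom_group C S S" using SO by (intro hom_comm_group)
  note inc = coproduct_inc[OF S] and pr = coproduct_proj[OF S]
  have ip: "inc i \<cdot> coproduct_proj C I X S inc i \<in> Hom C S S" if "i \<in> I" for i
    using inc[OF that] pr(1)[OF that] Comp_Hom by blast
  show "finprod (hom_group C S S) (\<lambda>i. inc i \<cdot> coproduct_proj C I X S inc i) F \<in> Hom C S S"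
    using G.finprod_closed[of "\<lambda>i. inc i \<cdot> coproduct_proj C I X S inc i" F] ip F by auto
  fix j assume j: "j \<in> I"
  have XO: "X j \<in> Obj C" using Hom_Obj inc[OF j] by blast
  interpret H: comm_group "hom_group C (X j) S" using SO XO by (intro hom_comm_group)
  have "finprod (hom_group C S S) (\<lambda>i. inc i \<cdot> coproduct_proj C I X S inc i) F \<cdot> inc j
      = finprod (hom_group C (X j) S) (\<lambda>i. (inc i \<cdot> coproduct_proj C I X S inc i) \<cdot> inc j) F"
    by (rule finprod_comp[OF inc[OF j] SO F(1)]) (use ip F in blast)
  also have "\<dots> = finprod (hom_group C (X j) S) (\<lambda>i. if j = i then inc j else Zer C (X j) S) F"
  proof (rule H.finprod_cong')
    show "F = F" ..
    show "(\<lambda>i. if j = i then inc j else Zer C (X j) S) \<in> F \<rightarrow> carrier (hom_group C (X j) S)"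
      using inc[OF j] XO by (auto simp: Hom_iff)
    fix i assume "i \<in> F"
    then have i: "i \<in> I" using F by auto
    have "(inc i \<cdot> coproduct_proj C I X S inc i) \<cdot> inc j = inc i \<cdot> (coproduct_proj C I X S inc i \<cdot> inc j)"
      using inc[OF i] inc[OF j] pr(1)[OF i] by (simp add: Hom_iff)
    also have "\<dots> = (if j = i then inc j else Zer C (X j) S)"
      using inc[OF i] pr(2)[OF i j] XO by (simp add: Hom_iff)
    finally show "(inc i \<cdot> coproduct_proj C I X S inc i) \<cdot> inc j = (if j = i then inc j else Zer C (X j) S)" .
  qed
  also have "\<dots> = (if j \<in> F then inc j else Zer C (X j) S)"
  proof (cases "j \<in> F")
    case True
    then show ?thesis using H.finprod_singleton[OF True F(1), of "\<lambda>_. inc j", unfolded hom_group_simps] inc[OF j] by simp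
  next
    case False
    have "finprod (hom_group C (X j) S) (\<lambda>i. if j = i then inc j else Zer C (X j) S) F
      = finprod (hom_group C (X j) S) (\<lambda>i. \<one>\<^bsub>hom_group C (X j) S\<^esub>) F"
      by (rule H.finprod_cong') (use False SO XO in \<open>auto simp: Hom_iff\<close>)
    then show ?thesis using False H.finprod_one by simp
  qed
  finally show "finprod (hom_group C S S) (\<lambda>i. inc i \<cdot> coproduct_proj C I X S inc i) F \<cdot> inc j
      = (if j \<in> F then inc j else Zer C (X j) S)" .
qed

text \<open>The finite set \<open>F\<close> is the support of the family \<open>p\<close> that
  corresponds to \<open>h\<close> under the canonical bijection.\<close>

lemma compact_objectsD:
  assumes "c \<in> compact_objects U C" "I \<subseteq> U" "small U I" "\<And>i. i \<in> I \<Longrightarrow> Y i \<in> Obj C"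
    "is_coproduct C I Y S inc" "h \<in> Hom C c S"
  shows "\<exists>F. finite F \<and> F \<subseteq> I \<and> coproduct_part C I Y S inc F \<cdot> h = h"
proof -
  have c: "c \<in> Obj C" using assms(1) by (simp add: compact_objects_def)
  have SO: "S \<in> Obj C" using coproduct_Obj[OF assms(5)] .
  note inc = coproduct_inc[OF assms(5)]
  have "(\<lambda>p. gfinprod (hom_group C c S) (\<lambda>i. inc i \<cdot> p i) I)
       \<in> iso (sum_group I (\<lambda>i. hom_group C c (Y i))) (hom_group C c S)"
    using assms(1-5) unfolding compact_objects_def by blast
  then have "h \<in> (\<lambda>p. gfinprod (hom_group C c S) (\<lambda>i. inc i \<cdot> p i) I) `
      carrier (sum_group I (\<lambda>i. hom_group C c (Y i)))"
    using assms(6) by (simp add: iso_def bij_betw_def)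
  moreover have "group (hom_group C c (Y i))" if "i \<in> I" for i
    using hom_comm_group[OF c assms(4)[OF that]] by (simp add: comm_group_def)
  ultimately obtain p where p: "p \<in> (\<Pi>\<^sub>E i\<in>I. Hom C c (Y i))" "finite {i \<in> I. p i \<noteq> Zer C c (Y i)}"
    "h = gfinprod (hom_group C c S) (\<lambda>i. inc i \<cdot> p i) I"
    by (auto simp: carrier_sum_group)
  define F where "F = {i \<in> I. p i \<noteq> Zer C c (Y i)}"
  have F: "finite F" "F \<subseteq> I" using p by (auto simp: F_def)
  interpret G: comm_group "hom_group C c S" using hom_comm_group[OF c SO] .
  have pi: "p i \<in> Hom C c (Y i)" if "i \<in> I" for i using p(1) that by auto
  have ip: "inc i \<cdot> p i \<in> Hom C c S" if "i \<in> I" for i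
    using pi[OF that] inc[OF that] Comp_Hom by blast
  have "h = gfinprod (hom_group C c S) (\<lambda>i. inc i \<cdot> p i) F"
    unfolding p(3)
    by (rule G.gfinprod_mono_neutral_cong_right) (use ip inc c in \<open>auto simp: F_def Hom_iff\<close>)
  also have "\<dots> = finprod (hom_group C c S) (\<lambda>i. inc i \<cdot> p i) F"
    by (rule G.gfinprod_eq_finprod) (use F ip in auto)
  finally have h: "h = finprod (hom_group C c S) (\<lambda>i. inc i \<cdot> p i) F" .
  have "coproduct_part C I Y S inc F \<cdot> h = finprod (hom_group C c S) (\<lambda>i. coproduct_part C I Y S inc F \<cdot> inc i \<cdot> p i) F"
    unfolding h by (rule comp_finprod[OF coproduct_part(1)[OF assms(5)] c F(1)]) (use ip F in blast)
  also have "\<dots> = finprod (hom_group C c S) (\<lambda>i. inc i \<cdot> p i) F"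
  proof (rule G.finprod_cong')
    fix i assume i: "i \<in> F"
    then have "i \<in> I" using F by auto
    then show "coproduct_part C I Y S inc F \<cdot> inc i \<cdot> p i = inc i \<cdot> p i"
      using coproduct_part(2)[OF assms(5), of i F] coproduct_part_typ[OF assms(5), of F] i inc[of i] pi[of i]
        comp_red[of "coproduct_part C I Y S inc F" "inc i" "inc i" "p i"] by (simp add: Hom_iff)
  qed (use ip F in auto)
  finally show ?thesis using F h by blast
qed

text \<open>The assumption on finite parts gives surjectivity of the canonical map. Injectivity
  holds for every object, because the projections recover each component of a family of finite
  support.\<close>

lemma compact_objectsI:
  assumes c: "c \<in> Obj C"
    and *: "\<And>I Y S inc h. I \<subseteq> U \<Longrightarrow> small U I \<Longrightarrow> (\<And>i. i \<in> I \<Longrightarrow> Y i \<in> Obj C) \<Longrightarrow>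
      is_coproduct C I Y S inc \<Longrightarrow> h \<in> Hom C c S \<Longrightarrow>
      \<exists>F. finite F \<and> F \<subseteq> I \<and> coproduct_part C I Y S inc F \<cdot> h = h"
  shows "c \<in> compact_objects U C"
  unfolding compact_objects_def
proof (intro CollectI conjI allI impI c; elim conjE)
  fix I Y S and inc :: "_ \<Rightarrow> 'm"
  assume I: "I \<subseteq> U" "small U I" and Y: "\<forall>i\<in>I. Y i \<in> Obj C" and S: "is_coproduct C I Y S inc"
  have SO: "S \<in> Obj C" using coproduct_Obj[OF S] .
  note inc = coproduct_inc[OF S] and pr = coproduct_proj[OF S]
  interpret G: comm_group "hom_group C c S" using hom_comm_group[OF c SO] .
  have gr: "group (hom_group C c (Y i))" if "i \<in> I" for i
    using hom_comm_group[OF c] Y that by (simp add: comm_group_def)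
  let ?\<Phi> = "\<lambda>p. gfinprod (hom_group C c S) (\<lambda>i. inc i \<cdot> p i) I"
  have hom1: "(\<lambda>f. inc i \<cdot> f) \<in> hom (hom_group C c (Y i)) (hom_group C c S)" if "i \<in> I" for i
    using inc[OF that] by (auto simp: hom_def Hom_iff)
  have hom: "?\<Phi> \<in> hom (sum_group I (\<lambda>i. hom_group C c (Y i))) (hom_group C c S)"
    by (rule G.hom_group_sum) (use gr hom1 in auto)
  have carr: "carrier (sum_group I (\<lambda>i. hom_group C c (Y i))) =
     {p \<in> \<Pi>\<^sub>E i\<in>I. Hom C c (Y i). finite {i \<in> I. p i \<noteq> Zer C c (Y i)}}"
    using gr by (simp add: carrier_sum_group)
  have val: "?\<Phi> p = finprod (hom_group C c S) (\<lambda>i. inc i \<cdot> p i) F"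
    if p: "p \<in> (\<Pi>\<^sub>E i\<in>I. Hom C c (Y i))" and F: "finite F" "F \<subseteq> I"
      and z: "\<And>i. i \<in> I - F \<Longrightarrow> p i = Zer C c (Y i)" for p F
  proof -
    have ip: "inc i \<cdot> p i \<in> Hom C c S" if "i \<in> I" for i
      using p that inc[OF that] Comp_Hom by blast
    have "?\<Phi> p = gfinprod (hom_group C c S) (\<lambda>i. inc i \<cdot> p i) F"
      by (rule G.gfinprod_mono_neutral_cong_right) (use F ip z inc c in \<open>auto simp: Hom_iff\<close>)
    also have "\<dots> = finprod (hom_group C c S) (\<lambda>i. inc i \<cdot> p i) F"
      by (rule G.gfinprod_eq_finprod) (use F ip in auto)
    finally show ?thesis .
  qed
  have pr\<Phi>: "coproduct_proj C I Y S inc j \<cdot> ?\<Phi> p = p j"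
    if p: "p \<in> (\<Pi>\<^sub>E i\<in>I. Hom C c (Y i))" and fin: "finite {i \<in> I. p i \<noteq> Zer C c (Y i)}"
      and j: "j \<in> I" for p j
  proof -
    define F where "F = insert j {i \<in> I. p i \<noteq> Zer C c (Y i)}"
    have F: "finite F" "F \<subseteq> I" "j \<in> F" using fin j by (auto simp: F_def)
    have pi: "p i \<in> Hom C c (Y i)" if "i \<in> I" for i using p that by auto
    interpret H: comm_group "hom_group C c (Y j)" using hom_comm_group[OF c] Y j by simp
    have "?\<Phi> p = finprod (hom_group C c S) (\<lambda>i. inc i \<cdot> p i) F"
      by (rule val) (use p F in \<open>auto simp: F_def\<close>)
    then have "coproduct_proj C I Y S inc j \<cdot> ?\<Phi> p =
        finprod (hom_group C c (Y j)) (\<lambda>i. coproduct_proj C I Y S inc j \<cdot> inc i \<cdot> p i) F"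
      using comp_finprod[OF pr(1)[OF j] c F(1), of "\<lambda>i. inc i \<cdot> p i"] F pi inc Comp_Hom by (metis subsetD)
    also have "\<dots> = finprod (hom_group C c (Y j)) (\<lambda>i. if j = i then p j else Zer C c (Y j)) F"
    proof (rule H.finprod_cong')
      fix i assume "i \<in> F"
      then have i: "i \<in> I" using F by auto
      have "coproduct_proj C I Y S inc j \<cdot> inc i \<cdot> p i = (coproduct_proj C I Y S inc j \<cdot> inc i) \<cdot> p i"
        using inc[OF i] pi[OF i] pr(1)[OF j] by (simp add: Hom_iff)
      then show "coproduct_proj C I Y S inc j \<cdot> inc i \<cdot> p i = (if j = i then p j else Zer C c (Y j))"
        using pr(2)[OF j i] pi[OF i] Y j by (auto simp: Hom_iff)
    qed (use F pi Y c j in \<open>auto simp: Hom_iff\<close>)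
    also have "\<dots> = p j"
      using H.finprod_singleton[OF F(3,1), of "\<lambda>_. p j", unfolded hom_group_simps] pi[OF j] by auto
    finally show ?thesis .
  qed
  have inj: "inj_on ?\<Phi> (carrier (sum_group I (\<lambda>i. hom_group C c (Y i))))"
  proof (rule inj_onI)
    fix p q assume p: "p \<in> carrier (sum_group I (\<lambda>i. hom_group C c (Y i)))"
      and q: "q \<in> carrier (sum_group I (\<lambda>i. hom_group C c (Y i)))" and eq: "?\<Phi> p = ?\<Phi> q"
    have "p j = q j" if "j \<in> I" for j
      using pr\<Phi>[of p j] pr\<Phi>[of q j] p q eq that carr by auto
    then show "p = q" using p q carr PiE_ext[of p I _ q] by auto
  qed
  have "h \<in> ?\<Phi> ` carrier (sum_group I (\<lambda>i. hom_group C c (Y i)))" if h: "h \<in> Hom C c S" for h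
  proof -
    obtain F where F: "finite F" "F \<subseteq> I" "coproduct_part C I Y S inc F \<cdot> h = h"
      using *[OF I _ S h] Y by blast
    define p where "p = (\<lambda>i\<in>I. if i \<in> F then coproduct_proj C I Y S inc i \<cdot> h else Zer C c (Y i))"
    have ph: "coproduct_proj C I Y S inc i \<cdot> h \<in> Hom C c (Y i)" if "i \<in> I" for i
      using pr(1)[OF that] h Comp_Hom by blast
    have p: "p \<in> (\<Pi>\<^sub>E i\<in>I. Hom C c (Y i))" using ph Y c by (auto simp: p_def Hom_iff)
    have "finite {i \<in> I. p i \<noteq> Zer C c (Y i)}"
      by (rule finite_subset[OF _ F(1)]) (auto simp: p_def split: if_splits)
    then have pc: "p \<in> carrier (sum_group I (\<lambda>i. hom_group C c (Y i)))" using p carr by auto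
    have "h = finprod (hom_group C S S) (\<lambda>i. inc i \<cdot> coproduct_proj C I Y S inc i) F \<cdot> h"
      using F coproduct_part_eq_finprod[OF S F(1,2)] by simp
    also have "\<dots> = finprod (hom_group C c S) (\<lambda>i. (inc i \<cdot> coproduct_proj C I Y S inc i) \<cdot> h) F"
      by (rule finprod_comp[OF h SO F(1)]) (use F pr inc Comp_Hom in blast)
    also have "\<dots> = finprod (hom_group C c S) (\<lambda>i. inc i \<cdot> p i) F"
    proof (rule G.finprod_cong')
      fix i assume "i \<in> F"
      then have "i \<in> I" "p i = coproduct_proj C I Y S inc i \<cdot> h" using F by (auto simp: p_def)
      then show "(inc i \<cdot> coproduct_proj C I Y S inc i) \<cdot> h = inc i \<cdot> p i"
        using inc[of i] pr(1)[of i] h by (simp add: Hom_iff)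
    next
      show "(\<lambda>i. inc i \<cdot> p i) \<in> F \<rightarrow> carrier (hom_group C c S)"
        using p F inc Comp_Hom by fastforce
    qed simp
    also have "\<dots> = ?\<Phi> p" by (rule val[symmetric]) (use p F in \<open>auto simp: p_def\<close>)
    finally show ?thesis using pc by blast
  qed
  moreover have "?\<Phi> p \<in> Hom C c S" if "p \<in> carrier (sum_group I (\<lambda>i. hom_group C c (Y i)))" for p
    using hom_in_carrier[OF hom that] by simp
  ultimately show "?\<Phi> \<in> iso (sum_group I (\<lambda>i. hom_group C c (Y i))) (hom_group C c S)"
    unfolding iso_def bij_betw_def using hom inj by auto
qed

lemma compact_Obj: "c \<in> compact_objects U C \<Longrightarrow> c \<in> Obj C"
  by (simp add: compact_objects_def)

text \<open>The finite \<open>F\<close> writes \<open>h\<close> as a finite sum of its components,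
  each followed by an inclusion; so vanishing components force \<open>h\<close> to vanish.\<close>

lemma coproduct_part_zero:
  assumes S: "is_coproduct C I Y S inc" and F: "finite F" "F \<subseteq> I" "coproduct_part C I Y S inc F \<cdot> h = h"
    and h: "h \<in> Hom C c S"
    and z: "\<And>i. i \<in> I \<Longrightarrow> coproduct_proj C I Y S inc i \<cdot> h = Zer C c (Y i)"
  shows "h = Zer C c S"
proof -
  have c: "c \<in> Obj C" using Hom_Obj[OF h] by simp
  have SO: "S \<in> Obj C" using coproduct_Obj[OF S] .
  interpret G: comm_group "hom_group C c S" using hom_comm_group[OF c SO] .
  note inc = coproduct_inc[OF S] and pr = coproduct_proj[OF S]
  have "h = finprod (hom_group C S S) (\<lambda>i. inc i \<cdot> coproduct_proj C I Y S inc i) F \<cdot> h"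
    using F coproduct_part_eq_finprod[OF S F(1,2)] by simp
  also have "\<dots> = finprod (hom_group C c S) (\<lambda>i. (inc i \<cdot> coproduct_proj C I Y S inc i) \<cdot> h) F"
    by (rule finprod_comp[OF h SO F(1)]) (use F pr inc Comp_Hom in blast)
  also have "\<dots> = finprod (hom_group C c S) (\<lambda>i. \<one>\<^bsub>hom_group C c S\<^esub>) F"
  proof (rule G.finprod_cong')
    fix i assume "i \<in> F"
    then have i: "i \<in> I" using F by auto
    then show "(inc i \<cdot> coproduct_proj C I Y S inc i) \<cdot> h = \<one>\<^bsub>hom_group C c S\<^esub>"
      using inc[of i] pr(1)[of i] h z[OF i] c by (simp add: Hom_iff)
  qed (use c SO in \<open>auto simp: Hom_iff\<close>)
  finally show ?thesis using G.finprod_one by simp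
qed

lemma coproduct_part_finite_induct:
  assumes "is_coproduct C I X S inc" "finite F" "F \<subseteq> I" "h \<in> Hom C c S"
    and zero: "P (Zer C c S)"
    and step: "\<And>i k. i \<in> I \<Longrightarrow> P k \<Longrightarrow> k \<in> Hom C c S \<Longrightarrow> P (Add C (inc i \<cdot> coproduct_proj C I X S inc i \<cdot> h) k)"
  shows "P (coproduct_part C I X S inc F \<cdot> h)"
proof -
  have c: "c \<in> Obj C" using assms(4) by (auto simp: Hom_iff)
  have SO: "S \<in> Obj C" using coproduct_Obj[OF assms(1)] .
  interpret G: comm_group "hom_group C c S" using hom_comm_group[OF c SO] .
  note inc = coproduct_inc[OF assms(1)] and pr = coproduct_proj[OF assms(1)]
  have ip: "(inc i \<cdot> coproduct_proj C I X S inc i) \<cdot> h \<in> Hom C c S" if "i \<in> I" for i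
    using inc[OF that] pr(1)[OF that] assms(4) Comp_Hom by blast
  have "P (finprod (hom_group C c S) (\<lambda>i. (inc i \<cdot> coproduct_proj C I X S inc i) \<cdot> h) F)"
    using assms(2,3)
  proof (induction F rule: finite_induct)
    case empty
    then show ?case using zero by simp
  next
    case (insert i F)
    have "finprod (hom_group C c S) (\<lambda>i. (inc i \<cdot> coproduct_proj C I X S inc i) \<cdot> h) F \<in> Hom C c S"
      using G.finprod_closed[of "\<lambda>i. (inc i \<cdot> coproduct_proj C I X S inc i) \<cdot> h" F] ip insert.prems by auto
    moreover have "(\<lambda>i. (inc i \<cdot> coproduct_proj C I X S inc i) \<cdot> h) \<in> F \<rightarrow> Hom C c S"
      "(inc i \<cdot> coproduct_proj C I X S inc i) \<cdot> h \<in> Hom C c S" using ip insert.prems by auto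
    moreover have "(inc i \<cdot> coproduct_proj C I X S inc i) \<cdot> h = inc i \<cdot> coproduct_proj C I X S inc i \<cdot> h"
      using inc[of i] pr(1)[of i] insert.prems assms(4) by (simp add: Hom_iff)
    ultimately show ?case using insert step[of i] by (simp del: Comp_assoc')
  qed
  moreover have "coproduct_part C I X S inc F \<cdot> h = finprod (hom_group C c S) (\<lambda>i. (inc i \<cdot> coproduct_proj C I X S inc i) \<cdot> h) F"
    unfolding coproduct_part_eq_finprod[OF assms(1-3)]
    by (rule finprod_comp[OF assms(4) SO assms(2)]) (use assms(3) pr inc Comp_Hom in blast)
  ultimately show ?thesis by simp
qed

section \<open>Biproducts and additive functors\<close>

lemma binary_coproductE:
  assumes "is_binary_coproduct C X Y S" "X \<in> Obj C" "Y \<in> Obj C"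
  obtains i j p q where "i \<in> Hom C X S" "j \<in> Hom C Y S" "p \<in> Hom C S X" "q \<in> Hom C S Y"
    "p \<cdot> i = Ide C X" "q \<cdot> j = Ide C Y" "p \<cdot> j = Zer C Y X" "q \<cdot> i = Zer C X Y"
    "Add C (i \<cdot> p) (j \<cdot> q) = Ide C S"
proof -
  obtain inc where S: "is_coproduct C (UNIV :: bool set) (\<lambda>b. if b then X else Y) S inc"
    using assms(1) by (auto simp: is_binary_coproduct_def)
  have SO: "S \<in> Obj C" using coproduct_Obj[OF S] .
  note inc = coproduct_inc[OF S, simplified] and pr = coproduct_proj[OF S UNIV_I, simplified]
  let ?P = "coproduct_proj C UNIV (\<lambda>b. if b then X else Y) S inc"
  have i: "inc True \<in> Hom C X S" "inc False \<in> Hom C Y S" using inc[of True] inc[of False] by auto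
  have p: "?P True \<in> Hom C S X" "?P False \<in> Hom C S Y" using pr(1)[of True] pr(1)[of False] by auto
  have e: "?P True \<cdot> inc True = Ide C X" "?P False \<cdot> inc False = Ide C Y"
    "?P True \<cdot> inc False = Zer C Y X" "?P False \<cdot> inc True = Zer C X Y"
    using pr(2)[of True True] pr(2)[of False False] pr(2)[of True False] pr(2)[of False True] by auto
  have "Add C (inc True \<cdot> ?P True) (inc False \<cdot> ?P False) = Ide C S"
  proof (rule coproduct_ext[OF S, of _ S])
    fix b show "Add C (inc True \<cdot> ?P True) (inc False \<cdot> ?P False) \<cdot> inc b = Ide C S \<cdot> inc b"
      using i p e by (cases b) (auto simp: Hom_iff)
  qed (use i p SO in \<open>auto simp: Hom_iff\<close>)
  then show ?thesis using that i p e by blast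
qed

lemma binary_coproductI:
  assumes "i \<in> Hom C X S" "j \<in> Hom C Y S" "p \<in> Hom C S X" "q \<in> Hom C S Y"
    "p \<cdot> i = Ide C X" "q \<cdot> j = Ide C Y" "p \<cdot> j = Zer C Y X" "q \<cdot> i = Zer C X Y"
    "Add C (i \<cdot> p) (j \<cdot> q) = Ide C S"
  shows "is_binary_coproduct C X Y S"
  unfolding is_binary_coproduct_def
proof (rule exI[of _ "\<lambda>b. if b then i else j"], rule coproductI)
  note ty = assms(1-4)[unfolded Hom_iff]
  show "S \<in> Obj C" using assms Hom_Obj by blast
  show "(if b then i else j) \<in> Hom C (if b then X else Y) S" for b using assms by simp
  show "\<exists>h. h \<in> Hom C S Z \<and> (\<forall>b\<in>UNIV. h \<cdot> (if b then i else j) = f b)"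
    if "Z \<in> Obj C" "\<And>b. b \<in> UNIV \<Longrightarrow> f b \<in> Hom C (if b then X else Y) Z" for Z f
  proof -
    have "f True \<in> Hom C X Z" "f False \<in> Hom C Y Z" using that(2)[of True] that(2)[of False] by auto
    then have f: "f True \<in> Arr C" "Dom C (f True) = X" "Cod C (f True) = Z"
      "f False \<in> Arr C" "Dom C (f False) = Y" "Cod C (f False) = Z" by (auto simp: Hom_iff)
    have "X \<in> Obj C" "Y \<in> Obj C" using assms Hom_Obj by blast+
    with f ty assms(5-8) show ?thesis
      by (intro exI[of _ "Add C (f True \<cdot> p) (f False \<cdot> q)"]) (auto simp: Hom_iff)
  qed
  show "h = k" if h: "h \<in> Hom C S Z" "k \<in> Hom C S Z"
    and eq: "\<And>b. b \<in> UNIV \<Longrightarrow> h \<cdot> (if b then i else j) = k \<cdot> (if b then i else j)" for Z h k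
  proof -
    have e: "h \<cdot> i = k \<cdot> i" "h \<cdot> j = k \<cdot> j" using eq[of True] eq[of False] by auto
    have "l \<cdot> Add C (i \<cdot> p) (j \<cdot> q) = Add C ((l \<cdot> i) \<cdot> p) ((l \<cdot> j) \<cdot> q)" if "l \<in> Hom C S Z" for l
      using that ty by (simp add: Hom_iff)
    from this[OF h(1)] this[OF h(2)] show ?thesis using e assms(9) h by (simp add: Hom_iff)
  qed
qed

end

lemma additive_functorD:
  assumes "is_additive_functor C D Fo Fa" "additive_category C" "additive_category D"
  shows "is_functor C D Fo Fa"
    "\<lbrakk>f \<in> Arr C; g \<in> Arr C; Dom C f = Dom C g; Cod C f = Cod C g\<rbrakk>
      \<Longrightarrow> Fa (Add C f g) = Add D (Fa f) (Fa g)"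
    "\<lbrakk>X \<in> Obj C; Y \<in> Obj C\<rbrakk> \<Longrightarrow> Fa (Zer C X Y) = Zer D (Fo X) (Fo Y)"
    "f \<in> Arr C \<Longrightarrow> Fa (Neg C f) = Neg D (Fa f)"
    "zero_object C X \<Longrightarrow> zero_object D (Fo X)"
proof -
  interpret C: additive_category C by fact
  interpret D: additive_category D by fact
  show F: "is_functor C D Fo Fa" using assms(1) by (simp add: is_additive_functor_def)
  note FD = functorD[OF F]
  show A: "Fa (Add C f g) = Add D (Fa f) (Fa g)"
    if "f \<in> Arr C" "g \<in> Arr C" "Dom C f = Dom C g" "Cod C f = Cod C g" for f g
  proof -
    have "Fa \<in> hom (hom_group C (Dom C g) (Cod C g)) (hom_group D (Fo (Dom C g)) (Fo (Cod C g)))"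
      using assms(1) that unfolding is_additive_functor_def by auto
    from hom_mult[OF this, of f g] show ?thesis using that by (simp add: Hom_iff)
  qed
  show Z: "Fa (Zer C X Y) = Zer D (Fo X) (Fo Y)" if "X \<in> Obj C" "Y \<in> Obj C" for X Y
  proof -
    have "Add D (Fa (Zer C X Y)) (Fa (Zer C X Y)) = Fa (Zer C X Y)"
      using A[of "Zer C X Y" "Zer C X Y"] that by simp
    from D.Add_self_Zer[OF _ this] show ?thesis using FD that by simp
  qed
  show "Fa (Neg C f) = Neg D (Fa f)" if "f \<in> Arr C"
    using D.Neg_unique[of "Fa f" "Fa (Neg C f)"] A[of "Neg C f" f] Z FD that by simp
  show "zero_object D (Fo X)" if "zero_object C X"
    using that Z[of X X] FD(1,2)[of X] by (simp add: C.zero_object_iff D.zero_object_iff)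
qed

section \<open>Triangulated categories\<close>

context triangulated_category
begin

lemma Sh_functor: "is_functor C C (ShO C) (ShA C)"
  using Sh_additive by (simp add: is_additive_functor_def)

lemma Sh_typ[simp]:
  "X \<in> Obj C \<Longrightarrow> ShO C X \<in> Obj C"
  "f \<in> Arr C \<Longrightarrow> ShA C f \<in> Arr C" "f \<in> Arr C \<Longrightarrow> Dom C (ShA C f) = ShO C (Dom C f)"
  "f \<in> Arr C \<Longrightarrow> Cod C (ShA C f) = ShO C (Cod C f)"
  "X \<in> Obj C \<Longrightarrow> ShA C (Ide C X) = Ide C (ShO C X)"
  "X \<in> Obj C \<Longrightarrow> Y \<in> Obj C \<Longrightarrow> ShA C (Zer C X Y) = Zer C (ShO C X) (ShO C Y)"
  using functorD[OF Sh_functor] additive_functorD(3)[OF Sh_additive] additive_category_axioms by auto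

lemma Sh_Comp:
  "\<lbrakk>f \<in> Arr C; g \<in> Arr C; Cod C f = Dom C g\<rbrakk> \<Longrightarrow> ShA C (g \<cdot> f) = ShA C g \<cdot> ShA C f"
  using functorD(7)[OF Sh_functor] by auto

lemma Sh_faithful:
  assumes "f \<in> Arr C" "g \<in> Arr C" "Dom C f = Dom C g" "Cod C f = Cod C g" "ShA C f = ShA C g"
  shows "f = g"
  using equivalence_faithful[OF Sh_equivalence, of f "Dom C g" "Cod C g" g] assms category_axioms
  by (auto simp: Hom_iff)

lemma Sh_zero_arr:
  assumes "f \<in> Arr C" "ShA C f = Zer C (ShO C (Dom C f)) (ShO C (Cod C f))"
  shows "f = Zer C (Dom C f) (Cod C f)"
  by (rule Sh_faithful) (use assms in auto)

lemma Sh_full: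
  assumes "X \<in> Obj C" "Y \<in> Obj C" "g \<in> Hom C (ShO C X) (ShO C Y)"
  obtains f where "f \<in> Hom C X Y" "ShA C f = g"
  using equivalence_lift[OF Sh_equivalence assms] by blast

text \<open>The shift is only an equivalence; together with \<open>Sh_full\<close> this replaces its
  inverse throughout.\<close>

lemma desuspend:
  assumes "X \<in> Obj C" obtains Y where "Y \<in> Obj C" "isomorphic C (ShO C Y) X"
  using Sh_equivalence assms unfolding is_equivalence_def by blast

lemma Sh_isomorphic: "isomorphic C X Y \<Longrightarrow> isomorphic C (ShO C X) (ShO C Y)"
  using functor_isomorphic[OF Sh_functor] category_axioms by blast

lemma Sh_isomorphicD:
  "X \<in> Obj C \<Longrightarrow> Y \<in> Obj C \<Longrightarrow> isomorphic C (ShO C X) (ShO C Y) \<Longrightarrow> isomorphic C X Y"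
  using equivalence_isomorphicD[OF Sh_equivalence] category_axioms by blast

lemma Sh_zero_object: "X \<in> Obj C \<Longrightarrow> zero_object C (ShO C X) \<longleftrightarrow> zero_object C X"
proof -
  assume X: "X \<in> Obj C"
  have "Ide C X = Zer C X X" if "ShA C (Ide C X) = Zer C (ShO C X) (ShO C X)"
    using Sh_zero_arr[of "Ide C X"] X that by simp
  moreover have "zero_object C (ShO C X)" if "zero_object C X"
    using additive_functorD(5)[OF Sh_additive _ _ that] additive_category_axioms by blast
  ultimately show ?thesis using X by (auto simp: zero_object_iff)
qed

lemma Sh_coproduct:
  assumes "is_coproduct C I X S inc" "\<And>i. i \<in> I \<Longrightarrow> X i \<in> Obj C"
  shows "is_coproduct C I (ShO C \<circ> X) (ShO C S) (ShA C \<circ> inc)"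
  using equivalence_coproduct[OF Sh_equivalence _ _ assms] category_axioms by blast

section \<open>Exactness of triangles and uniqueness of cones\<close>

lemma TriE:
  assumes "(f, g, h) \<in> Tri C"
  shows "f \<in> Arr C" "g \<in> Arr C" "h \<in> Arr C" "Dom C g = Cod C f" "Dom C h = Cod C g"
    "Cod C h = ShO C (Dom C f)"
  using Tri_Hom[OF assms] by (auto simp: Hom_iff)

lemma Tri_rotate':
  assumes "(f, g, h) \<in> Tri C" shows "(g, h, Neg C (ShA C f)) \<in> Tri C"
  using Tri_rotate[of f "Dom C f" "Cod C f" g "Cod C g" h] TriE[OF assms] assms by (simp add: Hom_iff)

lemma ex_zero: obtains Z where "zero_object C Z" "Z \<in> Obj C"
  using ex_zero_object by (auto simp: zero_object_def)

lemma Tri_fill':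
  assumes T: "(f, g, h) \<in> Tri C" and T': "(f', g', h') \<in> Tri C"
    and a: "a \<in> Hom C (Dom C f) (Dom C f')" and b: "b \<in> Hom C (Cod C f) (Cod C f')"
    and eq: "b \<cdot> f = f' \<cdot> a"
  obtains c where "c \<in> Hom C (Cod C g) (Cod C g')" "c \<cdot> g = g' \<cdot> b" "ShA C a \<cdot> h = h' \<cdot> c"
proof -
  note ty = TriE[OF T] and ty' = TriE[OF T']
  have "f \<in> Hom C (Dom C f) (Cod C f)" "g \<in> Hom C (Cod C f) (Cod C g)"
    "f' \<in> Hom C (Dom C f') (Cod C f')" "g' \<in> Hom C (Cod C f') (Cod C g')"
    using ty ty' by (simp_all add: Hom_iff)
  from Tri_fill[OF T T' this a b eq] show ?thesis using that by blast
qed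

text \<open>Comparing the triangle on the identity of \<open>Dom C f\<close> with the given one
  factors the composite through a zero object.\<close>

lemma Tri_Comp1:
  assumes "(f, g, h) \<in> Tri C" shows "g \<cdot> f = Zer C (Dom C f) (Cod C g)"
proof -
  note ty = TriE[OF assms]
  obtain Z where Z: "zero_object C Z" "Z \<in> Obj C" by (rule ex_zero)
  let ?X = "Dom C f"
  have X: "?X \<in> Obj C" using ty by simp
  have T: "(Ide C ?X, Zer C ?X Z, Zer C Z (ShO C ?X)) \<in> Tri C" by (rule Tri_Ide[OF X Z(1)])
  obtain c where c: "c \<in> Hom C Z (Cod C g)" "c \<cdot> Zer C ?X Z = g \<cdot> f"
    by (rule Tri_fill'[OF T assms, of "Ide C ?X" f]) (use ty Z in \<open>auto simp: Hom_iff\<close>)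
  then show ?thesis using X by (auto simp: Hom_iff)
qed

lemma Tri_Comp2:
  assumes "(f, g, h) \<in> Tri C" shows "h \<cdot> g = Zer C (Cod C f) (ShO C (Dom C f))"
  using Tri_Comp1[OF Tri_rotate'[OF assms]] TriE[OF assms] by simp

lemma Tri_Comp3:
  assumes "(f, g, h) \<in> Tri C" shows "ShA C f \<cdot> h = Zer C (Cod C g) (ShO C (Cod C f))"
proof -
  note ty = TriE[OF assms]
  have "Neg C (ShA C f) \<cdot> h = Zer C (Cod C g) (ShO C (Cod C f))"
    using Tri_Comp2[OF Tri_rotate'[OF assms]] ty by simp
  then show ?thesis using Neg_eq_Zer[of "ShA C f \<cdot> h"] ty by simp
qed

lemma Tri_Zer: "X \<in> Obj C \<Longrightarrow> zero_object C Z \<Longrightarrow>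
  (Zer C X Z, Zer C Z (ShO C X), Neg C (Ide C (ShO C X))) \<in> Tri C"
  using Tri_rotate'[OF Tri_Ide, of X Z] by simp

text \<open>Weak kernels and cokernels: the representable functors of a triangle are exact.\<close>

lemma Tri_ext1:
  assumes T: "(f, g, h) \<in> Tri C" and k: "k \<in> Hom C (Cod C f) W" "k \<cdot> f = Zer C (Dom C f) W"
  obtains l where "l \<in> Hom C (Cod C g) W" "l \<cdot> g = k"
proof -
  note ty = TriE[OF T]
  obtain Z where Z: "zero_object C Z" "Z \<in> Obj C" by (rule ex_zero)
  have W: "W \<in> Obj C" using k by (auto simp: Hom_iff)
  obtain W0 t where W0: "W0 \<in> Obj C" "t \<in> Iso C W W" using Ide_Iso[OF W] W by blast
  \<comment> \<open>The triangle with a zero object in first place and the identity of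
    \<open>W\<close> in second, obtained by reading \<open>Tri_rotate\<close> backwards. A morphism
    into it with zero first component is an extension of \<open>k\<close> along
    \<open>g\<close>.\<close>
  have ZI: "(Zer C Z W, Ide C W, Zer C W (ShO C Z)) \<in> Tri C"
  proof -
    have SZ: "zero_object C (ShO C Z)" using Sh_zero_object Z by blast
    have "(Ide C W, Zer C W (ShO C Z), Zer C (ShO C Z) (ShO C W)) \<in> Tri C"
      by (rule Tri_Ide[OF W SZ])
    moreover have "Neg C (ShA C (Zer C Z W)) = Zer C (ShO C Z) (ShO C W)" using Z W by simp
    ultimately show ?thesis
      using Tri_rotate[of "Zer C Z W" Z W "Ide C W" W "Zer C W (ShO C Z)"] Z W by (simp add: Hom_iff)
  qed
  obtain l where l: "l \<in> Hom C (Cod C g) W" "l \<cdot> g = Ide C W \<cdot> k"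
    by (rule Tri_fill'[OF T ZI, of "Zer C (Dom C f) Z" k]) (use ty k W Z in \<open>auto simp: Hom_iff\<close>)
  then show ?thesis using that k by (auto simp: Hom_iff)
qed

lemma Tri_ext2:
  assumes T: "(f, g, h) \<in> Tri C" and k: "k \<in> Hom C (Cod C g) W" "k \<cdot> g = Zer C (Cod C f) W"
  obtains l where "l \<in> Hom C (ShO C (Dom C f)) W" "l \<cdot> h = k"
  using Tri_ext1[OF Tri_rotate'[OF T], of k W] TriE[OF T] k by auto

text \<open>The fill-in axiom is applied to the triangle from \<open>W\<close> over a zero object to
  its suspension, so it yields an arrow between suspensions, which fullness of the shift brings
  back. This works directly for lifts through \<open>g\<close>; lifts through \<open>h\<close>
  follow by rotation, and lifts through \<open>f\<close> by shifting and rotating.\<close>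

lemma Tri_lift2:
  assumes T: "(f, g, h) \<in> Tri C" and k: "k \<in> Hom C W (Cod C g)"
    and z: "h \<cdot> k = Zer C W (ShO C (Dom C f))"
  obtains l where "l \<in> Hom C W (Cod C f)" "g \<cdot> l = k"
proof -
  note ty = TriE[OF T]
  have W: "W \<in> Obj C" using k by (auto simp: Hom_iff)
  obtain Z where Z: "zero_object C Z" "Z \<in> Obj C" by (rule ex_zero)
  have T2: "(Zer C W Z, Zer C Z (ShO C W), Neg C (Ide C (ShO C W))) \<in> Tri C"
    by (rule Tri_Zer[OF W Z(1)])
  have T3: "(h, Neg C (ShA C f), Neg C (ShA C g)) \<in> Tri C"
    using Tri_rotate'[OF Tri_rotate'[OF T]] .
  have sq: "Zer C Z (ShO C (Dom C f)) \<cdot> Zer C W Z = h \<cdot> k" using z W Z ty by simp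
  have "\<exists>c \<in> Hom C (ShO C W) (ShO C (Cod C f)).
     c \<cdot> Zer C Z (ShO C W) = Neg C (ShA C f) \<cdot> Zer C Z (ShO C (Dom C f)) \<and>
     ShA C k \<cdot> Neg C (Ide C (ShO C W)) = Neg C (ShA C g) \<cdot> c"
    by (rule Tri_fill[OF T2 T3, of W Z "ShO C W" "Cod C g" "ShO C (Dom C f)" "ShO C (Cod C f)" k
          "Zer C Z (ShO C (Dom C f))"]) (use Z ty k sq in \<open>auto simp: Hom_iff\<close>)
  then obtain c where c: "c \<in> Hom C (ShO C W) (ShO C (Cod C f))"
    "ShA C k \<cdot> Neg C (Ide C (ShO C W)) = Neg C (ShA C g) \<cdot> c" by blast
  obtain l where l: "l \<in> Hom C W (Cod C f)" "ShA C l = c"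
    using Sh_full[OF W _ c(1)] ty by (metis Cod_Obj)
  have "Neg C (ShA C k) = Neg C (ShA C (g \<cdot> l))"
    using c l(2) HomD[OF l(1)] k ty W Sh_Comp[of l g] by (simp add: Hom_iff)
  then have "Neg C (Neg C (ShA C k)) = Neg C (Neg C (ShA C (g \<cdot> l)))" by (rule arg_cong)
  then have "ShA C k = ShA C (g \<cdot> l)" using l k ty by (simp add: Hom_iff)
  then have "g \<cdot> l = k" using Sh_faithful[of k "g \<cdot> l"] l k ty by (simp add: Hom_iff)
  then show ?thesis using that l by blast
qed

lemma Tri_lift3:
  assumes T: "(f, g, h) \<in> Tri C" and k: "k \<in> Hom C W (ShO C (Dom C f))"
    and z: "ShA C f \<cdot> k = Zer C W (ShO C (Cod C f))"
  obtains l where "l \<in> Hom C W (Cod C g)" "h \<cdot> l = k"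
proof -
  note ty = TriE[OF T]
  have W: "W \<in> Obj C" using k by (auto simp: Hom_iff)
  have "Neg C (ShA C f) \<cdot> k = Zer C W (ShO C (Cod C f))"
    using z k ty W by (simp add: Hom_iff)
  then show ?thesis
    using Tri_lift2[OF Tri_rotate'[OF T], of k W] ty k that by auto
qed

lemma Tri_lift1:
  assumes T: "(f, g, h) \<in> Tri C" and k: "k \<in> Hom C W (Cod C f)"
    and z: "g \<cdot> k = Zer C W (Cod C g)"
  obtains l where "l \<in> Hom C W (Dom C f)" "f \<cdot> l = k"
proof -
  note ty = TriE[OF T]
  have W: "W \<in> Obj C" using k by (auto simp: Hom_iff)
  have "ShA C g \<cdot> ShA C k = Zer C (ShO C W) (ShO C (Cod C g))"
    using z k ty W Sh_Comp[of k g, symmetric] by (simp add: Hom_iff)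
  then obtain m where m: "m \<in> Hom C (ShO C W) (ShO C (Dom C f))" "Neg C (ShA C f) \<cdot> m = ShA C k"
    using Tri_lift3[OF Tri_rotate'[OF T], of "ShA C k" "ShO C W"] ty k
    by (auto simp: Hom_iff)
  obtain l where l: "l \<in> Hom C W (Dom C f)" "ShA C l = Neg C m"
    using Sh_full[OF W, of "Dom C f" "Neg C m"] m ty by (auto simp: Hom_iff)
  have "ShA C (f \<cdot> l) = ShA C f \<cdot> Neg C m" using l ty Sh_Comp[of l f] by (simp add: Hom_iff)
  also have "\<dots> = ShA C k" using m ty by (simp add: Hom_iff)
  finally have "f \<cdot> l = k" using Sh_faithful[of "f \<cdot> l" k] l k ty by (simp add: Hom_iff)
  then show ?thesis using that l by blast
qed

text \<open>Lifting the identity through \<open>f\<close> gives a right inverse \<open>l\<close>. An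
  endomorphism killed by \<open>f\<close> lifts, after shifting, through the zero cone and is
  therefore zero; applied to the difference of \<open>l \<cdot> f\<close> and the identity, this
  makes the inverse two-sided.\<close>

lemma Tri_zero_iso:
  assumes T: "(f, g, h) \<in> Tri C" and Z: "zero_object C (Cod C g)"
  shows "f \<in> Iso C (Dom C f) (Cod C f)"
proof -
  note ty = TriE[OF T]
  have g: "g = Zer C (Cod C f) (Cod C g)" using zero_object_arr(1)[OF Z] ty by metis
  have h: "h = Zer C (Cod C g) (ShO C (Dom C f))" using zero_object_arr(2)[OF Z] ty by metis
  have "g \<cdot> Ide C (Cod C f) = Zer C (Cod C f) (Cod C g)" using g ty by simp
  then obtain l where l: "l \<in> Hom C (Cod C f) (Dom C f)" "f \<cdot> l = Ide C (Cod C f)"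
    using Tri_lift1[OF T, of "Ide C (Cod C f)" "Cod C f"] ty by (auto simp: Hom_iff)
  have mono: "k = Zer C (Dom C f) (Dom C f)"
    if k: "k \<in> Hom C (Dom C f) (Dom C f)" "f \<cdot> k = Zer C (Dom C f) (Cod C f)" for k
  proof -
    have "ShA C f \<cdot> ShA C k = Zer C (ShO C (Dom C f)) (ShO C (Cod C f))"
      using k ty Sh_Comp[of k f, symmetric] by (simp add: Hom_iff)
    then obtain m where m: "m \<in> Hom C (ShO C (Dom C f)) (Cod C g)" "h \<cdot> m = ShA C k"
      using Tri_lift3[OF T, of "ShA C k" "ShO C (Dom C f)"] k by (auto simp: Hom_iff)
    have "h \<cdot> m = Zer C (ShO C (Dom C f)) (ShO C (Dom C f))"
      by (subst h) (use m ty in \<open>auto simp: Hom_iff\<close>)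
    then show ?thesis using Sh_zero_arr[of k] m k by (simp add: Hom_iff)
  qed
  have fl: "f \<cdot> l \<cdot> f = f" using l ty by (simp add: Hom_iff comp_red[OF l(2)])
  have "Add C (l \<cdot> f) (Neg C (Ide C (Dom C f))) = Zer C (Dom C f) (Dom C f)"
    by (rule mono) (use l ty fl in \<open>auto simp: Hom_iff\<close>)
  note z = this
  have "l \<cdot> f = Ide C (Dom C f)"
    by (rule diff_eq_Zer) (use z l ty in \<open>auto simp: Hom_iff\<close>)
  then show ?thesis using l ty by (intro IsoI[of _ _ _ _ l]) (auto simp: Hom_iff)
qed

text \<open>\<open>epi\<close> makes the second map of the cone triangle vanish and
  \<open>mono\<close> the third. Then the identity of the cone lifts through a zero map, so the cone
  is zero.\<close>

lemma mono_epi_iso: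
  assumes c: "c \<in> Arr C"
    and mono: "\<And>k. k \<in> Arr C \<Longrightarrow> Cod C k = Dom C c \<Longrightarrow> c \<cdot> k = Zer C (Dom C k) (Cod C c)
      \<Longrightarrow> k = Zer C (Dom C k) (Dom C c)"
    and epi: "\<And>k. k \<in> Arr C \<Longrightarrow> Dom C k = Cod C c \<Longrightarrow> k \<cdot> c = Zer C (Dom C c) (Cod C k)
      \<Longrightarrow> k = Zer C (Cod C c) (Cod C k)"
  shows "c \<in> Iso C (Dom C c) (Cod C c)"
proof -
  obtain v w where T: "(c, v, w) \<in> Tri C" using Tri_cone[OF c] by blast
  note ty = TriE[OF T]
  have v: "v = Zer C (Cod C c) (Cod C v)" by (rule epi) (use ty Tri_Comp1[OF T] in auto)
  \<comment> \<open>The arrow \<open>w\<close> ends in a suspension. Its source is replaced by an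
    isomorphic suspension, so that it can be desuspended before \<open>mono\<close> is
    applied.\<close>
  have w: "w = Zer C (Cod C v) (ShO C (Dom C c))"
  proof -
    obtain V where V: "V \<in> Obj C" "isomorphic C (ShO C V) (Cod C v)"
      using desuspend[of "Cod C v"] ty by auto
    obtain s where s: "s \<in> Iso C (ShO C V) (Cod C v)" using V by (auto simp: isomorphic_def)
    note sty = IsoD[OF s]
    obtain w' where w': "w' \<in> Hom C V (Dom C c)" "ShA C w' = w \<cdot> s"
      using Sh_full[of V "Dom C c" "w \<cdot> s"] V sty ty by (auto simp: Hom_iff)
    have "ShA C (c \<cdot> w') = ShA C c \<cdot> w \<cdot> s" using w' ty Sh_Comp[of w' c] by (simp add: Hom_iff)
    also have "\<dots> = (ShA C c \<cdot> w) \<cdot> s" using ty sty by simp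
    also have "\<dots> = Zer C (ShO C V) (ShO C (Cod C c))" using Tri_Comp3[OF T] ty sty by simp
    finally have "c \<cdot> w' = Zer C V (Cod C c)" using Sh_zero_arr[of "c \<cdot> w'"] w' ty by (simp add: Hom_iff)
    then have "w' = Zer C V (Dom C c)" using mono[of w'] w' by (simp add: Hom_iff)
    then have "w \<cdot> s = Zer C (ShO C V) (ShO C (Dom C c))" using w' ty V by simp
    moreover have "Zer C (Cod C v) (ShO C (Dom C c)) \<cdot> s = Zer C (ShO C V) (ShO C (Dom C c))"
      using sty ty by simp
    ultimately have "w \<cdot> s = Zer C (Cod C v) (ShO C (Dom C c)) \<cdot> s" by simp
    then show ?thesis by (rule Iso_right_cancel[OF s]) (use ty in auto)
  qed
  have "w \<cdot> Ide C (Cod C v) = Zer C (Cod C v) (ShO C (Dom C c))" using w ty by simp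
  then obtain l where l: "l \<in> Hom C (Cod C v) (Cod C c)" "v \<cdot> l = Ide C (Cod C v)"
    using Tri_lift2[OF T, of "Ide C (Cod C v)" "Cod C v"] ty by (auto simp: Hom_iff)
  have "v \<cdot> l = Zer C (Cod C v) (Cod C v)" by (subst v) (use l ty in \<open>auto simp: Hom_iff\<close>)
  then have "zero_object C (Cod C v)" using l ty by (auto simp: zero_object_iff)
  then show ?thesis by (rule Tri_zero_iso[OF T])
qed

text \<open>The five lemma without long exact sequences: the fill-in of two identities is shown to
  be monic and epic by chasing through weak kernels and cokernels.\<close>

lemma cone_unique:
  assumes T: "(f, g, h) \<in> Tri C" and T': "(f, g', h') \<in> Tri C"
  shows "isomorphic C (Cod C g) (Cod C g')"
proof -
  note ty = TriE[OF T] and ty' = TriE[OF T']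
  obtain c where c': "c \<in> Hom C (Cod C g) (Cod C g')" "c \<cdot> g = g' \<cdot> Ide C (Cod C f)"
    "ShA C (Ide C (Dom C f)) \<cdot> h = h' \<cdot> c"
    by (rule Tri_fill'[OF T T', of "Ide C (Dom C f)" "Ide C (Cod C f)"]) (use ty in \<open>auto simp: Hom_iff\<close>)
  have c: "c \<in> Hom C (Cod C g) (Cod C g')" "c \<cdot> g = g'" "h' \<cdot> c = h"
    using c' ty ty' by simp_all
  note cty = HomD[OF c(1)]
  have "c \<in> Iso C (Dom C c) (Cod C c)"
  proof (rule mono_epi_iso)
    show "c \<in> Arr C" using cty by simp
  next
    fix k assume k: "k \<in> Arr C" "Cod C k = Dom C c" "c \<cdot> k = Zer C (Dom C k) (Cod C c)"
    have "h \<cdot> k = h' \<cdot> c \<cdot> k" using k(1,2) cty ty' by (simp add: comp_red[OF c(3)])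
    also have "\<dots> = Zer C (Dom C k) (ShO C (Dom C f))" unfolding k(3) using k(1) cty ty' by simp
    finally have "h \<cdot> k = Zer C (Dom C k) (ShO C (Dom C f))" .
    then obtain l where l: "l \<in> Hom C (Dom C k) (Cod C f)" "g \<cdot> l = k"
      using Tri_lift2[OF T, of k "Dom C k"] k cty by (auto simp: Hom_iff)
    have "c \<cdot> (g \<cdot> l) = g' \<cdot> l" by (rule comp_red[OF c(2)]) (use HomD[OF l(1)] cty ty in auto)
    then have "g' \<cdot> l = c \<cdot> k" by (simp only: l(2))
    then have "g' \<cdot> l = Zer C (Dom C k) (Cod C g')" using k cty by simp
    then obtain m where m: "m \<in> Hom C (Dom C k) (Dom C f)" "f \<cdot> m = l"
      using Tri_lift1[OF T', of l "Dom C k"] l by auto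
    have "k = g \<cdot> (f \<cdot> m)" by (simp only: m(2) l(2))
    also have "\<dots> = (g \<cdot> f) \<cdot> m" using HomD[OF m(1)] ty by simp
    also have "\<dots> = Zer C (Dom C k) (Dom C c)" using Tri_Comp1[OF T] HomD[OF m(1)] ty cty by simp
    finally show "k = Zer C (Dom C k) (Dom C c)" .
  next
    fix k assume k: "k \<in> Arr C" "Dom C k = Cod C c" "k \<cdot> c = Zer C (Dom C c) (Cod C k)"
    have "k \<cdot> g' = k \<cdot> (c \<cdot> g)" by (simp only: c(2))
    also have "\<dots> = (k \<cdot> c) \<cdot> g" by (rule Comp_assoc'[symmetric]) (use k cty ty in auto)
    also have "\<dots> = Zer C (Cod C f) (Cod C k)" unfolding k(3) using k(1) cty ty by simp
    finally have "k \<cdot> g' = Zer C (Cod C f) (Cod C k)" .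
    then obtain l where l: "l \<in> Hom C (ShO C (Dom C f)) (Cod C k)" "l \<cdot> h' = k"
      using Tri_ext2[OF T', of k "Cod C k"] k cty by (auto simp: Hom_iff)
    have "l \<cdot> h = (l \<cdot> h') \<cdot> c" using c(3) HomD[OF l(1)] cty ty' by simp
    then have "l \<cdot> h = Zer C (Cod C g) (Cod C k)" using l k cty by simp
    then obtain m where m: "m \<in> Hom C (ShO C (Cod C f)) (Cod C k)" "m \<cdot> Neg C (ShA C f) = l"
      using Tri_ext2[OF Tri_rotate'[OF T], of l "Cod C k"] ty l by auto
    have "k = (m \<cdot> Neg C (ShA C f)) \<cdot> h'" using m l by simp
    also have "\<dots> = Zer C (Cod C c) (Cod C k)"
      using Tri_Comp3[OF T'] HomD[OF m(1)] ty' cty k(1) by simp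
    finally show "k = Zer C (Cod C c) (Cod C k)" .
  qed
  then show ?thesis using cty isomorphicI by metis
qed

text \<open>The third map is killed by \<open>ShA C i\<close>, which is split monic, so it vanishes
  and \<open>q\<close> has a section \<open>j\<close>. The given retraction \<open>p\<close> need
  not vanish on \<open>j\<close>; it is replaced by \<open>p'\<close>, the factorization through
  \<open>i\<close> of the identity minus \<open>j \<cdot> q\<close>.\<close>

lemma split_mono_summand:
  assumes T: "(i, q, w) \<in> Tri C" and p: "p \<in> Hom C (Cod C i) (Dom C i)" "p \<cdot> i = Ide C (Dom C i)"
  obtains j p' where "j \<in> Hom C (Cod C q) (Cod C i)" "p' \<in> Hom C (Cod C i) (Dom C i)"
    "q \<cdot> j = Ide C (Cod C q)" "p' \<cdot> i = Ide C (Dom C i)" "p' \<cdot> j = Zer C (Cod C q) (Dom C i)"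
    "q \<cdot> i = Zer C (Dom C i) (Cod C q)" "Add C (i \<cdot> p') (j \<cdot> q) = Ide C (Cod C i)"
proof -
  note ty = TriE[OF T] and pty = HomD[OF p(1)]
  have "w = ShA C (p \<cdot> i) \<cdot> w" using p ty by simp
  also have "\<dots> = ShA C p \<cdot> (ShA C i \<cdot> w)" using p(1) ty Sh_Comp[of i p] by (simp add: Hom_iff)
  also have "\<dots> = Zer C (Cod C q) (ShO C (Dom C i))" using Tri_Comp3[OF T] pty ty by simp
  finally have w: "w = Zer C (Cod C q) (ShO C (Dom C i))" .
  have "w \<cdot> Ide C (Cod C q) = Zer C (Cod C q) (ShO C (Dom C i))" using w ty by simp
  then obtain j where j: "j \<in> Hom C (Cod C q) (Cod C i)" "q \<cdot> j = Ide C (Cod C q)"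
    using Tri_lift2[OF T, of "Ide C (Cod C q)" "Cod C q"] ty by (auto simp: Hom_iff)
  note jty = HomD[OF j(1)]
  let ?r = "Add C (Ide C (Cod C i)) (Neg C (j \<cdot> q))"
  have qi: "q \<cdot> i = Zer C (Dom C i) (Cod C q)" by (rule Tri_Comp1[OF T])
  have qjq: "q \<cdot> j \<cdot> q = q" using jty ty by (simp add: comp_red[OF j(2)])
  have rty: "?r \<in> Hom C (Cod C i) (Cod C i)" using jty ty by (simp add: Hom_iff)
  have "q \<cdot> ?r = Zer C (Cod C i) (Cod C q)" using jty ty qjq by simp
  then obtain p' where p': "p' \<in> Hom C (Cod C i) (Dom C i)" "i \<cdot> p' = ?r"
    using Tri_lift1[OF T rty] by auto
  note pty' = HomD[OF p'(1)]
  have imono: "k = l" if "i \<cdot> k = i \<cdot> l" "k \<in> Arr C" "l \<in> Arr C" "Cod C k = Dom C i"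
    "Cod C l = Dom C i" for k l
  proof -
    have "p \<cdot> i \<cdot> k = p \<cdot> i \<cdot> l" using that by simp
    then show ?thesis using that(2-) pty ty by (simp add: comp_red[OF p(2)])
  qed
  have ri: "?r \<cdot> i = i" using jty ty qi by simp
  have rj: "?r \<cdot> j = Zer C (Cod C q) (Cod C i)" using jty ty j(2) by simp
  have "p' \<cdot> i = Ide C (Dom C i)"
    by (rule imono) (use ri pty' ty in \<open>auto simp: comp_red[OF p'(2)] simp del: Add_Comp'\<close>)
  moreover have "p' \<cdot> j = Zer C (Cod C q) (Dom C i)"
    by (rule imono) (use rj pty' jty ty in \<open>auto simp: comp_red[OF p'(2)] simp del: Add_Comp'\<close>)
  moreover have "Add C (i \<cdot> p') (j \<cdot> q) = Ide C (Cod C i)"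
    unfolding p'(2) by (rule diff_add) (use jty ty in auto)
  ultimately show ?thesis using that j p' qi by blast
qed

text \<open>The complement is the cone of the section. \<open>thick_tensor_ideal\<close> speaks of
  summands of binary coproducts, whereas the arguments about duals produce retracts.\<close>

lemma retract_summand:
  assumes "retract C X S" obtains Y where "Y \<in> Obj C" "is_binary_coproduct C X Y S"
proof -
  obtain i p where i: "i \<in> Hom C X S" "p \<in> Hom C S X" "p \<cdot> i = Ide C X"
    using assms by (auto simp: retract_def)
  obtain q w where T: "(i, q, w) \<in> Tri C" using Tri_cone[OF HomD(1)[OF i(1)]] by blast
  note ty = TriE[OF T]
  obtain j p' where j: "j \<in> Hom C (Cod C q) (Cod C i)" "p' \<in> Hom C (Cod C i) (Dom C i)"
    "q \<cdot> j = Ide C (Cod C q)" "p' \<cdot> i = Ide C (Dom C i)" "p' \<cdot> j = Zer C (Cod C q) (Dom C i)"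
    "q \<cdot> i = Zer C (Dom C i) (Cod C q)" "Add C (i \<cdot> p') (j \<cdot> q) = Ide C (Cod C i)"
    by (rule split_mono_summand[OF T, of p]) (use i in \<open>auto simp: Hom_iff\<close>)
  have "is_binary_coproduct C X (Cod C q) S"
    by (rule binary_coproductI[of i X S j "Cod C q" p' q]) (use i j ty in \<open>auto simp: Hom_iff\<close>)
  then show ?thesis by (rule that[rotated]) (use ty in simp)
qed

lemma binary_coproduct_retract:
  assumes "is_binary_coproduct C X Y S" "X \<in> Obj C" "Y \<in> Obj C"
  shows "retract C X S"
  using binary_coproductE[OF assms] unfolding retract_def by metis

text \<open>\<open>Y\<close> and the cone of the inclusion of \<open>X\<close> are both complements
  of \<open>X\<close> in \<open>S\<close>. Comparing the two decompositions gives an isomorphism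
  along which the cone triangle is adjusted.\<close>

lemma binary_coproduct_Tri:
  assumes "is_binary_coproduct C X Y S" "X \<in> Obj C" "Y \<in> Obj C"
  obtains f g h where "(f, g, h) \<in> Tri C" "Dom C f = X" "Cod C f = S" "Cod C g = Y"
proof -
  obtain i j p q where b: "i \<in> Hom C X S" "j \<in> Hom C Y S" "p \<in> Hom C S X" "q \<in> Hom C S Y"
    "p \<cdot> i = Ide C X" "q \<cdot> j = Ide C Y" "p \<cdot> j = Zer C Y X" "q \<cdot> i = Zer C X Y"
    "Add C (i \<cdot> p) (j \<cdot> q) = Ide C S" by (rule binary_coproductE[OF assms])
  note bty = b(1-4)[unfolded Hom_iff]
  obtain g h where T: "(i, g, h) \<in> Tri C" using Tri_cone[OF HomD(1)[OF b(1)]] by blast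
  note ty = TriE[OF T]
  obtain j' p' where j': "j' \<in> Hom C (Cod C g) (Cod C i)" "p' \<in> Hom C (Cod C i) (Dom C i)"
    "g \<cdot> j' = Ide C (Cod C g)" "p' \<cdot> i = Ide C (Dom C i)" "p' \<cdot> j' = Zer C (Cod C g) (Dom C i)"
    "g \<cdot> i = Zer C (Dom C i) (Cod C g)" "Add C (i \<cdot> p') (j' \<cdot> g) = Ide C (Cod C i)"
    by (rule split_mono_summand[OF T, of p]) (use b in \<open>auto simp: Hom_iff\<close>)
  note jty' = j'(1-2)[unfolded Hom_iff]
  have "q \<cdot> j' \<cdot> g = q"
  proof -
    have "q = q \<cdot> Add C (i \<cdot> p') (j' \<cdot> g)" using j' bty by simp
    also have "\<dots> = Add C ((q \<cdot> i) \<cdot> p') (q \<cdot> j' \<cdot> g)" using jty' bty ty by simp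
    also have "\<dots> = q \<cdot> j' \<cdot> g" using b(8) jty' bty ty assms by simp
    finally show ?thesis by simp
  qed
  moreover have "g \<cdot> j \<cdot> q = g"
  proof -
    have "g = g \<cdot> Add C (i \<cdot> p) (j \<cdot> q)" using b bty ty by simp
    also have "\<dots> = Add C ((g \<cdot> i) \<cdot> p) (g \<cdot> j \<cdot> q)" using bty ty by simp
    also have "\<dots> = g \<cdot> j \<cdot> q" using j'(6) bty ty by simp
    finally show ?thesis by simp
  qed
  ultimately have qj: "q \<cdot> (j' \<cdot> g) = q" and gj: "g \<cdot> (j \<cdot> q) = g" by simp_all
  have "(q \<cdot> j') \<cdot> (g \<cdot> j) = (q \<cdot> (j' \<cdot> g)) \<cdot> j" using bty jty' ty by simp
  also have "\<dots> = Ide C Y" by (simp only: qj b(6))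
  finally have 1: "(q \<cdot> j') \<cdot> (g \<cdot> j) = Ide C Y" .
  have "(g \<cdot> j) \<cdot> (q \<cdot> j') = (g \<cdot> (j \<cdot> q)) \<cdot> j'" using bty jty' ty by simp
  also have "\<dots> = Ide C (Cod C g)" by (simp only: gj j'(3))
  finally have 2: "(g \<cdot> j) \<cdot> (q \<cdot> j') = Ide C (Cod C g)" .
  have iso: "q \<cdot> j' \<in> Iso C (Cod C g) Y"
    by (rule IsoI[of _ _ _ _ "g \<cdot> j", OF _ _ 2 1]) (use bty jty' ty in \<open>auto simp: Hom_iff\<close>)
  let ?t = "q \<cdot> j'"
  note it = IsoD[OF iso] Inv_typ[OF iso] Inv_props[OF iso]
  have "(i, ?t \<cdot> g, h \<cdot> Inv C ?t) \<in> Tri C"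
  proof (rule Tri_iso[OF T, of X S "Cod C g" i X S "?t \<cdot> g" Y "h \<cdot> Inv C ?t" "Ide C X" "Ide C S" ?t])
    show "ShA C (Ide C X) \<cdot> h = (h \<cdot> Inv C ?t) \<cdot> ?t"
      using it(8) it(1-7) bty ty assms Comp_assoc'[of ?t "Inv C ?t" h] by (simp del: Comp_assoc')
  qed (use bty ty it iso assms Ide_Iso in \<open>auto simp: Hom_iff\<close>)
  then show ?thesis using that[of i "?t \<cdot> g"] bty ty it by simp
qed

end

section \<open>Triangulated subcategories, in particular the compact objects\<close>

lemma triangulated_subcategoryD:
  assumes "triangulated_subcategory C S"
  shows "S \<subseteq> Obj C" "zero_object C Z \<Longrightarrow> Z \<in> S" "X \<in> S \<Longrightarrow> isomorphic C X Y \<Longrightarrow> Y \<in> Obj C \<Longrightarrow> Y \<in> S"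
    "X \<in> Obj C \<Longrightarrow> ShO C X \<in> S \<longleftrightarrow> X \<in> S"
    "(f, g, h) \<in> Tri C \<Longrightarrow> Dom C f \<in> S \<Longrightarrow> Cod C f \<in> S \<Longrightarrow> Cod C g \<in> S"
  using assms unfolding triangulated_subcategory_def by blast+

context triangulated_category
begin

lemma triangulated_iso:
  "triangulated_subcategory C S \<Longrightarrow> X \<in> S \<Longrightarrow> isomorphic C X Y \<Longrightarrow> Y \<in> S"
  using triangulated_subcategoryD(3)[of C S X Y] isomorphic_Obj[of X Y] by blast

lemma triangulated_first:
  assumes S: "triangulated_subcategory C S" and T: "(f, g, h) \<in> Tri C"
    and "Cod C f \<in> S" "Cod C g \<in> S"
  shows "Dom C f \<in> S"
proof -
  note ty = TriE[OF T]
  have "Cod C h \<in> S"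
    using triangulated_subcategoryD(5)[OF S Tri_rotate'[OF T]] assms(3,4) ty by simp
  then show ?thesis using triangulated_subcategoryD(4)[OF S] ty by simp
qed

lemma triangulated_middle:
  assumes S: "triangulated_subcategory C S" and T: "(f, g, h) \<in> Tri C"
    and "Dom C f \<in> S" "Cod C g \<in> S"
  shows "Cod C f \<in> S"
proof -
  note ty = TriE[OF T]
  have "Dom C g \<in> S"
    by (rule triangulated_first[OF S Tri_rotate'[OF T]])
      (use ty assms triangulated_subcategoryD(4)[OF S] in auto)
  then show ?thesis using ty by simp
qed

lemma triangulated_binary_coproduct:
  assumes S: "triangulated_subcategory C S" and "X \<in> S" "Y \<in> S" "is_binary_coproduct C X Y Z"
  shows "Z \<in> S"
proof -
  have XY: "X \<in> Obj C" "Y \<in> Obj C" using assms triangulated_subcategoryD(1)[OF S] by auto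
  obtain f g h where T: "(f, g, h) \<in> Tri C" "Dom C f = X" "Cod C f = Z" "Cod C g = Y"
    by (rule binary_coproduct_Tri[OF assms(4) XY])
  then show ?thesis using triangulated_middle[OF S T(1)] assms by auto
qed

lemma cone_exists:
  assumes "f \<in> Hom C X Y"
  obtains g h Z where "(f, g, h) \<in> Tri C" "g \<in> Hom C Y Z" "h \<in> Hom C Z (ShO C X)"
proof -
  obtain g h where T: "(f, g, h) \<in> Tri C" using Tri_cone[OF HomD(1)[OF assms]] by blast
  then show ?thesis using that[OF T, of "Cod C g"] TriE[OF T] assms by (auto simp: Hom_iff)
qed

text \<open>The cone of \<open>g\<close> is desuspended and the triangle rotated back; the sign in
  the rotation axiom is absorbed into the choice of \<open>f\<close>.\<close>

lemma fiber_exists: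
  assumes "g \<in> Hom C Y Z"
  obtains f h X where "(f, g, h) \<in> Tri C" "f \<in> Hom C X Y" "h \<in> Hom C Z (ShO C X)"
proof -
  note gty = HomD[OF assms]
  obtain u v where T: "(g, u, v) \<in> Tri C" using Tri_cone[OF HomD(1)[OF assms]] by blast
  note ty = TriE[OF T]
  obtain X where X: "X \<in> Obj C" "isomorphic C (ShO C X) (Cod C u)" using desuspend[of "Cod C u"] ty by auto
  obtain t where t: "t \<in> Iso C (Cod C u) (ShO C X)"
    using isomorphic_sym[OF X(2)] by (auto simp: isomorphic_def)
  note it = IsoD[OF t] Inv_typ[OF t] Inv_props[OF t]
  have T2: "(g, t \<cdot> u, v \<cdot> Inv C t) \<in> Tri C"
  proof (rule Tri_iso[OF T, of Y Z "Cod C u" g Y Z "t \<cdot> u" "ShO C X" "v \<cdot> Inv C t"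
        "Ide C Y" "Ide C Z" t])
    show "ShA C (Ide C Y) \<cdot> v = (v \<cdot> Inv C t) \<cdot> t"
      using it(8) it(1-7) gty ty Dom_Obj'[of g] Comp_assoc'[of t "Inv C t" v] by (simp del: Comp_assoc')
  qed (use gty ty it t Ide_Iso Dom_Obj'[of g] Cod_Obj'[of g] in \<open>auto simp: Hom_iff\<close>)
  have YO: "Y \<in> Obj C" "Z \<in> Obj C" using Hom_Obj assms by blast+
  obtain f where f: "f \<in> Hom C X Y" "ShA C f = Neg C (v \<cdot> Inv C t)"
    using Sh_full[OF X(1) YO(1), of "Neg C (v \<cdot> Inv C t)"] it ty gty by (auto simp: Hom_iff)
  have "Neg C (ShA C f) = v \<cdot> Inv C t" using f it ty by simp
  then have "(f, g, t \<cdot> u) \<in> Tri C"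
    using Tri_rotate[of f X Y g Z "t \<cdot> u"] T2 f assms it ty by (simp add: Hom_iff)
  then show ?thesis using that f it ty gty by (simp add: Hom_iff)
qed

text \<open>A coproduct of the \<open>Y i\<close> is turned into one of desuspensions
  \<open>Z i\<close>, where a finite part fixes the desuspended arrow. Conjugating the shifted
  idempotent with \<open>s\<close> gives the corresponding finite part of the original
  coproduct.\<close>

lemma Sh_compact:
  assumes "c \<in> compact_objects U C" shows "ShO C c \<in> compact_objects U C"
proof (rule compact_objectsI)
  have c: "c \<in> Obj C" using compact_Obj[OF assms] .
  then show "ShO C c \<in> Obj C" by simp
  fix I Y S and inc :: "_ \<Rightarrow> 'm" and h
  assume I: "I \<subseteq> U" "small U I" and Y: "\<And>i. i \<in> I \<Longrightarrow> Y i \<in> Obj C"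
    and S: "is_coproduct C I Y S inc" and h: "h \<in> Hom C (ShO C c) S"
  have "\<exists>Z. Z \<in> Obj C \<and> isomorphic C (ShO C Z) (Y i)" if "i \<in> I" for i using desuspend[OF Y[OF that]] by blast
  then obtain Z where Z: "\<And>i. i \<in> I \<Longrightarrow> Z i \<in> Obj C \<and> isomorphic C (ShO C (Z i)) (Y i)" by metis
  have "\<exists>t. t \<in> Iso C (ShO C (Z i)) (Y i)" if "i \<in> I" for i using Z[OF that] by (auto simp: isomorphic_def)
  then obtain t where t: "\<And>i. i \<in> I \<Longrightarrow> t i \<in> Iso C (ShO C (Z i)) (Y i)" by metis
  obtain R where R: "R \<in> Obj C" "isomorphic C (ShO C R) S" using desuspend[OF coproduct_Obj[OF S]] .
  then obtain s where s: "s \<in> Iso C (ShO C R) S" by (auto simp: isomorphic_def)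
  note st = IsoD[OF s] Inv_typ[OF s] Inv_props[OF s] Inv_cancel[OF s]
  note inc = coproduct_inc[OF S]
  have "\<exists>j. j \<in> Hom C (Z i) R \<and> ShA C j = Inv C s \<cdot> inc i \<cdot> t i" if i: "i \<in> I" for i
    by (rule Sh_full[of "Z i" R "Inv C s \<cdot> inc i \<cdot> t i"])
      (use Z[OF i] R IsoD[OF t[OF i]] inc[OF i] st in \<open>auto simp: Hom_iff\<close>)
  then obtain j where j: "\<And>i. i \<in> I \<Longrightarrow> j i \<in> Hom C (Z i) R \<and> ShA C (j i) = Inv C s \<cdot> inc i \<cdot> t i" by metis
  have js: "s \<cdot> ShA C (j i) = inc i \<cdot> t i" if i: "i \<in> I" for i
    using j[OF i] st IsoD[OF t[OF i]] inc[OF i] by (simp add: Hom_iff)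
  have "is_coproduct C I (ShO C \<circ> Z) (ShO C R) (ShA C \<circ> j)"
    by (rule coproduct_cong[OF coproduct_iso_transport[OF coproduct_iso_objects[OF S t] Inv_Iso[OF s]]])
      (use j in \<open>auto simp: Iso_def Hom_def\<close>)
  then have cop: "is_coproduct C I Z R j"
    by (rule equivalence_coproduct_reflect[OF Sh_equivalence category_axioms category_axioms _ R(1)]) (use j in blast)
  obtain k where k: "k \<in> Hom C c R" "ShA C k = Inv C s \<cdot> h"
    by (rule Sh_full[OF c R(1), of "Inv C s \<cdot> h"]) (use h st in \<open>auto simp: Hom_iff\<close>)
  obtain F where F: "finite F" "F \<subseteq> I" "coproduct_part C I Z R j F \<cdot> k = k"
    using compact_objectsD[OF assms I _ cop k(1)] Z by blast
  let ?e = "coproduct_part C I Z R j F"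
  note et = coproduct_part_typ[OF cop, of F]
  have "s \<cdot> ShA C ?e \<cdot> Inv C s = coproduct_part C I Y S inc F"
  proof (rule coproduct_part_unique[OF S])
    fix i assume i: "i \<in> I"
    have "(s \<cdot> ShA C ?e \<cdot> Inv C s) \<cdot> inc i = s \<cdot> ShA C ?e \<cdot> (Inv C s \<cdot> inc i \<cdot> t i) \<cdot> Inv C (t i)"
      using st et inc[OF i] IsoD[OF t[OF i]] Inv_typ[OF t[OF i]] Inv_props(3)[OF t[OF i]] by (simp add: Hom_iff)
    also have "\<dots> = s \<cdot> ShA C (?e \<cdot> j i) \<cdot> Inv C (t i)"
      using j[OF i] et Sh_Comp[of "j i" ?e] Inv_typ[OF t[OF i]] st inc[OF i] IsoD[OF t[OF i]]
      by (simp add: Hom_iff)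
    also have "\<dots> = (if i \<in> F then inc i else Zer C (Y i) S)"
    proof (cases "i \<in> F")
      case True
      have "s \<cdot> ShA C (j i) \<cdot> Inv C (t i) = inc i \<cdot> t i \<cdot> Inv C (t i)"
        by (subst comp_red[OF js[OF i]])
          (use HomD[OF conjunct1[OF j[OF i]]] inc[OF i] IsoD[OF t[OF i]] Inv_typ[OF t[OF i]] st in \<open>auto simp: Hom_iff\<close>)
      then show ?thesis using True coproduct_part(2)[OF cop i] Inv_props(3)[OF t[OF i]] inc[OF i]
        by (simp add: Hom_iff)
    next
      case False
      then show ?thesis using coproduct_part(2)[OF cop i, of F] Z[OF i] R(1) Inv_typ[OF t[OF i]] st Y[OF i]
        by simp
    qed
    finally show "(s \<cdot> ShA C ?e \<cdot> Inv C s) \<cdot> inc i = (if i \<in> F then inc i else Zer C (Y i) S)" .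
  qed (use st et in \<open>auto simp: Hom_iff\<close>)
  moreover have "(s \<cdot> ShA C ?e \<cdot> Inv C s) \<cdot> h = h"
  proof -
    have "(s \<cdot> ShA C ?e \<cdot> Inv C s) \<cdot> h = s \<cdot> ShA C (?e \<cdot> k)"
      using st et h k Sh_Comp[of k ?e] by (simp add: Hom_iff)
    then show ?thesis using F(3) k(2) st h by (simp add: Hom_iff)
  qed
  ultimately show "\<exists>F. finite F \<and> F \<subseteq> I \<and> coproduct_part C I Y S inc F \<cdot> h = h" using F by metis
qed

lemma compact_desuspend:
  assumes "ShO C c \<in> compact_objects U C" "c \<in> Obj C" shows "c \<in> compact_objects U C"
proof (rule compact_objectsI[OF assms(2)])
  fix I Y S and inc :: "_ \<Rightarrow> 'm" and h
  assume I: "I \<subseteq> U" "small U I" and Y: "\<And>i. i \<in> I \<Longrightarrow> Y i \<in> Obj C"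
    and S: "is_coproduct C I Y S inc" and h: "h \<in> Hom C c S"
  have S': "is_coproduct C I (ShO C \<circ> Y) (ShO C S) (ShA C \<circ> inc)" by (rule Sh_coproduct[OF S Y])
  obtain F where F: "finite F" "F \<subseteq> I"
    "coproduct_part C I (ShO C \<circ> Y) (ShO C S) (ShA C \<circ> inc) F \<cdot> ShA C h = ShA C h"
    using compact_objectsD[OF assms(1) I _ S', of "ShA C h"] h Y by (auto simp: Hom_iff)
  have SO: "S \<in> Obj C" using coproduct_Obj[OF S] .
  note et = coproduct_part_typ[OF S, of F]
  have "ShA C (coproduct_part C I Y S inc F) = coproduct_part C I (ShO C \<circ> Y) (ShO C S) (ShA C \<circ> inc) F"
  proof (rule coproduct_part_unique[OF S'])
    fix i assume i: "i \<in> I"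
    have "ShA C (coproduct_part C I Y S inc F) \<cdot> ShA C (inc i) = ShA C (coproduct_part C I Y S inc F \<cdot> inc i)"
      by (rule Sh_Comp[symmetric]) (use et coproduct_inc[OF S i] in \<open>auto simp: Hom_iff\<close>)
    then show "ShA C (coproduct_part C I Y S inc F) \<cdot> (ShA C \<circ> inc) i =
       (if i \<in> F then (ShA C \<circ> inc) i else Zer C ((ShO C \<circ> Y) i) (ShO C S))"
      using coproduct_part(2)[OF S i, of F] Y[OF i] SO by auto
  qed (use et in \<open>auto simp: Hom_iff\<close>)
  then have "ShA C (coproduct_part C I Y S inc F \<cdot> h) = ShA C h"
    using F(3) Sh_Comp[of h "coproduct_part C I Y S inc F"] et h by (simp add: Hom_iff)
  then have "coproduct_part C I Y S inc F \<cdot> h = h"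
    by (rule Sh_faithful[rotated -1]) (use et h in \<open>auto simp: Hom_iff\<close>)
  then show "\<exists>F. finite F \<and> F \<subseteq> I \<and> coproduct_part C I Y S inc F \<cdot> h = h" using F by blast
qed

lemma compact_retract:
  assumes "retract C b c" "c \<in> compact_objects U C" shows "b \<in> compact_objects U C"
proof -
  obtain i p where i: "i \<in> Hom C b c" "p \<in> Hom C c b" "p \<cdot> i = Ide C b"
    using assms(1) by (auto simp: retract_def)
  have b: "b \<in> Obj C" using i Hom_Obj by blast
  show ?thesis
  proof (rule compact_objectsI[OF b])
    fix I Y S and inc :: "_ \<Rightarrow> 'm" and h
    assume I: "I \<subseteq> U" "small U I" and Y: "\<And>i. i \<in> I \<Longrightarrow> Y i \<in> Obj C"
      and S: "is_coproduct C I Y S inc" and h: "h \<in> Hom C b S"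
    have "h \<cdot> p \<in> Hom C c S" using h i Comp_Hom by blast
    then obtain F where F: "finite F" "F \<subseteq> I" "coproduct_part C I Y S inc F \<cdot> h \<cdot> p = h \<cdot> p"
      using compact_objectsD[OF assms(2) I Y S] by blast
    note et = coproduct_part_typ[OF S, of F]
    have "coproduct_part C I Y S inc F \<cdot> h = (coproduct_part C I Y S inc F \<cdot> h \<cdot> p) \<cdot> i"
      using et h i by (simp add: Hom_iff)
    also have "\<dots> = h" unfolding F(3) using h i by (simp add: Hom_iff)
    finally show "\<exists>F. finite F \<and> F \<subseteq> I \<and> coproduct_part C I Y S inc F \<cdot> h = h" using F by blast
  qed
qed

text \<open>A finite part over \<open>F\<close> fixes \<open>k \<cdot> g\<close>. The error
  \<open>?d\<close> kills \<open>g\<close>, so it factors through the suspension of the first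
  object, which is compact; that gives \<open>G\<close>. The union works because the idempotent of a
  larger set fixes those of its subsets.\<close>

lemma compact_cone:
  assumes T: "(f, g, h) \<in> Tri C" and "Dom C f \<in> compact_objects U C" "Cod C f \<in> compact_objects U C"
  shows "Cod C g \<in> compact_objects U C"
proof -
  note ty = TriE[OF T]
  show ?thesis
  proof (rule compact_objectsI)
    show "Cod C g \<in> Obj C" using ty by simp
    fix I Y S and inc :: "_ \<Rightarrow> 'm" and k
    assume I: "I \<subseteq> U" "small U I" and Y: "\<And>i. i \<in> I \<Longrightarrow> Y i \<in> Obj C"
      and S: "is_coproduct C I Y S inc" and k: "k \<in> Hom C (Cod C g) S"
    let ?e = "coproduct_part C I Y S inc"
    note kt = HomD[OF k]
    have "k \<cdot> g \<in> Hom C (Cod C f) S" using kt ty by (simp add: Hom_iff)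
    then obtain F where F: "finite F" "F \<subseteq> I" "?e F \<cdot> k \<cdot> g = k \<cdot> g"
      using compact_objectsD[OF assms(3) I Y S] by blast
    note et = coproduct_part_typ[OF S, of F]
    let ?d = "Add C k (Neg C (?e F \<cdot> k))"
    have dt: "?d \<in> Hom C (Cod C g) S" using kt et by (simp add: Hom_iff)
    have "?d \<cdot> g = Zer C (Cod C f) S" using F(3) kt et ty by simp
    then obtain l where l: "l \<in> Hom C (ShO C (Dom C f)) S" "l \<cdot> h = ?d"
      using Tri_ext2[OF T dt] by blast
    obtain G where G: "finite G" "G \<subseteq> I" "?e G \<cdot> l = l"
      using compact_objectsD[OF Sh_compact[OF assms(2)] I Y S l(1)] by blast
    note gt = coproduct_part_typ[OF S, of G] and ht = coproduct_part_typ[OF S, of "F \<union> G"]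
    have 1: "?e (F \<union> G) \<cdot> ?e F = ?e F" "?e (F \<union> G) \<cdot> ?e G = ?e G" by (rule coproduct_part_mono[OF S]; simp)+
    have "?e (F \<union> G) \<cdot> (?e G \<cdot> l) = ?e G \<cdot> l"
      by (rule comp_red[OF 1(2)]) (use gt ht HomD[OF l(1)] in auto)
    then have eG: "?e (F \<union> G) \<cdot> l = l" by (simp only: G(3))
    have "?e (F \<union> G) \<cdot> (l \<cdot> h) = l \<cdot> h"
      by (rule comp_red[OF eG]) (use ht HomD[OF l(1)] ty in auto)
    then have "?e (F \<union> G) \<cdot> ?d = ?d" by (simp only: l(2))
    moreover have "?e (F \<union> G) \<cdot> ?e F \<cdot> k = ?e F \<cdot> k" by (rule comp_red[OF 1(1)]) (use et ht kt in auto)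
    moreover have "k = Add C ?d (?e F \<cdot> k)" by (rule diff_add[symmetric]) (use kt et in auto)
    moreover have "?e (F \<union> G) \<cdot> Add C ?d (?e F \<cdot> k) = Add C (?e (F \<union> G) \<cdot> ?d) (?e (F \<union> G) \<cdot> ?e F \<cdot> k)"
      by (rule Comp_Add') (use kt et ht in auto)
    ultimately have "?e (F \<union> G) \<cdot> k = k" by metis
    then show "\<exists>F. finite F \<and> F \<subseteq> I \<and> ?e F \<cdot> k = k" using F G by (metis finite_UnI le_sup_iff)
  qed
qed

lemma compact_triangulated: "triangulated_subcategory C (compact_objects U C)"
  unfolding triangulated_subcategory_def
proof (intro conjI ballI allI impI subsetI)
  show "X \<in> Obj C" if "X \<in> compact_objects U C" for X using compact_Obj[OF that] .
  show "Z \<in> compact_objects U C" if "Z \<in> {Z. zero_object C Z}" for Z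
  proof (rule compact_objectsI)
    have Z: "zero_object C Z" using that by simp
    then show "Z \<in> Obj C" by (simp add: zero_object_def)
    fix I Y S and inc :: "_ \<Rightarrow> 'm" and k
    assume S: "is_coproduct C I Y S inc" and k: "k \<in> Hom C Z S"
    have "k = Zer C Z S" using zero_object_arr(2)[OF Z] HomD[OF k] by auto
    then have "coproduct_part C I Y S inc {} \<cdot> k = k"
      using coproduct_part_typ[OF S, of "{}"] Hom_Obj[OF k] by simp
    then show "\<exists>F. finite F \<and> F \<subseteq> I \<and> coproduct_part C I Y S inc F \<cdot> k = k" by blast
  qed
  show "Y \<in> compact_objects U C" if "X \<in> compact_objects U C" "isomorphic C X Y" for X Y
    using that compact_retract isomorphic_retract isomorphic_sym by blast
  show "ShO C X \<in> compact_objects U C \<longleftrightarrow> X \<in> compact_objects U C" if "X \<in> Obj C" for X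
    using Sh_compact compact_desuspend that by blast
  show "Cod C g \<in> compact_objects U C" if "(f, g, h) \<in> Tri C \<and> Dom C f \<in> compact_objects U C \<and>
    Cod C f \<in> compact_objects U C" for f g h
    using compact_cone that by blast
qed

end

section \<open>Symmetric monoidal categories\<close>

context closed_symmetric_monoidal_category
begin

lemma TenO_Obj'[simp]: "X \<in> Obj C \<Longrightarrow> Y \<in> Obj C \<Longrightarrow> X \<boxtimes> Y \<in> Obj C"
  by (rule TenO_Obj)

lemma Uni_Obj'[simp]: "Uni C \<in> Obj C"
  by (rule Uni_Obj)

lemma TenA_typ[simp]:
  assumes "f \<in> Arr C" "g \<in> Arr C"
  shows "f \<star> g \<in> Arr C" "Dom C (f \<star> g) = Dom C f \<boxtimes> Dom C g" "Cod C (f \<star> g) = Cod C f \<boxtimes> Cod C g"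
  using TenA_Hom[of f "Dom C f" "Cod C f" g "Dom C g" "Cod C g"] assms by (auto simp: Hom_iff)

lemma TenA_Ide'[simp]: "X \<in> Obj C \<Longrightarrow> Y \<in> Obj C \<Longrightarrow> Ide C X \<star> Ide C Y = Ide C (X \<boxtimes> Y)"
  by (rule TenA_Ide)

lemma TenA_fuse[simp]:
  "\<lbrakk>f \<in> Arr C; f' \<in> Arr C; g \<in> Arr C; g' \<in> Arr C; Cod C f = Dom C f'; Cod C g = Dom C g'\<rbrakk>
    \<Longrightarrow> (f' \<star> g') \<cdot> (f \<star> g) = (f' \<cdot> f) \<star> (g' \<cdot> g)"
  using TenA_Comp[of f "Dom C f" "Cod C f" f' "Cod C f'" g "Dom C g" "Cod C g" g' "Cod C g'"]
  by (simp add: Hom_iff)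

lemma TenA_fuse'[simp]:
  assumes "f \<in> Arr C" "f' \<in> Arr C" "g \<in> Arr C" "g' \<in> Arr C" "Cod C f = Dom C f'"
    "Cod C g = Dom C g'" "k \<in> Arr C" "Cod C k = Dom C f \<boxtimes> Dom C g"
  shows "(f' \<star> g') \<cdot> ((f \<star> g) \<cdot> k) = ((f' \<cdot> f) \<star> (g' \<cdot> g)) \<cdot> k"
  by (rule comp_red[OF TenA_fuse]) (use assms in auto)

lemma Asc_typ[simp]:
  assumes "X \<in> Obj C" "Y \<in> Obj C" "Z \<in> Obj C"
  shows "Asc C X Y Z \<in> Arr C" "Dom C (Asc C X Y Z) = (X \<boxtimes> Y) \<boxtimes> Z"
    "Cod C (Asc C X Y Z) = X \<boxtimes> (Y \<boxtimes> Z)"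
    "Inv C (Asc C X Y Z) \<in> Arr C" "Cod C (Inv C (Asc C X Y Z)) = (X \<boxtimes> Y) \<boxtimes> Z"
    "Dom C (Inv C (Asc C X Y Z)) = X \<boxtimes> (Y \<boxtimes> Z)"
    "Inv C (Asc C X Y Z) \<cdot> Asc C X Y Z = Ide C ((X \<boxtimes> Y) \<boxtimes> Z)"
    "Asc C X Y Z \<cdot> Inv C (Asc C X Y Z) = Ide C (X \<boxtimes> (Y \<boxtimes> Z))"
    "k \<in> Arr C \<Longrightarrow> Cod C k = (X \<boxtimes> Y) \<boxtimes> Z \<Longrightarrow> Inv C (Asc C X Y Z) \<cdot> (Asc C X Y Z \<cdot> k) = k"
    "k \<in> Arr C \<Longrightarrow> Cod C k = X \<boxtimes> (Y \<boxtimes> Z) \<Longrightarrow> Asc C X Y Z \<cdot> (Inv C (Asc C X Y Z) \<cdot> k) = k"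
  using IsoD[OF Asc_Iso[OF assms]] Inv_typ[OF Asc_Iso[OF assms]] Inv_props[OF Asc_Iso[OF assms]]
    Inv_cancel[OF Asc_Iso[OF assms]] by auto

lemma Lun_typ[simp]:
  assumes "X \<in> Obj C"
  shows "Lun C X \<in> Arr C" "Dom C (Lun C X) = Uni C \<boxtimes> X" "Cod C (Lun C X) = X"
    "Inv C (Lun C X) \<in> Arr C" "Cod C (Inv C (Lun C X)) = Uni C \<boxtimes> X" "Dom C (Inv C (Lun C X)) = X"
    "Inv C (Lun C X) \<cdot> Lun C X = Ide C (Uni C \<boxtimes> X)" "Lun C X \<cdot> Inv C (Lun C X) = Ide C X"
    "k \<in> Arr C \<Longrightarrow> Cod C k = Uni C \<boxtimes> X \<Longrightarrow> Inv C (Lun C X) \<cdot> (Lun C X \<cdot> k) = k"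
    "k \<in> Arr C \<Longrightarrow> Cod C k = X \<Longrightarrow> Lun C X \<cdot> (Inv C (Lun C X) \<cdot> k) = k"
  using IsoD[OF Lun_Iso[OF assms]] Inv_typ[OF Lun_Iso[OF assms]] Inv_props[OF Lun_Iso[OF assms]]
    Inv_cancel[OF Lun_Iso[OF assms]] by auto

lemma Run_typ[simp]:
  assumes "X \<in> Obj C"
  shows "Run C X \<in> Arr C" "Dom C (Run C X) = X \<boxtimes> Uni C" "Cod C (Run C X) = X"
    "Inv C (Run C X) \<in> Arr C" "Cod C (Inv C (Run C X)) = X \<boxtimes> Uni C" "Dom C (Inv C (Run C X)) = X"
    "Inv C (Run C X) \<cdot> Run C X = Ide C (X \<boxtimes> Uni C)" "Run C X \<cdot> Inv C (Run C X) = Ide C X"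
    "k \<in> Arr C \<Longrightarrow> Cod C k = X \<boxtimes> Uni C \<Longrightarrow> Inv C (Run C X) \<cdot> (Run C X \<cdot> k) = k"
    "k \<in> Arr C \<Longrightarrow> Cod C k = X \<Longrightarrow> Run C X \<cdot> (Inv C (Run C X) \<cdot> k) = k"
  using IsoD[OF Run_Iso[OF assms]] Inv_typ[OF Run_Iso[OF assms]] Inv_props[OF Run_Iso[OF assms]]
    Inv_cancel[OF Run_Iso[OF assms]] by auto

lemma Swp_typ[simp]:
  assumes "X \<in> Obj C" "Y \<in> Obj C"
  shows "Swp C X Y \<in> Arr C" "Dom C (Swp C X Y) = X \<boxtimes> Y" "Cod C (Swp C X Y) = Y \<boxtimes> X"
    "Swp C Y X \<cdot> Swp C X Y = Ide C (X \<boxtimes> Y)"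
    "k \<in> Arr C \<Longrightarrow> Cod C k = X \<boxtimes> Y \<Longrightarrow> Swp C Y X \<cdot> (Swp C X Y \<cdot> k) = k"
proof -
  show *: "Swp C X Y \<in> Arr C" "Dom C (Swp C X Y) = X \<boxtimes> Y" "Cod C (Swp C X Y) = Y \<boxtimes> X"
    using Swp_Hom[OF assms] by (auto simp: Hom_iff)
  show "Swp C Y X \<cdot> Swp C X Y = Ide C (X \<boxtimes> Y)" by (rule Swp_Swp[OF assms])
  show "k \<in> Arr C \<Longrightarrow> Cod C k = X \<boxtimes> Y \<Longrightarrow> Swp C Y X \<cdot> (Swp C X Y \<cdot> k) = k"
    using comp_red[OF Swp_Swp[OF assms], of k] * Swp_Hom[OF assms(2,1)] by (simp add: Hom_iff)
qed

lemma Swp_Iso: "X \<in> Obj C \<Longrightarrow> Y \<in> Obj C \<Longrightarrow> Swp C X Y \<in> Iso C (X \<boxtimes> Y) (Y \<boxtimes> X)"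
  by (rule IsoI[of _ _ _ _ "Swp C Y X"]) (auto simp: Hom_iff)

lemma TenA_Iso:
  assumes "f \<in> Iso C X X'" "g \<in> Iso C Y Y'" shows "f \<star> g \<in> Iso C (X \<boxtimes> Y) (X' \<boxtimes> Y')"
proof -
  note a = IsoD[OF assms(1)] Inv_typ[OF assms(1)] Inv_props(2,3)[OF assms(1)]
    and b = IsoD[OF assms(2)] Inv_typ[OF assms(2)] Inv_props(2,3)[OF assms(2)]
  have "X \<in> Obj C" "X' \<in> Obj C" "Y \<in> Obj C" "Y' \<in> Obj C"
    using a b by auto
  then show ?thesis
    by (intro IsoI[of _ _ _ _ "Inv C f \<star> Inv C g"]) (use a b in \<open>auto simp: Hom_iff\<close>)
qed

lemma isomorphic_TenO:
  "isomorphic C X X' \<Longrightarrow> isomorphic C Y Y' \<Longrightarrow> isomorphic C (X \<boxtimes> Y) (X' \<boxtimes> Y')"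
  unfolding isomorphic_def using TenA_Iso[of _ X X' _ Y Y'] by blast

lemma isomorphic_Swp: "X \<in> Obj C \<Longrightarrow> Y \<in> Obj C \<Longrightarrow> isomorphic C (X \<boxtimes> Y) (Y \<boxtimes> X)"
  by (rule isomorphicI[OF Swp_Iso])

lemma isomorphic_Asc: "X \<in> Obj C \<Longrightarrow> Y \<in> Obj C \<Longrightarrow> Z \<in> Obj C
  \<Longrightarrow> isomorphic C ((X \<boxtimes> Y) \<boxtimes> Z) (X \<boxtimes> (Y \<boxtimes> Z))"
  by (rule isomorphicI[OF Asc_Iso])

lemma isomorphic_Lun: "X \<in> Obj C \<Longrightarrow> isomorphic C (Uni C \<boxtimes> X) X"
  by (rule isomorphicI[OF Lun_Iso])

lemma isomorphic_Run: "X \<in> Obj C \<Longrightarrow> isomorphic C (X \<boxtimes> Uni C) X"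
  by (rule isomorphicI[OF Run_Iso])

lemma isomorphic_left_commute:
  assumes "X \<in> Obj C" "Y \<in> Obj C" "Z \<in> Obj C"
  shows "isomorphic C (X \<boxtimes> (Y \<boxtimes> Z)) (Y \<boxtimes> (X \<boxtimes> Z))"
proof -
  note [trans] = isomorphic_trans
  have "isomorphic C (X \<boxtimes> (Y \<boxtimes> Z)) ((X \<boxtimes> Y) \<boxtimes> Z)" by (rule isomorphic_sym[OF isomorphic_Asc[OF assms]])
  also have "isomorphic C \<dots> ((Y \<boxtimes> X) \<boxtimes> Z)"
    by (rule isomorphic_TenO[OF isomorphic_Swp isomorphic_refl]) (use assms in auto)
  also have "isomorphic C \<dots> (Y \<boxtimes> (X \<boxtimes> Z))" by (rule isomorphic_Asc) (use assms in auto)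
  finally show ?thesis .
qed

section \<open>Naturality and coherence of associator and unitors\<close>

lemma Asc_nat:
  "\<lbrakk>f \<in> Arr C; g \<in> Arr C; h \<in> Arr C\<rbrakk> \<Longrightarrow> Asc C (Cod C f) (Cod C g) (Cod C h) \<cdot> ((f \<star> g) \<star> h)
    = (f \<star> (g \<star> h)) \<cdot> Asc C (Dom C f) (Dom C g) (Dom C h)"
  by (rule Asc_natural) (auto simp: Hom_iff)

lemma Asc_Inv_nat:
  assumes "f \<in> Arr C" "g \<in> Arr C" "h \<in> Arr C"
  shows "((f \<star> g) \<star> h) \<cdot> Inv C (Asc C (Dom C f) (Dom C g) (Dom C h))
    = Inv C (Asc C (Cod C f) (Cod C g) (Cod C h)) \<cdot> (f \<star> (g \<star> h))"
proof -
  let ?A = "Asc C (Dom C f) (Dom C g) (Dom C h)" and ?B = "Asc C (Cod C f) (Cod C g) (Cod C h)"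
  have "((f \<star> g) \<star> h) \<cdot> Inv C ?A = Inv C ?B \<cdot> (?B \<cdot> ((f \<star> g) \<star> h)) \<cdot> Inv C ?A"
    using assms by simp
  also have "\<dots> = Inv C ?B \<cdot> ((f \<star> (g \<star> h)) \<cdot> ?A) \<cdot> Inv C ?A" by (simp only: Asc_nat[OF assms])
  also have "\<dots> = Inv C ?B \<cdot> (f \<star> (g \<star> h))" using assms by simp
  finally show ?thesis .
qed

lemma Lun_nat: "f \<in> Arr C \<Longrightarrow> Lun C (Cod C f) \<cdot> (Ide C (Uni C) \<star> f) = f \<cdot> Lun C (Dom C f)"
  by (rule Lun_natural) (auto simp: Hom_iff)

lemma Run_nat: "f \<in> Arr C \<Longrightarrow> Run C (Cod C f) \<cdot> (f \<star> Ide C (Uni C)) = f \<cdot> Run C (Dom C f)"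
  by (rule Run_natural) (auto simp: Hom_iff)

text \<open>Naturality of the unitors makes tensoring with the unit isomorphic to the identity
  functor, hence faithful. The coherence laws below are proved after such a tensoring.\<close>

lemma Uni_TenA_cancel:
  assumes "f \<in> Arr C" "g \<in> Arr C" "Dom C f = Dom C g" "Cod C f = Cod C g"
  shows "Ide C (Uni C) \<star> f = Ide C (Uni C) \<star> g \<Longrightarrow> f = g"
    "f \<star> Ide C (Uni C) = g \<star> Ide C (Uni C) \<Longrightarrow> f = g"
proof -
  assume "Ide C (Uni C) \<star> f = Ide C (Uni C) \<star> g"
  then have "f \<cdot> Lun C (Dom C g) = g \<cdot> Lun C (Dom C g)" using Lun_nat[of f] Lun_nat[of g] assms by simp
  then show "f = g" by (rule Iso_right_cancel[OF Lun_Iso[OF Dom_Obj'[OF assms(2)]]]) (use assms in auto)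
next
  assume "f \<star> Ide C (Uni C) = g \<star> Ide C (Uni C)"
  then have "f \<cdot> Run C (Dom C g) = g \<cdot> Run C (Dom C g)" using Run_nat[of f] Run_nat[of g] assms by simp
  then show "f = g" by (rule Iso_right_cancel[OF Run_Iso[OF Dom_Obj'[OF assms(2)]]]) (use assms in auto)
qed

text \<open>Kelly: this coherence law follows from the pentagon and the triangle.\<close>

lemma Lun_Asc:
  assumes X: "X \<in> Obj C" and Y: "Y \<in> Obj C"
  shows "Lun C (X \<boxtimes> Y) \<cdot> Asc C (Uni C) X Y = Lun C X \<star> Ide C Y"
proof (rule Uni_TenA_cancel(1))
  let ?I = "Uni C" and ?i = "Ide C (Uni C)" and ?y = "Ide C Y"
  let ?R = "Asc C ?I (?I \<boxtimes> X) Y" and ?S = "Asc C ?I ?I X \<star> ?y"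
  have tri: "(?i \<star> Lun C X) \<cdot> Asc C ?I ?I X = Run C ?I \<star> Ide C X" using triangle[of ?I X] X by simp
  have tri2: "(?i \<star> Lun C (X \<boxtimes> Y)) \<cdot> Asc C ?I ?I (X \<boxtimes> Y) = Run C ?I \<star> Ide C (X \<boxtimes> Y)"
    using triangle[of ?I "X \<boxtimes> Y"] X Y by simp
  have pent: "Asc C ?I ?I (X \<boxtimes> Y) \<cdot> Asc C (?I \<boxtimes> ?I) X Y = (?i \<star> Asc C ?I X Y) \<cdot> ?R \<cdot> ?S"
    using pentagon[of ?I ?I X Y] X Y by simp
  have iso: "?R \<cdot> ?S \<in> Iso C (((?I \<boxtimes> ?I) \<boxtimes> X) \<boxtimes> Y) (?I \<boxtimes> (?I \<boxtimes> X) \<boxtimes> Y)"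
    using X Y by (intro Comp_Iso[of _ _ "(?I \<boxtimes> (?I \<boxtimes> X)) \<boxtimes> Y"] TenA_Iso Asc_Iso Ide_Iso) auto
  have "(?i \<star> (Lun C (X \<boxtimes> Y) \<cdot> Asc C ?I X Y)) \<cdot> (?R \<cdot> ?S)
      = (?i \<star> Lun C (X \<boxtimes> Y)) \<cdot> ((?i \<star> Asc C ?I X Y) \<cdot> ?R \<cdot> ?S)" using X Y by simp
  also have "\<dots> = (?i \<star> Lun C (X \<boxtimes> Y)) \<cdot> (Asc C ?I ?I (X \<boxtimes> Y) \<cdot> Asc C (?I \<boxtimes> ?I) X Y)"
    by (simp only: pent)
  also have "\<dots> = ((?i \<star> Lun C (X \<boxtimes> Y)) \<cdot> Asc C ?I ?I (X \<boxtimes> Y)) \<cdot> Asc C (?I \<boxtimes> ?I) X Y"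
    using X Y by simp
  also have "\<dots> = (Run C ?I \<star> (Ide C X \<star> ?y)) \<cdot> Asc C (?I \<boxtimes> ?I) X Y" unfolding tri2 using X Y by simp
  also have "\<dots> = Asc C ?I X Y \<cdot> ((Run C ?I \<star> Ide C X) \<star> ?y)"
    using Asc_nat[of "Run C ?I" "Ide C X" ?y] X Y by (simp del: TenA_Ide')
  also have "\<dots> = Asc C ?I X Y \<cdot> (((?i \<star> Lun C X) \<star> ?y) \<cdot> ?S)" unfolding tri[symmetric] using X Y by simp
  also have "\<dots> = (Asc C ?I X Y \<cdot> ((?i \<star> Lun C X) \<star> ?y)) \<cdot> ?S" using X Y by simp
  also have "\<dots> = ((?i \<star> (Lun C X \<star> ?y)) \<cdot> ?R) \<cdot> ?S"
    using Asc_nat[of ?i "Lun C X" ?y] X Y by simp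
  also have "\<dots> = (?i \<star> (Lun C X \<star> ?y)) \<cdot> (?R \<cdot> ?S)" using X Y by simp
  finally show "?i \<star> (Lun C (X \<boxtimes> Y) \<cdot> Asc C ?I X Y) = ?i \<star> (Lun C X \<star> ?y)"
    by (rule Iso_right_cancel[OF iso]) (use X Y in auto)
qed (use X Y in auto)

text \<open>Naturality of the left unitor at itself shows that the identity tensored with the unitor
  of the unit is the unitor of the doubled unit. \<open>Lun_Asc\<close> and the triangle axiom then
  identify the two unitors after tensoring with the unit.\<close>

lemma Lun_Uni: "Lun C (Uni C) = Run C (Uni C)"
proof (rule Uni_TenA_cancel(2))
  let ?I = "Uni C" and ?i = "Ide C (Uni C)"
  have "Lun C ?I \<cdot> (?i \<star> Lun C ?I) = Lun C ?I \<cdot> Lun C (?I \<boxtimes> ?I)" using Lun_nat[of "Lun C ?I"] by simp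
  then have *: "?i \<star> Lun C ?I = Lun C (?I \<boxtimes> ?I)"
    by (rule Iso_left_cancel[OF Lun_Iso[OF Uni_Obj]]) auto
  have "Lun C ?I \<star> ?i = Lun C (?I \<boxtimes> ?I) \<cdot> Asc C ?I ?I ?I" using Lun_Asc[of ?I ?I] by simp
  also have "\<dots> = (?i \<star> Lun C ?I) \<cdot> Asc C ?I ?I ?I" by (simp only: *)
  also have "\<dots> = Run C ?I \<star> ?i" using triangle[of ?I ?I] by simp
  finally show "Lun C ?I \<star> ?i = Run C ?I \<star> ?i" .
qed auto

text \<open>The unit is its own dual: evaluation is the unitor and coevaluation its inverse. With
  \<open>compact_eq_rigid\<close> this makes the unit compact.\<close>

lemma Uni_rigid: "Uni C \<in> rigid_objects C"
proof -
  let ?I = "Uni C" and ?i = "Ide C (Uni C)" and ?L = "Lun C (Uni C)"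
  have tri: "(?i \<star> ?L) \<cdot> Asc C ?I ?I ?I = ?L \<star> ?i" using triangle[of ?I ?I] Lun_Uni by simp
  have "Run C ?I \<cdot> (?i \<star> ?L) \<cdot> Asc C ?I ?I ?I \<cdot> (Inv C ?L \<star> ?i)
      = Run C ?I \<cdot> ((?i \<star> ?L) \<cdot> Asc C ?I ?I ?I) \<cdot> (Inv C ?L \<star> ?i)" by simp
  also have "\<dots> = ?L" unfolding tri by (simp add: Lun_Uni[symmetric])
  finally have 1: "Run C ?I \<cdot> (?i \<star> ?L) \<cdot> Asc C ?I ?I ?I \<cdot> (Inv C ?L \<star> ?i) = ?L" .
  have "?L \<cdot> (?L \<star> ?i) \<cdot> Inv C (Asc C ?I ?I ?I) \<cdot> (?i \<star> Inv C ?L)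
      = ?L \<cdot> ((?i \<star> ?L) \<cdot> Asc C ?I ?I ?I) \<cdot> Inv C (Asc C ?I ?I ?I) \<cdot> (?i \<star> Inv C ?L)"
    unfolding tri by simp
  also have "\<dots> = Run C ?I" by (simp add: Lun_Uni[symmetric])
  finally have 2: "?L \<cdot> (?L \<star> ?i) \<cdot> Inv C (Asc C ?I ?I ?I) \<cdot> (?i \<star> Inv C ?L) = Run C ?I" .
  have "?L \<in> Hom C (?I \<boxtimes> ?I) ?I" "Inv C ?L \<in> Hom C ?I (?I \<boxtimes> ?I)" by (simp_all add: Hom_iff)
  then show ?thesis unfolding rigid_objects_def using 1 2 by (auto intro!: bexI[of _ ?I])
qed

lemma internal_hom:
  assumes X: "X \<in> Obj C" and Y: "Y \<in> Obj C"
  obtains H ev where "H \<in> Obj C" "ev \<in> Hom C (H \<boxtimes> X) Y"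
    "\<And>W f. W \<in> Obj C \<Longrightarrow> f \<in> Hom C (W \<boxtimes> X) Y \<Longrightarrow> \<exists>h. h \<in> Hom C W H \<and> ev \<cdot> (h \<star> Ide C X) = f"
    "\<And>W h k. W \<in> Obj C \<Longrightarrow> h \<in> Hom C W H \<Longrightarrow> k \<in> Hom C W H \<Longrightarrow>
       ev \<cdot> (h \<star> Ide C X) = ev \<cdot> (k \<star> Ide C X) \<Longrightarrow> h = k"
proof -
  obtain H ev where H: "H \<in> Obj C" "ev \<in> Hom C (H \<boxtimes> X) Y"
    "\<And>W f. W \<in> Obj C \<Longrightarrow> f \<in> Hom C (W \<boxtimes> X) Y \<Longrightarrow> \<exists>!h. h \<in> Hom C W H \<and> ev \<cdot> (h \<star> Ide C X) = f"
    using closed[OF X Y] by blast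
  show ?thesis
  proof (rule that[OF H(1,2)])
    show "\<exists>h. h \<in> Hom C W H \<and> ev \<cdot> (h \<star> Ide C X) = f" if "W \<in> Obj C" "f \<in> Hom C (W \<boxtimes> X) Y" for W f
      using H(3)[OF that] by auto
    show "h = k" if "W \<in> Obj C" "h \<in> Hom C W H" "k \<in> Hom C W H"
      "ev \<cdot> (h \<star> Ide C X) = ev \<cdot> (k \<star> Ide C X)" for W h k
    proof -
      have "ev \<cdot> (h \<star> Ide C X) \<in> Hom C (W \<boxtimes> X) Y" using that H X by (simp add: Hom_iff)
      from H(3)[OF that(1) this] that show ?thesis by auto
    qed
  qed
qed

text \<open>Tensoring with \<open>X\<close> is left adjoint to the internal hom: a cocone is
  transposed, factored through \<open>S\<close>, and transposed back.\<close>

lemma TenO_coproduct: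
  assumes S: "is_coproduct C I Z S inc" and X: "X \<in> Obj C"
  shows "is_coproduct C I (\<lambda>i. Z i \<boxtimes> X) (S \<boxtimes> X) (\<lambda>i. inc i \<star> Ide C X)"
proof (rule coproductI)
  have SO: "S \<in> Obj C" using coproduct_Obj[OF S] .
  note inc = coproduct_inc[OF S]
  show "S \<boxtimes> X \<in> Obj C" using SO X by simp
  show "inc i \<star> Ide C X \<in> Hom C (Z i \<boxtimes> X) (S \<boxtimes> X)" if "i \<in> I" for i
    using inc[OF that] X by (simp add: Hom_iff)
  show "\<exists>h. h \<in> Hom C (S \<boxtimes> X) Y \<and> (\<forall>i\<in>I. h \<cdot> (inc i \<star> Ide C X) = f i)"
    if Y: "Y \<in> Obj C" and f: "\<And>i. i \<in> I \<Longrightarrow> f i \<in> Hom C (Z i \<boxtimes> X) Y" for Y f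
  proof -
    obtain H ev where H: "H \<in> Obj C" "ev \<in> Hom C (H \<boxtimes> X) Y"
      "\<And>W f. W \<in> Obj C \<Longrightarrow> f \<in> Hom C (W \<boxtimes> X) Y \<Longrightarrow> \<exists>h. h \<in> Hom C W H \<and> ev \<cdot> (h \<star> Ide C X) = f"
      by (rule internal_hom[OF X Y]) blast
    have "\<exists>g. g \<in> Hom C (Z i) H \<and> ev \<cdot> (g \<star> Ide C X) = f i" if "i \<in> I" for i
      using H(3)[OF _ f[OF that]] Hom_Obj(1)[OF inc[OF that]] by blast
    then obtain g where g: "\<And>i. i \<in> I \<Longrightarrow> g i \<in> Hom C (Z i) H \<and> ev \<cdot> (g i \<star> Ide C X) = f i" by metis
    obtain k where k: "k \<in> Hom C S H" "\<And>i. i \<in> I \<Longrightarrow> k \<cdot> inc i = g i"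
      using coproduct_map[OF S H(1), of g] g by blast
    have "(ev \<cdot> (k \<star> Ide C X)) \<cdot> (inc i \<star> Ide C X) = f i" if i: "i \<in> I" for i
    proof -
      have "(ev \<cdot> (k \<star> Ide C X)) \<cdot> (inc i \<star> Ide C X) = ev \<cdot> ((k \<cdot> inc i) \<star> Ide C X)"
        using HomD[OF k(1)] HomD[OF inc[OF i]] HomD[OF H(2)] X by simp
      then show ?thesis using k(2)[OF i] g[OF i] by simp
    qed
    moreover have "ev \<cdot> (k \<star> Ide C X) \<in> Hom C (S \<boxtimes> X) Y" using H k X by (simp add: Hom_iff)
    ultimately show ?thesis by blast
  qed
  show "h = k" if hk: "h \<in> Hom C (S \<boxtimes> X) Y" "k \<in> Hom C (S \<boxtimes> X) Y"
    and eq: "\<And>i. i \<in> I \<Longrightarrow> h \<cdot> (inc i \<star> Ide C X) = k \<cdot> (inc i \<star> Ide C X)" for Y h k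
  proof -
    have Y: "Y \<in> Obj C" using Hom_Obj[OF hk(1)] by simp
    obtain H ev where H: "H \<in> Obj C" "ev \<in> Hom C (H \<boxtimes> X) Y"
      "\<And>W f. W \<in> Obj C \<Longrightarrow> f \<in> Hom C (W \<boxtimes> X) Y \<Longrightarrow> \<exists>h. h \<in> Hom C W H \<and> ev \<cdot> (h \<star> Ide C X) = f"
      "\<And>W h k. W \<in> Obj C \<Longrightarrow> h \<in> Hom C W H \<Longrightarrow> k \<in> Hom C W H \<Longrightarrow>
         ev \<cdot> (h \<star> Ide C X) = ev \<cdot> (k \<star> Ide C X) \<Longrightarrow> h = k"
      by (rule internal_hom[OF X Y], rule that)
    obtain h' where h': "h' \<in> Hom C S H" "ev \<cdot> (h' \<star> Ide C X) = h" using H(3)[OF SO hk(1)] by blast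
    obtain k' where k': "k' \<in> Hom C S H" "ev \<cdot> (k' \<star> Ide C X) = k" using H(3)[OF SO hk(2)] by blast
    have "h' = k'"
    proof (rule coproduct_ext[OF S h'(1) k'(1)])
      fix i assume i: "i \<in> I"
      have *: "ev \<cdot> ((l \<cdot> inc i) \<star> Ide C X) = (ev \<cdot> (l \<star> Ide C X)) \<cdot> (inc i \<star> Ide C X)"
        if "l \<in> Hom C S H" for l
        using HomD[OF that] HomD[OF inc[OF i]] HomD[OF H(2)] X by simp
      show "h' \<cdot> inc i = k' \<cdot> inc i"
      proof (rule H(4))
        show "Z i \<in> Obj C" using Hom_Obj(1)[OF inc[OF i]] .
        show "h' \<cdot> inc i \<in> Hom C (Z i) H" "k' \<cdot> inc i \<in> Hom C (Z i) H"
          using Comp_Hom[OF inc[OF i]] h'(1) k'(1) by blast+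
        show "ev \<cdot> ((h' \<cdot> inc i) \<star> Ide C X) = ev \<cdot> ((k' \<cdot> inc i) \<star> Ide C X)"
          by (simp only: *[OF h'(1)] *[OF k'(1)] h'(2) k'(2) eq[OF i])
      qed
    qed
    then show "h = k" using h'(2) k'(2) by simp
  qed
qed

lemma TenO_coproduct_left:
  assumes S: "is_coproduct C I Z S inc" and X: "X \<in> Obj C"
  shows "is_coproduct C I (\<lambda>i. X \<boxtimes> Z i) (X \<boxtimes> S) (\<lambda>i. Ide C X \<star> inc i)"
proof -
  have SO: "S \<in> Obj C" using coproduct_Obj[OF S] .
  have ZO: "Z i \<in> Obj C" if "i \<in> I" for i using Hom_Obj(1)[OF coproduct_inc[OF S that]] .
  have 1: "is_coproduct C I (\<lambda>i. Z i \<boxtimes> X) (X \<boxtimes> S) (\<lambda>i. Swp C S X \<cdot> (inc i \<star> Ide C X))"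
    by (rule coproduct_iso_transport[OF TenO_coproduct[OF S X] Swp_Iso[OF SO X]])
  have 2: "is_coproduct C I (\<lambda>i. X \<boxtimes> Z i) (X \<boxtimes> S) (\<lambda>i. (Swp C S X \<cdot> (inc i \<star> Ide C X)) \<cdot> Swp C X (Z i))"
    by (rule coproduct_iso_objects[OF 1]) (use Swp_Iso X ZO in blast)
  show ?thesis
  proof (rule coproduct_cong[OF 2])
    fix i assume i: "i \<in> I"
    note ity = HomD[OF coproduct_inc[OF S i]]
    have "Swp C S X \<cdot> (inc i \<star> Ide C X) = (Ide C X \<star> inc i) \<cdot> Swp C (Z i) X"
      by (rule Swp_natural) (use ity X in \<open>auto simp: Hom_iff\<close>)
    then have "(Swp C S X \<cdot> (inc i \<star> Ide C X)) \<cdot> Swp C X (Z i) =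
        ((Ide C X \<star> inc i) \<cdot> Swp C (Z i) X) \<cdot> Swp C X (Z i)" by simp
    also have "\<dots> = Ide C X \<star> inc i" using ity X ZO[OF i] by simp
    finally show "Ide C X \<star> inc i = (Swp C S X \<cdot> (inc i \<star> Ide C X)) \<cdot> Swp C X (Z i)" by simp
  qed simp
qed

end

text \<open>Only one of the two triangle identities enters each of the two transposition lemmas below.\<close>

context tensor_triangulated_category
begin

section \<open>Rigid objects and their duals\<close>

lemma TenA_Zer[simp]:
  assumes "X \<in> Obj C" "Y \<in> Obj C" "W \<in> Obj C"
  shows "Zer C X Y \<star> Ide C W = Zer C (X \<boxtimes> W) (Y \<boxtimes> W)"
    "Ide C W \<star> Zer C X Y = Zer C (W \<boxtimes> X) (W \<boxtimes> Y)"
proof -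
  have "Add C (Zer C X Y \<star> Ide C W) (Zer C X Y \<star> Ide C W) = Add C (Zer C X Y) (Zer C X Y) \<star> Ide C W"
    by (rule TenA_Add[symmetric]) (use assms in \<open>auto simp: Hom_iff\<close>)
  then have "Add C (Zer C X Y \<star> Ide C W) (Zer C X Y \<star> Ide C W) = Zer C X Y \<star> Ide C W" using assms by simp
  from Add_self_Zer[OF _ this] show 1: "Zer C X Y \<star> Ide C W = Zer C (X \<boxtimes> W) (Y \<boxtimes> W)" using assms by simp
  have "Swp C Y W \<cdot> (Zer C X Y \<star> Ide C W) = (Ide C W \<star> Zer C X Y) \<cdot> Swp C X W"
    by (rule Swp_natural) (use assms in \<open>auto simp: Hom_iff\<close>)
  then have "(Ide C W \<star> Zer C X Y) \<cdot> Swp C X W = Zer C (W \<boxtimes> X) (W \<boxtimes> Y) \<cdot> Swp C X W"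
    unfolding 1 using assms by simp
  then show "Ide C W \<star> Zer C X Y = Zer C (W \<boxtimes> X) (W \<boxtimes> Y)"
    by (rule Iso_right_cancel[OF Swp_Iso[OF assms(1,3)]]) (use assms in auto)
qed

lemma TenO_zero:
  assumes "zero_object C Z" "X \<in> Obj C"
  shows "zero_object C (Z \<boxtimes> X)" "zero_object C (X \<boxtimes> Z)"
proof -
  have Z: "Z \<in> Obj C" "Ide C Z = Zer C Z Z" using assms by (auto simp: zero_object_iff)
  have "Ide C (Z \<boxtimes> X) = Ide C Z \<star> Ide C X" using Z(1) assms by simp
  also have "\<dots> = Zer C (Z \<boxtimes> X) (Z \<boxtimes> X)" unfolding Z(2) using Z(1) assms by simp
  finally show "zero_object C (Z \<boxtimes> X)" using assms by (simp add: zero_object_iff)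
  then show "zero_object C (X \<boxtimes> Z)" using zero_object_iso isomorphic_Swp Z assms by blast
qed

lemma pentagon_inv:
  assumes "W \<in> Obj C" "X \<in> Obj C" "Y \<in> Obj C" "Z \<in> Obj C"
  shows "(Ide C W \<star> Inv C (Asc C X Y Z)) \<cdot> Asc C W X (Y \<boxtimes> Z)
    = Asc C W (X \<boxtimes> Y) Z \<cdot> (Asc C W X Y \<star> Ide C Z) \<cdot> Inv C (Asc C (W \<boxtimes> X) Y Z)"
    "Asc C (W \<boxtimes> X) Y Z \<cdot> (Inv C (Asc C W X Y) \<star> Ide C Z)
    = Inv C (Asc C W X (Y \<boxtimes> Z)) \<cdot> (Ide C W \<star> Asc C X Y Z) \<cdot> Asc C W (X \<boxtimes> Y) Z"
proof -
  let ?A = "Asc C W X (Y \<boxtimes> Z)" and ?B = "Asc C (W \<boxtimes> X) Y Z" and ?E = "Ide C W \<star> Asc C X Y Z"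
    and ?D = "Asc C W (X \<boxtimes> Y) Z" and ?G = "Asc C W X Y \<star> Ide C Z"
  note P = pentagon[OF assms]
  have "(Ide C W \<star> Inv C (Asc C X Y Z)) \<cdot> ?A = (Ide C W \<star> Inv C (Asc C X Y Z)) \<cdot> (?A \<cdot> ?B) \<cdot> Inv C ?B"
    using assms by simp
  also have "\<dots> = (Ide C W \<star> Inv C (Asc C X Y Z)) \<cdot> (?E \<cdot> ?D \<cdot> ?G) \<cdot> Inv C ?B" by (simp only: P)
  also have "\<dots> = ?D \<cdot> ?G \<cdot> Inv C ?B" using assms by simp
  finally show "(Ide C W \<star> Inv C (Asc C X Y Z)) \<cdot> ?A = ?D \<cdot> ?G \<cdot> Inv C ?B" .
  have "?B \<cdot> (Inv C (Asc C W X Y) \<star> Ide C Z) = Inv C ?A \<cdot> (?A \<cdot> ?B) \<cdot> (Inv C (Asc C W X Y) \<star> Ide C Z)"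
    using assms by simp
  also have "\<dots> = Inv C ?A \<cdot> (?E \<cdot> ?D \<cdot> ?G) \<cdot> (Inv C (Asc C W X Y) \<star> Ide C Z)" by (simp only: P)
  also have "\<dots> = Inv C ?A \<cdot> ?E \<cdot> ?D" using assms by simp
  finally show "?B \<cdot> (Inv C (Asc C W X Y) \<star> Ide C Z) = Inv C ?A \<cdot> ?E \<cdot> ?D" .
qed

lemma transpose_left_zero:
  assumes XY: "X \<in> Obj C" "Y \<in> Obj C" and ev: "ev \<in> Hom C (Y \<boxtimes> X) (Uni C)"
    and coev: "coev \<in> Hom C (Uni C) (X \<boxtimes> Y)"
    and zig: "Run C X \<cdot> (Ide C X \<star> ev) \<cdot> Asc C X Y X \<cdot> (coev \<star> Ide C X) = Lun C X"
    and f: "f \<in> Obj C" and al: "al \<in> Hom C k (X \<boxtimes> f)"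
    and zero: "\<And>be. be \<in> Hom C (Y \<boxtimes> k) f \<Longrightarrow> be = Zer C (Y \<boxtimes> k) f"
  shows "al = Zer C k (X \<boxtimes> f)"
proof -
  note ety = HomD[OF ev] and cty = HomD[OF coev] and aty = HomD[OF al]
  have k: "k \<in> Obj C" using Hom_Obj[OF al] by simp
  let ?x = "Ide C X" and ?f = "Ide C f" and ?i = "Ide C (Uni C)"
  \<comment> \<open>The counit at \<open>f\<close> of the adjunction between tensoring on the left
    with \<open>Y\<close> and with \<open>X\<close>. The computation that follows is the triangle
    identity on \<open>X \<boxtimes> f\<close>, up to unitors.\<close>
  define be where "be = Lun C f \<cdot> (ev \<star> ?f) \<cdot> Inv C (Asc C Y X f)"
  have bty: "be \<in> Arr C" "Dom C be = Y \<boxtimes> (X \<boxtimes> f)" "Cod C be = f"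
    using ety XY f by (auto simp: be_def)
  let ?A = "Asc C X Y (X \<boxtimes> f)"
  have "(?x \<star> be) \<cdot> ?A \<cdot> (coev \<star> Ide C (X \<boxtimes> f))
      = (?x \<star> Lun C f) \<cdot> (?x \<star> (ev \<star> ?f)) \<cdot> ((?x \<star> Inv C (Asc C Y X f)) \<cdot> ?A) \<cdot> (coev \<star> (?x \<star> ?f))"
    unfolding be_def using ety cty XY f by simp
  also have "\<dots> = (?x \<star> Lun C f) \<cdot> ((?x \<star> (ev \<star> ?f)) \<cdot> Asc C X (Y \<boxtimes> X) f) \<cdot> (Asc C X Y X \<star> ?f)
      \<cdot> (Inv C (Asc C (X \<boxtimes> Y) X f) \<cdot> (coev \<star> (?x \<star> ?f)))"
    unfolding pentagon_inv(1)[OF XY(1,2,1) f] using ety cty XY f by (simp del: TenA_fuse TenA_fuse' TenA_Ide')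
  also have "\<dots> = (?x \<star> Lun C f) \<cdot> (Asc C X (Uni C) f \<cdot> ((?x \<star> ev) \<star> ?f)) \<cdot> (Asc C X Y X \<star> ?f)
      \<cdot> (((coev \<star> ?x) \<star> ?f) \<cdot> Inv C (Asc C (Uni C) X f))"
    using Asc_nat[of ?x ev ?f] Asc_Inv_nat[of coev ?x ?f] ety cty XY f by (simp del: TenA_fuse TenA_fuse' TenA_Ide')
  also have "\<dots> = ((?x \<star> Lun C f) \<cdot> Asc C X (Uni C) f) \<cdot> ((?x \<star> ev) \<star> ?f) \<cdot> (Asc C X Y X \<star> ?f)
      \<cdot> ((coev \<star> ?x) \<star> ?f) \<cdot> Inv C (Asc C (Uni C) X f)"
    using ety cty XY f by (simp del: TenA_fuse TenA_fuse')
  also have "\<dots> = (Run C X \<star> ?f) \<cdot> ((?x \<star> ev) \<star> ?f) \<cdot> (Asc C X Y X \<star> ?f)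
      \<cdot> ((coev \<star> ?x) \<star> ?f) \<cdot> Inv C (Asc C (Uni C) X f)"
    unfolding triangle[OF XY(1) f] ..
  also have "\<dots> = ((Run C X \<cdot> (?x \<star> ev) \<cdot> Asc C X Y X \<cdot> (coev \<star> ?x)) \<star> ?f) \<cdot> Inv C (Asc C (Uni C) X f)"
    using ety cty XY f by simp
  also have "\<dots> = (Lun C X \<star> ?f) \<cdot> Inv C (Asc C (Uni C) X f)" unfolding zig ..
  finally have th: "(?x \<star> be) \<cdot> ?A \<cdot> (coev \<star> Ide C (X \<boxtimes> f)) = (Lun C X \<star> ?f) \<cdot> Inv C (Asc C (Uni C) X f)" .
  have iso: "(Lun C X \<star> ?f) \<cdot> Inv C (Asc C (Uni C) X f) \<in> Iso C (Uni C \<boxtimes> (X \<boxtimes> f)) (X \<boxtimes> f)"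
    using XY f by (intro Comp_Iso[of _ _ "(Uni C \<boxtimes> X) \<boxtimes> f"] TenA_Iso Lun_Iso Ide_Iso Inv_Iso Asc_Iso) auto
  \<comment> \<open>The transpose of \<open>al\<close> vanishes by assumption; the identity
    \<open>th\<close> recovers \<open>al\<close> from its transpose.\<close>
  have z: "be \<cdot> (Ide C Y \<star> al) = Zer C (Y \<boxtimes> k) f" by (rule zero) (use bty aty XY in \<open>auto simp: Hom_iff\<close>)
  have "((Lun C X \<star> ?f) \<cdot> Inv C (Asc C (Uni C) X f)) \<cdot> (?i \<star> al)
      = (?x \<star> be) \<cdot> (?A \<cdot> ((?x \<star> Ide C Y) \<star> al)) \<cdot> (coev \<star> Ide C k)"
    unfolding th[symmetric] using bty aty cty XY f k by simp
  also have "\<dots> = (?x \<star> be) \<cdot> ((?x \<star> (Ide C Y \<star> al)) \<cdot> Asc C X Y k) \<cdot> (coev \<star> Ide C k)"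
    using Asc_nat[of ?x "Ide C Y" al] aty XY by (simp del: TenA_Ide')
  also have "\<dots> = (?x \<star> (be \<cdot> (Ide C Y \<star> al))) \<cdot> Asc C X Y k \<cdot> (coev \<star> Ide C k)"
    using bty aty cty XY k by simp
  also have "\<dots> = Zer C (Uni C \<boxtimes> k) (X \<boxtimes> f)" unfolding z using cty XY f k by simp
  also have "\<dots> = ((Lun C X \<star> ?f) \<cdot> Inv C (Asc C (Uni C) X f)) \<cdot> Zer C (Uni C \<boxtimes> k) (Uni C \<boxtimes> (X \<boxtimes> f))"
    using XY f k by simp
  finally have "?i \<star> al = Zer C (Uni C \<boxtimes> k) (Uni C \<boxtimes> (X \<boxtimes> f))"
    by (rule Iso_left_cancel[OF iso]) (use aty XY f in auto)
  also have "\<dots> = ?i \<star> Zer C k (X \<boxtimes> f)" using XY f k by simp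
  finally show ?thesis by (rule Uni_TenA_cancel(1)[rotated -1]) (use aty XY f in auto)
qed

lemma transpose_right:
  assumes XY: "X \<in> Obj C" "Y \<in> Obj C" and ev: "ev \<in> Hom C (Y \<boxtimes> X) (Uni C)"
    and coev: "coev \<in> Hom C (Uni C) (X \<boxtimes> Y)"
    and zig: "Run C X \<cdot> (Ide C X \<star> ev) \<cdot> Asc C X Y X \<cdot> (coev \<star> Ide C X) = Lun C X"
    and c: "c \<in> Obj C" and h: "h \<in> Hom C (c \<boxtimes> X) S"
  obtains w where "w \<in> Hom C c ((c \<boxtimes> X) \<boxtimes> Y)"
    "\<And>E. E \<in> Hom C S S \<Longrightarrow> (E \<star> Ide C Y) \<cdot> (h \<star> Ide C Y) \<cdot> w = (h \<star> Ide C Y) \<cdot> w \<Longrightarrow> E \<cdot> h = h"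
proof -
  note ety = HomD[OF ev] and cty = HomD[OF coev] and hty = HomD[OF h]
  have S: "S \<in> Obj C" using Hom_Obj[OF h] by simp
  let ?x = "Ide C X" and ?y = "Ide C Y" and ?c = "Ide C c" and ?cx = "Ide C (c \<boxtimes> X)"
  \<comment> \<open>The unit at \<open>c\<close> of the adjunction between tensoring on the right
    with \<open>X\<close> and with \<open>Y\<close>.\<close>
  define w where "w = Inv C (Asc C c X Y) \<cdot> (?c \<star> coev) \<cdot> Inv C (Run C c)"
  have wty: "w \<in> Arr C" "Dom C w = c" "Cod C w = (c \<boxtimes> X) \<boxtimes> Y" using cty XY c by (auto simp: w_def)
  \<comment> \<open>The unit tensored with \<open>X\<close>, followed by the counit. It suffices
    that \<open>th\<close> is invertible: by \<open>zig\<close> it is a composite of coherence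
    isomorphisms.\<close>
  define th where "th = Run C (c \<boxtimes> X) \<cdot> (?cx \<star> ev) \<cdot> Asc C (c \<boxtimes> X) Y X \<cdot> (w \<star> ?x)"
  have tty: "th \<in> Arr C" "Dom C th = c \<boxtimes> X" "Cod C th = c \<boxtimes> X"
    using wty ety XY by (auto simp: th_def)
  let ?z = "(?x \<star> ev) \<cdot> Asc C X Y X \<cdot> (coev \<star> ?x)"
  have zz: "?z = Inv C (Run C X) \<cdot> Lun C X" unfolding zig[symmetric] using ety cty XY by simp
  have "th = Run C (c \<boxtimes> X) \<cdot> (?cx \<star> ev) \<cdot> (Asc C (c \<boxtimes> X) Y X \<cdot> (Inv C (Asc C c X Y) \<star> ?x))
      \<cdot> ((?c \<star> coev) \<star> ?x) \<cdot> (Inv C (Run C c) \<star> ?x)"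
    unfolding th_def w_def using cty XY c by simp
  also have "\<dots> = Run C (c \<boxtimes> X) \<cdot> (((?c \<star> ?x) \<star> ev) \<cdot> Inv C (Asc C c X (Y \<boxtimes> X))) \<cdot> (?c \<star> Asc C X Y X)
      \<cdot> (Asc C c (X \<boxtimes> Y) X \<cdot> ((?c \<star> coev) \<star> ?x)) \<cdot> (Inv C (Run C c) \<star> ?x)"
    unfolding pentagon_inv(2)[OF c XY(1,2,1)] using ety cty XY c by (simp del: TenA_fuse TenA_fuse')
  also have "\<dots> = Run C (c \<boxtimes> X) \<cdot> (Inv C (Asc C c X (Uni C)) \<cdot> (?c \<star> (?x \<star> ev))) \<cdot> (?c \<star> Asc C X Y X)
      \<cdot> ((?c \<star> (coev \<star> ?x)) \<cdot> Asc C c (Uni C) X) \<cdot> (Inv C (Run C c) \<star> ?x)"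
    using Asc_nat[of ?c coev ?x] Asc_Inv_nat[of ?c ?x ev] ety cty XY c by (simp del: TenA_fuse TenA_fuse' TenA_Ide')
  also have "\<dots> = Run C (c \<boxtimes> X) \<cdot> Inv C (Asc C c X (Uni C)) \<cdot> (?c \<star> ?z) \<cdot> Asc C c (Uni C) X \<cdot> (Inv C (Run C c) \<star> ?x)"
    using ety cty XY c by simp
  finally have th: "th = Run C (c \<boxtimes> X) \<cdot> Inv C (Asc C c X (Uni C)) \<cdot> (?c \<star> (Inv C (Run C X) \<cdot> Lun C X))
      \<cdot> Asc C c (Uni C) X \<cdot> (Inv C (Run C c) \<star> ?x)" unfolding zz .
  have i1: "Inv C (Run C c) \<star> ?x \<in> Iso C (c \<boxtimes> X) ((c \<boxtimes> Uni C) \<boxtimes> X)"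
    using XY c by (intro TenA_Iso Inv_Iso Run_Iso Ide_Iso)
  have i2: "Asc C c (Uni C) X \<in> Iso C ((c \<boxtimes> Uni C) \<boxtimes> X) (c \<boxtimes> (Uni C \<boxtimes> X))"
    using XY c by (intro Asc_Iso) auto
  have i3: "?c \<star> (Inv C (Run C X) \<cdot> Lun C X) \<in> Iso C (c \<boxtimes> (Uni C \<boxtimes> X)) (c \<boxtimes> (X \<boxtimes> Uni C))"
    using XY c by (intro TenA_Iso Ide_Iso Comp_Iso[OF Lun_Iso Inv_Iso[OF Run_Iso]])
  have i4: "Inv C (Asc C c X (Uni C)) \<in> Iso C (c \<boxtimes> (X \<boxtimes> Uni C)) ((c \<boxtimes> X) \<boxtimes> Uni C)"
    using XY c by (intro Inv_Iso Asc_Iso) auto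
  have i5: "Run C (c \<boxtimes> X) \<in> Iso C ((c \<boxtimes> X) \<boxtimes> Uni C) (c \<boxtimes> X)"
    using XY c by (intro Run_Iso) auto
  have iso: "th \<in> Iso C (c \<boxtimes> X) (c \<boxtimes> X)"
    unfolding th by (rule Comp_Iso[OF Comp_Iso[OF Comp_Iso[OF Comp_Iso[OF i1 i2] i3] i4] i5])
  \<comment> \<open>Naturality of transposition in the target: used once to see that
    \<open>w\<close> recovers \<open>h\<close> up to \<open>th\<close>, and once more for the
    endomorphism \<open>E\<close>.\<close>
  have nat: "Run C S \<cdot> (Ide C S \<star> ev) \<cdot> Asc C S Y X \<cdot> (((l \<star> ?y) \<cdot> v) \<star> ?x)
     = l \<cdot> Run C T \<cdot> (Ide C T \<star> ev) \<cdot> Asc C T Y X \<cdot> (v \<star> ?x)"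
    if l: "l \<in> Hom C T S" and v: "v \<in> Hom C c (T \<boxtimes> Y)" for l v T
  proof -
    note lty = HomD[OF l] and vty = HomD[OF v]
    have T: "T \<in> Obj C" using Hom_Obj[OF l] by simp
    have "Run C S \<cdot> (Ide C S \<star> ev) \<cdot> Asc C S Y X \<cdot> (((l \<star> ?y) \<cdot> v) \<star> ?x)
      = Run C S \<cdot> (Ide C S \<star> ev) \<cdot> (Asc C S Y X \<cdot> ((l \<star> ?y) \<star> ?x)) \<cdot> (v \<star> ?x)"
      using lty vty XY S by simp
    also have "\<dots> = Run C S \<cdot> (Ide C S \<star> ev) \<cdot> ((l \<star> (?y \<star> ?x)) \<cdot> Asc C T Y X) \<cdot> (v \<star> ?x)"
      using Asc_nat[of l ?y ?x] lty XY by (simp del: TenA_Ide')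
    also have "\<dots> = Run C S \<cdot> ((Ide C S \<star> ev) \<cdot> (l \<star> (?y \<star> ?x))) \<cdot> Asc C T Y X \<cdot> (v \<star> ?x)"
      using lty vty ety XY S T by (simp del: TenA_fuse TenA_fuse' TenA_Ide')
    also have "(Ide C S \<star> ev) \<cdot> (l \<star> (?y \<star> ?x)) = (l \<star> Ide C (Uni C)) \<cdot> (Ide C T \<star> ev)"
      using lty ety XY S T by simp
    also have "Run C S \<cdot> ((l \<star> Ide C (Uni C)) \<cdot> (Ide C T \<star> ev)) \<cdot> Asc C T Y X \<cdot> (v \<star> ?x)
      = (Run C S \<cdot> (l \<star> Ide C (Uni C))) \<cdot> (Ide C T \<star> ev) \<cdot> Asc C T Y X \<cdot> (v \<star> ?x)"
      using lty vty ety XY S T by (simp del: TenA_fuse TenA_fuse')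
    also have "\<dots> = (l \<cdot> Run C T) \<cdot> (Ide C T \<star> ev) \<cdot> Asc C T Y X \<cdot> (v \<star> ?x)"
      using Run_nat[of l] lty by simp
    also have "\<dots> = l \<cdot> Run C T \<cdot> (Ide C T \<star> ev) \<cdot> Asc C T Y X \<cdot> (v \<star> ?x)"
      using lty vty ety XY T by simp
    finally show ?thesis .
  qed
  have hw: "Run C S \<cdot> (Ide C S \<star> ev) \<cdot> Asc C S Y X \<cdot> (((h \<star> ?y) \<cdot> w) \<star> ?x) = h \<cdot> th"
    using nat[OF h, of w] wty by (simp add: th_def Hom_iff)
  show ?thesis
  proof (rule that[of w])
    show "w \<in> Hom C c ((c \<boxtimes> X) \<boxtimes> Y)" using wty by (simp add: Hom_iff)
    fix E assume E: "E \<in> Hom C S S" and eq: "(E \<star> ?y) \<cdot> (h \<star> ?y) \<cdot> w = (h \<star> ?y) \<cdot> w"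
    note Ety = HomD[OF E]
    have "(h \<star> ?y) \<cdot> w \<in> Hom C c (S \<boxtimes> Y)" using wty hty XY by (simp add: Hom_iff)
    from nat[OF E this] have "h \<cdot> th = E \<cdot> h \<cdot> th" unfolding eq hw .
    then have "(E \<cdot> h) \<cdot> th = h \<cdot> th" using Ety hty tty by simp
    then show "E \<cdot> h = h" by (rule Iso_right_cancel[OF iso]) (use Ety hty in auto)
  qed
qed

text \<open>An arrow from \<open>c \<boxtimes> X\<close> to \<open>S\<close> transposes to one from
  \<open>c\<close> to \<open>S \<boxtimes> Y\<close>, which is the coproduct of the
  \<open>Z i \<boxtimes> Y\<close>. The finite part found there is a finite part of \<open>S\<close>
  tensored with \<open>Y\<close>, so \<open>transpose_right\<close> carries the equation
  back.\<close>

lemma compact_TenO_rigid: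
  assumes "c \<in> compact_objects U C" "X \<in> rigid_objects C"
  shows "c \<boxtimes> X \<in> compact_objects U C"
proof -
  have c: "c \<in> Obj C" using compact_Obj assms(1) by blast
  obtain Y ev coev where X: "X \<in> Obj C" and Y: "Y \<in> Obj C" and ev: "ev \<in> Hom C (Y \<boxtimes> X) (Uni C)"
    and coev: "coev \<in> Hom C (Uni C) (X \<boxtimes> Y)"
    and zig: "Run C X \<cdot> (Ide C X \<star> ev) \<cdot> Asc C X Y X \<cdot> (coev \<star> Ide C X) = Lun C X"
    using assms(2) unfolding rigid_objects_def by blast
  show ?thesis
  proof (rule compact_objectsI)
    show "c \<boxtimes> X \<in> Obj C" using c X by simp
    fix I Z S and inc :: "_ \<Rightarrow> 'm" and h
    assume I: "I \<subseteq> U" "small U I" and Z: "\<And>i. i \<in> I \<Longrightarrow> Z i \<in> Obj C"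
      and S: "is_coproduct C I Z S inc" and h: "h \<in> Hom C (c \<boxtimes> X) S"
    have SO: "S \<in> Obj C" using coproduct_Obj[OF S] .
    obtain w where w: "w \<in> Hom C c ((c \<boxtimes> X) \<boxtimes> Y)"
      "\<And>E. E \<in> Hom C S S \<Longrightarrow> (E \<star> Ide C Y) \<cdot> (h \<star> Ide C Y) \<cdot> w = (h \<star> Ide C Y) \<cdot> w \<Longrightarrow> E \<cdot> h = h"
      using transpose_right[OF X Y ev coev zig c h] by blast
    have S': "is_coproduct C I (\<lambda>i. Z i \<boxtimes> Y) (S \<boxtimes> Y) (\<lambda>i. inc i \<star> Ide C Y)" by (rule TenO_coproduct[OF S Y])
    have hw: "(h \<star> Ide C Y) \<cdot> w \<in> Hom C c (S \<boxtimes> Y)" using h w(1) Y by (simp add: Hom_iff)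
    obtain F where F: "finite F" "F \<subseteq> I"
      "coproduct_part C I (\<lambda>i. Z i \<boxtimes> Y) (S \<boxtimes> Y) (\<lambda>i. inc i \<star> Ide C Y) F \<cdot> (h \<star> Ide C Y) \<cdot> w = (h \<star> Ide C Y) \<cdot> w"
      using compact_objectsD[OF assms(1) I _ S' hw] Z Y by auto
    note et = coproduct_part_typ[OF S, of F]
    have "coproduct_part C I Z S inc F \<star> Ide C Y
      = coproduct_part C I (\<lambda>i. Z i \<boxtimes> Y) (S \<boxtimes> Y) (\<lambda>i. inc i \<star> Ide C Y) F"
    proof (rule coproduct_part_unique[OF S'])
      fix i assume i: "i \<in> I"
      have "(coproduct_part C I Z S inc F \<star> Ide C Y) \<cdot> (inc i \<star> Ide C Y)
          = (coproduct_part C I Z S inc F \<cdot> inc i) \<star> Ide C Y"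
        using et HomD[OF coproduct_inc[OF S i]] Y by simp
      then show "(coproduct_part C I Z S inc F \<star> Ide C Y) \<cdot> (inc i \<star> Ide C Y) =
         (if i \<in> F then inc i \<star> Ide C Y else Zer C (Z i \<boxtimes> Y) (S \<boxtimes> Y))"
        using coproduct_part(2)[OF S i, of F] Z[OF i] SO Y by simp
    qed (use et Y in \<open>auto simp: Hom_iff\<close>)
    then have "coproduct_part C I Z S inc F \<cdot> h = h"
      using w(2)[OF coproduct_part(1)[OF S]] F(3) by simp
    then show "\<exists>F. finite F \<and> F \<subseteq> I \<and> coproduct_part C I Z S inc F \<cdot> h = h" using F by blast
  qed
qed

text \<open>The facts about duals in the form in which they are used, without evaluation and
  coevaluation: each triangle identity exhibits an object as a retract of a threefold product, and
  the last clause is the adjunction, saying that an arrow is zero if its transpose has to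
  be.\<close>

lemma rigid_retract:
  assumes "X \<in> rigid_objects C"
  obtains Y where "Y \<in> Obj C" "retract C X (X \<boxtimes> (Y \<boxtimes> X))" "retract C Y (Y \<boxtimes> (X \<boxtimes> Y))"
    "\<And>k f al. f \<in> Obj C \<Longrightarrow> al \<in> Hom C k (X \<boxtimes> f) \<Longrightarrow> Hom C (Y \<boxtimes> k) f \<subseteq> {Zer C (Y \<boxtimes> k) f}
      \<Longrightarrow> al = Zer C k (X \<boxtimes> f)"
proof -
  obtain Y ev coev where X: "X \<in> Obj C" and Y: "Y \<in> Obj C" and ev: "ev \<in> Hom C (Y \<boxtimes> X) (Uni C)"
    and coev: "coev \<in> Hom C (Uni C) (X \<boxtimes> Y)"
    and zig: "Run C X \<cdot> (Ide C X \<star> ev) \<cdot> Asc C X Y X \<cdot> (coev \<star> Ide C X) = Lun C X"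
    and zag: "Lun C Y \<cdot> (ev \<star> Ide C Y) \<cdot> Inv C (Asc C Y X Y) \<cdot> (Ide C Y \<star> coev) = Run C Y"
    using assms unfolding rigid_objects_def by blast
  note ety = HomD[OF ev] and cty = HomD[OF coev]
  have 1: "retract C X (X \<boxtimes> (Y \<boxtimes> X))"
    unfolding retract_def
  proof (intro bexI)
    show "Asc C X Y X \<cdot> (coev \<star> Ide C X) \<cdot> Inv C (Lun C X) \<in> Hom C X (X \<boxtimes> Y \<boxtimes> X)"
      "Run C X \<cdot> (Ide C X \<star> ev) \<in> Hom C (X \<boxtimes> Y \<boxtimes> X) X" using X Y ety cty by (auto simp: Hom_iff)
    have "(Run C X \<cdot> (Ide C X \<star> ev)) \<cdot> Asc C X Y X \<cdot> (coev \<star> Ide C X) \<cdot> Inv C (Lun C X)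
      = (Run C X \<cdot> (Ide C X \<star> ev) \<cdot> Asc C X Y X \<cdot> (coev \<star> Ide C X)) \<cdot> Inv C (Lun C X)"
      using X Y ety cty by simp
    then show "(Run C X \<cdot> (Ide C X \<star> ev)) \<cdot> Asc C X Y X \<cdot> (coev \<star> Ide C X) \<cdot> Inv C (Lun C X) = Ide C X"
      unfolding zig using X by simp
  qed
  have 2: "retract C Y (Y \<boxtimes> (X \<boxtimes> Y))"
    unfolding retract_def
  proof (intro bexI)
    show "(Ide C Y \<star> coev) \<cdot> Inv C (Run C Y) \<in> Hom C Y (Y \<boxtimes> X \<boxtimes> Y)"
      "Lun C Y \<cdot> (ev \<star> Ide C Y) \<cdot> Inv C (Asc C Y X Y) \<in> Hom C (Y \<boxtimes> X \<boxtimes> Y) Y"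
      using X Y ety cty by (auto simp: Hom_iff)
    have "(Lun C Y \<cdot> (ev \<star> Ide C Y) \<cdot> Inv C (Asc C Y X Y)) \<cdot> (Ide C Y \<star> coev) \<cdot> Inv C (Run C Y)
      = (Lun C Y \<cdot> (ev \<star> Ide C Y) \<cdot> Inv C (Asc C Y X Y) \<cdot> (Ide C Y \<star> coev)) \<cdot> Inv C (Run C Y)"
      using X Y ety cty by simp
    then show "(Lun C Y \<cdot> (ev \<star> Ide C Y) \<cdot> Inv C (Asc C Y X Y)) \<cdot> (Ide C Y \<star> coev) \<cdot> Inv C (Run C Y) = Ide C Y"
      unfolding zag using Y by simp
  qed
  show ?thesis
  proof (rule that[OF Y 1 2])
    fix k f al assume f: "f \<in> Obj C" and al: "al \<in> Hom C k (X \<boxtimes> f)"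
      and z: "Hom C (Y \<boxtimes> k) f \<subseteq> {Zer C (Y \<boxtimes> k) f}"
    show "al = Zer C k (X \<boxtimes> f)" by (rule transpose_left_zero[OF X Y ev coev zig f al]) (use z in blast)
  qed
qed

lemma retract_TenO:
  assumes "retract C X Y" "W \<in> Obj C"
  shows "retract C (X \<boxtimes> W) (Y \<boxtimes> W)" "retract C (W \<boxtimes> X) (W \<boxtimes> Y)"
proof -
  obtain i p where ip: "i \<in> Hom C X Y" "p \<in> Hom C Y X" "p \<cdot> i = Ide C X"
    using assms(1) by (auto simp: retract_def)
  have X: "X \<in> Obj C" using Hom_Obj[OF ip(1)] by simp
  show "retract C (X \<boxtimes> W) (Y \<boxtimes> W)" unfolding retract_def
    by (rule bexI[of _ "i \<star> Ide C W"], rule bexI[of _ "p \<star> Ide C W"]) (use ip assms in \<open>auto simp: Hom_iff\<close>)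
  show "retract C (W \<boxtimes> X) (W \<boxtimes> Y)" unfolding retract_def
    by (rule bexI[of _ "Ide C W \<star> i"], rule bexI[of _ "Ide C W \<star> p"]) (use ip assms in \<open>auto simp: Hom_iff\<close>)
qed

end

section \<open>Localizing subcategories\<close>

context triangulated_category
begin

text \<open>Filling in the rotated triangles gives the missing component between suspensions; the
  shift is full and faithful, so it comes from an arrow \<open>a\<close> with the right
  properties.\<close>

lemma Tri_fill_first:
  assumes T: "(f, g, h) \<in> Tri C" and T': "(f', g', h') \<in> Tri C"
    and b: "b \<in> Hom C (Cod C f) (Cod C f')" and c: "c \<in> Hom C (Cod C g) (Cod C g')"
    and eq: "c \<cdot> g = g' \<cdot> b"
  obtains a where "a \<in> Hom C (Dom C f) (Dom C f')" "b \<cdot> f = f' \<cdot> a" "ShA C a \<cdot> h = h' \<cdot> c"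
proof -
  note ty = TriE[OF T] and ty' = TriE[OF T'] and bty = HomD[OF b] and cty = HomD[OF c]
  have XO: "Dom C f \<in> Obj C" "Dom C f' \<in> Obj C" using ty ty' by auto
  obtain z where z: "z \<in> Hom C (Cod C h) (Cod C h')" "z \<cdot> h = h' \<cdot> c"
    "ShA C b \<cdot> Neg C (ShA C f) = Neg C (ShA C f') \<cdot> z"
    by (rule Tri_fill'[OF Tri_rotate'[OF T] Tri_rotate'[OF T'], of b c])
      (use ty ty' b c eq in auto)
  obtain a where a: "a \<in> Hom C (Dom C f) (Dom C f')" "ShA C a = z"
    using Sh_full[OF XO, of z] z(1) ty ty' by auto
  note aty = HomD[OF a(1)]
  have "Neg C (ShA C (b \<cdot> f)) = Neg C (ShA C (f' \<cdot> a))"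
    using z(3) a(2)[symmetric] aty bty ty ty' by (simp add: Sh_Comp)
  then have "Neg C (Neg C (ShA C (b \<cdot> f))) = Neg C (Neg C (ShA C (f' \<cdot> a)))" by (rule arg_cong)
  then have eq': "ShA C (b \<cdot> f) = ShA C (f' \<cdot> a)" using aty bty ty ty' by simp
  have "b \<cdot> f = f' \<cdot> a"
    by (rule Sh_faithful[OF _ _ _ _ eq']) (use aty bty ty ty' in auto)
  then show ?thesis using that a z(2) by simp
qed

lemma Tri_fill_middle:
  assumes T: "(f, g, h) \<in> Tri C" and T': "(f', g', h') \<in> Tri C"
    and a: "a \<in> Hom C (Dom C f) (Dom C f')" and c: "c \<in> Hom C (Cod C g) (Cod C g')"
    and eq: "ShA C a \<cdot> h = h' \<cdot> c"
  obtains b where "b \<in> Hom C (Cod C f) (Cod C f')" "b \<cdot> f = f' \<cdot> a" "c \<cdot> g = g' \<cdot> b"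
proof -
  note ty = TriE[OF T] and ty' = TriE[OF T'] and aty = HomD[OF a] and cty = HomD[OF c]
  obtain b where b: "b \<in> Hom C (Dom C g) (Dom C g')" "c \<cdot> g = g' \<cdot> b"
    "ShA C b \<cdot> Neg C (ShA C f) = Neg C (ShA C f') \<cdot> ShA C a"
    by (rule Tri_fill_first[OF Tri_rotate'[OF T] Tri_rotate'[OF T'], of c "ShA C a"])
      (use ty ty' aty c eq in \<open>auto simp: Hom_iff\<close>)
  note bty = HomD[OF b(1)]
  have "Neg C (ShA C (b \<cdot> f)) = Neg C (ShA C (f' \<cdot> a))"
    using b(3) aty bty ty ty' by (simp add: Sh_Comp)
  then have "Neg C (Neg C (ShA C (b \<cdot> f))) = Neg C (Neg C (ShA C (f' \<cdot> a)))" by (rule arg_cong)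
  then have eq': "ShA C (b \<cdot> f) = ShA C (f' \<cdot> a)" using aty bty ty ty' by simp
  have "b \<cdot> f = f' \<cdot> a"
    by (rule Sh_faithful[OF _ _ _ _ eq']) (use aty bty ty ty' in auto)
  then show ?thesis using that b ty ty' by simp
qed

text \<open>A fibre of \<open>h\<close> exists; the remaining map of its triangle goes between
  suspensions and is, up to sign, the suspension of the desired \<open>f\<close>.\<close>

lemma Tri_third:
  assumes h: "h \<in> Hom C Z (ShO C X)" and X: "X \<in> Obj C"
  obtains f g Y where "(f, g, h) \<in> Tri C" "f \<in> Hom C X Y" "g \<in> Hom C Y Z"
proof -
  obtain g h' Y where T: "(g, h, h') \<in> Tri C" "g \<in> Hom C Y Z" "h' \<in> Hom C (ShO C X) (ShO C Y)"
    using fiber_exists[OF h] by blast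
  have Y: "Y \<in> Obj C" using Hom_Obj[OF T(2)] by simp
  obtain f where f: "f \<in> Hom C X Y" "ShA C f = Neg C h'"
    using Sh_full[OF X Y, of "Neg C h'"] T(3) by (auto simp: Hom_iff)
  have "Neg C (ShA C f) = h'" using f(2) HomD[OF T(3)] by simp
  then have "(f, g, h) \<in> Tri C" using Tri_rotate[OF f(1) T(2) h] T(1) by simp
  then show ?thesis using that f(1) T(2) by blast
qed

end

section \<open>Orthogonality, generated localizing subcategories and their preimages\<close>

definition right_orthogonal :: "('o, 'm, 'z) tricat_scheme \<Rightarrow> 'o set \<Rightarrow> 'o set" where
  "right_orthogonal C K = {Y \<in> Obj C. \<forall>k \<in> K. Hom C k Y \<subseteq> {Zer C k Y}}"

definition left_orthogonal :: "('o, 'm, 'z) tricat_scheme \<Rightarrow> 'o set \<Rightarrow> 'o set" where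
  "left_orthogonal C R = {W \<in> Obj C. \<forall>Y \<in> R. Hom C W Y \<subseteq> {Zer C W Y}}"

lemma localizingD:
  assumes "localizing_subcategory U C L"
  shows "triangulated_subcategory C L"
    "\<lbrakk>I \<subseteq> U; small U I; \<And>i. i \<in> I \<Longrightarrow> X i \<in> L; is_coproduct C I X S inc\<rbrakk> \<Longrightarrow> S \<in> L"
  using assms unfolding localizing_subcategory_def by blast+

lemma localizing_subcategoryI:
  assumes "triangulated_subcategory C L"
    "\<And>I X S inc. I \<subseteq> U \<Longrightarrow> small U I \<Longrightarrow> (\<And>i. i \<in> I \<Longrightarrow> X i \<in> L) \<Longrightarrow> is_coproduct C I X S inc
      \<Longrightarrow> S \<in> L"
  shows "localizing_subcategory U C L"
  unfolding localizing_subcategory_def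
  by (intro conjI allI impI, rule assms(1), elim conjE, rule assms(2)) auto

lemma localizing_Obj: "localizing_subcategory U C L \<Longrightarrow> X \<in> L \<Longrightarrow> X \<in> Obj C"
  using triangulated_subcategoryD(1) localizingD(1) by blast

lemma triangulated_subcategoryI:
  assumes "S \<subseteq> Obj C" "\<And>Z. zero_object C Z \<Longrightarrow> Z \<in> S"
    "\<And>X Y. X \<in> S \<Longrightarrow> Y \<in> Obj C \<Longrightarrow> isomorphic C X Y \<Longrightarrow> Y \<in> S"
    "\<And>X. X \<in> S \<Longrightarrow> ShO C X \<in> S" "\<And>X. X \<in> Obj C \<Longrightarrow> ShO C X \<in> S \<Longrightarrow> X \<in> S"
    "\<And>f g h. (f, g, h) \<in> Tri C \<Longrightarrow> Dom C f \<in> S \<Longrightarrow> Cod C f \<in> S \<Longrightarrow> Cod C g \<in> S"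
  shows "triangulated_subcategory C S"
  using assms unfolding triangulated_subcategory_def by blast

context triangulated_category
begin

lemma right_orthogonal_props:
  assumes K: "triangulated_subcategory C K"
  shows "Y \<in> right_orthogonal C K \<Longrightarrow> isomorphic C Y Y' \<Longrightarrow> Y' \<in> right_orthogonal C K"
    "Y \<in> Obj C \<Longrightarrow> ShO C Y \<in> right_orthogonal C K \<longleftrightarrow> Y \<in> right_orthogonal C K"
proof -
  show "Y' \<in> right_orthogonal C K" if Y: "Y \<in> right_orthogonal C K" and iso: "isomorphic C Y Y'" for Y Y'
  proof -
    obtain t where t: "t \<in> Iso C Y Y'" using iso by (auto simp: isomorphic_def)
    note ty = IsoD[OF t] Inv_typ[OF t] Inv_cancel[OF t]
    have "h = Zer C k Y'" if k: "k \<in> K" and h: "h \<in> Hom C k Y'" for h k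
    proof -
      have "Inv C t \<cdot> h = Zer C k Y" using Y k Comp_Hom[OF h Inv_props(1)[OF t]] unfolding right_orthogonal_def by blast
      then have "t \<cdot> (Inv C t \<cdot> h) = t \<cdot> Zer C k Y" by simp
      then show ?thesis using HomD[OF h] ty Hom_Obj[OF h] by simp
    qed
    then show ?thesis using isomorphic_Obj[OF iso] unfolding right_orthogonal_def by blast
  qed
  fix Y assume YO: "Y \<in> Obj C"
  have KO: "K \<subseteq> Obj C" using triangulated_subcategoryD(1)[OF K] .
  show "ShO C Y \<in> right_orthogonal C K \<longleftrightarrow> Y \<in> right_orthogonal C K"
  proof
    assume Y: "ShO C Y \<in> right_orthogonal C K"
    have "h = Zer C k Y" if k: "k \<in> K" and h: "h \<in> Hom C k Y" for h k
    proof -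
      have "ShO C k \<in> K" using triangulated_subcategoryD(4)[OF K] KO k by blast
      moreover have "ShA C h \<in> Hom C (ShO C k) (ShO C Y)" using h by (simp add: Hom_iff)
      ultimately have "ShA C h = Zer C (ShO C k) (ShO C Y)"
        using Y unfolding right_orthogonal_def by blast
      then show ?thesis using Sh_zero_arr[of h] h by (simp add: Hom_iff)
    qed
    then show "Y \<in> right_orthogonal C K" using YO unfolding right_orthogonal_def by blast
  next
    assume Y: "Y \<in> right_orthogonal C K"
    have "h = Zer C k (ShO C Y)" if k: "k \<in> K" and h: "h \<in> Hom C k (ShO C Y)" for h k
    proof -
      have kO: "k \<in> Obj C" using KO k by blast
      obtain k' where k': "k' \<in> Obj C" "isomorphic C (ShO C k') k" using desuspend[OF kO] .
      obtain t where t: "t \<in> Iso C (ShO C k') k" using k' by (auto simp: isomorphic_def)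
      note ty = IsoD[OF t]
      have "ShO C k' \<in> K" using triangulated_iso[OF K k isomorphic_sym[OF k'(2)]] .
      then have kK: "k' \<in> K" using triangulated_subcategoryD(4)[OF K k'(1)] by simp
      obtain l where l: "l \<in> Hom C k' Y" "ShA C l = h \<cdot> t"
        using Sh_full[OF k'(1) YO Comp_Hom[OF Iso_Hom[OF t] h]] .
      have "l = Zer C k' Y" using Y kK l unfolding right_orthogonal_def by blast
      then have "h \<cdot> t = Zer C k (ShO C Y) \<cdot> t" using l(2) k' YO ty by simp
      then show ?thesis by (rule Iso_right_cancel[OF t]) (use HomD[OF h] YO in auto)
    qed
    then show "ShO C Y \<in> right_orthogonal C K" using YO unfolding right_orthogonal_def by auto
  qed
qed

text \<open>Exactness of the functor of arrows into a fixed \<open>Y\<close> gives closure under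
  cones, and its behaviour on coproducts gives closure under these; closure of \<open>R\<close>
  under shift is what lets the exact sequence pass to the neighbouring degree.\<close>

lemma left_orthogonal_localizing:
  assumes R: "R \<subseteq> Obj C"
    and iso: "\<And>Y Y'. Y \<in> R \<Longrightarrow> isomorphic C Y Y' \<Longrightarrow> Y' \<in> R"
    and sh: "\<And>Y. Y \<in> Obj C \<Longrightarrow> ShO C Y \<in> R \<longleftrightarrow> Y \<in> R"
  shows "localizing_subcategory U C (left_orthogonal C R)"
proof -
  let ?N = "left_orthogonal C R"
  have NI: "W \<in> ?N" if "W \<in> Obj C" "\<And>Y h. Y \<in> R \<Longrightarrow> h \<in> Hom C W Y \<Longrightarrow> h = Zer C W Y" for W
    using that unfolding left_orthogonal_def by blast
  have ND: "h = Zer C W Y" if "W \<in> ?N" "Y \<in> R" "h \<in> Hom C W Y" for W Y h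
    using that unfolding left_orthogonal_def by blast
  have NO: "W \<in> Obj C" if "W \<in> ?N" for W using that unfolding left_orthogonal_def by blast
  have S1: "ShO C W \<in> ?N" if W: "W \<in> ?N" for W
  proof (rule NI)
    show "ShO C W \<in> Obj C" using NO[OF W] by simp
    fix Y h assume Y: "Y \<in> R" and h: "h \<in> Hom C (ShO C W) Y"
    have YO: "Y \<in> Obj C" using R Y by blast
    obtain Y' where Y': "Y' \<in> Obj C" "isomorphic C (ShO C Y') Y" using desuspend[OF YO] .
    obtain t where t: "t \<in> Iso C (ShO C Y') Y" using Y' by (auto simp: isomorphic_def)
    note ty = IsoD[OF t] Inv_typ[OF t] Inv_cancel[OF t]
    have "ShO C Y' \<in> R" using iso[OF Y isomorphic_sym[OF Y'(2)]] .
    then have YR: "Y' \<in> R" using sh[OF Y'(1)] by simp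
    obtain l where l: "l \<in> Hom C W Y'" "ShA C l = Inv C t \<cdot> h"
      using Sh_full[OF NO[OF W] Y'(1) Comp_Hom[OF h Inv_props(1)[OF t]]] .
    have "l = Zer C W Y'" by (rule ND[OF W YR l(1)])
    then have "Inv C t \<cdot> h = Zer C (ShO C W) (ShO C Y')" using l(2) NO[OF W] Y' by simp
    then have "t \<cdot> (Inv C t \<cdot> h) = t \<cdot> Zer C (ShO C W) (ShO C Y')" by simp
    then show "h = Zer C (ShO C W) Y" using HomD[OF h] ty NO[OF W] by simp
  qed
  have S2: "W \<in> ?N" if W: "W \<in> Obj C" "ShO C W \<in> ?N" for W
  proof (rule NI[OF W(1)])
    fix Y h assume Y: "Y \<in> R" and h: "h \<in> Hom C W Y"
    have "ShO C Y \<in> R" using sh R Y by blast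
    from ND[OF W(2) this, of "ShA C h"] have "ShA C h = Zer C (ShO C W) (ShO C Y)"
      using h by (simp add: Hom_iff)
    then show "h = Zer C W Y" using Sh_zero_arr[of h] h by (simp add: Hom_iff)
  qed
  have T: "triangulated_subcategory C ?N"
  proof (rule triangulated_subcategoryI)
    show "?N \<subseteq> Obj C" using NO by blast
    show "Z \<in> ?N" if Z: "zero_object C Z" for Z
      by (rule NI) (use Z zero_object_arr(2)[OF Z] in \<open>auto simp: Hom_iff zero_object_def\<close>)
    show "W' \<in> ?N" if W: "W \<in> ?N" "W' \<in> Obj C" "isomorphic C W W'" for W W'
    proof (rule NI[OF W(2)])
      fix Y h assume Y: "Y \<in> R" and h: "h \<in> Hom C W' Y"
      obtain t where t: "t \<in> Iso C W W'" using W by (auto simp: isomorphic_def)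
      have "h \<cdot> t = Zer C W Y" by (rule ND[OF W(1) Y Comp_Hom[OF Iso_Hom[OF t] h]])
      also have "\<dots> = Zer C W' Y \<cdot> t" using IsoD[OF t] R Y by auto
      finally show "h = Zer C W' Y"
        by (rule Iso_right_cancel[OF t]) (use HomD[OF h] in auto)
    qed
    show "ShO C W \<in> ?N" if "W \<in> ?N" for W by (rule S1[OF that])
    show "W \<in> ?N" if "W \<in> Obj C" "ShO C W \<in> ?N" for W by (rule S2[OF that])
    show "Cod C g \<in> ?N" if T: "(f, g, h) \<in> Tri C" and fN: "Dom C f \<in> ?N" "Cod C f \<in> ?N" for f g h
    proof (rule NI)
      note ty = TriE[OF T]
      show "Cod C g \<in> Obj C" using ty by simp
      fix Y k assume Y: "Y \<in> R" and k: "k \<in> Hom C (Cod C g) Y"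
      have "k \<cdot> g = Zer C (Cod C f) Y" by (rule ND[OF fN(2) Y]) (use ty k in \<open>auto simp: Hom_iff\<close>)
      then obtain l where l: "l \<in> Hom C (ShO C (Dom C f)) Y" "l \<cdot> h = k" using Tri_ext2[OF T k] by blast
      have "l = Zer C (ShO C (Dom C f)) Y" by (rule ND[OF S1[OF fN(1)] Y l(1)])
      then show "k = Zer C (Cod C g) Y" using l(2) ty R Y by auto
    qed
  qed
  show ?thesis
  proof (rule localizing_subcategoryI[OF T])
    fix I X S and inc :: "_ \<Rightarrow> 'm"
    assume I: "\<And>i. i \<in> I \<Longrightarrow> X i \<in> ?N" and S: "is_coproduct C I X S inc"
    show "S \<in> ?N"
  proof (rule NI)
    show SO: "S \<in> Obj C" using coproduct_Obj[OF S] .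
    fix Y h assume Y: "Y \<in> R" and h: "h \<in> Hom C S Y"
    have YO: "Y \<in> Obj C" using R Y by blast
    show "h = Zer C S Y"
    proof (rule coproduct_ext[OF S h])
      show "Zer C S Y \<in> Hom C S Y" using SO YO by (simp add: Hom_iff)
      fix i assume i: "i \<in> I"
      note ity = HomD[OF coproduct_inc[OF S i]]
      have "h \<cdot> inc i = Zer C (X i) Y"
        by (rule ND[OF I[OF i] Y Comp_Hom[OF coproduct_inc[OF S i] h]])
      then show "h \<cdot> inc i = Zer C S Y \<cdot> inc i" using ity YO by simp
    qed
  qed
  qed
qed

text \<open>Used with \<open>Loc_minimal\<close> to see that objects of \<open>Loc U C K\<close>
  have no nonzero arrow to an object that is right orthogonal to \<open>K\<close>.\<close>

lemma biorthogonal_localizing: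
  assumes "triangulated_subcategory C K"
  shows "localizing_subcategory U C (left_orthogonal C (right_orthogonal C K))"
    "K \<subseteq> left_orthogonal C (right_orthogonal C K)"
proof -
  show "localizing_subcategory U C (left_orthogonal C (right_orthogonal C K))"
    by (rule left_orthogonal_localizing[OF _ right_orthogonal_props[OF assms]])
      (auto simp: right_orthogonal_def)
  show "K \<subseteq> left_orthogonal C (right_orthogonal C K)"
    using triangulated_subcategoryD(1)[OF assms] unfolding left_orthogonal_def right_orthogonal_def by blast
qed

text \<open>Ensures that the families intersected in \<open>Loc\<close> and
  \<open>Loc_tensor\<close> are nonempty.\<close>

lemma Obj_localizing: "localizing_subcategory U C (Obj C)"
  unfolding localizing_subcategory_def
proof (intro conjI allI impI)
  show "triangulated_subcategory C (Obj C)"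
    by (rule triangulated_subcategoryI) (auto simp: zero_object_def dest: TriE)
qed (auto dest: coproduct_Obj)

lemma Inter_triangulated:
  assumes "\<And>L. L \<in> F \<Longrightarrow> triangulated_subcategory C L" "F \<noteq> {}"
  shows "triangulated_subcategory C (\<Inter>F)"
proof (rule triangulated_subcategoryI)
  show "\<Inter>F \<subseteq> Obj C" using assms(2) triangulated_subcategoryD(1)[OF assms(1)] by blast
  show "Z \<in> \<Inter>F" if "zero_object C Z" for Z using triangulated_subcategoryD(2)[OF assms(1) that] by simp
  show "Y \<in> \<Inter>F" if "X \<in> \<Inter>F" "Y \<in> Obj C" "isomorphic C X Y" for X Y
    using that triangulated_subcategoryD(3)[OF assms(1), of _ X Y] by simp
  show "ShO C X \<in> \<Inter>F" if "X \<in> \<Inter>F" for X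
  proof
    fix L assume L: "L \<in> F"
    then have "X \<in> L" "X \<in> Obj C" using that triangulated_subcategoryD(1)[OF assms(1)[OF L]] by auto
    then show "ShO C X \<in> L" using triangulated_subcategoryD(4)[OF assms(1)[OF L]] by blast
  qed
  show "X \<in> \<Inter>F" if "X \<in> Obj C" "ShO C X \<in> \<Inter>F" for X
  proof
    fix L assume L: "L \<in> F"
    then show "X \<in> L" using triangulated_subcategoryD(4)[OF assms(1)[OF L] that(1)] that(2) by blast
  qed
  show "Cod C g \<in> \<Inter>F" if T: "(f, g, h) \<in> Tri C" "Dom C f \<in> \<Inter>F" "Cod C f \<in> \<Inter>F" for f g h
  proof
    fix L assume L: "L \<in> F"
    then show "Cod C g \<in> L" using triangulated_subcategoryD(5)[OF assms(1)[OF L] T(1)] that(2,3) by blast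
  qed
qed

lemma Inter_localizing:
  assumes "\<And>L. L \<in> F \<Longrightarrow> localizing_subcategory U C L" "F \<noteq> {}"
  shows "localizing_subcategory U C (\<Inter>F)"
  unfolding localizing_subcategory_def
proof (intro conjI allI impI)
  show "triangulated_subcategory C (\<Inter>F)"
    by (rule Inter_triangulated[OF localizingD(1)[OF assms(1)] assms(2)])
  fix I X S and inc :: "_ \<Rightarrow> 'm"
  assume *: "I \<subseteq> U \<and> small U I \<and> (\<forall>i\<in>I. X i \<in> \<Inter>F) \<and> is_coproduct C I X S inc"
  show "S \<in> \<Inter>F"
  proof
    fix L assume L: "L \<in> F"
    show "S \<in> L" by (rule localizingD(2)[OF assms(1)[OF L], of I X S inc]) (use * L in auto)
  qed
qed

lemma Loc_localizing: "S \<subseteq> Obj C \<Longrightarrow> localizing_subcategory U C (Loc U C S)"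
  unfolding Loc_def by (rule Inter_localizing) (use Obj_localizing in auto)

end

lemma Loc_subset: "S \<subseteq> Loc U C S"
  and Loc_minimal: "localizing_subcategory U C L \<Longrightarrow> S \<subseteq> L \<Longrightarrow> Loc U C S \<subseteq> L"
  unfolding Loc_def by blast+

text \<open>The object part of a functor that is exact and preserves small coproducts, up to isomorphism.\<close>

definition exact_on_objects ::
  "'u set \<Rightarrow> ('o, 'm, 'z) tricat_scheme \<Rightarrow> ('p, 'n, 'y) tricat_scheme \<Rightarrow> ('o \<Rightarrow> 'p) \<Rightarrow> bool" where
  "exact_on_objects U C D Fo \<longleftrightarrow>
     (\<forall>X\<in>Obj C. Fo X \<in> Obj D \<and> isomorphic D (Fo (ShO C X)) (ShO D (Fo X))) \<and>
     (\<forall>Z. zero_object C Z \<longrightarrow> zero_object D (Fo Z)) \<and>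
     (\<forall>X Y. isomorphic C X Y \<longrightarrow> isomorphic D (Fo X) (Fo Y)) \<and>
     (\<forall>f g h. (f, g, h) \<in> Tri C \<longrightarrow> (\<exists>f' g' h'. (f', g', h') \<in> Tri D \<and>
        Dom D f' = Fo (Dom C f) \<and> Cod D f' = Fo (Cod C f) \<and> Cod D g' = Fo (Cod C g))) \<and>
     (\<forall>I X S inc. I \<subseteq> U \<and> small U I \<and> (\<forall>i\<in>I. X i \<in> Obj C) \<and> is_coproduct C I X S inc \<longrightarrow>
        (\<exists>inc'. is_coproduct D I (Fo \<circ> X) (Fo S) inc'))"

lemma preimage_localizing:
  assumes F: "exact_on_objects U C D Fo" and L: "localizing_subcategory U D L"
    and "triangulated_category C" "triangulated_category D"
  shows "localizing_subcategory U C {X \<in> Obj C. Fo X \<in> L}"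
proof -
  interpret C: triangulated_category C by fact
  interpret D: triangulated_category D by fact
  note LT = localizingD(1)[OF L]
  have F1: "Fo X \<in> Obj D" "isomorphic D (Fo (ShO C X)) (ShO D (Fo X))" if "X \<in> Obj C" for X
    using F that unfolding exact_on_objects_def by blast+
  have F2: "zero_object D (Fo Z)" if "zero_object C Z" for Z
    using F that unfolding exact_on_objects_def by blast
  have F3: "isomorphic D (Fo X) (Fo Y)" if "isomorphic C X Y" for X Y
    using F that unfolding exact_on_objects_def by blast
  have F4: "\<exists>f' g' h'. (f', g', h') \<in> Tri D \<and> Dom D f' = Fo (Dom C f) \<and> Cod D f' = Fo (Cod C f) \<and>
      Cod D g' = Fo (Cod C g)" if "(f, g, h) \<in> Tri C" for f g h
    using F that unfolding exact_on_objects_def by blast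
  have F5: "\<exists>inc'. is_coproduct D I (Fo \<circ> X) (Fo S) inc'"
    if "I \<subseteq> U" "small U I" "\<forall>i\<in>I. X i \<in> Obj C" "is_coproduct C I X S inc" for I X S inc
    using F that unfolding exact_on_objects_def by blast
  have T: "triangulated_subcategory C {X \<in> Obj C. Fo X \<in> L}"
  proof (rule triangulated_subcategoryI)
    show "Z \<in> {X \<in> Obj C. Fo X \<in> L}" if "zero_object C Z" for Z
      using F2[OF that] triangulated_subcategoryD(2)[OF LT] that by (auto simp: zero_object_def)
    show "Y \<in> {X \<in> Obj C. Fo X \<in> L}" if "X \<in> {X \<in> Obj C. Fo X \<in> L}" "Y \<in> Obj C" "isomorphic C X Y" for X Y
      using that F3[OF that(3)] D.triangulated_iso[OF LT] by blast
    show "ShO C X \<in> {X \<in> Obj C. Fo X \<in> L}" if "X \<in> {X \<in> Obj C. Fo X \<in> L}" for X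
    proof -
      have X: "X \<in> Obj C" "Fo X \<in> L" using that by auto
      then have "ShO D (Fo X) \<in> L" using triangulated_subcategoryD(4)[OF LT] F1 by blast
      then show ?thesis using D.triangulated_iso[OF LT _ D.isomorphic_sym[OF F1(2)[OF X(1)]]] X by simp
    qed
    show "X \<in> {X \<in> Obj C. Fo X \<in> L}" if "X \<in> Obj C" "ShO C X \<in> {X \<in> Obj C. Fo X \<in> L}" for X
    proof -
      have "ShO D (Fo X) \<in> L" using D.triangulated_iso[OF LT _ F1(2)[OF that(1)]] that(2) by simp
      then show ?thesis using triangulated_subcategoryD(4)[OF LT] F1 that(1) by blast
    qed
    show "Cod C g \<in> {X \<in> Obj C. Fo X \<in> L}" if t: "(f, g, h) \<in> Tri C" "Dom C f \<in> {X \<in> Obj C. Fo X \<in> L}"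
      "Cod C f \<in> {X \<in> Obj C. Fo X \<in> L}" for f g h
    proof -
      obtain f' g' h' where "(f', g', h') \<in> Tri D" "Dom D f' = Fo (Dom C f)" "Cod D f' = Fo (Cod C f)"
        "Cod D g' = Fo (Cod C g)" using F4[OF t(1)] by blast
      then have "Fo (Cod C g) \<in> L" using triangulated_subcategoryD(5)[OF LT, of f' g' h'] t(2,3) by simp
      then show ?thesis using C.TriE[OF t(1)] by simp
    qed
  qed auto
  show ?thesis unfolding localizing_subcategory_def
  proof (intro conjI allI impI T)
    fix I X S and inc
    assume *: "I \<subseteq> U \<and> small U I \<and> (\<forall>i\<in>I. X i \<in> {X \<in> Obj C. Fo X \<in> L}) \<and> is_coproduct C I X S inc"
    then obtain inc' where "is_coproduct D I (Fo \<circ> X) (Fo S) inc'" using F5[of I X S inc] by blast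
    then have "Fo S \<in> L" using localizingD(2)[OF L, of I "Fo \<circ> X" "Fo S" inc'] * by auto
    then show "S \<in> {X \<in> Obj C. Fo X \<in> L}" using C.coproduct_Obj * by blast
  qed
qed

context tensor_triangulated_category
begin

lemma TenO_exact:
  assumes W: "W \<in> Obj C"
  shows "exact_on_objects U C C (\<lambda>X. X \<boxtimes> W)"
  unfolding exact_on_objects_def
proof (intro conjI ballI allI impI)
  show "X \<boxtimes> W \<in> Obj C" if "X \<in> Obj C" for X using that W by simp
  show "isomorphic C (ShO C X \<boxtimes> W) (ShO C (X \<boxtimes> W))" if "X \<in> Obj C" for X
    by (rule isomorphicI[OF Slf_Iso[OF that W]])
  show "zero_object C (Z \<boxtimes> W)" if "zero_object C Z" for Z using TenO_zero[OF that W] by simp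
  show "isomorphic C (X \<boxtimes> W) (Y \<boxtimes> W)" if "isomorphic C X Y" for X Y
    by (rule isomorphic_TenO[OF that isomorphic_refl[OF W]])
  show "\<exists>f' g' h'. (f', g', h') \<in> Tri C \<and> Dom C f' = Dom C f \<boxtimes> W \<and> Cod C f' = Cod C f \<boxtimes> W \<and>
      Cod C g' = Cod C g \<boxtimes> W" if T: "(f, g, h) \<in> Tri C" for f g h
    using TenA_Tri[OF T _ W, of "Dom C f" "Cod C f"] TriE[OF T] W
    by (intro exI[of _ "f \<star> Ide C W"] exI[of _ "g \<star> Ide C W"] exI[of _ "Slf C (Dom C f) W \<cdot> (h \<star> Ide C W)"])
      (auto simp: Hom_iff)
  show "\<exists>inc'. is_coproduct C I ((\<lambda>X. X \<boxtimes> W) \<circ> X) (S \<boxtimes> W) inc'"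
    if "I \<subseteq> U \<and> small U I \<and> (\<forall>i\<in>I. X i \<in> Obj C) \<and> is_coproduct C I X S inc" for I X S and inc :: "_ \<Rightarrow> 'm"
    using TenO_coproduct[of I X S inc W] that W by (auto simp: comp_def)
qed

lemma TenO_preimage_localizing:
  assumes "localizing_subcategory U C L" "W \<in> Obj C"
  shows "localizing_subcategory U C {X \<in> Obj C. X \<boxtimes> W \<in> L}"
  by (rule preimage_localizing[OF TenO_exact[OF assms(2)] assms(1)]) (fact triangulated_category_axioms)+

end

section \<open>Coproducts over arbitrary small index sets, and closure under retracts\<close>

locale compactly_generated_universe = compactly_generated U C
  for U :: "'u set" and C :: "('o, 'm, 'z) tricat_scheme" (structure) +
  assumes inaccessible: "inaccessible U"
begin

lemma ex_coproduct:
  assumes "small U J" "\<And>j. j \<in> J \<Longrightarrow> X j \<in> Obj C"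
  obtains S inc where "is_coproduct C J X S inc"
proof -
  obtain I b where I: "I \<subseteq> U" "small U I" "bij_betw b I J" by (rule small_index[OF assms(1)])
  have "\<forall>i\<in>I. (X \<circ> b) i \<in> Obj C" using assms(2) bij_betwE[OF I(3)] by auto
  then obtain S inc where S: "is_coproduct C I (X \<circ> b) S inc" using ex_small_coproduct[OF I(1,2)] by blast
  have b: "bij_betw (inv_into I b) J I" by (rule bij_betw_inv_into[OF I(3)])
  have "is_coproduct C J X S (inc \<circ> inv_into I b)"
    by (rule coproduct_cong[OF coproduct_reindex[OF b S]])
      (use bij_betw_inv_into_right[OF I(3)] in auto)
  then show ?thesis by (rule that)
qed

lemma localizing_coproduct:
  assumes "localizing_subcategory U C L" "small U J" "\<And>j. j \<in> J \<Longrightarrow> X j \<in> L" "is_coproduct C J X S inc"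
  shows "S \<in> L"
proof -
  obtain I b where I: "I \<subseteq> U" "small U I" "bij_betw b I J" by (rule small_index[OF assms(2)])
  show ?thesis
    by (rule localizingD(2)[OF assms(1) I(1,2) _ coproduct_reindex[OF I(3) assms(4)]])
      (use assms(3) bij_betwE[OF I(3)] in auto)
qed

lemma compact_small:
  assumes "c \<in> compact_objects U C" "small U J" "\<And>j. j \<in> J \<Longrightarrow> Y j \<in> Obj C"
    "is_coproduct C J Y S inc" "h \<in> Hom C c S"
  obtains F where "finite F" "F \<subseteq> J" "coproduct_part C J Y S inc F \<cdot> h = h"
proof -
  obtain I b where I: "I \<subseteq> U" "small U I" "bij_betw b I J" by (rule small_index[OF assms(2)])
  have S': "is_coproduct C I (Y \<circ> b) S (inc \<circ> b)" by (rule coproduct_reindex[OF I(3) assms(4)])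
  obtain F where F: "finite F" "F \<subseteq> I" "coproduct_part C I (Y \<circ> b) S (inc \<circ> b) F \<cdot> h = h"
    using compact_objectsD[OF assms(1) I(1,2) _ S' assms(5)] assms(3) bij_betwE[OF I(3)] by auto
  have "coproduct_part C I (Y \<circ> b) S (inc \<circ> b) F = coproduct_part C J Y S inc (b ` F)"
  proof (rule coproduct_part_unique[OF assms(4) coproduct_part(1)[OF S']])
    fix j assume "j \<in> J"
    then obtain i where i: "i \<in> I" "j = b i" using bij_betw_imp_surj_on[OF I(3)] by blast
    have "b i \<in> b ` F \<longleftrightarrow> i \<in> F" using bij_betw_imp_inj_on[OF I(3)] i F(2) by (auto dest: inj_onD)
    then show "coproduct_part C I (Y \<circ> b) S (inc \<circ> b) F \<cdot> inc j
        = (if j \<in> b ` F then inc j else Zer C (Y j) S)"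
      using coproduct_part(2)[OF S' i(1), of F] i(2) by simp
  qed
  then show ?thesis using that[of "b ` F"] F bij_betwE[OF I(3)] by auto
qed

text \<open>
  The Eilenberg swindle: if \<open>e\<close> is the idempotent of the retract \<open>X\<close> of \<open>S\<close>, the countable coproduct
  \<open>T\<close> of copies of \<open>S\<close> is a sum of \<open>X\<close> and \<open>T\<close>, by shifting the image of \<open>e\<close> by one summand.
\<close>

lemma localizing_retract:
  assumes L: "localizing_subcategory U C L" and S: "S \<in> L" and X: "retract C X S"
  shows "X \<in> L"
proof -
  obtain i p where ip: "i \<in> Hom C X S" "p \<in> Hom C S X" "p \<cdot> i = Ide C X"
    using X by (auto simp: retract_def)
  note ity = HomD[OF ip(1)] and pty = HomD[OF ip(2)]
  have SO: "S \<in> Obj C" and XO: "X \<in> Obj C" using Hom_Obj ip(1) by blast+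
  define e where "e = i \<cdot> p"
  define d where "d = Add C (Ide C S) (Neg C e)"
  have ety: "e \<in> Arr C" "Dom C e = S" "Cod C e = S" using ity pty by (auto simp: e_def)
  have dty: "d \<in> Arr C" "Dom C d = S" "Cod C d = S" using ety by (auto simp: d_def)
  have pe: "p \<cdot> e = p" unfolding e_def using ity pty by (simp add: comp_red[OF ip(3)])
  have ei: "e \<cdot> i = i" unfolding e_def using ity pty ip(3) by simp
  have ee: "e \<cdot> e = e" using comp_red[OF ei, of p] ety ity pty unfolding e_def by simp
  have pd: "p \<cdot> d = Zer C S X" unfolding d_def using ety pty pe SO by simp
  have di: "d \<cdot> i = Zer C X S" unfolding d_def using ety ity ei SO by simp
  have ed: "e \<cdot> d = Zer C S S" unfolding d_def using ety ee SO by simp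
  have de: "d \<cdot> e = Zer C S S" unfolding d_def using ety ee SO by simp
  have dd: "d \<cdot> d = d"
  proof -
    have "d \<cdot> d = Add C d (Neg C (d \<cdot> e))" unfolding d_def[of] using ety SO by (simp add: ee)
    then show ?thesis unfolding de using dty SO by simp
  qed
  have sum: "Add C e d = Ide C S" unfolding d_def by (rule add_diff) (use ety in auto)
  obtain T inc where T: "is_coproduct C (UNIV :: nat set) (\<lambda>_. S) T inc"
    using ex_coproduct[OF small_countable[OF inaccessible], of UNIV "\<lambda>_. S"] SO by blast
  have TO: "T \<in> Obj C" using coproduct_Obj[OF T] .
  have inc: "inc n \<in> Arr C" "Dom C (inc n) = S" "Cod C (inc n) = T" for n
    using HomD[OF coproduct_inc[OF T, of n]] by auto
  have TL: "T \<in> L" by (rule localizing_coproduct[OF L small_countable[OF inaccessible] _ T]) (use S in auto)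
  \<comment> \<open>The arrow \<open>m\<close> moves the image of \<open>e\<close> in each summand
    one place up and fixes the complementary part. Below, \<open>r\<close> moves it back, and
    \<open>q\<close> reads off through \<open>p\<close> what is missed at place zero, a copy of
    \<open>X\<close>.\<close>
  obtain m where m: "m \<in> Hom C T T" "\<And>n. m \<cdot> inc n = Add C (inc (Suc n) \<cdot> e) (inc n \<cdot> d)"
    by (rule coproduct_map[OF T TO, of "\<lambda>n. Add C (inc (Suc n) \<cdot> e) (inc n \<cdot> d)"])
      (use inc ety dty in \<open>auto simp: Hom_iff\<close>)
  obtain r where r: "r \<in> Hom C T T"
    "\<And>n. r \<cdot> inc n = (case n of 0 \<Rightarrow> inc 0 \<cdot> d | Suc k \<Rightarrow> Add C (inc k \<cdot> e) (inc (Suc k) \<cdot> d))"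
    by (rule coproduct_map[OF T TO, of "\<lambda>n. case n of 0 \<Rightarrow> inc 0 \<cdot> d | Suc k \<Rightarrow> Add C (inc k \<cdot> e) (inc (Suc k) \<cdot> d)"])
      (use inc ety dty in \<open>auto simp: Hom_iff split: nat.splits\<close>)
  obtain q where q: "q \<in> Hom C T X" "\<And>n. q \<cdot> inc n = (case n of 0 \<Rightarrow> p | Suc k \<Rightarrow> Zer C S X)"
    by (rule coproduct_map[OF T XO, of "\<lambda>n. case n of 0 \<Rightarrow> p | Suc k \<Rightarrow> Zer C S X"])
      (use pty in \<open>auto simp: Hom_iff split: nat.splits\<close>)
  note mty = HomD[OF m(1)] and rty = HomD[OF r(1)] and qty = HomD[OF q(1)]
  have r0: "r \<cdot> inc 0 = inc 0 \<cdot> d" and rS: "r \<cdot> inc (Suc n) = Add C (inc n \<cdot> e) (inc (Suc n) \<cdot> d)"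
    and q0: "q \<cdot> inc 0 = p" and qS: "q \<cdot> inc (Suc n) = Zer C S X" for n
    using r(2)[of 0] r(2)[of "Suc n"] q(2)[of 0] q(2)[of "Suc n"] by auto
  let ?j = "inc 0 \<cdot> i"
  have fold: "Add C (inc n \<cdot> e) (inc n \<cdot> d) = inc n" "Add C (inc n \<cdot> d) (inc n \<cdot> e) = inc n" for n
  proof -
    have "Add C (inc n \<cdot> e) (inc n \<cdot> d) = inc n \<cdot> Add C e d"
      by (rule Comp_Add'[symmetric]) (use inc ety dty in auto)
    then show "Add C (inc n \<cdot> e) (inc n \<cdot> d) = inc n" unfolding sum using inc by simp
    then show "Add C (inc n \<cdot> d) (inc n \<cdot> e) = inc n"
      by (subst Add_commute) (use inc ety dty in auto)
  qed
  have rm: "r \<cdot> m = Ide C T"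
  proof (rule coproduct_ext[OF T])
    show "r \<cdot> m \<in> Hom C T T" "Ide C T \<in> Hom C T T" using rty mty by (auto simp: Hom_iff)
    fix n
    have 1: "r \<cdot> (inc (Suc n) \<cdot> e) = inc n \<cdot> e"
      by (subst comp_red[OF rS]) (use inc rty ety dty ee de in auto)
    have 2: "r \<cdot> (inc n \<cdot> d) = inc n \<cdot> d"
    proof (cases n)
      case 0
      then show ?thesis by (simp, subst comp_red[OF r0]) (use inc rty dty dd in auto)
    next
      case (Suc k)
      show ?thesis unfolding Suc by (subst comp_red[OF rS]) (use inc rty ety dty dd ed in auto)
    qed
    have "(r \<cdot> m) \<cdot> inc n = r \<cdot> Add C (inc (Suc n) \<cdot> e) (inc n \<cdot> d)" using m(2) mty rty inc by simp
    also have "\<dots> = Add C (r \<cdot> (inc (Suc n) \<cdot> e)) (r \<cdot> (inc n \<cdot> d))"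
      by (rule Comp_Add') (use rty inc ety dty in auto)
    also have "\<dots> = inc n" unfolding 1 2 by (rule fold)
    finally show "(r \<cdot> m) \<cdot> inc n = Ide C T \<cdot> inc n" using inc by simp
  qed
  have qm: "q \<cdot> m = Zer C T X"
  proof (rule coproduct_ext[OF T])
    show "q \<cdot> m \<in> Hom C T X" "Zer C T X \<in> Hom C T X" using qty mty by (auto simp: Hom_iff)
    fix n
    have 1: "q \<cdot> (inc (Suc n) \<cdot> e) = Zer C S X" by (subst comp_red[OF qS]) (use inc qty ety in auto)
    have 2: "q \<cdot> (inc n \<cdot> d) = Zer C S X"
    proof (cases n)
      case 0
      then show ?thesis by (simp, subst comp_red[OF q0]) (use inc qty dty pd in auto)
    next
      case (Suc k)
      show ?thesis unfolding Suc by (subst comp_red[OF qS]) (use inc qty dty in auto)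
    qed
    have "(q \<cdot> m) \<cdot> inc n = q \<cdot> Add C (inc (Suc n) \<cdot> e) (inc n \<cdot> d)" using m(2) mty qty inc by simp
    also have "\<dots> = Add C (q \<cdot> (inc (Suc n) \<cdot> e)) (q \<cdot> (inc n \<cdot> d))"
      by (rule Comp_Add') (use qty inc ety dty in auto)
    also have "\<dots> = Zer C S X" unfolding 1 2 using SO XO by simp
    finally show "(q \<cdot> m) \<cdot> inc n = Zer C T X \<cdot> inc n" using inc XO by simp
  qed
  have rj: "r \<cdot> ?j = Zer C X T"
    by (subst comp_red[OF r0]) (use inc rty dty ity di in auto)
  have qj: "q \<cdot> ?j = Ide C X" by (subst comp_red[OF q0]) (use inc qty ity ip(3) in auto)
  have all: "Add C (m \<cdot> r) (?j \<cdot> q) = Ide C T"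
  proof (rule coproduct_ext[OF T])
    show "Add C (m \<cdot> r) (?j \<cdot> q) \<in> Hom C T T" "Ide C T \<in> Hom C T T"
      using qty mty rty inc ity by (auto simp: Hom_iff)
    fix n
    have me: "m \<cdot> (inc k \<cdot> e) = inc (Suc k) \<cdot> e" for k
      by (subst comp_red[OF m(2)]) (use inc mty ety dty ee de in auto)
    have md: "m \<cdot> (inc k \<cdot> d) = inc k \<cdot> d" for k
      by (subst comp_red[OF m(2)]) (use inc mty ety dty ed dd in auto)
    have "Add C (m \<cdot> r) (?j \<cdot> q) \<cdot> inc n = Add C (m \<cdot> (r \<cdot> inc n)) (inc 0 \<cdot> (i \<cdot> (q \<cdot> inc n)))"
      using qty mty rty inc ity by simp
    also have "\<dots> = inc n"
    proof (cases n)
      case 0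
      show ?thesis unfolding 0 r0 q0 md using fold(2)[of 0] by (simp add: e_def)
    next
      case (Suc k)
      have "m \<cdot> (r \<cdot> inc (Suc k)) = Add C (m \<cdot> (inc k \<cdot> e)) (m \<cdot> (inc (Suc k) \<cdot> d))" unfolding rS
        by (rule Comp_Add') (use mty inc ety dty in auto)
      also have "\<dots> = inc (Suc k)" unfolding me md by (rule fold(1))
      finally show ?thesis unfolding Suc qS using inc ity SO by simp
    qed
    finally show "Add C (m \<cdot> r) (?j \<cdot> q) \<cdot> inc n = Ide C T \<cdot> inc n" using inc by simp
  qed
  \<comment> \<open>Thus \<open>X\<close> is the cone of an endomorphism of \<open>T\<close>, and
    \<open>T\<close> lies in \<open>L\<close>.\<close>
  have "is_binary_coproduct C T X T"
    by (rule binary_coproductI[of m T T ?j X r q]) (use m r q rm qm rj qj all inc ity in \<open>auto simp: Hom_iff\<close>)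
  then obtain f g h where "(f, g, h) \<in> Tri C" "Dom C f = T" "Cod C f = T" "Cod C g = X"
    by (rule binary_coproduct_Tri[OF _ TO XO])
  then show ?thesis using triangulated_subcategoryD(5)[OF localizingD(1)[OF L]] TL by metis
qed

end

section \<open>Localization at a set of compact objects\<close>

context compactly_generated_universe
begin

lemma Tri_kills:
  assumes T: "(f, g, h) \<in> Tri C" and k: "k \<in> Hom C W (Dom C f)" shows "g \<cdot> (f \<cdot> k) = Zer C W (Cod C g)"
proof -
  have "g \<cdot> (f \<cdot> k) = (g \<cdot> f) \<cdot> k" using TriE[OF T] HomD[OF k] by simp
  then show ?thesis using Tri_Comp1[OF T] TriE[OF T] HomD[OF k] by simp
qed

text \<open>All arrows from objects of \<open>R\<close> that \<open>a\<close> kills are treated at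
  once, through the coproduct over the set \<open>J\<close> of these arrows. The cone of its map to
  \<open>E\<close> kills each of them, and \<open>a\<close> extends to the cone because it kills
  them already.\<close>

lemma cell_step:
  assumes L: "localizing_subcategory U C L" and R: "R \<subseteq> L" "small U R"
    and E: "E \<in> L" and a: "a \<in> Hom C E X"
  obtains E' a' u where "E' \<in> L" "a' \<in> Hom C E' X" "u \<in> Hom C E E'" "a' \<cdot> u = a"
    "\<And>r k. r \<in> R \<Longrightarrow> k \<in> Hom C r E \<Longrightarrow> a \<cdot> k = Zer C r X \<Longrightarrow> u \<cdot> k = Zer C r E'"
proof -
  have EO: "E \<in> Obj C" and XO: "X \<in> Obj C" using Hom_Obj[OF a] by auto
  have RO: "r \<in> Obj C" if "r \<in> R" for r using localizing_Obj[OF L] R(1) that by blast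
  define J where "J = (SIGMA r : R. {k \<in> Hom C r E. a \<cdot> k = Zer C r X})"
  have smJ: "small U J" unfolding J_def
    by (rule small_Sigma[OF inaccessible R(2)]) (rule small_subset[OF small_Hom[OF RO EO]], auto)
  obtain S inc where S: "is_coproduct C J fst S inc"
    by (rule ex_coproduct[OF smJ, of fst]) (use RO in \<open>auto simp: J_def\<close>)
  have SL: "S \<in> L" by (rule localizing_coproduct[OF L smJ _ S]) (use R in \<open>auto simp: J_def\<close>)
  obtain m where m: "m \<in> Hom C S E" "\<And>j. j \<in> J \<Longrightarrow> m \<cdot> inc j = snd j"
    by (rule coproduct_map[OF S EO, of snd]) (auto simp: J_def)
  obtain u w E' where T: "(m, u, w) \<in> Tri C" "u \<in> Hom C E E'" using cone_exists[OF m(1)] by blast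
  note mty = HomD[OF m(1)] and uty = HomD[OF T(2)] and aty = HomD[OF a]
  have am: "a \<cdot> m = Zer C S X"
  proof (rule coproduct_ext[OF S])
    show "a \<cdot> m \<in> Hom C S X" "Zer C S X \<in> Hom C S X" using aty mty by (auto simp: Hom_iff)
    fix j assume j: "j \<in> J"
    note ity = HomD[OF coproduct_inc[OF S j]]
    have "(a \<cdot> m) \<cdot> inc j = a \<cdot> snd j" using m(2)[OF j] aty mty ity by simp
    also have "\<dots> = Zer C (fst j) X" using j by (auto simp: J_def)
    also have "\<dots> = Zer C S X \<cdot> inc j" using ity XO by simp
    finally show "(a \<cdot> m) \<cdot> inc j = Zer C S X \<cdot> inc j" .
  qed
  obtain a' where a': "a' \<in> Hom C E' X" "a' \<cdot> u = a"
    by (rule Tri_ext1[OF T(1), of a X]) (use am a mty uty in auto)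
  show ?thesis
  proof (rule that[OF _ a'(1) T(2) a'(2)])
    show "E' \<in> L" using triangulated_subcategoryD(5)[OF localizingD(1)[OF L] T(1)] SL E mty uty by simp
    fix r k assume r: "r \<in> R" and k: "k \<in> Hom C r E" and ak: "a \<cdot> k = Zer C r X"
    have j: "(r, k) \<in> J" using r k ak by (auto simp: J_def)
    have "u \<cdot> (m \<cdot> inc (r, k)) = Zer C r (Cod C u)"
      by (rule Tri_kills[OF T(1)]) (use coproduct_inc[OF S j] mty in simp)
    then show "u \<cdot> k = Zer C r E'" using m(2)[OF j] uty by simp
  qed
qed

text \<open>\<open>E 0\<close> is the coproduct over all arrows from \<open>R\<close> to
  \<open>X\<close>, which makes \<open>a 0\<close> surjective on arrows from \<open>R\<close>; the
  later stages repair injectivity.\<close>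

lemma cell_sequence:
  assumes L: "localizing_subcategory U C L" and R: "R \<subseteq> L" "small U R" and X: "X \<in> Obj C"
  obtains E a u where "\<And>n::nat. E n \<in> L" "\<And>n. a n \<in> Hom C (E n) X" "\<And>n. u n \<in> Hom C (E n) (E (Suc n))"
    "\<And>n. a (Suc n) \<cdot> u n = a n"
    "\<And>n r k. r \<in> R \<Longrightarrow> k \<in> Hom C r (E n) \<Longrightarrow> a n \<cdot> k = Zer C r X \<Longrightarrow> u n \<cdot> k = Zer C r (E (Suc n))"
    "\<And>r k. r \<in> R \<Longrightarrow> k \<in> Hom C r X \<Longrightarrow> \<exists>l. l \<in> Hom C r (E 0) \<and> a 0 \<cdot> l = k"
proof -
  have RO: "r \<in> Obj C" if "r \<in> R" for r using localizing_Obj[OF L] R(1) that by blast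
  define J where "J = (SIGMA r : R. Hom C r X)"
  have smJ: "small U J" unfolding J_def
    by (rule small_Sigma[OF inaccessible R(2)]) (rule small_Hom[OF RO X])
  obtain E0 inc where S: "is_coproduct C J fst E0 inc"
    by (rule ex_coproduct[OF smJ, of fst]) (use RO in \<open>auto simp: J_def\<close>)
  have E0: "E0 \<in> L" by (rule localizing_coproduct[OF L smJ _ S]) (use R in \<open>auto simp: J_def\<close>)
  obtain a0 where a0: "a0 \<in> Hom C E0 X" "\<And>j. j \<in> J \<Longrightarrow> a0 \<cdot> inc j = snd j"
    by (rule coproduct_map[OF S X, of snd]) (auto simp: J_def)
  \<comment> \<open>The clause for \<open>n = 0\<close> pins the starting cell, so that its
    surjectivity is still known after the dependent choice.\<close>
  define P where "P = (\<lambda>(n::nat) Ea. fst Ea \<in> L \<and> snd Ea \<in> Hom C (fst Ea) X \<and> (n = 0 \<longrightarrow> Ea = (E0, a0)))"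
  define Q where "Q = (\<lambda>(n::nat) Ea Ea'. \<exists>u. u \<in> Hom C (fst Ea) (fst Ea') \<and> snd Ea' \<cdot> u = snd Ea \<and>
    (\<forall>r\<in>R. \<forall>k\<in>Hom C r (fst Ea). snd Ea \<cdot> k = Zer C r X \<longrightarrow> u \<cdot> k = Zer C r (fst Ea')))"
  have "\<exists>f. \<forall>n. P n (f n) \<and> Q n (f n) (f (Suc n))"
  proof (rule dependent_nat_choice)
    show "\<exists>x. P 0 x" using E0 a0 by (intro exI[of _ "(E0, a0)"]) (auto simp: P_def)
    fix x n assume "P n x"
    then have x: "fst x \<in> L" "snd x \<in> Hom C (fst x) X" by (auto simp: P_def)
    obtain E' a' u where "E' \<in> L" "a' \<in> Hom C E' X" "u \<in> Hom C (fst x) E'" "a' \<cdot> u = snd x"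
      "\<And>r k. r \<in> R \<Longrightarrow> k \<in> Hom C r (fst x) \<Longrightarrow> snd x \<cdot> k = Zer C r X \<Longrightarrow> u \<cdot> k = Zer C r E'"
      by (rule cell_step[OF L R x]) blast
    then show "\<exists>y. P (Suc n) y \<and> Q n x y" by (intro exI[of _ "(E', a')"]) (auto simp: P_def Q_def)
  qed
  then obtain f where f: "\<And>n. P n (f n)" "\<And>n. Q n (f n) (f (Suc n))" by blast
  have "\<exists>u. \<forall>n. u n \<in> Hom C (fst (f n)) (fst (f (Suc n))) \<and> snd (f (Suc n)) \<cdot> u n = snd (f n) \<and>
    (\<forall>r\<in>R. \<forall>k\<in>Hom C r (fst (f n)). snd (f n) \<cdot> k = Zer C r X \<longrightarrow> u n \<cdot> k = Zer C r (fst (f (Suc n))))"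
    using f(2) unfolding Q_def by (intro choice allI)
  then obtain u where u: "\<And>n. u n \<in> Hom C (fst (f n)) (fst (f (Suc n)))" "\<And>n. snd (f (Suc n)) \<cdot> u n = snd (f n)"
    "\<And>n r k. r \<in> R \<Longrightarrow> k \<in> Hom C r (fst (f n)) \<Longrightarrow> snd (f n) \<cdot> k = Zer C r X \<Longrightarrow> u n \<cdot> k = Zer C r (fst (f (Suc n)))"
    by blast
  show ?thesis
  proof (rule that[of "fst \<circ> f" "snd \<circ> f" u])
    have f0: "f 0 = (E0, a0)" using f(1)[of 0] by (simp add: P_def)
    show "\<exists>l. l \<in> Hom C r ((fst \<circ> f) 0) \<and> (snd \<circ> f) 0 \<cdot> l = k" if "r \<in> R" "k \<in> Hom C r X" for r k
    proof -
      have j: "(r, k) \<in> J" using that by (auto simp: J_def)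
      show ?thesis using a0(2)[OF j] coproduct_inc[OF S j] by (intro exI[of _ "inc (r, k)"]) (simp add: f0)
    qed
  qed (use f(1) u in \<open>auto simp: P_def\<close>)
qed

text \<open>
  The homotopy colimit of the cells: compact objects see it as the colimit of the groups of arrows.
\<close>

lemma telescope:
  assumes E: "\<And>n::nat. E n \<in> Obj C" and u: "\<And>n. u n \<in> Hom C (E n) (E (Suc n))"
    and a: "\<And>n. a n \<in> Hom C (E n) X" "\<And>n. a (Suc n) \<cdot> u n = a n"
  obtains q al e where "\<And>n. q n \<in> Hom C (E n) e" "\<And>n. q (Suc n) \<cdot> u n = q n"
    "al \<in> Hom C e X" "\<And>n. al \<cdot> q n = a n"
    "\<And>r l. r \<in> compact_objects U C \<Longrightarrow> l \<in> Hom C r e \<Longrightarrow> \<exists>n k. k \<in> Hom C r (E n) \<and> l = q n \<cdot> k"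
    "\<And>L. localizing_subcategory U C L \<Longrightarrow> (\<And>n. E n \<in> L) \<Longrightarrow> e \<in> L"
proof -
  have X: "X \<in> Obj C" using Hom_Obj[OF a(1)] by blast
  obtain T inc where T: "is_coproduct C (UNIV :: nat set) E T inc"
    using ex_coproduct[OF small_countable[OF inaccessible], of UNIV E] E by blast
  have TO: "T \<in> Obj C" using coproduct_Obj[OF T] .
  have inc: "inc n \<in> Arr C" "Dom C (inc n) = E n" "Cod C (inc n) = T" for n
    using HomD[OF coproduct_inc[OF T, of n]] by auto
  have uty: "u n \<in> Arr C" "Dom C (u n) = E n" "Cod C (u n) = E (Suc n)" for n using HomD[OF u[of n]] by auto
  obtain sh where sh: "sh \<in> Hom C T T" "\<And>n. sh \<cdot> inc n = inc (Suc n) \<cdot> u n"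
    by (rule coproduct_map[OF T TO, of "\<lambda>n. inc (Suc n) \<cdot> u n"]) (use inc uty in \<open>auto simp: Hom_iff\<close>)
  note sty = HomD[OF sh(1)]
  \<comment> \<open>The identity minus the shift along the maps \<open>u\<close>; the homotopy
    colimit \<open>e\<close> is its cone.\<close>
  define d where "d = Add C (Ide C T) (Neg C sh)"
  have dty: "d \<in> Hom C T T" using sty by (auto simp: d_def Hom_iff)
  obtain q w e where tri: "(d, q, w) \<in> Tri C" "q \<in> Hom C T e" "w \<in> Hom C e (ShO C T)"
    using cone_exists[OF dty] by blast
  note qty = HomD[OF tri(2)] and wty = HomD[OF tri(3)]
  have dsh: "k = k \<cdot> sh" if "k \<in> Hom C T Y" "k \<cdot> d = Zer C T Y" for k Y
    by (rule diff_eq_Zer) (use that sty in \<open>auto simp: d_def Hom_iff\<close>)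
  have qd: "q \<cdot> d = Zer C T e" using Tri_Comp1[OF tri(1)] HomD[OF dty] qty by simp
  have qsh: "q \<cdot> sh = q" using dsh[OF tri(2) qd] by simp
  obtain A where A: "A \<in> Hom C T X" "\<And>n. A \<cdot> inc n = a n"
    by (rule coproduct_map[OF T X, of a]) (use a(1) in auto)
  note Aty = HomD[OF A(1)]
  have Ash: "A \<cdot> sh = A"
  proof (rule coproduct_ext[OF T])
    show "A \<cdot> sh \<in> Hom C T X" using Aty sty by (auto simp: Hom_iff)
    fix n
    have "(A \<cdot> sh) \<cdot> inc n = A \<cdot> (inc (Suc n) \<cdot> u n)" using Aty sty inc sh(2) by simp
    also have "\<dots> = (A \<cdot> inc (Suc n)) \<cdot> u n" using Aty inc uty by simp
    also have "\<dots> = A \<cdot> inc n" by (simp only: A(2) a(2))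
    finally show "(A \<cdot> sh) \<cdot> inc n = A \<cdot> inc n" .
  qed (rule A)
  have "A \<cdot> d = Zer C T X" using Aty sty TO Ash by (simp add: d_def)
  then obtain al where al: "al \<in> Hom C e X" "al \<cdot> q = A"
    using Tri_ext1[OF tri(1), of A X] A(1) HomD[OF dty] qty by auto
  note alty = HomD[OF al(1)]
  have qu: "(q \<cdot> inc (Suc n)) \<cdot> u n = q \<cdot> inc n" for n
  proof -
    have "(q \<cdot> inc (Suc n)) \<cdot> u n = q \<cdot> (sh \<cdot> inc n)" using qty inc uty sh(2) by simp
    also have "\<dots> = (q \<cdot> sh) \<cdot> inc n" using qty sty inc by simp
    finally show ?thesis by (simp only: qsh)
  qed
  show ?thesis
  proof (rule that[of "\<lambda>n. q \<cdot> inc n" e al])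
    show "q \<cdot> inc n \<in> Hom C (E n) e" for n using qty inc by (simp add: Hom_iff)
    show "(q \<cdot> inc (Suc n)) \<cdot> u n = q \<cdot> inc n" for n by (rule qu)
    show "al \<in> Hom C e X" by (rule al)
    show "al \<cdot> q \<cdot> inc n = a n" for n
      using alty qty inc A(2)[of n] by (subst comp_red[OF al(2)]) auto
    show "e \<in> L" if L: "localizing_subcategory U C L" and EL: "\<And>n. E n \<in> L" for L
    proof -
      have "T \<in> L" by (rule localizing_coproduct[OF L small_countable[OF inaccessible] _ T]) (use EL in auto)
      then show ?thesis
        using triangulated_subcategoryD(5)[OF localizingD(1)[OF L] tri(1)] HomD[OF dty] qty by simp
    qed
    fix r l assume r: "r \<in> compact_objects U C" and l: "l \<in> Hom C r e"
    note lty = HomD[OF l]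
    have rO: "r \<in> Obj C" using compact_Obj[OF r] .
    have ST: "is_coproduct C UNIV (ShO C \<circ> E) (ShO C T) (ShA C \<circ> inc)" by (rule Sh_coproduct[OF T E])
    let ?pr = "coproduct_proj C UNIV (ShO C \<circ> E) (ShO C T) (ShA C \<circ> inc)"
    have prt: "?pr n \<in> Arr C" "Dom C (?pr n) = ShO C T" "Cod C (?pr n) = ShO C (E n)" for n
      using HomD[OF coproduct_proj(1)[OF ST UNIV_I, of n]] by auto
    have pri: "?pr n \<cdot> ShA C (inc k) = (if k = n then Ide C (ShO C (E k)) else Zer C (ShO C (E k)) (ShO C (E n)))" for n k
      using coproduct_proj(2)[OF ST UNIV_I UNIV_I, of n k] by simp
    have Ssh: "ShA C sh \<cdot> ShA C (inc k) = ShA C (inc (Suc k)) \<cdot> ShA C (u k)" for k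
      using Sh_Comp[of "inc k" sh] Sh_Comp[of "u k" "inc (Suc k)"] sh(2)[of k] sty inc uty by simp
    \<comment> \<open>A recursion for components: the suspended \<open>sh\<close> has nothing in
      place zero, and its next component is the previous one followed by \<open>u\<close>. As
      \<open>w \<cdot> l\<close> turns out to be invariant under it, all components of
      \<open>w \<cdot> l\<close> vanish by induction.\<close>
    have p0: "?pr 0 \<cdot> ShA C sh = Zer C (ShO C T) (ShO C (E 0))"
    proof (rule coproduct_ext[OF ST])
      show "?pr 0 \<cdot> ShA C sh \<in> Hom C (ShO C T) (ShO C (E 0))"
        "Zer C (ShO C T) (ShO C (E 0)) \<in> Hom C (ShO C T) (ShO C (E 0))" using prt sty E by (auto simp: Hom_iff)
      fix k
      have "(?pr 0 \<cdot> ShA C sh) \<cdot> ShA C (inc k) = (?pr 0 \<cdot> ShA C (inc (Suc k))) \<cdot> ShA C (u k)"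
        using Ssh[of k] prt sty inc uty by simp
      then show "(?pr 0 \<cdot> ShA C sh) \<cdot> (ShA C \<circ> inc) k = Zer C (ShO C T) (ShO C (E 0)) \<cdot> (ShA C \<circ> inc) k"
        unfolding pri using inc uty E by simp
    qed
    have pS: "?pr (Suc n) \<cdot> ShA C sh = ShA C (u n) \<cdot> ?pr n" for n
    proof (rule coproduct_ext[OF ST])
      show "?pr (Suc n) \<cdot> ShA C sh \<in> Hom C (ShO C T) (ShO C (E (Suc n)))"
        "ShA C (u n) \<cdot> ?pr n \<in> Hom C (ShO C T) (ShO C (E (Suc n)))" using prt sty uty by (auto simp: Hom_iff)
      fix k
      have "(?pr (Suc n) \<cdot> ShA C sh) \<cdot> ShA C (inc k) = (?pr (Suc n) \<cdot> ShA C (inc (Suc k))) \<cdot> ShA C (u k)"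
        using Ssh[of k] prt sty inc uty by simp
      also have "\<dots> = ShA C (u n) \<cdot> (?pr n \<cdot> ShA C (inc k))"
        unfolding pri using uty E by simp
      also have "\<dots> = (ShA C (u n) \<cdot> ?pr n) \<cdot> ShA C (inc k)" using prt uty inc by simp
      finally show "(?pr (Suc n) \<cdot> ShA C sh) \<cdot> (ShA C \<circ> inc) k = (ShA C (u n) \<cdot> ?pr n) \<cdot> (ShA C \<circ> inc) k" by simp
    qed
    let ?v = "w \<cdot> l"
    have vty: "?v \<in> Hom C r (ShO C T)" "?v \<in> Arr C" "Dom C ?v = r" "Cod C ?v = ShO C T"
      using wty lty by (auto simp: Hom_iff)
    have "ShA C d \<cdot> w = Zer C e (ShO C T)" using Tri_Comp3[OF tri(1)] HomD[OF dty] qty by simp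
    then have "ShA C d \<cdot> ?v = Zer C r (ShO C T)"
      using comp_red[of "ShA C d" w "Zer C e (ShO C T)" l] HomD[OF dty] wty lty TO by simp
    moreover have "ShA C d = Add C (Ide C (ShO C T)) (Neg C (ShA C sh))"
      unfolding d_def using additive_functorD(2,4)[OF Sh_additive] additive_category_axioms sty TO by simp
    ultimately have "Add C ?v (Neg C (ShA C sh \<cdot> ?v)) = Zer C r (ShO C T)"
      using sty vty(2-4) TO by (simp del: Comp_assoc')
    then have shv: "?v = ShA C sh \<cdot> ?v"
      by (intro diff_eq_Zer[of ?v "ShA C sh \<cdot> ?v"]) (use sty vty in auto)
    have prv: "?pr n \<cdot> ?v = Zer C r (ShO C (E n))" for n
    proof (induction n)
      case 0
      have "?pr 0 \<cdot> ?v = ?pr 0 \<cdot> (ShA C sh \<cdot> ?v)" using shv by simp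
      also have "\<dots> = Zer C (ShO C T) (ShO C (E 0)) \<cdot> ?v"
        by (rule comp_red[OF p0]) (use prt sty vty in auto)
      also have "\<dots> = Zer C r (ShO C (E 0))" using vty E by simp
      finally show ?case .
    next
      case (Suc n)
      have "?pr (Suc n) \<cdot> ?v = ?pr (Suc n) \<cdot> (ShA C sh \<cdot> ?v)" using shv by simp
      also have "\<dots> = (ShA C (u n) \<cdot> ?pr n) \<cdot> ?v"
        by (rule comp_red[OF pS]) (use prt sty vty in auto)
      also have "\<dots> = ShA C (u n) \<cdot> (?pr n \<cdot> ?v)" by (rule Comp_assoc') (use prt uty vty in auto)
      also have "\<dots> = Zer C r (ShO C (E (Suc n)))" unfolding Suc using uty rO by simp
      finally show ?case .
    qed
    \<comment> \<open>Compactness of \<open>r\<close> leaves finitely many components of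
      \<open>?v\<close>, all of them zero; hence \<open>w\<close> kills \<open>l\<close>, and
      \<open>l\<close> lifts to the coproduct.\<close>
    obtain F where F: "finite F" "F \<subseteq> UNIV"
      "coproduct_part C UNIV (ShO C \<circ> E) (ShO C T) (ShA C \<circ> inc) F \<cdot> ?v = ?v"
      by (rule compact_small[OF r small_countable[OF inaccessible] _ ST vty(1)]) (use E in auto)
    have "?v = Zer C r (ShO C T)"
      by (rule coproduct_part_zero[OF ST F vty(1)]) (simp only: prv o_apply)
    then obtain l' where l': "l' \<in> Hom C r T" "q \<cdot> l' = l"
      using Tri_lift2[OF tri(1), of l r] l HomD[OF dty] qty by auto
    obtain G where G: "finite G" "G \<subseteq> UNIV" "coproduct_part C UNIV E T inc G \<cdot> l' = l'"
      by (rule compact_small[OF r small_countable[OF inaccessible] _ T l'(1)]) (use E in auto)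
    \<comment> \<open>An arrow through stage \<open>n\<close> can be pushed to any later stage
      without changing it in the colimit. This brings the finitely many components of
      \<open>l'\<close> to a common stage, where they are added.\<close>
    have up: "\<exists>k'. k' \<in> Hom C r (E (n + m)) \<and> q \<cdot> inc n \<cdot> k = q \<cdot> inc (n + m) \<cdot> k'"
      if "k \<in> Hom C r (E n)" for k n m
    proof (induction m)
      case 0
      then show ?case using that by auto
    next
      case (Suc m)
      then obtain k' where k': "k' \<in> Hom C r (E (n + m))" "q \<cdot> inc n \<cdot> k = q \<cdot> inc (n + m) \<cdot> k'" by blast
      note kty = HomD[OF k'(1)]
      have "q \<cdot> inc (n + m) \<cdot> k' = (q \<cdot> inc (n + m)) \<cdot> k'" using qty inc kty by simp
      also have "\<dots> = ((q \<cdot> inc (Suc (n + m))) \<cdot> u (n + m)) \<cdot> k'" by (simp only: qu)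
      also have "\<dots> = q \<cdot> inc (n + Suc m) \<cdot> (u (n + m) \<cdot> k')" using qty inc uty kty by simp
      finally show ?case using k' uty by (intro exI[of _ "u (n + m) \<cdot> k'"]) (auto simp: Hom_iff)
    qed
    define P where "P = (\<lambda>x. \<exists>n k. k \<in> Hom C r (E n) \<and> q \<cdot> x = q \<cdot> inc n \<cdot> k)"
    have "P (coproduct_part C UNIV E T inc G \<cdot> l')"
    proof (rule coproduct_part_finite_induct[OF T G(1,2) l'(1), of P])
      show "P (Zer C r T)" unfolding P_def
        using inc rO E by (intro exI[of _ 0] exI[of _ "Zer C r (E 0)"]) (auto simp: Hom_iff)
      fix i x assume "P x" and x: "x \<in> Hom C r T"
      let ?p = "coproduct_proj C UNIV E T inc i"
      have pt: "?p \<cdot> l' \<in> Hom C r (E i)" using Comp_Hom[OF l'(1) coproduct_proj(1)[OF T UNIV_I]] .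
      obtain n k where k: "k \<in> Hom C r (E n)" "q \<cdot> x = q \<cdot> inc n \<cdot> k" using \<open>P x\<close> by (auto simp: P_def)
      obtain k1 where k1: "k1 \<in> Hom C r (E (n + i))" "q \<cdot> inc n \<cdot> k = q \<cdot> inc (n + i) \<cdot> k1"
        using up[OF k(1), of i] by blast
      obtain k2 where k2: "k2 \<in> Hom C r (E (n + i))" "q \<cdot> inc i \<cdot> (?p \<cdot> l') = q \<cdot> inc (n + i) \<cdot> k2"
        using up[OF pt, of n] by (auto simp: add.commute)
      note ky = HomD[OF k1(1)] HomD[OF k2(1)] HomD[OF pt] HomD[OF x]
      have "q \<cdot> Add C (inc i \<cdot> (?p \<cdot> l')) x = Add C (q \<cdot> inc i \<cdot> (?p \<cdot> l')) (q \<cdot> x)"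
        by (rule Comp_Add') (use qty inc ky in auto)
      also have "\<dots> = Add C (q \<cdot> inc (n + i) \<cdot> k2) (q \<cdot> inc (n + i) \<cdot> k1)" by (simp only: k k1 k2)
      also have "\<dots> = q \<cdot> inc (n + i) \<cdot> Add C k2 k1" using qty inc ky by simp
      finally show "P (Add C (inc i \<cdot> (?p \<cdot> l')) x)" unfolding P_def using ky
        by (intro exI[of _ "n + i"] exI[of _ "Add C k2 k1"]) (auto simp: Hom_iff)
    qed
    then obtain n k where k: "k \<in> Hom C r (E n)" "q \<cdot> l' = q \<cdot> inc n \<cdot> k" unfolding G(3) P_def by blast
    have "l = (q \<cdot> inc n) \<cdot> k" using k(2) l'(2) qty inc HomD[OF k(1)] by simp
    then show "\<exists>n k. k \<in> Hom C r (E n) \<and> l = (q \<cdot> inc n) \<cdot> k" using k(1) by blast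
  qed
qed

text \<open>The map from the telescope of the cells to \<open>X\<close> is bijective on arrows from
  \<open>R\<close>: surjective at stage zero, injective because an arrow killed at one stage dies at
  the next. The exact sequence of the triangle makes the cone orthogonal to \<open>K\<close>. The
  small set \<open>R\<close> of representatives is what indexes the cells.\<close>

lemma localization_triangle:
  assumes K: "triangulated_subcategory C K" "K \<subseteq> compact_objects U C"
    and R: "R \<subseteq> K" "small U R" "\<And>k. k \<in> K \<Longrightarrow> \<exists>r\<in>R. isomorphic C k r" and X: "X \<in> Obj C"
  obtains al b c e f where "(al, b, c) \<in> Tri C" "al \<in> Hom C e X" "b \<in> Hom C X f" "c \<in> Hom C f (ShO C e)"
    "e \<in> Loc U C K" "f \<in> right_orthogonal C K"
proof -
  have KO: "K \<subseteq> Obj C" using triangulated_subcategoryD(1)[OF K(1)] .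
  have L: "localizing_subcategory U C (Loc U C K)" by (rule Loc_localizing[OF KO])
  have RL: "R \<subseteq> Loc U C K" using R(1) Loc_subset[of K U C] by blast
  obtain E a u where E: "\<And>n::nat. E n \<in> Loc U C K" "\<And>n. a n \<in> Hom C (E n) X"
    "\<And>n. u n \<in> Hom C (E n) (E (Suc n))" "\<And>n. a (Suc n) \<cdot> u n = a n"
    "\<And>n r k. r \<in> R \<Longrightarrow> k \<in> Hom C r (E n) \<Longrightarrow> a n \<cdot> k = Zer C r X \<Longrightarrow> u n \<cdot> k = Zer C r (E (Suc n))"
    "\<And>r k. r \<in> R \<Longrightarrow> k \<in> Hom C r X \<Longrightarrow> \<exists>l. l \<in> Hom C r (E 0) \<and> a 0 \<cdot> l = k"
    by (rule cell_sequence[OF L RL R(2) X]) blast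
  have EO: "E n \<in> Obj C" for n using localizing_Obj[OF L E(1)] .
  obtain q al e where q: "\<And>n. q n \<in> Hom C (E n) e" "\<And>n. q (Suc n) \<cdot> u n = q n"
    "al \<in> Hom C e X" "\<And>n. al \<cdot> q n = a n"
    "\<And>r l. r \<in> compact_objects U C \<Longrightarrow> l \<in> Hom C r e \<Longrightarrow> \<exists>n k. k \<in> Hom C r (E n) \<and> l = q n \<cdot> k"
    "\<And>L. localizing_subcategory U C L \<Longrightarrow> (\<And>n. E n \<in> L) \<Longrightarrow> e \<in> L"
    by (rule telescope[of E u a X, OF EO E(3,2,4)]) blast
  note alty = HomD[OF q(3)]
  have eO: "e \<in> Obj C" using Hom_Obj[OF q(3)] by simp
  have inj: "l = Zer C r e" if r: "r \<in> R" and l: "l \<in> Hom C r e" and z: "al \<cdot> l = Zer C r X" for r l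
  proof -
    have rc: "r \<in> compact_objects U C" using r R(1) K(2) by blast
    have rO: "r \<in> Obj C" using compact_Obj[OF rc] .
    obtain n k where k: "k \<in> Hom C r (E n)" "l = q n \<cdot> k" using q(5)[OF rc l] by blast
    note kty = HomD[OF k(1)]
    have "a n \<cdot> k = (al \<cdot> q n) \<cdot> k" by (simp only: q(4))
    also have "\<dots> = Zer C r X" using z k(2) HomD[OF q(1)[of n]] alty kty by simp
    finally have "u n \<cdot> k = Zer C r (E (Suc n))" by (rule E(5)[OF r k(1)])
    then have "q (Suc n) \<cdot> (u n \<cdot> k) = Zer C r e" using HomD[OF q(1)[of "Suc n"]] rO by simp
    moreover have "q (Suc n) \<cdot> (u n \<cdot> k) = q n \<cdot> k"
      by (rule comp_red[OF q(2)]) (use HomD[OF q(1)[of "Suc n"]] HomD[OF E(3)[of n]] kty in auto)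
    ultimately show ?thesis using k(2) by simp
  qed
  have surj: "\<exists>l. l \<in> Hom C r e \<and> al \<cdot> l = k" if r: "r \<in> R" and k: "k \<in> Hom C r X" for r k
  proof -
    obtain l where l: "l \<in> Hom C r (E 0)" "a 0 \<cdot> l = k" using E(6)[OF r k] by blast
    have "al \<cdot> (q 0 \<cdot> l) = a 0 \<cdot> l"
      by (rule comp_red[OF q(4)]) (use alty HomD[OF q(1)[of 0]] HomD[OF l(1)] in auto)
    then show ?thesis using l Comp_Hom[OF l(1) q(1)] by auto
  qed
  obtain b c f where T: "(al, b, c) \<in> Tri C" "b \<in> Hom C X f" "c \<in> Hom C f (ShO C e)"
    using cone_exists[OF q(3)] by blast
  note bty = HomD[OF T(2)] and cty = HomD[OF T(3)]
  have fO: "f \<in> Obj C" using Hom_Obj[OF T(2)] by simp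
  \<comment> \<open>Injectivity after one shift, for all of \<open>K\<close>: the source is replaced
    by the suspension of a representative from \<open>R\<close>, and the arrow is
    desuspended.\<close>
  have injS: "g = Zer C k (ShO C e)" if k: "k \<in> K" and g: "g \<in> Hom C k (ShO C e)"
    and z: "ShA C al \<cdot> g = Zer C k (ShO C X)" for g k
  proof -
    have kO: "k \<in> Obj C" using k KO by blast
    obtain k' where k': "k' \<in> Obj C" "isomorphic C (ShO C k') k" using desuspend[OF kO] .
    have "ShO C k' \<in> K" using triangulated_iso[OF K(1) k isomorphic_sym[OF k'(2)]] .
    then have "k' \<in> K" using triangulated_subcategoryD(4)[OF K(1) k'(1)] by simp
    then obtain r where r: "r \<in> R" "isomorphic C k' r" using R(3) by blast
    have rO: "r \<in> Obj C" using r R(1) KO by blast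
    have "isomorphic C (ShO C r) k"
      by (rule isomorphic_trans[OF Sh_isomorphic[OF isomorphic_sym[OF r(2)]] k'(2)])
    then obtain t where t: "t \<in> Iso C (ShO C r) k" by (auto simp: isomorphic_def)
    note tty = IsoD[OF t] and gty = HomD[OF g]
    obtain l where l: "l \<in> Hom C r e" "ShA C l = g \<cdot> t"
      using Sh_full[OF rO eO Comp_Hom[OF Iso_Hom[OF t] g]] .
    have "ShA C (al \<cdot> l) = ShA C al \<cdot> (g \<cdot> t)" using l Sh_Comp[of l al] HomD[OF l(1)] alty by simp
    also have "\<dots> = (ShA C al \<cdot> g) \<cdot> t" using alty gty tty by simp
    also have "\<dots> = Zer C (ShO C r) (ShO C X)" unfolding z using tty X by simp
    finally have "al \<cdot> l = Zer C r X" using Sh_zero_arr[of "al \<cdot> l"] HomD[OF l(1)] alty by simp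
    then have "l = Zer C r e" by (rule inj[OF r(1) l(1)])
    then have "g \<cdot> t = Zer C k (ShO C e) \<cdot> t" using l(2) rO eO tty by simp
    then show ?thesis by (rule Iso_right_cancel[OF t]) (use gty eO in auto)
  qed
  have "f \<in> right_orthogonal C K"
  proof -
    have "h = Zer C k f" if k: "k \<in> K" and h: "h \<in> Hom C k f" for h k
    proof -
      have kO: "k \<in> Obj C" using k KO by blast
      note hty = HomD[OF h]
      have "ShA C al \<cdot> (c \<cdot> h) = (ShA C al \<cdot> c) \<cdot> h" using alty cty hty by simp
      also have "\<dots> = Zer C k (ShO C X)" using Tri_Comp3[OF T(1)] alty bty hty X by simp
      finally have "c \<cdot> h = Zer C k (ShO C e)" using injS[OF k Comp_Hom[OF h T(3)]] by simp
      then obtain l where l: "l \<in> Hom C k X" "b \<cdot> l = h"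
        using Tri_lift2[OF T(1), of h k] h alty bty by auto
      obtain r where r: "r \<in> R" "isomorphic C k r" using R(3)[OF k] by blast
      obtain t where t: "t \<in> Iso C r k" using isomorphic_sym[OF r(2)] by (auto simp: isomorphic_def)
      obtain m where m: "m \<in> Hom C r e" "al \<cdot> m = l \<cdot> t"
        using surj[OF r(1) Comp_Hom[OF Iso_Hom[OF t] l(1)]] by blast
      have "h \<cdot> t = b \<cdot> (l \<cdot> t)" using HomD[OF l(1)] IsoD[OF t] bty by (simp flip: l(2))
      also have "\<dots> = b \<cdot> (al \<cdot> m)" by (simp only: m(2))
      also have "\<dots> = Zer C r f" using Tri_kills[OF T(1), of m r] m(1) alty bty by simp
      also have "\<dots> = Zer C k f \<cdot> t" using IsoD[OF t] fO by simp
      finally show ?thesis by (rule Iso_right_cancel[OF t]) (use hty in auto)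
    qed
    then show ?thesis using fO unfolding right_orthogonal_def by blast
  qed
  then show ?thesis using that[OF T(1) q(3) T(2,3)] q(6)[OF L E(1)] by blast
qed

text \<open>Countably many rounds of adding shifts, desuspensions and cones. One chosen cone per
  arrow suffices because cones are unique up to isomorphism, and a round stays small because the
  sets of arrows between its objects are small.\<close>

lemma small_triangulated_closure:
  assumes G: "G \<subseteq> Obj C" "small U G"
  obtains T R where "triangulated_subcategory C T" "G \<subseteq> T" "R \<subseteq> T" "small U R"
    "\<And>t. t \<in> T \<Longrightarrow> \<exists>r\<in>R. isomorphic C t r"
    "\<And>S. triangulated_subcategory C S \<Longrightarrow> G \<subseteq> S \<Longrightarrow> T \<subseteq> S"
proof -
  obtain Z where Z: "zero_object C Z" "Z \<in> Obj C" by (rule ex_zero)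
  have "\<exists>Y. Y \<in> Obj C \<and> isomorphic C (ShO C Y) X" if "X \<in> Obj C" for X
    using desuspend[OF that] by blast
  then obtain des where des: "\<And>X. X \<in> Obj C \<Longrightarrow> des X \<in> Obj C \<and> isomorphic C (ShO C (des X)) X"
    by metis
  define cone where "cone = (\<lambda>f. SOME Y. \<exists>g h. (f, g, h) \<in> Tri C \<and> Cod C g = Y)"
  have cone: "\<exists>g h. (f, g, h) \<in> Tri C \<and> Cod C g = cone f" if "f \<in> Arr C" for f
    unfolding cone_def by (rule someI_ex) (use Tri_cone[OF that] in blast)
  \<comment> \<open>\<open>R\<close> itself is kept, so the stages increase and any two
    representatives lie in a common stage.\<close>
  define step where "step = (\<lambda>R. R \<union> (ShO C ` R \<union> (des ` R \<union> cone ` (\<Union>X\<in>R. \<Union>Y\<in>R. Hom C X Y))))"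
  define Rn where "Rn = (\<lambda>n. (step ^^ n) (insert Z G))"
  have Rn0: "Rn 0 = insert Z G" and RnS: "Rn (Suc n) = step (Rn n)" for n by (auto simp: Rn_def)
  define R where "R = (\<Union>n. Rn n)"
  have mono: "Rn n \<subseteq> Rn (n + m)" for n m by (induction m) (auto simp: RnS step_def)
  have stepR: "r \<in> R" if "r \<in> step (Rn n)" for r n using that RnS[of n] by (auto simp: R_def)
  have SinR: "S1 \<in> S" if S: "triangulated_subcategory C S" "G \<subseteq> S" and "S1 \<in> R" for S S1
  proof -
    have SO: "S \<subseteq> Obj C" using triangulated_subcategoryD(1)[OF S(1)] .
    have "Rn n \<subseteq> S" for n
    proof (induction n)
      case 0
      then show ?case using S(2) triangulated_subcategoryD(2)[OF S(1) Z(1)] by (auto simp: Rn0)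
    next
      case (Suc n)
      have "step (Rn n) \<subseteq> S"
      proof
        fix x assume "x \<in> step (Rn n)"
        then consider "x \<in> Rn n" | y where "y \<in> Rn n" "x = ShO C y" | y where "y \<in> Rn n" "x = des y"
          | X Y f where "X \<in> Rn n" "Y \<in> Rn n" "f \<in> Hom C X Y" "x = cone f" unfolding step_def by blast
        then show "x \<in> S"
        proof cases
          case 1
          then show ?thesis using Suc by blast
        next
          case 2
          then show ?thesis using Suc SO triangulated_subcategoryD(4)[OF S(1), of y] by blast
        next
          case (3 y)
          have y: "y \<in> S" "y \<in> Obj C" using 3 Suc SO by auto
          have "ShO C (des y) \<in> S" using triangulated_iso[OF S(1) y(1) isomorphic_sym] des[OF y(2)] by blast
          then show ?thesis using triangulated_subcategoryD(4)[OF S(1), of "des y"] des[OF y(2)] 3 by blast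
        next
          case (4 X Y f)
          obtain g h where "(f, g, h) \<in> Tri C" "Cod C g = cone f" using cone HomD(1)[OF 4(3)] by blast
          then show ?thesis using triangulated_subcategoryD(5)[OF S(1), of f g h] HomD[OF 4(3)] 4 Suc by auto
        qed
      qed
      then show ?case by (simp add: RnS)
    qed
    then show ?thesis using that(3) by (auto simp: R_def)
  qed
  have RO: "R \<subseteq> Obj C" using SinR[OF localizingD(1)[OF Obj_localizing[of U]] G(1)] by blast
  have smRn: "small U (Rn n)" for n
  proof (induction n)
    case 0
    have "small U ({Z} \<union> G)" by (rule small_Un[OF inaccessible small_finite[OF inaccessible] G(2)]) simp
    then show ?case by (simp add: Rn0)
  next
    case (Suc n)
    have H: "small U (\<Union>X\<in>Rn n. \<Union>Y\<in>Rn n. Hom C X Y)"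
      by (intro small_UN[OF inaccessible Suc] small_Hom) (use RO in \<open>auto simp: R_def\<close>)
    show ?case unfolding RnS step_def
      by (intro small_Un[OF inaccessible] Suc small_image H)
  qed
  have smR: "small U R" unfolding R_def by (rule small_UN[OF inaccessible small_countable[OF inaccessible] smRn])
  define T where "T = {Y \<in> Obj C. \<exists>r\<in>R. isomorphic C Y r}"
  have TT: "triangulated_subcategory C T"
  proof (rule triangulated_subcategoryI)
    show "T \<subseteq> Obj C" by (auto simp: T_def)
    show "Z' \<in> T" if "zero_object C Z'" for Z'
    proof -
      have "Z \<in> R" using Rn0 by (auto simp: R_def)
      then show ?thesis using zero_objects_isomorphic[OF that Z(1)] that by (auto simp: T_def zero_object_def)
    qed
    show "Y \<in> T" if "X \<in> T" "Y \<in> Obj C" "isomorphic C X Y" for X Y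
      using that isomorphic_trans[OF isomorphic_sym[OF that(3)]] by (auto simp: T_def)
    show "ShO C X \<in> T" if X: "X \<in> T" for X
    proof -
      obtain r n where r: "r \<in> Rn n" "isomorphic C X r" "X \<in> Obj C" using X by (auto simp: T_def R_def)
      have "ShO C r \<in> R" by (rule stepR[of _ n]) (use r in \<open>auto simp: step_def\<close>)
      then show ?thesis using Sh_isomorphic[OF r(2)] r(3) by (auto simp: T_def)
    qed
    show "X \<in> T" if X: "X \<in> Obj C" "ShO C X \<in> T" for X
    proof -
      obtain r n where r: "r \<in> Rn n" "isomorphic C (ShO C X) r" using X by (auto simp: T_def R_def)
      have rO: "r \<in> Obj C" using r RO by (auto simp: R_def)
      have "des r \<in> R" by (rule stepR[of _ n]) (use r in \<open>auto simp: step_def\<close>)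
      moreover have "isomorphic C X (des r)"
        by (rule Sh_isomorphicD[OF X(1)]) (use des[OF rO] isomorphic_trans[OF r(2) isomorphic_sym] in auto)
      ultimately show ?thesis using X(1) by (auto simp: T_def)
    qed
    show "Cod C g \<in> T" if tri: "(f, g, h) \<in> Tri C" and XY: "Dom C f \<in> T" "Cod C f \<in> T" for f g h
    proof -
      note ty = TriE[OF tri]
      obtain r n where r: "r \<in> Rn n" "isomorphic C (Dom C f) r" using XY by (auto simp: T_def R_def)
      obtain r' n' where r': "r' \<in> Rn n'" "isomorphic C (Cod C f) r'" using XY by (auto simp: T_def R_def)
      have rn: "r \<in> Rn (n + n')" "r' \<in> Rn (n + n')"
        using r(1) r'(1) mono[of n n'] mono[of n' n] by (auto simp: add.commute)
      obtain s where s: "s \<in> Iso C (Dom C f) r" using r by (auto simp: isomorphic_def)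
      obtain t where t: "t \<in> Iso C (Cod C f) r'" using r' by (auto simp: isomorphic_def)
      note st = IsoD[OF s] Inv_typ[OF s] and tt = IsoD[OF t] Inv_typ[OF t]
      have f': "t \<cdot> f \<cdot> Inv C s \<in> Hom C r r'" using st tt ty by (auto simp: Hom_iff)
      obtain g' h' where T': "(t \<cdot> f \<cdot> Inv C s, g', h') \<in> Tri C" "Cod C g' = cone (t \<cdot> f \<cdot> Inv C s)"
        using cone HomD(1)[OF f'] by blast
      have "cone (t \<cdot> f \<cdot> Inv C s) \<in> R"
        by (rule stepR[of _ "n + n'"]) (unfold step_def, use rn f' in blast)
      \<comment> \<open>The triangle is moved along \<open>s\<close> and \<open>t\<close> onto
        representatives, so its third object is isomorphic to the chosen cone of the conjugated
        arrow.\<close>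
      moreover have T2: "(t \<cdot> f \<cdot> Inv C s, g \<cdot> Inv C t, ShA C s \<cdot> h) \<in> Tri C"
      proof (rule Tri_iso[OF tri, of "Dom C f" "Cod C f" "Cod C g" _ r r' _ "Cod C g" _ s t "Ide C (Cod C g)"])
        show "t \<cdot> f = (t \<cdot> f \<cdot> Inv C s) \<cdot> s" using st tt ty Inv_props(2)[OF s] by simp
        show "Ide C (Cod C g) \<cdot> g = (g \<cdot> Inv C t) \<cdot> t" using tt ty Inv_props(2)[OF t] by simp
      qed (use st tt ty f' s t Ide_Iso in \<open>auto simp: Hom_iff\<close>)
      have "isomorphic C (Cod C g) (cone (t \<cdot> f \<cdot> Inv C s))"
        using cone_unique[OF T2 T'(1)] tt ty T'(2) by simp
      ultimately show ?thesis using ty by (auto simp: T_def)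
    qed
  qed
  have RT: "R \<subseteq> T" using RO isomorphic_refl by (auto simp: T_def)
  have GT: "G \<subseteq> T" using RT Rn0 by (auto simp: R_def)
  have min: "T \<subseteq> S" if S: "triangulated_subcategory C S" "G \<subseteq> S" for S
  proof
    fix Y assume "Y \<in> T"
    then obtain r where r: "r \<in> R" "isomorphic C Y r" by (auto simp: T_def)
    show "Y \<in> S" by (rule triangulated_iso[OF S(1) SinR[OF S r(1)] isomorphic_sym[OF r(2)]])
  qed
  show ?thesis by (rule that[OF TT GT RT smR _ min]) (auto simp: T_def)
qed

text \<open>After localizing at the closure \<open>T\<close> of the generators, the local part
  \<open>f\<close> of an object receives no nonzero arrow from any shift of a generator. It is
  therefore zero, and the object lies in \<open>Loc U C T\<close>.\<close>

lemma small_compact_generation: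
  obtains T R where "triangulated_subcategory C T" "T \<subseteq> compact_objects U C" "R \<subseteq> T" "small U R"
    "\<And>t. t \<in> T \<Longrightarrow> \<exists>r\<in>R. isomorphic C t r" "Loc U C T = Obj C"
proof -
  obtain G where G: "G \<subseteq> compact_objects U C" "small U G" and gen: "\<forall>X \<in> Obj C. (\<forall>g\<in>G. \<forall>n::nat.
      Hom C ((ShO C ^^ n) g) X = {Zer C ((ShO C ^^ n) g) X} \<and>
      Hom C g ((ShO C ^^ n) X) = {Zer C g ((ShO C ^^ n) X)}) \<longrightarrow> zero_object C X"
    using ex_generators by (elim exE conjE) (rule that)
  have GO: "G \<subseteq> Obj C" using G(1) compact_Obj by blast
  obtain T R where T: "triangulated_subcategory C T" "G \<subseteq> T" "R \<subseteq> T" "small U R"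
    "\<And>t. t \<in> T \<Longrightarrow> \<exists>r\<in>R. isomorphic C t r" "\<And>S. triangulated_subcategory C S \<Longrightarrow> G \<subseteq> S \<Longrightarrow> T \<subseteq> S"
    by (rule small_triangulated_closure[OF GO G(2)]) blast
  have TO: "T \<subseteq> Obj C" using triangulated_subcategoryD(1)[OF T(1)] .
  have Tc: "T \<subseteq> compact_objects U C" using T(6)[OF compact_triangulated G(1)] .
  have L: "localizing_subcategory U C (Loc U C T)" by (rule Loc_localizing[OF TO])
  have "X \<in> Loc U C T" if X: "X \<in> Obj C" for X
  proof -
    obtain al b c e f where t: "(al, b, c) \<in> Tri C" "al \<in> Hom C e X" "b \<in> Hom C X f" "c \<in> Hom C f (ShO C e)"
      "e \<in> Loc U C T" "f \<in> right_orthogonal C T"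
      by (rule localization_triangle[OF T(1) Tc T(3-5) X])
    have fO: "f \<in> Obj C" using Hom_Obj[OF t(3)] by simp
    have Tn: "(ShO C ^^ n) g \<in> T" if "g \<in> G" for g n
      by (induction n) (use that T(2) TO triangulated_subcategoryD(4)[OF T(1)] in auto)
    have fn: "(ShO C ^^ n) f \<in> right_orthogonal C T \<and> (ShO C ^^ n) f \<in> Obj C" for n
      by (induction n) (use t(6) fO right_orthogonal_props(2)[OF T(1)] in auto)
    have hom: "Hom C k Y = {Zer C k Y}" if "k \<in> T" "Y \<in> right_orthogonal C T" for k Y
    proof -
      have "k \<in> Obj C" "Y \<in> Obj C" using that TO by (auto simp: right_orthogonal_def)
      then have "Zer C k Y \<in> Hom C k Y" by (simp add: Hom_iff)
      then show ?thesis using that unfolding right_orthogonal_def by blast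
    qed
    have "zero_object C f"
    proof (rule bspec[OF gen fO, THEN mp], intro ballI allI)
      fix g and n :: nat assume g: "g \<in> G"
      show "Hom C ((ShO C ^^ n) g) f = {Zer C ((ShO C ^^ n) g) f} \<and>
        Hom C g ((ShO C ^^ n) f) = {Zer C g ((ShO C ^^ n) f)}"
        using hom[OF Tn[OF g] t(6)] hom[of g "(ShO C ^^ n) f"] fn T(2) g by blast
    qed
    then have "al \<in> Iso C e X" using Tri_zero_iso[OF t(1)] HomD[OF t(2)] HomD[OF t(3)] by simp
    then show ?thesis using triangulated_iso[OF localizingD(1)[OF L] t(5) isomorphicI] by blast
  qed
  then have "Loc U C T = Obj C" using localizing_Obj[OF L] by blast
  then show ?thesis using that[OF T(1) Tc T(3,4,5)] by blast
qed

text \<open>The device by which a property spreads from compact objects to all objects: it is enough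
  that the objects having it form a localizing subcategory.\<close>

lemma localizing_all:
  assumes "localizing_subcategory U C L" "compact_objects U C \<subseteq> L"
  shows "L = Obj C"
proof -
  obtain T R where "T \<subseteq> compact_objects U C" "Loc U C T = Obj C"
    by (rule small_compact_generation) blast
  then show ?thesis using Loc_minimal[OF assms(1), of T] localizing_Obj[OF assms(1)] assms(2) by blast
qed

section \<open>Arrows that factor through a triangulated subcategory of compact objects\<close>

definition factors :: "'o set \<Rightarrow> 'm \<Rightarrow> bool" where
  "factors K h \<longleftrightarrow> (\<exists>k\<in>K. \<exists>p \<in> Hom C (Dom C h) k. \<exists>q \<in> Hom C k (Cod C h). h = q \<cdot> p)"

lemma factorsI:
  assumes "k \<in> K" "p \<in> Hom C X k" "q \<in> Hom C k Y" shows "factors K (q \<cdot> p)"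
proof -
  have d: "Dom C (q \<cdot> p) = X" "Cod C (q \<cdot> p) = Y" using Comp_Hom[OF assms(2,3)] by (auto simp: Hom_iff)
  show ?thesis unfolding factors_def d using assms by blast
qed

lemma factorsE:
  assumes "factors K h" "h \<in> Hom C X Y"
  obtains k p q where "k \<in> K" "p \<in> Hom C X k" "q \<in> Hom C k Y" "h = q \<cdot> p"
  using assms(1) that unfolding factors_def HomD(2,3)[OF assms(2)] by blast

lemma factors_comp:
  assumes "factors K h" "h \<in> Hom C X Y" "g \<in> Hom C W X" "l \<in> Hom C Y Z"
  shows "factors K (l \<cdot> h \<cdot> g)"
proof -
  obtain k p q where k: "k \<in> K" "p \<in> Hom C X k" "q \<in> Hom C k Y" "h = q \<cdot> p" by (rule factorsE[OF assms(1,2)])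
  have "l \<cdot> h \<cdot> g = (l \<cdot> q) \<cdot> (p \<cdot> g)"
    using k(4) HomD[OF k(2)] HomD[OF k(3)] HomD[OF assms(3)] HomD[OF assms(4)] by simp
  then show ?thesis using factorsI[OF k(1) Comp_Hom[OF assms(3) k(2)] Comp_Hom[OF k(3) assms(4)]] by simp
qed

lemma factors_Zer:
  assumes "triangulated_subcategory C K" "X \<in> Obj C" "Y \<in> Obj C" shows "factors K (Zer C X Y)"
proof -
  obtain Z where Z: "zero_object C Z" "Z \<in> Obj C" by (rule ex_zero)
  have "factors K (Zer C Z Y \<cdot> Zer C X Z)"
    by (rule factorsI[OF triangulated_subcategoryD(2)[OF assms(1) Z(1)], of _ X _ Y])
      (use Z assms in \<open>auto simp: Hom_iff\<close>)
  then show ?thesis using Z assms by simp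
qed

lemma factors_Add:
  assumes K: "triangulated_subcategory C K" and h: "factors K h" "h \<in> Hom C X Y"
    and h': "factors K h'" "h' \<in> Hom C X Y"
  shows "factors K (Add C h h')"
proof -
  obtain k p q where k: "k \<in> K" "p \<in> Hom C X k" "q \<in> Hom C k Y" "h = q \<cdot> p" by (rule factorsE[OF h])
  obtain k' p' q' where k': "k' \<in> K" "p' \<in> Hom C X k'" "q' \<in> Hom C k' Y" "h' = q' \<cdot> p'" by (rule factorsE[OF h'])
  have kO: "k \<in> Obj C" "k' \<in> Obj C" using Hom_Obj k(2) k'(2) by blast+
  obtain B where B: "is_binary_coproduct C k k' B" using ex_binary_coproduct[OF kO] by blast
  obtain i j r s where b: "i \<in> Hom C k B" "j \<in> Hom C k' B" "r \<in> Hom C B k" "s \<in> Hom C B k'"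
    "r \<cdot> i = Ide C k" "s \<cdot> j = Ide C k'" "r \<cdot> j = Zer C k' k" "s \<cdot> i = Zer C k k'"
    by (rule binary_coproductE[OF B kO])
  note ty = HomD[OF b(1)] HomD[OF b(2)] HomD[OF b(3)] HomD[OF b(4)] HomD[OF k(2)] HomD[OF k(3)] HomD[OF k'(2)] HomD[OF k'(3)]
  have BK: "B \<in> K" by (rule triangulated_binary_coproduct[OF K k(1) k'(1) B])
  have XYO: "X \<in> Obj C" "Y \<in> Obj C" using Hom_Obj[OF h(2)] by auto
  have "factors K (Add C (q \<cdot> r) (q' \<cdot> s) \<cdot> Add C (i \<cdot> p) (j \<cdot> p'))"
    by (rule factorsI[OF BK, of _ X _ Y]) (use ty in \<open>auto simp: Hom_iff\<close>)
  moreover have "Add C (q \<cdot> r) (q' \<cdot> s) \<cdot> Add C (i \<cdot> p) (j \<cdot> p') = Add C h h'"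
    using ty kO XYO by (simp add: k(4) k'(4) comp_red[OF b(5)] comp_red[OF b(6)] comp_red[OF b(7)] comp_red[OF b(8)])
  ultimately show ?thesis by simp
qed

text \<open>Neeman's argument: the compact objects of the localizing subcategory generated by \<open>K\<close>.\<close>

definition factoring :: "'o set \<Rightarrow> 'o set" where
  "factoring K = {Y \<in> Obj C. \<forall>c \<in> compact_objects U C. \<forall>h \<in> Hom C c Y. factors K h}"

text \<open>The image of \<open>al\<close> in the third object factors through some
  \<open>k2\<close>. The fibre \<open>Z\<close> of the map from \<open>c\<close> to
  \<open>k2\<close> is again compact, and its map to the first object factors through some
  \<open>k1\<close>. An extension \<open>X\<close> of \<open>k2\<close> by \<open>k1\<close> lies in
  \<open>K\<close> and maps to the middle object; the difference between \<open>al\<close> and the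
  arrow through \<open>X\<close> factors through \<open>k2\<close>, and sums of arrows through
  \<open>K\<close> again factor through \<open>K\<close>.\<close>

lemma factoring_extension:
  assumes K: "triangulated_subcategory C K" "K \<subseteq> compact_objects U C"
    and T: "(f, g, h) \<in> Tri C" and E: "Dom C f \<in> factoring K" "Cod C g \<in> factoring K"
  shows "Cod C f \<in> factoring K"
proof -
  note ty = TriE[OF T]
  have FD: "factors K x" if "Y \<in> factoring K" "c \<in> compact_objects U C" "x \<in> Hom C c Y" for x c Y
    using that unfolding factoring_def by blast
  have "factors K al" if c: "c \<in> compact_objects U C" and al: "al \<in> Hom C c (Cod C f)" for c al
  proof -
    note aty = HomD[OF al]
    have ga: "g \<cdot> al \<in> Hom C c (Cod C g)" using ty aty by (simp add: Hom_iff)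
    obtain k2 p2 q2 where k2: "k2 \<in> K" "p2 \<in> Hom C c k2" "q2 \<in> Hom C k2 (Cod C g)" "g \<cdot> al = q2 \<cdot> p2"
      by (rule factorsE[OF FD[OF E(2) c ga] ga])
    note p2y = HomD[OF k2(2)] and q2y = HomD[OF k2(3)]
    obtain z w Z where T2: "(z, p2, w) \<in> Tri C" "z \<in> Hom C Z c" "w \<in> Hom C k2 (ShO C Z)"
      using fiber_exists[OF k2(2)] by blast
    note zy = HomD[OF T2(2)] and wy = HomD[OF T2(3)]
    have Zc: "Z \<in> compact_objects U C"
      using triangulated_first[OF compact_triangulated T2(1)] K(2) k2(1) c p2y zy by auto
    obtain be where be: "be \<in> Hom C Z (Dom C f)" "al \<cdot> z = f \<cdot> be" "ShA C be \<cdot> w = h \<cdot> q2"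
      by (rule Tri_fill_first[OF T2(1) T, of al q2]) (use zy p2y k2(3,4) al in auto)
    obtain k1 p1 q1 where k1: "k1 \<in> K" "p1 \<in> Hom C Z k1" "q1 \<in> Hom C k1 (Dom C f)" "be = q1 \<cdot> p1"
      by (rule factorsE[OF FD[OF E(1) Zc be(1)] be(1)])
    note p1y = HomD[OF k1(2)] and q1y = HomD[OF k1(3)]
    have k1O: "k1 \<in> Obj C" using Hom_Obj[OF k1(2)] by simp
    have v: "ShA C p1 \<cdot> w \<in> Hom C k2 (ShO C k1)" using p1y wy by (simp add: Hom_iff)
    obtain i j X where T3: "(i, j, ShA C p1 \<cdot> w) \<in> Tri C" "i \<in> Hom C k1 X" "j \<in> Hom C X k2"
      by (rule Tri_third[OF v k1O])
    note iy = HomD[OF T3(2)] and jy = HomD[OF T3(3)]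
    have XK: "X \<in> K" using triangulated_middle[OF K(1) T3(1)] iy jy k1(1) k2(1) by simp
    have k2O: "k2 \<in> Obj C" using Hom_Obj[OF T3(3)] by simp
    obtain ga where ga: "ga \<in> Hom C c X" "ga \<cdot> z = i \<cdot> p1" "Ide C k2 \<cdot> p2 = j \<cdot> ga"
      by (rule Tri_fill_middle[OF T2(1) T3(1), of p1 "Ide C k2"])
        (use zy p2y wy p1y iy jy k2O in \<open>auto simp: Hom_iff\<close>)
    have q2w: "ShA C q1 \<cdot> (ShA C p1 \<cdot> w) = h \<cdot> q2"
    proof -
      have "ShA C q1 \<cdot> (ShA C p1 \<cdot> w) = ShA C (q1 \<cdot> p1) \<cdot> w" using q1y p1y wy by (simp add: Sh_Comp)
      then show ?thesis using k1(4) be(3) by simp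
    qed
    obtain de where de: "de \<in> Hom C X (Cod C f)" "de \<cdot> i = f \<cdot> q1" "q2 \<cdot> j = g \<cdot> de"
      by (rule Tri_fill_middle[OF T3(1) T, of q1 q2]) (use iy jy k1(3) k2(3) q2w in auto)
    note gay = HomD[OF ga(1)] and dey = HomD[OF de(1)]
    let ?e = "Add C al (Neg C (de \<cdot> ga))"
    have ey: "?e \<in> Hom C c (Cod C f)" using aty dey gay by (simp add: Hom_iff)
    have "(de \<cdot> ga) \<cdot> z = de \<cdot> (i \<cdot> p1)" using dey gay zy ga(2) by simp
    also have "\<dots> = (f \<cdot> q1) \<cdot> p1" by (rule comp_red[OF de(2)]) (use dey iy p1y in auto)
    also have "\<dots> = al \<cdot> z" using be(2) k1(4) ty q1y p1y by simp
    finally have dgz: "(de \<cdot> ga) \<cdot> z = al \<cdot> z" .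
    have "?e \<cdot> z = Add C (al \<cdot> z) (Neg C ((de \<cdot> ga) \<cdot> z))" using aty dey gay zy by simp
    also have "\<dots> = Zer C Z (Cod C f)" unfolding dgz using aty zy by simp
    finally obtain l where l: "l \<in> Hom C k2 (Cod C f)" "l \<cdot> p2 = ?e"
      using Tri_ext1[OF T2(1), of ?e "Cod C f"] ey zy p2y by auto
    have "factors K (de \<cdot> ga)" by (rule factorsI[OF XK ga(1) de(1)])
    moreover have "factors K ?e" using factorsI[OF k2(1,2) l(1)] l(2) by simp
    ultimately have "factors K (Add C ?e (de \<cdot> ga))"
      by (rule factors_Add[OF K(1) _ ey _ Comp_Hom[OF ga(1) de(1)], rotated])
    moreover have "Add C ?e (de \<cdot> ga) = al" by (rule diff_add) (use aty dey gay in auto)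
    ultimately show ?thesis by simp
  qed
  then show ?thesis using ty unfolding factoring_def by auto
qed

text \<open>Cones are \<open>factoring_extension\<close> for the rotated triangle. For a coproduct,
  an arrow from a compact object is a finite sum of arrows through single summands.\<close>

lemma factoring_localizing:
  assumes K: "triangulated_subcategory C K" "K \<subseteq> compact_objects U C"
  shows "localizing_subcategory U C (factoring K)"
proof (rule localizing_subcategoryI)
  have FD: "factors K x" if "Y \<in> factoring K" "c \<in> compact_objects U C" "x \<in> Hom C c Y" for x c Y
    using that unfolding factoring_def by blast
  have FI: "Y \<in> factoring K" if "Y \<in> Obj C" "\<And>c x. c \<in> compact_objects U C \<Longrightarrow> x \<in> Hom C c Y \<Longrightarrow> factors K x" for Y
    using that unfolding factoring_def by blast
  have FO: "Y \<in> Obj C" if "Y \<in> factoring K" for Y using that unfolding factoring_def by blast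
  have KO: "K \<subseteq> Obj C" using triangulated_subcategoryD(1)[OF K(1)] .
  have sh1: "ShO C Y \<in> factoring K" if Y: "Y \<in> factoring K" for Y
  proof (rule FI)
    show "ShO C Y \<in> Obj C" using FO[OF Y] by simp
    fix c x assume c: "c \<in> compact_objects U C" and x: "x \<in> Hom C c (ShO C Y)"
    obtain c' where c': "c' \<in> Obj C" "isomorphic C (ShO C c') c" using desuspend[OF compact_Obj[OF c]] .
    have "ShO C c' \<in> compact_objects U C"
      using triangulated_iso[OF compact_triangulated c isomorphic_sym[OF c'(2)]] .
    then have cc: "c' \<in> compact_objects U C" using compact_desuspend c'(1) by blast
    obtain t where t: "t \<in> Iso C (ShO C c') c" using c' by (auto simp: isomorphic_def)
    obtain l where l: "l \<in> Hom C c' Y" "ShA C l = x \<cdot> t"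
      using Sh_full[OF c'(1) FO[OF Y] Comp_Hom[OF Iso_Hom[OF t] x]] .
    obtain k p q where k: "k \<in> K" "p \<in> Hom C c' k" "q \<in> Hom C k Y" "l = q \<cdot> p"
      by (rule factorsE[OF FD[OF Y cc l(1)] l(1)])
    note ty = HomD[OF k(2)] HomD[OF k(3)] IsoD[OF t] Inv_typ[OF t] HomD[OF x]
    have "x = (x \<cdot> t) \<cdot> Inv C t" using ty Inv_props(3)[OF t] by simp
    also have "\<dots> = ShA C q \<cdot> (ShA C p \<cdot> Inv C t)" unfolding l(2)[symmetric] k(4) using ty by (simp add: Sh_Comp)
    finally have "x = ShA C q \<cdot> (ShA C p \<cdot> Inv C t)" .
    moreover have "ShO C k \<in> K" using triangulated_subcategoryD(4)[OF K(1)] k(1) KO by blast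
    ultimately show "factors K x"
      using factorsI[of "ShO C k" K "ShA C p \<cdot> Inv C t" c "ShA C q" "ShO C Y"] ty by (simp add: Hom_iff)
  qed
  show "triangulated_subcategory C (factoring K)"
  proof (rule triangulated_subcategoryI)
    show "factoring K \<subseteq> Obj C" using FO by blast
    show "Z \<in> factoring K" if Z: "zero_object C Z" for Z
    proof (rule FI)
      show ZO: "Z \<in> Obj C" using Z by (simp add: zero_object_def)
      fix c x assume x: "x \<in> Hom C c Z"
      then have "x = Zer C c Z" using zero_object_arr(1)[OF Z] by (auto simp: Hom_iff)
      then show "factors K x" using factors_Zer[OF K(1) _ ZO] Hom_Obj[OF x] by simp
    qed
    show "Y \<in> factoring K" if X: "X \<in> factoring K" "Y \<in> Obj C" "isomorphic C X Y" for X Y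
    proof (rule FI[OF X(2)])
      fix c x assume c: "c \<in> compact_objects U C" and x: "x \<in> Hom C c Y"
      obtain t where t: "t \<in> Iso C X Y" using X by (auto simp: isomorphic_def)
      have it: "Inv C t \<cdot> x \<in> Hom C c X" by (rule Comp_Hom[OF x Inv_props(1)[OF t]])
      have "factors K (t \<cdot> (Inv C t \<cdot> x) \<cdot> Ide C c)"
        by (rule factors_comp[OF FD[OF X(1) c it] it Ide_Hom[OF compact_Obj[OF c]] Iso_Hom[OF t]])
      then show "factors K x" using HomD[OF x] Inv_cancel(2)[OF t] Inv_typ[OF t] by simp
    qed
    show "ShO C X \<in> factoring K" if "X \<in> factoring K" for X by (rule sh1[OF that])
    show "X \<in> factoring K" if X: "X \<in> Obj C" "ShO C X \<in> factoring K" for X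
    proof (rule FI[OF X(1)])
      fix c x assume c: "c \<in> compact_objects U C" and x: "x \<in> Hom C c X"
      have cO: "c \<in> Obj C" using compact_Obj[OF c] .
      have sx: "ShA C x \<in> Hom C (ShO C c) (ShO C X)" using x by (simp add: Hom_iff)
      obtain k p q where k: "k \<in> K" "p \<in> Hom C (ShO C c) k" "q \<in> Hom C k (ShO C X)" "ShA C x = q \<cdot> p"
        by (rule factorsE[OF FD[OF X(2) Sh_compact[OF c] sx] sx])
      have kO: "k \<in> Obj C" using k(1) KO by blast
      obtain k' where k': "k' \<in> Obj C" "isomorphic C (ShO C k') k" using desuspend[OF kO] .
      have "ShO C k' \<in> K" using triangulated_iso[OF K(1) k(1) isomorphic_sym[OF k'(2)]] .
      then have kK: "k' \<in> K" using triangulated_subcategoryD(4)[OF K(1) k'(1)] by simp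
      obtain t where t: "t \<in> Iso C (ShO C k') k" using k' by (auto simp: isomorphic_def)
      obtain p' where p': "p' \<in> Hom C c k'" "ShA C p' = Inv C t \<cdot> p"
        using Sh_full[OF cO k'(1) Comp_Hom[OF k(2) Inv_props(1)[OF t]]] .
      obtain q' where q': "q' \<in> Hom C k' X" "ShA C q' = q \<cdot> t"
        using Sh_full[OF k'(1) X(1) Comp_Hom[OF Iso_Hom[OF t] k(3)]] .
      note ty = HomD[OF p'(1)] HomD[OF q'(1)] IsoD[OF t] Inv_typ[OF t] HomD[OF k(2)] HomD[OF k(3)] HomD[OF x]
      have "ShA C (q' \<cdot> p') = (q \<cdot> t) \<cdot> (Inv C t \<cdot> p)" using ty p'(2) q'(2) by (simp add: Sh_Comp)
      also have "\<dots> = ShA C x" unfolding k(4) using ty Inv_cancel(2)[OF t] by simp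
      finally have "q' \<cdot> p' = x" by (rule Sh_faithful[rotated -1]) (use ty in auto)
      then show "factors K x" using factorsI[OF kK p'(1) q'(1)] by simp
    qed
    show "Cod C g \<in> factoring K" if T: "(f, g, h) \<in> Tri C" and E: "Dom C f \<in> factoring K" "Cod C f \<in> factoring K" for f g h
      using factoring_extension[OF K Tri_rotate'[OF T]] TriE[OF T] E sh1[OF E(1)] by simp
  qed
  fix I X S and inc :: "_ \<Rightarrow> 'm"
  assume I: "I \<subseteq> U" "small U I" "\<And>i. i \<in> I \<Longrightarrow> X i \<in> factoring K" and S: "is_coproduct C I X S inc"
  show "S \<in> factoring K"
  proof (rule FI)
    show SO: "S \<in> Obj C" using coproduct_Obj[OF S] .
    fix c x assume c: "c \<in> compact_objects U C" and x: "x \<in> Hom C c S"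
    have cO: "c \<in> Obj C" using compact_Obj[OF c] .
    obtain F where F: "finite F" "F \<subseteq> I" "coproduct_part C I X S inc F \<cdot> x = x"
      using compact_objectsD[OF c I(1,2) _ S x] FO I(3) by blast
    have "factors K (coproduct_part C I X S inc F \<cdot> x)"
    proof (rule coproduct_part_finite_induct[OF S F(1,2) x])
      show "factors K (Zer C c S)" by (rule factors_Zer[OF K(1) cO SO])
      fix i k assume i: "i \<in> I" and k: "factors K k" "k \<in> Hom C c S"
      let ?y = "coproduct_proj C I X S inc i \<cdot> x"
      have y: "?y \<in> Hom C c (X i)" by (rule Comp_Hom[OF x coproduct_proj(1)[OF S i]])
      have "factors K (inc i \<cdot> ?y \<cdot> Ide C c)"
        by (rule factors_comp[OF FD[OF I(3)[OF i] c y] y Ide_Hom[OF cO] coproduct_inc[OF S i]])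
      moreover have "?y \<cdot> Ide C c = ?y" by (rule Comp_Ide') (use HomD[OF y] in auto)
      ultimately have "factors K (inc i \<cdot> ?y)" by simp
      then show "factors K (Add C (inc i \<cdot> ?y) k)"
        by (rule factors_Add[OF K(1) _ Comp_Hom[OF y coproduct_inc[OF S i]] k])
    qed
    then show "factors K x" using F(3) by simp
  qed
qed

text \<open>The factorization property, shared by all objects of \<open>Loc U C K\<close>, is
  applied to the identity of \<open>c\<close>.\<close>

lemma compact_in_Loc:
  assumes K: "triangulated_subcategory C K" "K \<subseteq> compact_objects U C"
    and c: "c \<in> compact_objects U C" "c \<in> Loc U C K"
  obtains k where "k \<in> K" "retract C c k"
proof -
  have cO: "c \<in> Obj C" using compact_Obj[OF c(1)] .
  have "K \<subseteq> factoring K"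
  proof
    fix k assume k: "k \<in> K"
    have kO: "k \<in> Obj C" using k triangulated_subcategoryD(1)[OF K(1)] by blast
    have "factors K x" if x: "x \<in> Hom C b k" for b x
      using factorsI[OF k x Ide_Hom[OF kO]] HomD[OF x] by simp
    then show "k \<in> factoring K" using kO unfolding factoring_def by blast
  qed
  then have "c \<in> factoring K" using Loc_minimal[OF factoring_localizing[OF K]] c(2) by blast
  then have "factors K (Ide C c)" using c(1) Ide_Hom[OF cO] unfolding factoring_def by blast
  then obtain k p q where "k \<in> K" "p \<in> Hom C c k" "q \<in> Hom C k c" "Ide C c = q \<cdot> p"
    by (rule factorsE[OF _ Ide_Hom[OF cO]])
  then show ?thesis using that[of k] unfolding retract_def by metis
qed

text \<open>Every compact object is a retract of a member of a small set, and a retract is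
  determined up to isomorphism by its idempotent. The idempotents in question form a small set
  because sets of arrows are small.\<close>

lemma compact_small_skeleton:
  obtains R where "R \<subseteq> compact_objects U C" "small U R" "\<And>c. c \<in> compact_objects U C \<Longrightarrow> \<exists>r\<in>R. isomorphic C c r"
proof -
  let ?K = "compact_objects U C"
  obtain T R where T: "triangulated_subcategory C T" "T \<subseteq> ?K" "R \<subseteq> T" "small U R"
    "\<And>t. t \<in> T \<Longrightarrow> \<exists>r\<in>R. isomorphic C t r" "Loc U C T = Obj C"
    by (rule small_compact_generation) blast
  have RO: "r \<in> Obj C" if "r \<in> R" for r using T(2,3) that compact_Obj by blast
  have "\<exists>r i p. r \<in> R \<and> i \<in> Hom C c r \<and> p \<in> Hom C r c \<and> p \<cdot> i = Ide C c" if c: "c \<in> ?K" for c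
  proof -
    obtain t where t: "t \<in> T" "retract C c t" by (rule compact_in_Loc[OF T(1,2) c]) (use T(6) compact_Obj[OF c] in auto)
    obtain r where r: "r \<in> R" "isomorphic C t r" using T(5)[OF t(1)] by blast
    have "retract C c r" by (rule retract_iso_right[OF t(2) r(2)])
    then show ?thesis using r(1) unfolding retract_def by blast
  qed
  then obtain rr ii pp where rip: "\<And>c. c \<in> ?K \<Longrightarrow> rr c \<in> R \<and> ii c \<in> Hom C c (rr c) \<and> pp c \<in> Hom C (rr c) c \<and> pp c \<cdot> ii c = Ide C c"
    by metis
  \<comment> \<open>The isomorphism invariant of \<open>c\<close>: the representative of which it is
    a retract, with the idempotent on it.\<close>
  define ph where "ph = (\<lambda>c. (rr c, ii c \<cdot> pp c))"
  have iso: "isomorphic C c c'" if c: "c \<in> ?K" "c' \<in> ?K" and eq: "ph c = ph c'" for c c'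
  proof -
    have r: "rr c' = rr c" and e: "ii c \<cdot> pp c = ii c' \<cdot> pp c'" using eq by (auto simp: ph_def)
    note a = rip[OF c(1)] and b = rip[OF c(2), unfolded r]
    have ty: "ii c \<in> Arr C" "Dom C (ii c) = c" "Cod C (ii c) = rr c" "pp c \<in> Arr C" "Dom C (pp c) = rr c" "Cod C (pp c) = c"
      "ii c' \<in> Arr C" "Dom C (ii c') = c'" "Cod C (ii c') = rr c" "pp c' \<in> Arr C" "Dom C (pp c') = rr c" "Cod C (pp c') = c'"
      using a b by (auto simp: Hom_iff)
    have pi: "pp c \<cdot> ii c = Ide C c" "pp c' \<cdot> ii c' = Ide C c'" using a b by auto
    have cO: "c \<in> Obj C" "c' \<in> Obj C" using compact_Obj c by auto
    have "(pp c \<cdot> ii c') \<cdot> (pp c' \<cdot> ii c) = pp c \<cdot> (ii c' \<cdot> pp c') \<cdot> ii c" using ty by simp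
    also have "\<dots> = (pp c \<cdot> ii c) \<cdot> (pp c \<cdot> ii c)" unfolding e[symmetric] using ty by simp
    also have "\<dots> = Ide C c" unfolding pi using cO by simp
    finally have 1: "(pp c \<cdot> ii c') \<cdot> (pp c' \<cdot> ii c) = Ide C c" .
    have "(pp c' \<cdot> ii c) \<cdot> (pp c \<cdot> ii c') = pp c' \<cdot> (ii c \<cdot> pp c) \<cdot> ii c'" using ty by simp
    also have "\<dots> = (pp c' \<cdot> ii c') \<cdot> (pp c' \<cdot> ii c')" unfolding e using ty by simp
    also have "\<dots> = Ide C c'" unfolding pi using cO by simp
    finally have 2: "(pp c' \<cdot> ii c) \<cdot> (pp c \<cdot> ii c') = Ide C c'" .
    show ?thesis by (rule isomorphicI[OF IsoI[OF _ _ 1 2]]) (use ty in \<open>auto simp: Hom_iff\<close>)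
  qed
  let ?R = "inv_into ?K ph ` (ph ` ?K)"
  have "ii c \<cdot> pp c \<in> Hom C (rr c) (rr c)" if "c \<in> ?K" for c
    using Comp_Hom[of "pp c" "rr c" c "ii c" "rr c"] rip[OF that] by blast
  then have sub: "ph ` ?K \<subseteq> (SIGMA r : R. Hom C r r)" using rip by (auto simp: ph_def)
  have "small U (ph ` ?K)"
    by (rule small_subset[OF small_Sigma[OF inaccessible T(4) small_Hom] sub]) (use RO in auto)
  then have sm: "small U ?R" by (rule small_image)
  show ?thesis
  proof (rule that[OF _ sm])
    show "?R \<subseteq> ?K" using inv_into_into[of _ ph ?K] by blast
    fix c assume c: "c \<in> ?K"
    have "isomorphic C c (inv_into ?K ph (ph c))"
      by (rule iso[OF c inv_into_into]) (use c f_inv_into_f[of "ph c" ph ?K] in auto)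
    then show "\<exists>r\<in>?R. isomorphic C c r" using c by blast
  qed
qed

text \<open>The skeleton of the compact objects, intersected with \<open>K\<close>, supplies the
  representatives that \<open>localization_triangle\<close> asks for.\<close>

lemma ex_localization_triangle:
  assumes K: "triangulated_subcategory C K" "K \<subseteq> compact_objects U C" and X: "X \<in> Obj C"
  obtains al b c e f where "(al, b, c) \<in> Tri C" "al \<in> Hom C e X" "b \<in> Hom C X f" "c \<in> Hom C f (ShO C e)"
    "e \<in> Loc U C K" "f \<in> right_orthogonal C K"
proof -
  obtain R where R: "R \<subseteq> compact_objects U C" "small U R"
    "\<And>c. c \<in> compact_objects U C \<Longrightarrow> \<exists>r\<in>R. isomorphic C c r" by (rule compact_small_skeleton) blast
  have 1: "\<exists>r\<in>R \<inter> K. isomorphic C k r" if k: "k \<in> K" for k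
  proof -
    obtain r where r: "r \<in> R" "isomorphic C k r" using R(3) K(2) k by blast
    then show ?thesis using triangulated_iso[OF K(1) k r(2)] by blast
  qed
  have 2: "small U (R \<inter> K)" by (rule small_subset[OF R(2)]) simp
  show ?thesis by (rule localization_triangle[OF K _ 2 1 X that]) auto
qed

end

section \<open>Prime ideals and idempotent triangles\<close>

lemma noetherian_spaceD:
  "noetherian_space T \<Longrightarrow> (\<And>n::nat. closedin T (Z n)) \<Longrightarrow> decseq Z \<Longrightarrow> \<exists>N. \<forall>n\<ge>N. Z n = Z N"
  unfolding noetherian_space_def by simp

text \<open>A cover without finite subcover yields strictly increasing finite unions; their
  complements form a descending chain of closed sets that never becomes stationary.\<close>

lemma noetherian_compactin:
  assumes N: "noetherian_space T" and S: "S \<subseteq> topspace T"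
  shows "compactin T S"
  unfolding compactin_def
proof (intro conjI allI impI S)
  fix \<U> assume U: "Ball \<U> (openin T) \<and> S \<subseteq> \<Union>\<U>"
  show "\<exists>\<F>. finite \<F> \<and> \<F> \<subseteq> \<U> \<and> S \<subseteq> \<Union>\<F>"
  proof (rule ccontr)
    assume no: "\<not> (\<exists>\<F>. finite \<F> \<and> \<F> \<subseteq> \<U> \<and> S \<subseteq> \<Union>\<F>)"
    have "\<exists>f. \<forall>n::nat. (finite (f n) \<and> f n \<subseteq> \<U>) \<and> (f n \<subseteq> f (Suc n) \<and> \<Union>(f (Suc n)) \<noteq> \<Union>(f n))"
    proof (rule dependent_nat_choice)
      show "\<exists>x. finite x \<and> x \<subseteq> \<U>" by (rule exI[of _ "{}"]) simp
      fix x n assume x: "finite x \<and> x \<subseteq> \<U>"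
      then obtain s where s: "s \<in> S" "s \<notin> \<Union>x" using no by blast
      then obtain V where "V \<in> \<U>" "s \<in> V" using U by blast
      then show "\<exists>y. (finite y \<and> y \<subseteq> \<U>) \<and> (x \<subseteq> y \<and> \<Union>y \<noteq> \<Union>x)"
        using x s by (intro exI[of _ "insert V x"]) auto
    qed
    then obtain f where "\<forall>n::nat. (finite (f n) \<and> f n \<subseteq> \<U>) \<and> (f n \<subseteq> f (Suc n) \<and> \<Union>(f (Suc n)) \<noteq> \<Union>(f n))"
      by (elim exE)
    then have f: "\<And>n::nat. finite (f n)" "\<And>n. f n \<subseteq> \<U>" "\<And>n. f n \<subseteq> f (Suc n)"
      "\<And>n. \<Union>(f (Suc n)) \<noteq> \<Union>(f n)" by simp_all
    have sub: "\<Union>(f n) \<subseteq> topspace T" for n using f(2) U openin_subset by blast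
    have cl: "closedin T (topspace T - \<Union>(f n))" for n
    proof -
      have "openin T (\<Union>(f n))" by (rule openin_Union) (use f(2)[of n] U in blast)
      then show ?thesis unfolding openin_closedin_eq by simp
    qed
    have dec: "decseq (\<lambda>n. topspace T - \<Union>(f n))"
      by (rule decseq_SucI) (use f(3) in blast)
    obtain M where "\<forall>n\<ge>M. topspace T - \<Union>(f n) = topspace T - \<Union>(f M)"
      using noetherian_spaceD[where Z = "\<lambda>n. topspace T - \<Union>(f n)", OF N cl dec] by blast
    from this[rule_format, of "Suc M"] have "topspace T - \<Union>(f (Suc M)) = topspace T - \<Union>(f M)" by auto
    then show False using sub f(4) by blast
  qed
qed

text \<open>The descending chain condition as existence of minimal elements, for an indexed family,
  so that a minimal closed set comes with an index: here a compact object of minimal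
  support.\<close>

lemma noetherian_minimal:
  assumes N: "noetherian_space T" and cl: "\<And>x. x \<in> A \<Longrightarrow> closedin T (F x)" and ne: "A \<noteq> {}"
  obtains x where "x \<in> A" "\<And>y. y \<in> A \<Longrightarrow> F y \<subseteq> F x \<Longrightarrow> F y = F x"
proof (rule ccontr)
  assume no: "\<not> thesis"
  have "\<exists>f. \<forall>n::nat. f n \<in> A \<and> (F (f (Suc n)) \<subset> F (f n))"
  proof (rule dependent_nat_choice)
    show "\<exists>x. x \<in> A" using ne by blast
    fix x and n :: nat assume x: "x \<in> A"
    have "\<exists>y\<in>A. F y \<subset> F x"
    proof (rule ccontr)
      assume "\<not> (\<exists>y\<in>A. F y \<subset> F x)"
      then have "F y = F x" if "y \<in> A" "F y \<subseteq> F x" for y using that by blast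
      then show False using no that[OF x] by simp
    qed
    then show "\<exists>y. y \<in> A \<and> F y \<subset> F x" by blast
  qed
  then obtain f where f: "\<And>n::nat. f n \<in> A" "\<And>n. F (f (Suc n)) \<subset> F (f n)" by blast
  have dec: "decseq (\<lambda>n. F (f n))" by (rule decseq_SucI) (use f(2) in blast)
  obtain M where "\<forall>n\<ge>M. F (f n) = F (f M)"
    using noetherian_spaceD[where Z = "\<lambda>n. F (f n)", OF N cl[OF f(1)] dec] by blast
  from this[rule_format, of "Suc M"] have "F (f (Suc M)) = F (f M)" by auto
  then show False using f(2)[of M] by blast
qed

locale rigidly_compactly_generated_universe =
  rigidly_compactly_generated U C + compactly_generated_universe U C
  for U :: "'u set" and C :: "('o, 'm, 'z) ttcat_scheme" (structure)
begin

lemma Uni_compact: "Uni C \<in> compact_objects U C"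
  using Uni_rigid compact_eq_rigid by simp

lemma compact_TenO:
  "c \<in> compact_objects U C \<Longrightarrow> d \<in> compact_objects U C \<Longrightarrow> c \<boxtimes> d \<in> compact_objects U C"
  using compact_TenO_rigid[of c U d] unfolding compact_eq_rigid by blast

lemma localizing_idealI:
  assumes "localizing_subcategory U C L" "\<And>X Y. X \<in> Obj C \<Longrightarrow> Y \<in> L \<Longrightarrow> X \<boxtimes> Y \<in> L"
  shows "localizing_ideal U C L"
  using assms by (auto simp: localizing_ideal_def)

lemma localizing_idealD:
  assumes "localizing_ideal U C L"
  shows "localizing_subcategory U C L" "triangulated_subcategory C L"
    "X \<in> Obj C \<Longrightarrow> Y \<in> L \<Longrightarrow> X \<boxtimes> Y \<in> L" "X \<in> Obj C \<Longrightarrow> Y \<in> L \<Longrightarrow> Y \<boxtimes> X \<in> L" "Y \<in> L \<Longrightarrow> Y \<in> Obj C"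
    "Y \<in> L \<Longrightarrow> isomorphic C Y Z \<Longrightarrow> Z \<in> L" "retract C X Y \<Longrightarrow> Y \<in> L \<Longrightarrow> X \<in> L"
proof -
  show L: "localizing_subcategory U C L" using assms by (simp add: localizing_ideal_def)
  show T: "triangulated_subcategory C L" using localizingD(1)[OF L] .
  show 1: "X \<in> Obj C \<Longrightarrow> Y \<in> L \<Longrightarrow> X \<boxtimes> Y \<in> L" using assms by (simp add: localizing_ideal_def)
  show O: "Y \<in> L \<Longrightarrow> Y \<in> Obj C" using localizing_Obj[OF L] .
  show I: "Y \<in> L \<Longrightarrow> isomorphic C Y Z \<Longrightarrow> Z \<in> L" for Y Z using triangulated_iso[OF T] .
  show "X \<in> Obj C \<Longrightarrow> Y \<in> L \<Longrightarrow> Y \<boxtimes> X \<in> L"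
    using I[OF 1 isomorphic_Swp] O by blast
  show "retract C X Y \<Longrightarrow> Y \<in> L \<Longrightarrow> X \<in> L" using localizing_retract[OF L] by blast
qed

text \<open>With this ideal in the role of \<open>L\<close>, statements about membership in
  \<open>L\<close> become statements about vanishing.\<close>

lemma zero_localizing_ideal: "localizing_ideal U C {Z. zero_object C Z}"
proof (rule localizing_idealI)
  show "localizing_subcategory U C {Z. zero_object C Z}"
  proof (rule localizing_subcategoryI)
    show "triangulated_subcategory C {Z. zero_object C Z}"
    proof (rule triangulated_subcategoryI)
      show "{Z. zero_object C Z} \<subseteq> Obj C" by (auto simp: zero_object_def)
      show "Z \<in> {Z. zero_object C Z}" if "zero_object C Z" for Z using that by simp
      show "Y \<in> {Z. zero_object C Z}" if "X \<in> {Z. zero_object C Z}" "Y \<in> Obj C" "isomorphic C X Y" for X Y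
        using zero_object_iso that by simp
      show "ShO C X \<in> {Z. zero_object C Z}" if "X \<in> {Z. zero_object C Z}" for X
        using that Sh_zero_object[of X] by (auto simp: zero_object_def)
      show "X \<in> {Z. zero_object C Z}" if "X \<in> Obj C" "ShO C X \<in> {Z. zero_object C Z}" for X
        using that Sh_zero_object[of X] by simp
      show "Cod C g \<in> {Z. zero_object C Z}" if T: "(f, g, h) \<in> Tri C" and
        z: "Dom C f \<in> {Z. zero_object C Z}" "Cod C f \<in> {Z. zero_object C Z}" for f g h
      proof -
        note ty = TriE[OF T]
        have "h = Zer C (Cod C g) (ShO C (Dom C f))"
          using zero_object_arr(1)[of "ShO C (Dom C f)" h] Sh_zero_object[of "Dom C f"] z ty by simp
        then have "h \<cdot> Ide C (Cod C g) = Zer C (Cod C g) (ShO C (Dom C f))" using ty by simp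
        then obtain l where l: "l \<in> Hom C (Cod C g) (Cod C f)" "g \<cdot> l = Ide C (Cod C g)"
          using Tri_lift2[OF T, of "Ide C (Cod C g)" "Cod C g"] ty by (auto simp: Hom_iff)
        have "retract C (Cod C g) (Cod C f)"
          unfolding retract_def by (rule bexI[OF _ l(1)], rule bexI[of _ g]) (use l(2) ty in \<open>auto simp: Hom_iff\<close>)
        then show ?thesis using zero_object_retract z by simp
      qed
    qed
    show "S \<in> {Z. zero_object C Z}"
      if z: "\<And>i. i \<in> I \<Longrightarrow> X i \<in> {Z. zero_object C Z}" and S: "is_coproduct C I X S inc" for I X S and inc :: "_ \<Rightarrow> 'm"
    proof -
      have SO: "S \<in> Obj C" using coproduct_Obj[OF S] .
      have "Ide C S = Zer C S S"
      proof (rule coproduct_ext[OF S])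
        fix i assume i: "i \<in> I"
        note ity = HomD[OF coproduct_inc[OF S i]]
        have "inc i = Zer C (X i) S" using zero_object_arr(2)[of "X i" "inc i"] z[OF i] ity by simp
        then show "Ide C S \<cdot> inc i = Zer C S S \<cdot> inc i" using ity SO by simp
      qed (use SO in \<open>auto simp: Hom_iff\<close>)
      then show ?thesis using SO by (simp add: zero_object_iff)
    qed
  qed
  show "X \<boxtimes> Y \<in> {Z. zero_object C Z}" if "X \<in> Obj C" "Y \<in> {Z. zero_object C Z}" for X Y
    using TenO_zero that by simp
qed

lemma thick_tensor_idealD:
  assumes "thick_tensor_ideal U C P"
  shows "P \<subseteq> compact_objects U C" "triangulated_subcategory C P"
    "X \<in> compact_objects U C \<Longrightarrow> Y \<in> P \<Longrightarrow> X \<boxtimes> Y \<in> P"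
    "X \<in> compact_objects U C \<Longrightarrow> Y \<in> P \<Longrightarrow> Y \<boxtimes> X \<in> P"
    "retract C X S \<Longrightarrow> S \<in> P \<Longrightarrow> X \<in> P"
proof -
  show P: "P \<subseteq> compact_objects U C" "triangulated_subcategory C P"
    using assms by (auto simp: thick_tensor_ideal_def)
  show 1: "X \<in> compact_objects U C \<Longrightarrow> Y \<in> P \<Longrightarrow> X \<boxtimes> Y \<in> P" using assms by (simp add: thick_tensor_ideal_def)
  show "X \<in> compact_objects U C \<Longrightarrow> Y \<in> P \<Longrightarrow> Y \<boxtimes> X \<in> P"
    using triangulated_iso[OF P(2) 1 isomorphic_Swp] P(1) compact_Obj by blast
  show "X \<in> P" if r: "retract C X S" and S: "S \<in> P"
  proof -
    obtain Y where Y: "Y \<in> Obj C" "is_binary_coproduct C X Y S" by (rule retract_summand[OF r])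
    have "X \<in> Obj C" using r Hom_Obj(1) unfolding retract_def by blast
    then show ?thesis using assms Y S unfolding thick_tensor_ideal_def by blast
  qed
qed

lemma thick_tensor_idealI:
  assumes "P \<subseteq> compact_objects U C" "triangulated_subcategory C P"
    "\<And>X Y. X \<in> compact_objects U C \<Longrightarrow> Y \<in> P \<Longrightarrow> X \<boxtimes> Y \<in> P" "\<And>X S. retract C X S \<Longrightarrow> S \<in> P \<Longrightarrow> X \<in> P"
  shows "thick_tensor_ideal U C P"
  unfolding thick_tensor_ideal_def
proof (intro conjI ballI impI)
  fix X Y S assume "X \<in> Obj C" "Y \<in> Obj C" "S \<in> P" "is_binary_coproduct C X Y S"
  then show "X \<in> P" using assms(4)[OF binary_coproduct_retract] by blast
qed (use assms in auto)

section \<open>Annihilators, their radicality, and the existence of primes\<close>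

lemma Inter_two_triangulated:
  assumes "triangulated_subcategory C A" "triangulated_subcategory C B"
  shows "triangulated_subcategory C (A \<inter> B)"
  using Inter_triangulated[of "{A, B}"] assms by auto

lemma annihilator_thick:
  assumes L: "localizing_ideal U C L" and T: "T \<in> Obj C"
  shows "thick_tensor_ideal U C {y \<in> compact_objects U C. y \<boxtimes> T \<in> L}"
proof (rule thick_tensor_idealI)
  note LD = localizing_idealD[OF L]
  let ?J = "{y \<in> compact_objects U C. y \<boxtimes> T \<in> L}"
  have "?J = compact_objects U C \<inter> {X \<in> Obj C. X \<boxtimes> T \<in> L}" using compact_Obj by auto
  then show "triangulated_subcategory C ?J"
    using Inter_two_triangulated[OF compact_triangulated localizingD(1)[OF TenO_preimage_localizing[OF LD(1) T]]]
    by simp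
  show "X \<boxtimes> Y \<in> ?J" if X: "X \<in> compact_objects U C" and Y: "Y \<in> ?J" for X Y
  proof -
    have O: "X \<in> Obj C" "Y \<in> Obj C" using X Y compact_Obj by auto
    have "X \<boxtimes> (Y \<boxtimes> T) \<in> L" using LD(3) O Y by simp
    then have "(X \<boxtimes> Y) \<boxtimes> T \<in> L" by (rule LD(6)[OF _ isomorphic_sym[OF isomorphic_Asc[OF O T]]])
    then show ?thesis using compact_TenO X Y by simp
  qed
  show "X \<in> ?J" if r: "retract C X S" and S: "S \<in> ?J" for X S
    using compact_retract[OF r, of U] LD(7)[OF retract_TenO(1)[OF r T]] S by simp
qed auto

text \<open>With \<open>Y\<close> dual to \<open>z\<close>, the object \<open>z\<close> is a retract
  of \<open>z \<boxtimes> (Y \<boxtimes> z)\<close>, so \<open>z \<boxtimes> T\<close> is a retract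
  of \<open>Y \<boxtimes> (z \<boxtimes> (z \<boxtimes> T))\<close>. This is why annihilators are
  radical.\<close>

lemma nilpotent_mem:
  assumes L: "localizing_ideal U C L" and z: "z \<in> compact_objects U C" and T: "T \<in> Obj C"
    and zz: "z \<boxtimes> (z \<boxtimes> T) \<in> L"
  shows "z \<boxtimes> T \<in> L"
proof -
  note LD = localizing_idealD[OF L]
  have zO: "z \<in> Obj C" using compact_Obj[OF z] .
  obtain Y where Y: "Y \<in> Obj C" "retract C z (z \<boxtimes> (Y \<boxtimes> z))"
    by (rule rigid_retract[OF z[unfolded compact_eq_rigid]])
  have r: "retract C (z \<boxtimes> T) ((z \<boxtimes> (Y \<boxtimes> z)) \<boxtimes> T)" by (rule retract_TenO(1)[OF Y(2) T])
  note [trans] = isomorphic_trans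
  have "isomorphic C ((z \<boxtimes> (Y \<boxtimes> z)) \<boxtimes> T) (z \<boxtimes> ((Y \<boxtimes> z) \<boxtimes> T))"
    by (rule isomorphic_Asc) (use zO Y T in auto)
  also have "isomorphic C \<dots> (z \<boxtimes> (Y \<boxtimes> (z \<boxtimes> T)))"
    by (rule isomorphic_TenO[OF isomorphic_refl isomorphic_Asc]) (use zO Y T in auto)
  also have "isomorphic C \<dots> (Y \<boxtimes> (z \<boxtimes> (z \<boxtimes> T)))"
    by (rule isomorphic_left_commute) (use zO Y T in auto)
  finally have "isomorphic C ((z \<boxtimes> (Y \<boxtimes> z)) \<boxtimes> T) (Y \<boxtimes> (z \<boxtimes> (z \<boxtimes> T)))" .
  then have "retract C (z \<boxtimes> T) (Y \<boxtimes> (z \<boxtimes> (z \<boxtimes> T)))" by (rule retract_iso_right[OF r])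
  then show ?thesis using LD(3)[OF Y(1) zz] LD(7) by blast
qed

text \<open>Offset by one: \<open>tensor_power z n\<close> has \<open>n + 1\<close> factors, so the
  unit is never counted as a power.\<close>

definition tensor_power :: "'o \<Rightarrow> nat \<Rightarrow> 'o" where
  "tensor_power z n = ((\<lambda>x. z \<boxtimes> x) ^^ n) z"

lemma tensor_power_simps: "tensor_power z 0 = z" "tensor_power z (Suc n) = z \<boxtimes> tensor_power z n"
  by (auto simp: tensor_power_def)

lemma tensor_power_compact: "z \<in> compact_objects U C \<Longrightarrow> tensor_power z n \<in> compact_objects U C"
  by (induction n) (auto simp: tensor_power_simps compact_TenO)

lemma tensor_power_mult:
  assumes "z \<in> Obj C"
  shows "isomorphic C (tensor_power z n \<boxtimes> tensor_power z m) (tensor_power z (Suc (n + m)))"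
proof (induction n)
  have pO: "tensor_power z k \<in> Obj C" for k by (induction k) (use assms in \<open>auto simp: tensor_power_simps\<close>)
  case 0
  show ?case using isomorphic_refl[of "z \<boxtimes> tensor_power z m"] assms pO by (simp add: tensor_power_simps)
next
  have pO: "tensor_power z k \<in> Obj C" for k by (induction k) (use assms in \<open>auto simp: tensor_power_simps\<close>)
  case (Suc n)
  have "isomorphic C (tensor_power z (Suc n) \<boxtimes> tensor_power z m) (z \<boxtimes> (tensor_power z n \<boxtimes> tensor_power z m))"
    unfolding tensor_power_simps by (rule isomorphic_Asc[OF assms pO pO])
  moreover have "isomorphic C (z \<boxtimes> (tensor_power z n \<boxtimes> tensor_power z m)) (tensor_power z (Suc (Suc n + m)))"
    using isomorphic_TenO[OF isomorphic_refl[OF assms] Suc] by (simp add: tensor_power_simps)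
  ultimately show ?case using isomorphic_trans by blast
qed

text \<open>One factor is removed at a time, by \<open>nilpotent_mem\<close> with the remaining
  power tensored with \<open>T\<close> in the role of \<open>T\<close>.\<close>

lemma tensor_power_mem:
  assumes L: "localizing_ideal U C L" and z: "z \<in> compact_objects U C" and T: "T \<in> Obj C"
  shows "tensor_power z n \<boxtimes> T \<in> L \<Longrightarrow> z \<boxtimes> T \<in> L"
proof (induction n)
  case 0
  then show ?case by (simp add: tensor_power_simps)
next
  note LD = localizing_idealD[OF L]
  have zO: "z \<in> Obj C" using compact_Obj[OF z] .
  have pO: "tensor_power z k \<in> Obj C" for k using compact_Obj[OF tensor_power_compact[OF z]] .
  case (Suc n)
  have p: "z \<boxtimes> (tensor_power z n \<boxtimes> T) \<in> L"
    by (rule LD(6)[OF Suc.prems]) (unfold tensor_power_simps, rule isomorphic_Asc[OF zO pO T])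
  show ?case
  proof (cases n)
    case 0
    then show ?thesis using nilpotent_mem[OF L z T] p by (simp add: tensor_power_simps)
  next
    case (Suc k)
    have kT: "tensor_power z k \<boxtimes> T \<in> Obj C" using pO T by simp
    have "z \<boxtimes> (z \<boxtimes> (tensor_power z k \<boxtimes> T)) \<in> L"
      by (rule LD(6)[OF p])
        (unfold Suc tensor_power_simps, rule isomorphic_TenO[OF isomorphic_refl isomorphic_Asc], use zO pO T in auto)
    then have "z \<boxtimes> (tensor_power z k \<boxtimes> T) \<in> L" by (rule nilpotent_mem[OF L z kT])
    then have "tensor_power z n \<boxtimes> T \<in> L" unfolding Suc tensor_power_simps
      by (rule LD(6)[OF _ isomorphic_sym[OF isomorphic_Asc[OF zO pO T]]])
    then show ?thesis by (rule Suc.IH)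
  qed
qed

text \<open>The ideal quotient of \<open>R\<close> by \<open>b\<close>: the larger ideal to which
  maximality is applied when a maximal ideal is shown to be prime.\<close>

lemma colon_thick:
  assumes R: "thick_tensor_ideal U C R" and b: "b \<in> compact_objects U C"
  shows "thick_tensor_ideal U C {u \<in> compact_objects U C. u \<boxtimes> b \<in> R}" "R \<subseteq> {u \<in> compact_objects U C. u \<boxtimes> b \<in> R}"
proof -
  note RD = thick_tensor_idealD[OF R]
  have bO: "b \<in> Obj C" using compact_Obj[OF b] .
  let ?J = "{u \<in> compact_objects U C. u \<boxtimes> b \<in> R}"
  show "R \<subseteq> ?J" using RD(1,4) b by auto
  show "thick_tensor_ideal U C ?J"
  proof (rule thick_tensor_idealI)
    show "triangulated_subcategory C ?J"
    proof (rule triangulated_subcategoryI)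
      show "?J \<subseteq> Obj C" using compact_Obj by auto
      show "Z \<in> ?J" if "zero_object C Z" for Z
        using triangulated_subcategoryD(2)[OF compact_triangulated that] triangulated_subcategoryD(2)[OF RD(2)]
          TenO_zero(1)[OF that bO] by blast
      show "Y \<in> ?J" if X: "X \<in> ?J" "Y \<in> Obj C" "isomorphic C X Y" for X Y
        using triangulated_iso[OF compact_triangulated _ X(3)]
          triangulated_iso[OF RD(2) _ isomorphic_TenO[OF X(3) isomorphic_refl[OF bO]]] X(1) by blast
      show "ShO C X \<in> ?J" if X: "X \<in> ?J" for X
      proof -
        have XO: "X \<in> Obj C" using X compact_Obj by auto
        have "ShO C (X \<boxtimes> b) \<in> R" using triangulated_subcategoryD(4)[OF RD(2), of "X \<boxtimes> b"] X XO bO by simp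
        then have "ShO C X \<boxtimes> b \<in> R"
          by (rule triangulated_iso[OF RD(2) _ isomorphic_sym[OF isomorphicI[OF Slf_Iso[OF XO bO]]]])
        then show ?thesis using Sh_compact[of X U] X by simp
      qed
      show "X \<in> ?J" if X: "X \<in> Obj C" "ShO C X \<in> ?J" for X
      proof -
        have "ShO C (X \<boxtimes> b) \<in> R" using triangulated_iso[OF RD(2) _ isomorphicI[OF Slf_Iso[OF X(1) bO]]] X(2) by simp
        then have "X \<boxtimes> b \<in> R" using triangulated_subcategoryD(4)[OF RD(2), of "X \<boxtimes> b"] X bO by simp
        then show ?thesis using compact_desuspend[of X U] X by simp
      qed
      show "Cod C g \<in> ?J" if T: "(f, g, h) \<in> Tri C" and fJ: "Dom C f \<in> ?J" "Cod C f \<in> ?J" for f g h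
      proof -
        note ty = TriE[OF T]
        have "(f \<star> Ide C b, g \<star> Ide C b, Slf C (Dom C f) b \<cdot> (h \<star> Ide C b)) \<in> Tri C"
          by (rule TenA_Tri[OF T _ bO, of _ "Cod C f"]) (use ty in \<open>auto simp: Hom_iff\<close>)
        from triangulated_subcategoryD(5)[OF RD(2) this] have "Cod C g \<boxtimes> b \<in> R" using fJ ty bO by simp
        then show ?thesis using compact_cone[OF T, of U] fJ by simp
      qed
    qed
    show "X \<boxtimes> Y \<in> ?J" if X: "X \<in> compact_objects U C" and Y: "Y \<in> ?J" for X Y
    proof -
      have "X \<boxtimes> (Y \<boxtimes> b) \<in> R" using RD(3) X Y by simp
      then have "(X \<boxtimes> Y) \<boxtimes> b \<in> R"
        by (rule triangulated_iso[OF RD(2) _ isomorphic_sym[OF isomorphic_Asc]]) (use X Y bO compact_Obj in auto)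
      then show ?thesis using compact_TenO X Y by simp
    qed
    show "X \<in> ?J" if r: "retract C X S" and S: "S \<in> ?J" for X S
      using compact_retract[OF r, of U] RD(5)[OF retract_TenO(1)[OF r bO]] S by simp
  qed auto
qed

text \<open>A maximal ideal avoiding the powers of \<open>z\<close> is prime.\<close>

lemma prime_avoiding:
  assumes J: "thick_tensor_ideal U C J" and z: "z \<in> compact_objects U C"
    and avoid: "\<And>n. tensor_power z n \<notin> J"
  obtains R where "R \<in> Spc U C" "J \<subseteq> R" "z \<notin> R"
proof -
  define A where "A = {R. thick_tensor_ideal U C R \<and> J \<subseteq> R \<and> (\<forall>n. tensor_power z n \<notin> R)}"
  have "\<exists>M\<in>A. \<forall>X\<in>A. M \<subseteq> X \<longrightarrow> X = M"
  proof (rule subset_Zorn_nonempty)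
    show "A \<noteq> {}" using J avoid by (auto simp: A_def)
    fix \<C> assume ne: "\<C> \<noteq> {}" and ch: "subset.chain A \<C>"
    have C: "thick_tensor_ideal U C R" "J \<subseteq> R" "tensor_power z n \<notin> R" if "R \<in> \<C>" for R n
      using ch that by (auto simp: subset.chain_def A_def)
    have two: "\<exists>R\<in>\<C>. X \<in> R \<and> Y \<in> R" if XY: "X \<in> \<Union>\<C>" "Y \<in> \<Union>\<C>" for X Y
    proof -
      obtain R S where RS: "R \<in> \<C>" "S \<in> \<C>" "X \<in> R" "Y \<in> S" using XY by blast
      have "R \<subseteq> S \<or> S \<subseteq> R" using ch RS(1,2) unfolding subset.chain_def by blast
      then show ?thesis using RS by blast
    qed
    obtain R0 where R0: "R0 \<in> \<C>" using ne by blast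
    note CD = thick_tensor_idealD[OF C(1)]
    have "thick_tensor_ideal U C (\<Union>\<C>)"
    proof (rule thick_tensor_idealI)
      show "\<Union>\<C> \<subseteq> compact_objects U C" using CD(1) by blast
      then have UO: "\<Union>\<C> \<subseteq> Obj C" using compact_Obj by blast
      show "triangulated_subcategory C (\<Union>\<C>)"
      proof (rule triangulated_subcategoryI)
        show "\<Union>\<C> \<subseteq> Obj C" by (rule UO)
        show "Z \<in> \<Union>\<C>" if "zero_object C Z" for Z using triangulated_subcategoryD(2)[OF CD(2)[OF R0] that] R0 by blast
        show "Y \<in> \<Union>\<C>" if X: "X \<in> \<Union>\<C>" "Y \<in> Obj C" "isomorphic C X Y" for X Y
        proof -
          obtain R where R: "R \<in> \<C>" "X \<in> R" using X by blast
          show ?thesis using triangulated_iso[OF CD(2)[OF R(1)] R(2) X(3)] R(1) by blast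
        qed
        show "ShO C X \<in> \<Union>\<C>" if X: "X \<in> \<Union>\<C>" for X
        proof -
          obtain R where R: "R \<in> \<C>" "X \<in> R" using X by blast
          have "X \<in> Obj C" using UO X by blast
          then show ?thesis using triangulated_subcategoryD(4)[OF CD(2)[OF R(1)], of X] R by blast
        qed
        show "X \<in> \<Union>\<C>" if X: "X \<in> Obj C" "ShO C X \<in> \<Union>\<C>" for X
        proof -
          obtain R where R: "R \<in> \<C>" "ShO C X \<in> R" using X by blast
          show ?thesis using triangulated_subcategoryD(4)[OF CD(2)[OF R(1)], of X] R X by blast
        qed
        show "Cod C g \<in> \<Union>\<C>" if T: "(f, g, h) \<in> Tri C" "Dom C f \<in> \<Union>\<C>" "Cod C f \<in> \<Union>\<C>" for f g h
        proof -
          obtain R where R: "R \<in> \<C>" "Dom C f \<in> R" "Cod C f \<in> R" using two[OF T(2,3)] by blast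
          show ?thesis using triangulated_subcategoryD(5)[OF CD(2)[OF R(1)] T(1) R(2,3)] R(1) by blast
        qed
      qed
      show "X \<boxtimes> Y \<in> \<Union>\<C>" if X: "X \<in> compact_objects U C" "Y \<in> \<Union>\<C>" for X Y
      proof -
        obtain R where R: "R \<in> \<C>" "Y \<in> R" using X by blast
        show ?thesis using CD(3)[OF R(1) X(1) R(2)] R(1) by blast
      qed
      show "X \<in> \<Union>\<C>" if X: "retract C X S" "S \<in> \<Union>\<C>" for X S
      proof -
        obtain R where R: "R \<in> \<C>" "S \<in> R" using X by blast
        show ?thesis using CD(5)[OF R(1) X(1) R(2)] R(1) by blast
      qed
    qed
    then show "\<Union>\<C> \<in> A" using C(2,3) R0 unfolding A_def by blast
  qed
  then obtain R where R: "R \<in> A" "\<And>X. X \<in> A \<Longrightarrow> R \<subseteq> X \<Longrightarrow> X = R" by blast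
  have RT: "thick_tensor_ideal U C R" and RJ: "J \<subseteq> R" and Rz: "\<And>n. tensor_power z n \<notin> R" using R(1) by (auto simp: A_def)
  note RD = thick_tensor_idealD[OF RT]
  have big: "\<exists>n. tensor_power z n \<in> S" if "thick_tensor_ideal U C S" "R \<subseteq> S" "x \<in> S" "x \<notin> R" for S x
    using R(2)[of S] that RJ unfolding A_def by blast
  have "X \<in> R \<or> Y \<in> R" if X: "X \<in> compact_objects U C" and Y: "Y \<in> compact_objects U C" and XY: "X \<boxtimes> Y \<in> R" for X Y
  proof (rule ccontr)
    assume n: "\<not> (X \<in> R \<or> Y \<in> R)"
    \<comment> \<open>Maximality is used twice. The quotient of \<open>R\<close> by \<open>Y\<close>
      is strictly larger because it contains \<open>X\<close>, so it contains a power of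
      \<open>z\<close>; the quotient by that power contains \<open>Y\<close>, so it contains another
      power. The product of the two powers then lies in \<open>R\<close>.\<close>
    obtain n where zn: "tensor_power z n \<in> {u \<in> compact_objects U C. u \<boxtimes> Y \<in> R}"
      using big[OF colon_thick[OF RT Y], of X] X XY n by blast
    have pc: "tensor_power z n \<in> compact_objects U C" by (rule tensor_power_compact[OF z])
    have "Y \<boxtimes> tensor_power z n \<in> R"
      using triangulated_iso[OF RD(2) _ isomorphic_Swp[OF compact_Obj[OF pc] compact_Obj[OF Y]]] zn by simp
    then obtain m where zm: "tensor_power z m \<in> {u \<in> compact_objects U C. u \<boxtimes> tensor_power z n \<in> R}"
      using big[OF colon_thick[OF RT pc], of Y] Y n by blast
    then have "tensor_power z (Suc (m + n)) \<in> R"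
      using triangulated_iso[OF RD(2) _ tensor_power_mult[OF compact_Obj[OF z]]] by blast
    then show False using Rz by blast
  qed
  moreover have "z \<notin> R" using Rz[of 0] by (simp add: tensor_power_simps)
  ultimately have "R \<in> Spc U C" "z \<notin> R" using RT z unfolding Spc_def by auto
  then show ?thesis using that RJ by blast
qed

lemma prime_over_annihilator:
  assumes L: "localizing_ideal U C L" and T: "T \<in> Obj C" and z: "z \<in> compact_objects U C" "z \<boxtimes> T \<notin> L"
  obtains R where "R \<in> Spc U C" "\<And>y. y \<in> compact_objects U C \<Longrightarrow> y \<boxtimes> T \<in> L \<Longrightarrow> y \<in> R" "z \<notin> R"
proof -
  obtain R where R: "R \<in> Spc U C" "{y \<in> compact_objects U C. y \<boxtimes> T \<in> L} \<subseteq> R" "z \<notin> R"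
    by (rule prime_avoiding[OF annihilator_thick[OF L T] z(1)]) (use tensor_power_mem[OF L z(1) T] z(2) in blast)
  then show ?thesis using that by blast
qed

text \<open>Two passes. For fixed \<open>k\<close> in \<open>K\<close>, the \<open>X\<close> whose
  product with \<open>k\<close> lies in \<open>Loc U C K\<close> form a localizing subcategory
  containing the compact objects, hence are all objects. For fixed \<open>X\<close>, the
  \<open>Y\<close> with this property then form a localizing subcategory containing
  \<open>K\<close>.\<close>

lemma Loc_ideal:
  assumes K: "K \<subseteq> compact_objects U C" "\<And>X Y. X \<in> compact_objects U C \<Longrightarrow> Y \<in> K \<Longrightarrow> X \<boxtimes> Y \<in> K"
  shows "localizing_ideal U C (Loc U C K)"
proof (rule localizing_idealI)
  have KO: "K \<subseteq> Obj C" using K(1) compact_Obj by blast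
  show L: "localizing_subcategory U C (Loc U C K)" by (rule Loc_localizing[OF KO])
  note LT = localizingD(1)[OF L]
  have 1: "X \<boxtimes> k \<in> Loc U C K" if k: "k \<in> K" and X: "X \<in> Obj C" for X k
  proof -
    have "{X \<in> Obj C. X \<boxtimes> k \<in> Loc U C K} = Obj C"
      by (rule localizing_all[OF TenO_preimage_localizing[OF L]])
        (use k KO K(2) Loc_subset[of K U C] compact_Obj in auto)
    then show ?thesis using X by blast
  qed
  show "X \<boxtimes> Y \<in> Loc U C K" if X: "X \<in> Obj C" and Y: "Y \<in> Loc U C K" for X Y
  proof -
    have "K \<subseteq> {Y \<in> Obj C. Y \<boxtimes> X \<in> Loc U C K}"
      using 1[OF _ X] triangulated_iso[OF LT _ isomorphic_Swp[OF X]] KO by blast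
    then have "Loc U C K \<subseteq> {Y \<in> Obj C. Y \<boxtimes> X \<in> Loc U C K}"
      by (rule Loc_minimal[OF TenO_preimage_localizing[OF L X]])
    then have "Y \<boxtimes> X \<in> Loc U C K" "Y \<in> Obj C" using Y by auto
    then show ?thesis using triangulated_iso[OF LT _ isomorphic_Swp] X by blast
  qed
qed

section \<open>Idempotent triangles and generated ideals\<close>

lemma Tri_TenO:
  assumes T: "(f, g, h) \<in> Tri C" and W: "W \<in> Obj C"
  shows "zero_object C (Cod C g \<boxtimes> W) \<Longrightarrow> isomorphic C (Dom C f \<boxtimes> W) (Cod C f \<boxtimes> W)"
    "zero_object C (Dom C f \<boxtimes> W) \<Longrightarrow> isomorphic C (Cod C f \<boxtimes> W) (Cod C g \<boxtimes> W)"
proof -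
  note ty = TriE[OF T]
  have T1: "(f \<star> Ide C W, g \<star> Ide C W, Slf C (Dom C f) W \<cdot> (h \<star> Ide C W)) \<in> Tri C"
    by (rule TenA_Tri[OF T _ W, of _ "Cod C f"]) (use ty in \<open>auto simp: Hom_iff\<close>)
  show "isomorphic C (Dom C f \<boxtimes> W) (Cod C f \<boxtimes> W)" if "zero_object C (Cod C g \<boxtimes> W)"
    using isomorphicI[OF Tri_zero_iso[OF T1]] that ty W by simp
  show "isomorphic C (Cod C f \<boxtimes> W) (Cod C g \<boxtimes> W)" if "zero_object C (Dom C f \<boxtimes> W)"
    using isomorphicI[OF Tri_zero_iso[OF Tri_rotate'[OF T1]]] TriE[OF T1] that ty W Sh_zero_object[of "Dom C f \<boxtimes> W"]
    by simp
qed

text \<open>The localization triangle of the unit. The point is that \<open>f\<close> is annihilated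
  by \<open>?K\<close>, not merely orthogonal to it: arrows into \<open>k \<boxtimes> f\<close>
  transpose to arrows into \<open>f\<close> from an object of the ideal generated by
  \<open>?K\<close>. The rest follows by tensoring the triangle.\<close>

lemma ex_idempotent_triangle:
  assumes K: "thick_tensor_ideal U C (compact_supported U C Y)"
  obtains e f where "is_idempotent_triangle U C Y e f"
proof -
  let ?K = "compact_supported U C Y"
  let ?L = "Loc U C ?K"
  note KD = thick_tensor_idealD[OF K]
  have KO: "?K \<subseteq> Obj C" using KD(1) compact_Obj by blast
  have L: "localizing_ideal U C ?L" by (rule Loc_ideal[OF KD(1,3)])
  note LD = localizing_idealD[OF L]
  obtain a b c e f where T: "(a, b, c) \<in> Tri C" "a \<in> Hom C e (Uni C)" "b \<in> Hom C (Uni C) f" "c \<in> Hom C f (ShO C e)"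
    "e \<in> ?L" "f \<in> right_orthogonal C ?K"
    by (rule ex_localization_triangle[OF KD(2,1) Uni_Obj])
  note aty = HomD[OF T(2)] and bty = HomD[OF T(3)]
  have fO: "f \<in> Obj C" using Hom_Obj T(3) by blast
  let ?N = "left_orthogonal C (right_orthogonal C ?K)"
  have LN: "?L \<subseteq> ?N" by (rule Loc_minimal[OF biorthogonal_localizing[OF KD(2)]])
  have kf: "zero_object C (k \<boxtimes> f)" if k: "k \<in> ?K" for k
  proof -
    have kO: "k \<in> Obj C" using k KO by blast
    have kL: "k \<in> ?L" using Loc_subset[of ?K U C] k by blast
    obtain B where B: "B \<in> Obj C" "retract C B (B \<boxtimes> (k \<boxtimes> B))"
      "\<And>W f al. f \<in> Obj C \<Longrightarrow> al \<in> Hom C W (k \<boxtimes> f) \<Longrightarrow> Hom C (B \<boxtimes> W) f \<subseteq> {Zer C (B \<boxtimes> W) f}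
        \<Longrightarrow> al = Zer C W (k \<boxtimes> f)"
      by (rule rigid_retract[of k], use KD(1) k compact_eq_rigid in blast, rule that)
    have kfO: "k \<boxtimes> f \<in> Obj C" using kO fO by simp
    \<comment> \<open>The dual \<open>B\<close> of \<open>k\<close> is a retract of
      \<open>B \<boxtimes> (k \<boxtimes> B)\<close>, hence lies in the ideal. So arrows from
      \<open>B \<boxtimes> (k \<boxtimes> f)\<close> to \<open>f\<close> vanish, and by adjunction
      so does the identity of \<open>k \<boxtimes> f\<close>.\<close>
    have "B \<in> ?L" by (rule LD(7)[OF B(2)]) (use LD(3,4) kL B(1) in simp)
    then have "B \<boxtimes> (k \<boxtimes> f) \<in> ?N" using LD(4)[OF kfO] LN by blast
    then have "Hom C (B \<boxtimes> (k \<boxtimes> f)) f \<subseteq> {Zer C (B \<boxtimes> (k \<boxtimes> f)) f}" using T(6) unfolding left_orthogonal_def by blast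
    then have "Ide C (k \<boxtimes> f) = Zer C (k \<boxtimes> f) (k \<boxtimes> f)" by (rule B(3)[OF fO Ide_Hom[OF kfO]])
    then show ?thesis using kfO by (simp add: zero_object_iff)
  qed
  have Lf: "zero_object C (X \<boxtimes> f)" if "X \<in> ?L" for X
  proof -
    have "?L \<subseteq> {X \<in> Obj C. X \<boxtimes> f \<in> {Z. zero_object C Z}}"
      by (rule Loc_minimal[OF TenO_preimage_localizing[OF localizing_idealD(1)[OF zero_localizing_ideal] fO]])
        (use kf KO in auto)
    then show ?thesis using that by auto
  qed
  have ex: "X \<in> ?L \<and> isomorphic C X (e \<boxtimes> X)" if X: "X \<in> Obj C" and z: "zero_object C (f \<boxtimes> X)" for X
  proof -
    have "isomorphic C (e \<boxtimes> X) (Uni C \<boxtimes> X)" using Tri_TenO(1)[OF T(1) X] z aty bty by simp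
    then have "isomorphic C (e \<boxtimes> X) X" using isomorphic_trans isomorphic_Lun[OF X] by blast
    then show ?thesis using LD(6)[OF LD(4)[OF X T(5)]] isomorphic_sym by blast
  qed
  have s1: "{X \<in> Obj C. zero_object C (f \<boxtimes> X)} = ?L"
  proof
    show "{X \<in> Obj C. zero_object C (f \<boxtimes> X)} \<subseteq> ?L" using ex by blast
    show "?L \<subseteq> {X \<in> Obj C. zero_object C (f \<boxtimes> X)}"
      using zero_object_iso[OF Lf isomorphic_Swp] LD(5) fO by blast
  qed
  have s2: "?L = {X \<in> Obj C. \<exists>Z \<in> Obj C. isomorphic C X (e \<boxtimes> Z)}"
  proof
    show "?L \<subseteq> {X \<in> Obj C. \<exists>Z \<in> Obj C. isomorphic C X (e \<boxtimes> Z)}" using ex s1 by blast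
    show "{X \<in> Obj C. \<exists>Z \<in> Obj C. isomorphic C X (e \<boxtimes> Z)} \<subseteq> ?L"
      using LD(6)[OF LD(4)[OF _ T(5)] isomorphic_sym] by blast
  qed
  have "is_idempotent_triangle U C Y e f"
    unfolding is_idempotent_triangle_def using T(1-4) Lf[OF T(5)] s1 s2 by blast
  then show ?thesis by (rule that)
qed

lemma idempotent_triangleD:
  assumes "is_idempotent_triangle U C Y e f"
  shows "e \<in> Obj C" "f \<in> Obj C" "e \<in> Loc U C (compact_supported U C Y)"
    "X \<in> compact_supported U C Y \<Longrightarrow> zero_object C (f \<boxtimes> X)"
    "X \<in> Obj C \<Longrightarrow> zero_object C (f \<boxtimes> X) \<Longrightarrow> isomorphic C (e \<boxtimes> X) X"
    "X \<in> Obj C \<Longrightarrow> zero_object C (e \<boxtimes> X) \<Longrightarrow> isomorphic C (f \<boxtimes> X) X"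
    "X \<in> Obj C \<Longrightarrow> zero_object C (f \<boxtimes> X) \<longleftrightarrow> X \<in> Loc U C (compact_supported U C Y)"
proof -
  obtain a b c where T: "a \<in> Hom C e (Uni C)" "b \<in> Hom C (Uni C) f" "(a, b, c) \<in> Tri C"
    using assms unfolding is_idempotent_triangle_def by blast
  note aty = HomD[OF T(1)] and bty = HomD[OF T(2)]
  show eO: "e \<in> Obj C" and "f \<in> Obj C" using Hom_Obj T(1,2) by blast+
  have 1: "{X \<in> Obj C. zero_object C (f \<boxtimes> X)} = Loc U C (compact_supported U C Y)"
    and 2: "Loc U C (compact_supported U C Y) = {X \<in> Obj C. \<exists>Z \<in> Obj C. isomorphic C X (e \<boxtimes> Z)}"
    using assms unfolding is_idempotent_triangle_def by auto
  show "e \<in> Loc U C (compact_supported U C Y)"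
    unfolding 2 using eO isomorphic_sym[OF isomorphic_Run[OF eO]] Uni_Obj by blast
  show "zero_object C (f \<boxtimes> X)" if "X \<in> compact_supported U C Y"
    using 1 Loc_subset[of "compact_supported U C Y" U C] that by blast
  show "zero_object C (f \<boxtimes> X) \<longleftrightarrow> X \<in> Loc U C (compact_supported U C Y)" if "X \<in> Obj C"
    using 1 that by blast
  show "isomorphic C (e \<boxtimes> X) X" if X: "X \<in> Obj C" "zero_object C (f \<boxtimes> X)"
    using Tri_TenO(1)[OF T(3) X(1)] X(2) aty bty isomorphic_trans[OF _ isomorphic_Lun[OF X(1)]] by simp
  show "isomorphic C (f \<boxtimes> X) X" if X: "X \<in> Obj C" "zero_object C (e \<boxtimes> X)"
    using isomorphic_sym[OF Tri_TenO(2)[OF T(3) X(1)]] X(2) aty bty isomorphic_trans[OF _ isomorphic_Lun[OF X(1)]] by simp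
qed

lemma Loc_tensor_ideal:
  assumes "S \<subseteq> Obj C"
  shows "localizing_ideal U C (Loc_tensor U C S)"
proof -
  have O: "localizing_ideal U C (Obj C)" by (rule localizing_idealI[OF Obj_localizing]) auto
  show ?thesis
  proof (rule localizing_idealI)
    show "localizing_subcategory U C (Loc_tensor U C S)"
      unfolding Loc_tensor_def by (rule Inter_localizing) (use O assms localizing_idealD(1) in auto)
    show "X \<boxtimes> Y \<in> Loc_tensor U C S" if "X \<in> Obj C" "Y \<in> Loc_tensor U C S" for X Y
      using that localizing_idealD(3) unfolding Loc_tensor_def by auto
  qed
qed

lemma Loc_tensor_mem: "X \<in> S \<Longrightarrow> X \<in> Loc_tensor U C S"
  unfolding Loc_tensor_def by blast

lemma Loc_tensor_least: "localizing_ideal U C L \<Longrightarrow> S \<subseteq> L \<Longrightarrow> Loc_tensor U C S \<subseteq> L"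
  unfolding Loc_tensor_def by blast

section \<open>Supports and the topology of the spectrum\<close>

lemma supp_TenO:
  assumes "x \<in> compact_objects U C" "y \<in> compact_objects U C"
  shows "supp U C (x \<boxtimes> y) = supp U C x \<inter> supp U C y"
proof -
  have "x \<boxtimes> y \<in> P \<longleftrightarrow> x \<in> P \<or> y \<in> P" if "P \<in> Spc U C" for P
    using that thick_tensor_idealD(3,4)[of P] assms unfolding Spc_def by blast
  then show ?thesis unfolding supp_def by blast
qed

lemma supp_binary_coproduct:
  assumes "x \<in> compact_objects U C" "y \<in> compact_objects U C" "is_binary_coproduct C x y s"
  shows "supp U C s = supp U C x \<union> supp U C y" "s \<in> compact_objects U C"
proof -
  obtain i j p q where b: "i \<in> Hom C x s" "j \<in> Hom C y s" "p \<in> Hom C s x" "q \<in> Hom C s y"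
    "p \<cdot> i = Ide C x" "q \<cdot> j = Ide C y"
    using binary_coproductE[OF assms(3) compact_Obj[OF assms(1)] compact_Obj[OF assms(2)]] by metis
  have r: "retract C x s" "retract C y s" using b unfolding retract_def by blast+
  have "s \<in> P \<longleftrightarrow> x \<in> P \<and> y \<in> P" if "P \<in> Spc U C" for P
  proof -
    have P: "thick_tensor_ideal U C P" using that by (simp add: Spc_def)
    show ?thesis using thick_tensor_idealD(5)[OF P r(1)] thick_tensor_idealD(5)[OF P r(2)]
        triangulated_binary_coproduct[OF thick_tensor_idealD(2)[OF P] _ _ assms(3)] by blast
  qed
  then show "supp U C s = supp U C x \<union> supp U C y" unfolding supp_def by blast
  show "s \<in> compact_objects U C" by (rule triangulated_binary_coproduct[OF compact_triangulated assms])
qed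

lemma compact_supported_thick: "thick_tensor_ideal U C (compact_supported U C Y)"
proof -
  \<comment> \<open>An intersection of primes; the set of all compact objects is inserted so that
    the family is nonempty even if \<open>Y\<close> contains every prime.\<close>
  define F where "F = insert (compact_objects U C) (Spc U C - Y)"
  have F: "thick_tensor_ideal U C P" if "P \<in> F" for P
  proof (cases "P = compact_objects U C")
    case True
    then show ?thesis
      by (auto intro!: thick_tensor_idealI compact_triangulated compact_TenO intro: compact_retract)
  next
    case False
    then show ?thesis using that by (auto simp: F_def Spc_def)
  qed
  have eq: "compact_supported U C Y = \<Inter>F"
    unfolding compact_supported_def supp_def F_def by blast
  show ?thesis unfolding eq
  proof (rule thick_tensor_idealI)
    show "triangulated_subcategory C (\<Inter>F)"
      by (rule Inter_triangulated[OF thick_tensor_idealD(2)[OF F]]) (auto simp: F_def)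
    show "\<Inter>F \<subseteq> compact_objects U C" by (auto simp: F_def)
    show "X \<boxtimes> Y \<in> \<Inter>F" if "X \<in> compact_objects U C" "Y \<in> \<Inter>F" for X Y
      using that thick_tensor_idealD(3)[OF F] by blast
    show "X \<in> \<Inter>F" if "retract C X S" "S \<in> \<Inter>F" for X S
      using that thick_tensor_idealD(5)[OF F] by blast
  qed
qed

text \<open>A zero object has empty support, so the whole spectrum is itself one of the generating
  open sets.\<close>

lemma topspace_Spc: "topspace (Spc_topology U C) = Spc U C"
proof -
  obtain Z where Z: "zero_object C Z" "Z \<in> Obj C" by (rule ex_zero)
  have Zc: "Z \<in> compact_objects U C" by (rule triangulated_subcategoryD(2)[OF compact_triangulated Z(1)])
  have "supp U C Z = {}" unfolding supp_def Spc_def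
    using triangulated_subcategoryD(2)[OF thick_tensor_idealD(2) Z(1)] by blast
  then have "Spc U C \<in> {Spc U C - supp U C X | X. X \<in> compact_objects U C}" using Zc by blast
  then show ?thesis unfolding Spc_topology_def topology_generated_by_topspace by blast
qed

lemma open_Spc: "X \<in> compact_objects U C \<Longrightarrow> openin (Spc_topology U C) (Spc U C - supp U C X)"
  unfolding Spc_topology_def by (rule topology_generated_by_Basis) blast

lemma closed_supp: "X \<in> compact_objects U C \<Longrightarrow> closedin (Spc_topology U C) (supp U C X)"
  unfolding closedin_def topspace_Spc using open_Spc by (auto simp: supp_def)

text \<open>The support of a binary coproduct is the union of the supports, so the generating open
  sets are closed under binary intersection and form a basis.\<close>

lemma Spc_basis:
  assumes "openin (Spc_topology U C) W" "P \<in> W"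
  shows "\<exists>X \<in> compact_objects U C. P \<in> Spc U C - supp U C X \<and> Spc U C - supp U C X \<subseteq> W"
proof -
  have "generate_topology_on {Spc U C - supp U C X | X. X \<in> compact_objects U C} W"
    using assms(1) unfolding Spc_topology_def by (simp add: openin_topology_generated_by_iff)
  then show ?thesis using assms(2)
  proof (induction W)
    case (Int a b)
    obtain X where X: "X \<in> compact_objects U C" "P \<in> Spc U C - supp U C X" "Spc U C - supp U C X \<subseteq> a"
      using Int by blast
    obtain Y where Y: "Y \<in> compact_objects U C" "P \<in> Spc U C - supp U C Y" "Spc U C - supp U C Y \<subseteq> b"
      using Int by blast
    obtain S where S: "is_binary_coproduct C X Y S" using ex_binary_coproduct compact_Obj X(1) Y(1) by blast
    show ?case using supp_binary_coproduct[OF X(1) Y(1) S] X Y by (intro bexI[of _ S]) auto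
  next
    case (UN k)
    then show ?case by blast
  qed auto
qed

text \<open>Finitely many basic open sets cover the complement. The tensor product of the
  corresponding objects has as its support the intersection of their supports, which is
  \<open>Z\<close>.\<close>

lemma closed_qc_supp:
  assumes Z: "closedin (Spc_topology U C) Z" and qc: "compactin (Spc_topology U C) (topspace (Spc_topology U C) - Z)"
  obtains w where "w \<in> compact_objects U C" "supp U C w = Z"
proof -
  let ?B = "{Spc U C - supp U C X | X. X \<in> compact_objects U C \<and> Z \<subseteq> supp U C X}"
  have ZS: "Z \<subseteq> Spc U C" using closedin_subset[OF Z] topspace_Spc by simp
  have op: "openin (Spc_topology U C) (Spc U C - Z)" using Z unfolding closedin_def topspace_Spc by simp
  have cov: "Spc U C - Z \<subseteq> \<Union>?B"
  proof
    fix P assume P: "P \<in> Spc U C - Z"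
    obtain X where "X \<in> compact_objects U C" "P \<in> Spc U C - supp U C X" "Spc U C - supp U C X \<subseteq> Spc U C - Z"
      using Spc_basis[OF op P] by blast
    then show "P \<in> \<Union>?B" using ZS by blast
  qed
  have "\<exists>F. finite F \<and> F \<subseteq> ?B \<and> Spc U C - Z \<subseteq> \<Union>F"
  proof -
    have "Ball ?B (openin (Spc_topology U C)) \<and> Spc U C - Z \<subseteq> \<Union>?B" using open_Spc cov by blast
    from qc[unfolded compactin_def topspace_Spc, THEN conjunct2, THEN spec, THEN mp, OF this]
    show ?thesis .
  qed
  then obtain F where F: "finite F" "F \<subseteq> ?B" "Spc U C - Z \<subseteq> \<Union>F" by blast
  have "\<exists>w \<in> compact_objects U C. Z \<subseteq> supp U C w \<and> supp U C w \<inter> \<Union>F = {}" using F(1,2)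
  proof (induction F rule: finite_induct)
    case empty
    have "supp U C (Uni C) = Spc U C"
    proof -
      have "Uni C \<notin> P" if P: "P \<in> Spc U C" for P
      proof
        assume u: "Uni C \<in> P"
        have Pt: "thick_tensor_ideal U C P" "P \<noteq> compact_objects U C" using P by (auto simp: Spc_def)
        have "c \<in> P" if c: "c \<in> compact_objects U C" for c
          by (rule triangulated_iso[OF thick_tensor_idealD(2)[OF Pt(1)] thick_tensor_idealD(3)[OF Pt(1) c u]
                isomorphic_Run[OF compact_Obj[OF c]]])
        then show False using Pt thick_tensor_idealD(1)[OF Pt(1)] by blast
      qed
      then show ?thesis unfolding supp_def by blast
    qed
    then show ?case using Uni_compact ZS by blast
  next
    case (insert V F)
    obtain w where w: "w \<in> compact_objects U C" "Z \<subseteq> supp U C w" "supp U C w \<inter> \<Union>F = {}" using insert by blast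
    obtain X where X: "V = Spc U C - supp U C X" "X \<in> compact_objects U C" "Z \<subseteq> supp U C X" using insert by blast
    show ?case using supp_TenO[OF w(1) X(2)] compact_TenO[OF w(1) X(2)] w X by (intro bexI[of _ "w \<boxtimes> X"]) auto
  qed
  then obtain w where w: "w \<in> compact_objects U C" "Z \<subseteq> supp U C w" "supp U C w \<inter> \<Union>F = {}" by blast
  have "supp U C w \<subseteq> Z"
  proof
    fix P assume P: "P \<in> supp U C w"
    then have "P \<in> Spc U C" by (simp add: supp_def)
    then show "P \<in> Z" using w(3) F(3) P by blast
  qed
  then show ?thesis using that w by blast
qed

lemma Spc_thick: "P \<in> Spc U C \<Longrightarrow> thick_tensor_ideal U C P"
  and Spc_proper: "P \<in> Spc U C \<Longrightarrow> P \<noteq> compact_objects U C"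
  and Spc_prime: "P \<in> Spc U C \<Longrightarrow> X \<in> compact_objects U C \<Longrightarrow> Y \<in> compact_objects U C
    \<Longrightarrow> X \<boxtimes> Y \<in> P \<Longrightarrow> X \<in> P \<or> Y \<in> P"
  unfolding Spc_def by auto

text \<open>
  The point \<open>Q\<close> is cut out by its closure, which is the support of a single compact object \<open>x\<close>, and
  by the set of primes that do not contain \<open>Q\<close>; the compact objects supported on the latter form
  the ideal \<open>Q\<close> itself.
\<close>

lemma gamma_at_point:
  assumes N: "noetherian_space (Spc_topology U C)" and Q: "Q \<in> Spc U C"
  obtains x e1 f1 e2 f2 Y1 Y2 where "x \<in> compact_objects U C" "x \<notin> Q" "supp U C x = Y1"
    "\<And>P. P \<in> Spc U C \<Longrightarrow> x \<notin> P \<longleftrightarrow> P \<subseteq> Q" "is_idempotent_triangle U C Y1 e1 f1"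
    "is_idempotent_triangle U C Y2 e2 f2" "compact_supported U C Y2 = Q" "is_gamma U C Q (e1 \<boxtimes> f2)"
proof -
  let ?K = "compact_objects U C"
  note QT = thick_tensor_idealD[OF Spc_thick[OF Q]]
  have ne: "?K - Q \<noteq> {}" using Spc_proper[OF Q] QT(1) by blast
  \<comment> \<open>A compact object outside \<open>Q\<close> of minimal support. The product of two
    objects outside the prime \<open>Q\<close> is again outside, so the minimal support is in fact
    the least one.\<close>
  obtain x where x: "x \<in> ?K - Q" "\<And>y. y \<in> ?K - Q \<Longrightarrow> supp U C y \<subseteq> supp U C x \<Longrightarrow> supp U C y = supp U C x"
    by (rule noetherian_minimal[OF N closed_supp ne]) blast+
  have min: "supp U C x \<subseteq> supp U C y" if y: "y \<in> ?K - Q" for y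
  proof -
    have xy: "x \<boxtimes> y \<in> ?K - Q" using Spc_prime[OF Q, of x y] compact_TenO x y by blast
    have "supp U C (x \<boxtimes> y) = supp U C x \<inter> supp U C y" by (rule supp_TenO) (use x y in auto)
    then show ?thesis using x(2)[OF xy] by blast
  qed
  have xP: "x \<notin> P \<longleftrightarrow> P \<subseteq> Q" if P: "P \<in> Spc U C" for P
  proof
    assume "x \<notin> P"
    then have "P \<in> supp U C y" if "y \<in> ?K - Q" for y using min[OF that] P unfolding supp_def by blast
    then show "P \<subseteq> Q" using thick_tensor_idealD(1)[OF Spc_thick[OF P]] unfolding supp_def by blast
  qed (use x in blast)
  define Y2 where "Y2 = {P \<in> Spc U C. \<not> Q \<subseteq> P}"
  have Y2: "Y2 = \<Union>(supp U C ` Q)" unfolding Y2_def supp_def by blast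
  have Th: "closedin (Spc_topology U C) (supp U C y) \<and>
    compactin (Spc_topology U C) (topspace (Spc_topology U C) - supp U C y)" if "y \<in> ?K" for y
    using closed_supp[OF that] noetherian_compactin[OF N] by blast
  have T1: "Thomason (Spc_topology U C) (supp U C x)"
    unfolding Thomason_def using Th x by (intro exI[of _ "{supp U C x}"]) auto
  have T2: "Thomason (Spc_topology U C) Y2"
    unfolding Thomason_def Y2 using Th QT(1) by (intro exI[of _ "supp U C ` Q"]) auto
  have pt: "{Q} = supp U C x \<inter> (Spc U C - Y2)"
  proof
    show "{Q} \<subseteq> supp U C x \<inter> (Spc U C - Y2)" using Q x unfolding Y2_def supp_def by blast
    show "supp U C x \<inter> (Spc U C - Y2) \<subseteq> {Q}"
    proof
      fix P assume "P \<in> supp U C x \<inter> (Spc U C - Y2)"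
      then have "P \<in> Spc U C" "x \<notin> P" "Q \<subseteq> P" unfolding Y2_def supp_def by auto
      then show "P \<in> {Q}" using xP by blast
    qed
  qed
  have K2: "compact_supported U C Y2 = Q"
  proof
    show "compact_supported U C Y2 \<subseteq> Q" using Q unfolding compact_supported_def supp_def Y2_def by blast
    show "Q \<subseteq> compact_supported U C Y2" using QT(1) unfolding compact_supported_def supp_def Y2_def by blast
  qed
  obtain e1 f1 where i1: "is_idempotent_triangle U C (supp U C x) e1 f1"
    by (rule ex_idempotent_triangle[OF compact_supported_thick])
  obtain e2 f2 where i2: "is_idempotent_triangle U C Y2 e2 f2"
    by (rule ex_idempotent_triangle[OF compact_supported_thick])
  have "is_gamma U C Q (e1 \<boxtimes> f2)" unfolding is_gamma_def using T1 T2 pt i1 i2 by blast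
  then show ?thesis using that[of x "supp U C x" e1 f1 Y2 e2 f2] x xP i1 i2 K2 by auto
qed

end

section \<open>Modules over a commutative algebra\<close>

locale algebra_modules = tensor_triangulated_category C + commutative_algebra C A
  for C :: "('o, 'm, 'z) ttcat_scheme" (structure) and A :: "('o, 'm) alg"
begin

abbreviation "Ao \<equiv> Und A"
abbreviation "M \<equiv> Modules C A"

lemma alg_typ[simp]:
  "Ao \<in> Obj C" "Mul A \<in> Arr C" "Dom C (Mul A) = Ao \<boxtimes> Ao" "Cod C (Mul A) = Ao"
  "Unt A \<in> Arr C" "Dom C (Unt A) = Uni C" "Cod C (Unt A) = Ao"
  using Und_Obj Mul_Hom Unt_Hom by (auto simp: Hom_iff)

lemma Modules_simps[simp]:
  "Obj M = modules C A" "Dom M f = fst f" "Cod M f = snd (snd f)" "Ide M N = (N, Ide C (fst N), N)"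
  "Comp M g f = (fst f, und g \<cdot> und f, snd (snd g))" "Uni M = (Ao, Mul A)" "TenO M = ModTen C A"
  "Add M f g = (fst f, Add C (und f) (und g), snd (snd f))" "ShO M = ModSh C A"
  by (simp_all add: Modules_def)

lemma und_simp[simp]: "und (N, f, L) = f"
  by (simp add: und_def)

lemma modulesD:
  assumes "(X, a) \<in> modules C A"
  shows "X \<in> Obj C" "a \<in> Arr C" "Dom C a = Ao \<boxtimes> X" "Cod C a = X"
    "a \<cdot> (Mul A \<star> Ide C X) = a \<cdot> (Ide C Ao \<star> a) \<cdot> Asc C Ao Ao X"
    "a \<cdot> (Unt A \<star> Ide C X) = Lun C X"
  using assms by (auto simp: modules_def Hom_iff)

lemma modulesI:
  assumes "X \<in> Obj C" "a \<in> Arr C" "Dom C a = Ao \<boxtimes> X" "Cod C a = X"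
    "a \<cdot> (Mul A \<star> Ide C X) = a \<cdot> (Ide C Ao \<star> a) \<cdot> Asc C Ao Ao X"
    "a \<cdot> (Unt A \<star> Ide C X) = Lun C X"
  shows "(X, a) \<in> modules C A"
  using assms by (auto simp: modules_def Hom_iff)

lemma module_HomD:
  assumes "f \<in> module_Hom C A N L"
  shows "fst f = N" "snd (snd f) = L" "und f \<in> Arr C" "Dom C (und f) = fst N" "Cod C (und f) = fst L"
    "und f \<cdot> snd N = snd L \<cdot> (Ide C Ao \<star> und f)" "f = (N, und f, L)"
  using assms by (auto simp: module_Hom_def Hom_iff)

lemma module_HomI:
  assumes "f \<in> Hom C (fst N) (fst L)" "f \<cdot> snd N = snd L \<cdot> (Ide C Ao \<star> f)"
  shows "(N, f, L) \<in> module_Hom C A N L"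
  using assms by (auto simp: module_Hom_def)

lemma Modules_Hom_iff:
  "f \<in> Hom M N L \<longleftrightarrow> N \<in> modules C A \<and> L \<in> modules C A \<and> f \<in> module_Hom C A N L"
proof -
  have "Arr M = (\<Union>N \<in> modules C A. \<Union>L \<in> modules C A. module_Hom C A N L)" by (simp add: Modules_def)
  moreover have "fst f = N'" "snd (snd f) = L'" if "f \<in> module_Hom C A N' L'" for N' L'
    using module_HomD(1,2)[OF that] .
  ultimately show ?thesis unfolding Hom_iff Modules_simps by blast
qed

lemma Modules_category: "category M"
proof
  fix f assume "f \<in> Arr M"
  then have "f \<in> Hom M (Dom M f) (Cod M f)" by (simp add: Hom_iff del: Modules_simps)
  then show "Dom M f \<in> Obj M" "Cod M f \<in> Obj M" by (simp_all add: Modules_Hom_iff del: Modules_simps(2,3))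
next
  fix X assume "X \<in> Obj M"
  then have X: "X \<in> modules C A" "(fst X, snd X) \<in> modules C A" by simp_all
  note ty = modulesD(1-4)[OF X(2)]
  have "(X, Ide C (fst X), X) \<in> module_Hom C A X X" by (rule module_HomI) (use ty in \<open>auto simp: Hom_iff\<close>)
  then show "Ide M X \<in> Hom M X X" unfolding Modules_Hom_iff using X(1) by simp
next
  fix f X Y g Z assume f: "f \<in> Hom M X Y" and g: "g \<in> Hom M Y Z"
  have mf: "f \<in> module_Hom C A X Y" and mg: "g \<in> module_Hom C A Y Z" and
    ob: "X \<in> modules C A" "Y \<in> modules C A" "Z \<in> modules C A" using f g by (auto simp: Modules_Hom_iff)
  note F = module_HomD[OF mf] and G = module_HomD[OF mg]
  have obs: "(fst X, snd X) \<in> modules C A" "(fst Y, snd Y) \<in> modules C A" "(fst Z, snd Z) \<in> modules C A"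
    using ob by auto
  note t = modulesD(1-4)[OF obs(1)] modulesD(1-4)[OF obs(2)] modulesD(1-4)[OF obs(3)]
  have "(und g \<cdot> und f) \<cdot> snd X = und g \<cdot> (snd Y \<cdot> (Ide C Ao \<star> und f))" using F(3-5) G(3-5) t F(6) by simp
  also have "\<dots> = (snd Z \<cdot> (Ide C Ao \<star> und g)) \<cdot> (Ide C Ao \<star> und f)"
    by (rule comp_red[OF G(6)]) (use F(3-5) G(3-5) t in auto)
  also have "\<dots> = snd Z \<cdot> (Ide C Ao \<star> (und g \<cdot> und f))" using F(3-5) G(3-5) t by simp
  finally have "(X, und g \<cdot> und f, Z) \<in> module_Hom C A X Z"
    by (intro module_HomI) (use F(1-5) G(1-5) in \<open>auto simp: Hom_iff\<close>)
  then show "g \<cdot>\<^bsub>M\<^esub> f \<in> Hom M X Z" unfolding Modules_Hom_iff using F(1) G(2) ob by simp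
next
  fix f X Y assume "f \<in> Hom M X Y"
  then have f: "f \<in> module_Hom C A X Y" by (simp add: Modules_Hom_iff)
  note F = module_HomD[OF f]
  have "fst X \<in> Obj C" "fst Y \<in> Obj C" using F(3-5) Dom_Obj'[of "und f"] Cod_Obj'[of "und f"] by auto
  then show "f \<cdot>\<^bsub>M\<^esub> Ide M X = f" "Ide M Y \<cdot>\<^bsub>M\<^esub> f = f" using F(1-5) by (auto simp: und_def)
next
  fix f W X g Y h Z assume "f \<in> Hom M W X" "g \<in> Hom M X Y" "h \<in> Hom M Y Z"
  then have "f \<in> module_Hom C A W X" "g \<in> module_Hom C A X Y" "h \<in> module_Hom C A Y Z" by (auto simp: Modules_Hom_iff)
  from this[THEN module_HomD(3)] this[THEN module_HomD(4)] this[THEN module_HomD(5)]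
  show "h \<cdot>\<^bsub>M\<^esub> g \<cdot>\<^bsub>M\<^esub> f = (h \<cdot>\<^bsub>M\<^esub> g) \<cdot>\<^bsub>M\<^esub> f" by simp
qed

sublocale Mod: category M by (rule Modules_category)

lemma forget_functor: "is_functor M C fst und"
  unfolding is_functor_def
proof (intro conjI ballI allI)
  fix X assume "X \<in> Obj M"
  then have "(fst X, snd X) \<in> modules C A" by simp
  then show "fst X \<in> Obj C" by (rule modulesD)
next
  fix X Y f assume "f \<in> Hom M X Y"
  then have "f \<in> module_Hom C A X Y" unfolding Modules_Hom_iff by blast
  from module_HomD(3-5)[OF this] show "und f \<in> Hom C (fst X) (fst Y)" by (simp add: Hom_iff)
qed auto

lemma forget_isomorphic: "isomorphic M X Y \<Longrightarrow> isomorphic C (fst X) (fst Y)"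
  by (rule functor_isomorphic[OF forget_functor _ Modules_category])

text \<open>Tensoring with \<open>Ao\<close> preserves coproducts, so the coproduct of the
  underlying objects inherits an action and is a coproduct of modules. By uniqueness every coproduct
  of modules has this underlying coproduct.\<close>

lemma modules_coproduct:
  assumes S: "is_coproduct M I X S inc" and X: "\<And>i. i \<in> I \<Longrightarrow> X i \<in> modules C A"
    and S0: "is_coproduct C I (fst \<circ> X) S0 inc0"
  shows "is_coproduct C I (fst \<circ> X) (fst S) (und \<circ> inc)"
proof -
  have O: "S0 \<in> Obj C" using coproduct_Obj[OF S0] .
  have m: "(fst (X i), snd (X i)) \<in> modules C A" if "i \<in> I" for i using X[OF that] by simp
  note md = modulesD[OF m]
  have inc: "inc0 i \<in> Arr C" "Dom C (inc0 i) = fst (X i)" "Cod C (inc0 i) = S0" if "i \<in> I" for i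
    using HomD[OF coproduct_inc[OF S0 that]] by auto
  have AS: "is_coproduct C I (\<lambda>i. W \<boxtimes> (fst \<circ> X) i) (W \<boxtimes> S0) (\<lambda>i. Ide C W \<star> inc0 i)" if "W \<in> Obj C" for W
    by (rule TenO_coproduct_left[OF S0 that])
  obtain s where s: "s \<in> Hom C (Ao \<boxtimes> S0) S0" "\<And>i. i \<in> I \<Longrightarrow> s \<cdot> (Ide C Ao \<star> inc0 i) = inc0 i \<cdot> snd (X i)"
    by (rule coproduct_map[OF AS[OF alg_typ(1)] O, of "\<lambda>i. inc0 i \<cdot> snd (X i)"])
      (use inc md(1-4) in \<open>auto simp: Hom_iff\<close>)
  note sty = HomD[OF s(1)]
  have Sm: "(S0, s) \<in> modules C A"
  proof (rule modulesI[OF O sty])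
    have AAO: "Ao \<boxtimes> Ao \<in> Obj C" by simp
    show "s \<cdot> (Mul A \<star> Ide C S0) = s \<cdot> (Ide C Ao \<star> s) \<cdot> Asc C Ao Ao S0"
    proof (rule coproduct_ext[OF AS[OF AAO]])
      show "s \<cdot> (Mul A \<star> Ide C S0) \<in> Hom C ((Ao \<boxtimes> Ao) \<boxtimes> S0) S0"
        "s \<cdot> (Ide C Ao \<star> s) \<cdot> Asc C Ao Ao S0 \<in> Hom C ((Ao \<boxtimes> Ao) \<boxtimes> S0) S0" using sty by (auto simp: Hom_iff)
      fix i assume i: "i \<in> I"
      let ?a = "snd (X i)" and ?x = "fst (X i)" and ?i = "inc0 i"
      note ty = inc[OF i] md(1-4)[OF i] sty O
      have "(s \<cdot> (Mul A \<star> Ide C S0)) \<cdot> (Ide C (Ao \<boxtimes> Ao) \<star> ?i) = (s \<cdot> (Ide C Ao \<star> ?i)) \<cdot> (Mul A \<star> Ide C ?x)"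
        using ty by simp
      also have "\<dots> = ?i \<cdot> (?a \<cdot> (Mul A \<star> Ide C ?x))" unfolding s(2)[OF i] using ty by simp
      also have "\<dots> = (?i \<cdot> ?a) \<cdot> (Ide C Ao \<star> ?a) \<cdot> Asc C Ao Ao ?x" unfolding md(5)[OF i] using ty by simp
      also have "\<dots> = (s \<cdot> (Ide C Ao \<star> ?i)) \<cdot> (Ide C Ao \<star> ?a) \<cdot> Asc C Ao Ao ?x" by (simp only: s(2)[OF i])
      also have "\<dots> = s \<cdot> (Ide C Ao \<star> (?i \<cdot> ?a)) \<cdot> Asc C Ao Ao ?x" using ty by simp
      also have "\<dots> = s \<cdot> (Ide C Ao \<star> (s \<cdot> (Ide C Ao \<star> ?i))) \<cdot> Asc C Ao Ao ?x" by (simp only: s(2)[OF i])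
      also have "\<dots> = s \<cdot> (Ide C Ao \<star> s) \<cdot> ((Ide C Ao \<star> (Ide C Ao \<star> ?i)) \<cdot> Asc C Ao Ao ?x)" using ty by simp
      also have "\<dots> = s \<cdot> (Ide C Ao \<star> s) \<cdot> (Asc C Ao Ao S0 \<cdot> ((Ide C Ao \<star> Ide C Ao) \<star> ?i))"
        using Asc_nat[of "Ide C Ao" "Ide C Ao" ?i] ty by (simp del: TenA_Ide' TenA_fuse TenA_fuse')
      also have "\<dots> = (s \<cdot> (Ide C Ao \<star> s) \<cdot> Asc C Ao Ao S0) \<cdot> (Ide C (Ao \<boxtimes> Ao) \<star> ?i)" using ty by simp
      finally show "(s \<cdot> (Mul A \<star> Ide C S0)) \<cdot> (Ide C (Ao \<boxtimes> Ao) \<star> ?i)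
        = (s \<cdot> (Ide C Ao \<star> s) \<cdot> Asc C Ao Ao S0) \<cdot> (Ide C (Ao \<boxtimes> Ao) \<star> ?i)" .
    qed
    show "s \<cdot> (Unt A \<star> Ide C S0) = Lun C S0"
    proof (rule coproduct_ext[OF AS[OF Uni_Obj]])
      show "s \<cdot> (Unt A \<star> Ide C S0) \<in> Hom C (Uni C \<boxtimes> S0) S0" "Lun C S0 \<in> Hom C (Uni C \<boxtimes> S0) S0"
        using sty by (auto simp: Hom_iff)
      fix i assume i: "i \<in> I"
      let ?a = "snd (X i)" and ?x = "fst (X i)" and ?i = "inc0 i"
      note ty = inc[OF i] md(1-4)[OF i] sty O
      have "(s \<cdot> (Unt A \<star> Ide C S0)) \<cdot> (Ide C (Uni C) \<star> ?i) = (s \<cdot> (Ide C Ao \<star> ?i)) \<cdot> (Unt A \<star> Ide C ?x)"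
        using ty by simp
      also have "\<dots> = ?i \<cdot> (?a \<cdot> (Unt A \<star> Ide C ?x))" unfolding s(2)[OF i] using ty by simp
      also have "\<dots> = ?i \<cdot> Lun C ?x" by (simp only: md(6)[OF i])
      also have "\<dots> = Lun C S0 \<cdot> (Ide C (Uni C) \<star> ?i)" using Lun_nat[of ?i] ty by simp
      finally show "(s \<cdot> (Unt A \<star> Ide C S0)) \<cdot> (Ide C (Uni C) \<star> ?i) = Lun C S0 \<cdot> (Ide C (Uni C) \<star> ?i)" .
    qed
  qed
  have cop: "is_coproduct M I X (S0, s) (\<lambda>i. (X i, inc0 i, (S0, s)))"
  proof (rule Mod.coproductI)
    show "(S0, s) \<in> Obj M" using Sm by simp
    show "(X i, inc0 i, (S0, s)) \<in> Hom M (X i) (S0, s)" if "i \<in> I" for i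
      unfolding Modules_Hom_iff using that X Sm inc s(2) by (auto simp: Hom_iff intro!: module_HomI)
    show "\<exists>h. h \<in> Hom M (S0, s) Y \<and> (\<forall>i\<in>I. h \<cdot>\<^bsub>M\<^esub> (X i, inc0 i, (S0, s)) = f i)"
      if Y: "Y \<in> Obj M" and f: "\<And>i. i \<in> I \<Longrightarrow> f i \<in> Hom M (X i) Y" for Y f
    proof -
      have Ym: "(fst Y, snd Y) \<in> modules C A" using Y by simp
      note yd = modulesD[OF Ym]
      have fm: "f i \<in> module_Hom C A (X i) Y" if "i \<in> I" for i using f[OF that] by (simp add: Modules_Hom_iff)
      note fd = module_HomD[OF fm]
      obtain h where h: "h \<in> Hom C S0 (fst Y)" "\<And>i. i \<in> I \<Longrightarrow> h \<cdot> inc0 i = und (f i)"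
        by (rule coproduct_map[OF S0 yd(1), of "\<lambda>i. und (f i)"]) (use fd in \<open>auto simp: Hom_iff\<close>)
      note hty = HomD[OF h(1)]
      have "h \<cdot> s = snd Y \<cdot> (Ide C Ao \<star> h)"
      proof (rule coproduct_ext[OF AS[OF alg_typ(1)]])
        show "h \<cdot> s \<in> Hom C (Ao \<boxtimes> S0) (fst Y)" "snd Y \<cdot> (Ide C Ao \<star> h) \<in> Hom C (Ao \<boxtimes> S0) (fst Y)"
          using hty sty yd by (auto simp: Hom_iff)
        fix i assume i: "i \<in> I"
        note ty = inc[OF i] md(1-4)[OF i] sty O hty yd(1-4)
        have "(h \<cdot> s) \<cdot> (Ide C Ao \<star> inc0 i) = h \<cdot> (s \<cdot> (Ide C Ao \<star> inc0 i))" using ty by simp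
        also have "\<dots> = (h \<cdot> inc0 i) \<cdot> snd (X i)" unfolding s(2)[OF i] using ty by simp
        also have "\<dots> = snd Y \<cdot> (Ide C Ao \<star> (h \<cdot> inc0 i))" unfolding h(2)[OF i] by (rule fd(6)[OF i])
        also have "\<dots> = (snd Y \<cdot> (Ide C Ao \<star> h)) \<cdot> (Ide C Ao \<star> inc0 i)" using ty by simp
        finally show "(h \<cdot> s) \<cdot> (Ide C Ao \<star> inc0 i) = (snd Y \<cdot> (Ide C Ao \<star> h)) \<cdot> (Ide C Ao \<star> inc0 i)" .
      qed
      then have "((S0, s), h, Y) \<in> Hom M (S0, s) Y"
        unfolding Modules_Hom_iff using Sm Y h(1) by (auto intro!: module_HomI)
      moreover have "((S0, s), h, Y) \<cdot>\<^bsub>M\<^esub> (X i, inc0 i, (S0, s)) = f i" if "i \<in> I" for i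
        using h(2)[OF that] fd(7)[OF that] by simp
      ultimately show ?thesis by blast
    qed
    show "h = k" if h: "h \<in> Hom M (S0, s) Y" and k: "k \<in> Hom M (S0, s) Y"
      and eq: "\<And>i. i \<in> I \<Longrightarrow> h \<cdot>\<^bsub>M\<^esub> (X i, inc0 i, (S0, s)) = k \<cdot>\<^bsub>M\<^esub> (X i, inc0 i, (S0, s))" for Y h k
    proof -
      have hm: "h \<in> module_Hom C A (S0, s) Y" and km: "k \<in> module_Hom C A (S0, s) Y" using h k by (auto simp: Modules_Hom_iff)
      note hd = module_HomD[OF hm] and kd = module_HomD[OF km]
      have "und h = und k"
        by (rule coproduct_ext[OF S0, of _ "fst Y"]) (use hd(3-5) kd(3-5) eq in \<open>auto simp: Hom_iff\<close>)
      then show ?thesis using hd(7) kd(7) by simp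
    qed
  qed
  obtain t where t: "t \<in> Iso M (S0, s) S" "\<And>i. i \<in> I \<Longrightarrow> t \<cdot>\<^bsub>M\<^esub> (X i, inc0 i, (S0, s)) = inc i"
    by (rule Mod.coproduct_unique[OF cop S]) blast
  have ut: "und t \<in> Iso C S0 (fst S)" using functor_Iso[OF forget_functor t(1) Modules_category] by simp
  show ?thesis
  proof (rule coproduct_cong[OF coproduct_iso_transport[OF S0 ut]])
    show "(und \<circ> inc) i = und t \<cdot> inc0 i" if "i \<in> I" for i by (auto simp flip: t(2)[OF that])
  qed simp
qed

section \<open>Free modules and the tensor product over the algebra\<close>

lemma tensor_module:
  assumes X: "(X, a) \<in> modules C A" and c: "c \<in> Obj C"
  shows "(X \<boxtimes> c, (a \<star> Ide C c) \<cdot> Inv C (Asc C Ao X c)) \<in> modules C A"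
proof (rule modulesI)
  note ty = modulesD(1-4)[OF X] c
  let ?c = "Ide C c" and ?A = "Ide C Ao" and ?x = "Ide C X"
  let ?t = "(a \<star> ?c) \<cdot> Inv C (Asc C Ao X c)"
  show "X \<boxtimes> c \<in> Obj C" "?t \<in> Arr C" "Dom C ?t = Ao \<boxtimes> X \<boxtimes> c" "Cod C ?t = X \<boxtimes> c" using ty by auto
  have "?t \<cdot> (?A \<star> ?t) \<cdot> Asc C Ao Ao (X \<boxtimes> c)
     = (a \<star> ?c) \<cdot> (Inv C (Asc C Ao X c) \<cdot> (?A \<star> (a \<star> ?c))) \<cdot> ((?A \<star> Inv C (Asc C Ao X c)) \<cdot> Asc C Ao Ao (X \<boxtimes> c))"
    using ty by simp
  also have "\<dots> = (a \<star> ?c) \<cdot> (((?A \<star> a) \<star> ?c) \<cdot> Inv C (Asc C Ao (Ao \<boxtimes> X) c))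
      \<cdot> (Asc C Ao (Ao \<boxtimes> X) c \<cdot> (Asc C Ao Ao X \<star> ?c) \<cdot> Inv C (Asc C (Ao \<boxtimes> Ao) X c))"
    using pentagon_inv(1)[of Ao Ao X c] Asc_Inv_nat[of ?A a ?c] ty by simp
  also have "\<dots> = ((a \<cdot> (?A \<star> a) \<cdot> Asc C Ao Ao X) \<star> ?c) \<cdot> Inv C (Asc C (Ao \<boxtimes> Ao) X c)" using ty by simp
  also have "\<dots> = ((a \<cdot> (Mul A \<star> ?x)) \<star> ?c) \<cdot> Inv C (Asc C (Ao \<boxtimes> Ao) X c)" by (simp only: modulesD(5)[OF X])
  also have "\<dots> = (a \<star> ?c) \<cdot> (((Mul A \<star> ?x) \<star> ?c) \<cdot> Inv C (Asc C (Ao \<boxtimes> Ao) X c))" using ty by simp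
  also have "\<dots> = (a \<star> ?c) \<cdot> (Inv C (Asc C Ao X c) \<cdot> (Mul A \<star> (?x \<star> ?c)))"
    using Asc_Inv_nat[of "Mul A" ?x ?c] ty by simp
  also have "\<dots> = ?t \<cdot> (Mul A \<star> Ide C (X \<boxtimes> c))" using ty by simp
  finally show "?t \<cdot> (Mul A \<star> Ide C (X \<boxtimes> c)) = ?t \<cdot> (?A \<star> ?t) \<cdot> Asc C Ao Ao (X \<boxtimes> c)" by simp
  have "?t \<cdot> (Unt A \<star> Ide C (X \<boxtimes> c)) = (a \<star> ?c) \<cdot> (((Unt A \<star> ?x) \<star> ?c) \<cdot> Inv C (Asc C (Uni C) X c))"
    using Asc_Inv_nat[of "Unt A" ?x ?c] ty by simp
  also have "\<dots> = ((a \<cdot> (Unt A \<star> ?x)) \<star> ?c) \<cdot> Inv C (Asc C (Uni C) X c)" using ty by simp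
  also have "\<dots> = (Lun C X \<star> ?c) \<cdot> Inv C (Asc C (Uni C) X c)" by (simp only: modulesD(6)[OF X])
  also have "\<dots> = (Lun C (X \<boxtimes> c) \<cdot> Asc C (Uni C) X c) \<cdot> Inv C (Asc C (Uni C) X c)" using Lun_Asc[of X c] ty by simp
  also have "\<dots> = Lun C (X \<boxtimes> c)" using ty by simp
  finally show "?t \<cdot> (Unt A \<star> Ide C (X \<boxtimes> c)) = Lun C (X \<boxtimes> c)" .
qed

lemma unit_module: "(Ao, Mul A) \<in> modules C A"
  by (rule modulesI) (use Mul_assoc Mul_Unt_left in auto)

lemma free_module_mem: "c \<in> Obj C \<Longrightarrow> free_module C A c \<in> modules C A"
  unfolding free_module_def by (rule tensor_module[OF unit_module])

lemma hexagon_inv: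
  assumes "X \<in> Obj C" "Y \<in> Obj C" "Z \<in> Obj C"
  shows "(Swp C X Y \<star> Ide C Z) \<cdot> Inv C (Asc C X Y Z) \<cdot> Swp C (Y \<boxtimes> Z) X
    = Inv C (Asc C Y X Z) \<cdot> (Ide C Y \<star> Swp C Z X) \<cdot> Asc C Y Z X"
proof -
  note H = hexagon[OF assms]
  let ?L = "(Swp C X Y \<star> Ide C Z) \<cdot> Inv C (Asc C X Y Z) \<cdot> Swp C (Y \<boxtimes> Z) X"
  have "?L = (Inv C (Asc C Y X Z) \<cdot> (Ide C Y \<star> Swp C Z X)) \<cdot> ((Ide C Y \<star> Swp C X Z) \<cdot> Asc C Y X Z \<cdot> (Swp C X Y \<star> Ide C Z))
      \<cdot> Inv C (Asc C X Y Z) \<cdot> Swp C (Y \<boxtimes> Z) X"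
    using assms by simp
  also have "\<dots> = (Inv C (Asc C Y X Z) \<cdot> (Ide C Y \<star> Swp C Z X)) \<cdot> (Asc C Y Z X \<cdot> Swp C X (Y \<boxtimes> Z) \<cdot> Asc C X Y Z)
      \<cdot> Inv C (Asc C X Y Z) \<cdot> Swp C (Y \<boxtimes> Z) X"
    by (simp only: H)
  also have "\<dots> = Inv C (Asc C Y X Z) \<cdot> (Ide C Y \<star> Swp C Z X) \<cdot> Asc C Y Z X" using assms by simp
  finally show ?thesis .
qed

text \<open>Commutativity of the algebra turns the left action \<open>a\<close> into a right action
  \<open>r\<close>, and the last equation says that the two commute. Both follow from associativity
  of \<open>a\<close> by the hexagon.\<close>

lemma right_action:
  assumes X: "(X, a) \<in> modules C A"
  defines "r \<equiv> a \<cdot> Swp C X Ao"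
  shows "r \<in> Arr C" "Dom C r = X \<boxtimes> Ao" "Cod C r = X"
    "r \<cdot> (r \<star> Ide C Ao) = r \<cdot> (Ide C X \<star> Mul A) \<cdot> Asc C X Ao Ao"
    "a \<cdot> (Ide C Ao \<star> r) \<cdot> Asc C Ao X Ao = r \<cdot> (a \<star> Ide C Ao)"
proof -
  note ty = modulesD(1-4)[OF X] and assoc = modulesD(5)[OF X]
  let ?A = "Ide C Ao" and ?x = "Ide C X" and ?S = "Swp C X Ao" and ?s = "Swp C Ao Ao"
  show rty: "r \<in> Arr C" "Dom C r = X \<boxtimes> Ao" "Cod C r = X" using ty by (auto simp: r_def)
  have nat: "Swp C (Cod C f) (Cod C g) \<cdot> (f \<star> g) = (g \<star> f) \<cdot> Swp C (Dom C f) (Dom C g)"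
    if "f \<in> Arr C" "g \<in> Arr C" for f g
    by (rule Swp_natural) (use that in \<open>auto simp: Hom_iff\<close>)
  \<comment> \<open>Commutativity enters here: the swap of two algebra factors may be inserted in
    front of the multiplication.\<close>
  have am: "a \<cdot> (Mul A \<star> ?x) = (a \<cdot> (Mul A \<star> ?x)) \<cdot> (?s \<star> ?x)" using ty Mul_commute by simp
  have aa: "a \<cdot> (?A \<star> a) = (a \<cdot> (Mul A \<star> ?x)) \<cdot> Inv C (Asc C Ao Ao X)" unfolding assoc using ty by simp
  have "r \<cdot> (a \<star> ?A) = a \<cdot> (?S \<cdot> (a \<star> ?A))" using ty by (simp add: r_def)
  also have "\<dots> = (a \<cdot> (?A \<star> a)) \<cdot> Swp C (Ao \<boxtimes> X) Ao" using nat[of a ?A] ty by simp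
  also have "\<dots> = (a \<cdot> (Mul A \<star> ?x)) \<cdot> Inv C (Asc C Ao Ao X) \<cdot> Swp C (Ao \<boxtimes> X) Ao" unfolding aa using ty by simp
  also have "\<dots> = ((a \<cdot> (Mul A \<star> ?x)) \<cdot> (?s \<star> ?x)) \<cdot> Inv C (Asc C Ao Ao X) \<cdot> Swp C (Ao \<boxtimes> X) Ao" by (simp only: am[symmetric])
  also have "\<dots> = (a \<cdot> (Mul A \<star> ?x)) \<cdot> ((?s \<star> ?x) \<cdot> Inv C (Asc C Ao Ao X) \<cdot> Swp C (Ao \<boxtimes> X) Ao)" using ty by simp
  also have "\<dots> = (a \<cdot> (Mul A \<star> ?x)) \<cdot> (Inv C (Asc C Ao Ao X) \<cdot> (?A \<star> ?S) \<cdot> Asc C Ao X Ao)"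
    using hexagon_inv[of Ao Ao X] ty by simp
  also have "\<dots> = ((a \<cdot> (Mul A \<star> ?x)) \<cdot> Inv C (Asc C Ao Ao X)) \<cdot> (?A \<star> ?S) \<cdot> Asc C Ao X Ao" using ty by simp
  also have "\<dots> = (a \<cdot> (?A \<star> a)) \<cdot> (?A \<star> ?S) \<cdot> Asc C Ao X Ao" by (simp only: aa)
  also have "\<dots> = a \<cdot> (?A \<star> r) \<cdot> Asc C Ao X Ao" using ty by (simp add: r_def)
  finally show "a \<cdot> (?A \<star> r) \<cdot> Asc C Ao X Ao = r \<cdot> (a \<star> ?A)" by simp
  have coh: "Inv C (Asc C Ao Ao X) \<cdot> (?A \<star> ?S) \<cdot> Swp C (X \<boxtimes> Ao) Ao = (?s \<star> ?x) \<cdot> Swp C X (Ao \<boxtimes> Ao) \<cdot> Asc C X Ao Ao"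
  proof -
    have h2: "(Swp C Ao X \<star> ?A) \<cdot> Inv C (Asc C Ao X Ao) \<cdot> Swp C (X \<boxtimes> Ao) Ao
        = Inv C (Asc C X Ao Ao) \<cdot> (?x \<star> ?s) \<cdot> Asc C X Ao Ao"
      using hexagon_inv[of Ao X Ao] ty by simp
    have "Swp C (X \<boxtimes> Ao) Ao = (Asc C Ao X Ao \<cdot> (?S \<star> ?A)) \<cdot> ((Swp C Ao X \<star> ?A) \<cdot> Inv C (Asc C Ao X Ao) \<cdot> Swp C (X \<boxtimes> Ao) Ao)"
      using ty by simp
    also have "\<dots> = (Asc C Ao X Ao \<cdot> (?S \<star> ?A)) \<cdot> (Inv C (Asc C X Ao Ao) \<cdot> (?x \<star> ?s) \<cdot> Asc C X Ao Ao)" by (simp only: h2)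
    finally have sw: "Swp C (X \<boxtimes> Ao) Ao = (Asc C Ao X Ao \<cdot> (?S \<star> ?A)) \<cdot> (Inv C (Asc C X Ao Ao) \<cdot> (?x \<star> ?s) \<cdot> Asc C X Ao Ao)" .
    have "Inv C (Asc C Ao Ao X) \<cdot> (?A \<star> ?S) \<cdot> Swp C (X \<boxtimes> Ao) Ao
      = Inv C (Asc C Ao Ao X) \<cdot> ((?A \<star> ?S) \<cdot> Asc C Ao X Ao \<cdot> (?S \<star> ?A)) \<cdot> (Inv C (Asc C X Ao Ao) \<cdot> (?x \<star> ?s) \<cdot> Asc C X Ao Ao)"
      unfolding sw using ty by simp
    also have "\<dots> = Inv C (Asc C Ao Ao X) \<cdot> (Asc C Ao Ao X \<cdot> Swp C X (Ao \<boxtimes> Ao) \<cdot> Asc C X Ao Ao) \<cdot> (Inv C (Asc C X Ao Ao) \<cdot> (?x \<star> ?s) \<cdot> Asc C X Ao Ao)"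
      using hexagon[of X Ao Ao] ty by simp
    also have "\<dots> = (Swp C X (Ao \<boxtimes> Ao) \<cdot> (?x \<star> ?s)) \<cdot> Asc C X Ao Ao" using ty by simp
    also have "\<dots> = ((?s \<star> ?x) \<cdot> Swp C X (Ao \<boxtimes> Ao)) \<cdot> Asc C X Ao Ao" using nat[of ?x ?s] ty by simp
    also have "\<dots> = (?s \<star> ?x) \<cdot> Swp C X (Ao \<boxtimes> Ao) \<cdot> Asc C X Ao Ao" using ty by simp
    finally show ?thesis .
  qed
  have "r \<cdot> (r \<star> ?A) = a \<cdot> (?S \<cdot> (r \<star> ?A))" unfolding r_def using ty by simp
  also have "\<dots> = a \<cdot> ((?A \<star> r) \<cdot> Swp C (X \<boxtimes> Ao) Ao)" using nat[of r ?A] rty by simp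
  also have "\<dots> = (a \<cdot> (?A \<star> a)) \<cdot> (?A \<star> ?S) \<cdot> Swp C (X \<boxtimes> Ao) Ao" unfolding r_def using ty by simp
  also have "\<dots> = (a \<cdot> (Mul A \<star> ?x)) \<cdot> (Inv C (Asc C Ao Ao X) \<cdot> (?A \<star> ?S) \<cdot> Swp C (X \<boxtimes> Ao) Ao)" unfolding aa using ty by simp
  also have "\<dots> = (a \<cdot> (Mul A \<star> ?x)) \<cdot> ((?s \<star> ?x) \<cdot> Swp C X (Ao \<boxtimes> Ao) \<cdot> Asc C X Ao Ao)" by (simp only: coh)
  also have "\<dots> = ((a \<cdot> (Mul A \<star> ?x)) \<cdot> (?s \<star> ?x)) \<cdot> Swp C X (Ao \<boxtimes> Ao) \<cdot> Asc C X Ao Ao" using ty by simp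
  also have "\<dots> = (a \<cdot> (Mul A \<star> ?x)) \<cdot> Swp C X (Ao \<boxtimes> Ao) \<cdot> Asc C X Ao Ao" by (simp only: am[symmetric])
  also have "\<dots> = a \<cdot> (?S \<cdot> (?x \<star> Mul A)) \<cdot> Asc C X Ao Ao" using nat[of ?x "Mul A"] ty by simp
  also have "\<dots> = r \<cdot> (?x \<star> Mul A) \<cdot> Asc C X Ao Ao" unfolding r_def using ty by simp
  finally show "r \<cdot> (r \<star> ?A) = r \<cdot> (?x \<star> Mul A) \<cdot> Asc C X Ao Ao" .
qed

text \<open>
  The coequalizer defining the tensor product with a free module splits, the splitting being given
  by \<open>u\<close>, the unit of the adjunction.
\<close>

lemma free_unit:
  assumes c: "c \<in> Obj C"
  defines "u \<equiv> (Unt A \<star> Ide C c) \<cdot> Inv C (Lun C c)"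
  shows "u \<in> Arr C" "Dom C u = c" "Cod C u = Ao \<boxtimes> c"
    "snd (free_module C A c) \<cdot> (Ide C Ao \<star> u) = Ide C (Ao \<boxtimes> c)"
proof -
  show uty: "u \<in> Arr C" "Dom C u = c" "Cod C u = Ao \<boxtimes> c" using c by (auto simp: u_def)
  let ?A = "Ide C Ao" and ?c = "Ide C c"
  have tri: "Inv C (Asc C Ao (Uni C) c) \<cdot> (?A \<star> Inv C (Lun C c)) = Inv C (Run C Ao) \<star> ?c"
  proof -
    have "(Run C Ao \<star> ?c) \<cdot> (Inv C (Asc C Ao (Uni C) c) \<cdot> (?A \<star> Inv C (Lun C c)))
      = ((?A \<star> Lun C c) \<cdot> Asc C Ao (Uni C) c) \<cdot> (Inv C (Asc C Ao (Uni C) c) \<cdot> (?A \<star> Inv C (Lun C c)))"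
      using triangle[of Ao c] c by simp
    also have "\<dots> = (Run C Ao \<star> ?c) \<cdot> (Inv C (Run C Ao) \<star> ?c)" using c by simp
    finally show ?thesis
      by (rule Iso_left_cancel[OF TenA_Iso[OF Run_Iso[OF alg_typ(1)] Ide_Iso[OF c]]]) (use c in auto)
  qed
  have "snd (free_module C A c) \<cdot> (?A \<star> u)
     = (Mul A \<star> ?c) \<cdot> (Inv C (Asc C Ao Ao c) \<cdot> (?A \<star> (Unt A \<star> ?c))) \<cdot> (?A \<star> Inv C (Lun C c))"
    using c by (simp add: free_module_def u_def)
  also have "\<dots> = (Mul A \<star> ?c) \<cdot> (((?A \<star> Unt A) \<star> ?c) \<cdot> Inv C (Asc C Ao (Uni C) c)) \<cdot> (?A \<star> Inv C (Lun C c))"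
    using Asc_Inv_nat[of ?A "Unt A" ?c] c by simp
  also have "\<dots> = ((Mul A \<cdot> (?A \<star> Unt A)) \<star> ?c) \<cdot> (Inv C (Asc C Ao (Uni C) c) \<cdot> (?A \<star> Inv C (Lun C c)))"
    using c by simp
  also have "\<dots> = (Run C Ao \<star> ?c) \<cdot> (Inv C (Run C Ao) \<star> ?c)" unfolding tri Mul_Unt_right ..
  also have "\<dots> = Ide C (Ao \<boxtimes> c)" using c by simp
  finally show "snd (free_module C A c) \<cdot> (?A \<star> u) = Ide C (Ao \<boxtimes> c)" .
qed

lemma free_module_tensor:
  assumes X: "(X, a) \<in> modules C A" and c: "c \<in> Obj C"
  shows "\<exists>q. is_module_tensor C A (X, a) (free_module C A c) (X \<boxtimes> c, (a \<star> Ide C c) \<cdot> Inv C (Asc C Ao X c)) q"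
proof -
  note ty = modulesD(1-4)[OF X] c
  let ?A = "Ide C Ao" and ?x = "Ide C X" and ?c = "Ide C c" and ?Ac = "Ide C (Ao \<boxtimes> c)"
  define r where "r = a \<cdot> Swp C X Ao"
  note ra = right_action[OF X, folded r_def]
  define b where "b = (Mul A \<star> ?c) \<cdot> Inv C (Asc C Ao Ao c)"
  have fm: "free_module C A c = (Ao \<boxtimes> c, b)" by (simp add: free_module_def b_def)
  define u where "u = (Unt A \<star> ?c) \<cdot> Inv C (Lun C c)"
  note ud = free_unit[OF c, folded u_def, unfolded fm, simplified]
  have bty: "b \<in> Arr C" "Dom C b = Ao \<boxtimes> (Ao \<boxtimes> c)" "Cod C b = Ao \<boxtimes> c" using c by (auto simp: b_def)
  define q where "q = (r \<star> ?c) \<cdot> Inv C (Asc C X Ao c)"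
  have qty: "q \<in> Arr C" "Dom C q = X \<boxtimes> (Ao \<boxtimes> c)" "Cod C q = X \<boxtimes> c" using ra(1-3) ty by (auto simp: q_def)
  let ?l = "r \<star> ?Ac" and ?r = "(?x \<star> b) \<cdot> Asc C X Ao (Ao \<boxtimes> c)"
  let ?t = "(a \<star> ?c) \<cdot> Inv C (Asc C Ao X c)"
  have lr: "q \<cdot> ?l = q \<cdot> ?r"
  proof -
    have "q \<cdot> ?l = (r \<star> ?c) \<cdot> (Inv C (Asc C X Ao c) \<cdot> (r \<star> (?A \<star> ?c)))" using ra(1-3) ty by (simp add: q_def)
    also have "\<dots> = (r \<star> ?c) \<cdot> (((r \<star> ?A) \<star> ?c) \<cdot> Inv C (Asc C (X \<boxtimes> Ao) Ao c))"
      using Asc_Inv_nat[of r ?A ?c] ra(1-3) ty by simp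
    also have "\<dots> = ((r \<cdot> (r \<star> ?A)) \<star> ?c) \<cdot> Inv C (Asc C (X \<boxtimes> Ao) Ao c)" using ra(1-3) ty by simp
    also have "\<dots> = ((r \<cdot> (?x \<star> Mul A) \<cdot> Asc C X Ao Ao) \<star> ?c) \<cdot> Inv C (Asc C (X \<boxtimes> Ao) Ao c)" by (simp only: ra(4))
    also have "\<dots> = (r \<star> ?c) \<cdot> (((?x \<star> Mul A) \<star> ?c) \<cdot> Inv C (Asc C X (Ao \<boxtimes> Ao) c)) \<cdot>
      (Asc C X (Ao \<boxtimes> Ao) c \<cdot> (Asc C X Ao Ao \<star> ?c) \<cdot> Inv C (Asc C (X \<boxtimes> Ao) Ao c))" using ra(1-3) ty by simp
    also have "\<dots> = (r \<star> ?c) \<cdot> (Inv C (Asc C X Ao c) \<cdot> (?x \<star> (Mul A \<star> ?c))) \<cdot>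
      ((?x \<star> Inv C (Asc C Ao Ao c)) \<cdot> Asc C X Ao (Ao \<boxtimes> c))"
      using Asc_Inv_nat[of ?x "Mul A" ?c] pentagon_inv(1)[of X Ao Ao c] ty by simp
    also have "\<dots> = q \<cdot> ?r" using ra(1-3) ty by (simp add: q_def b_def)
    finally show ?thesis .
  qed
  \<comment> \<open>\<open>sg\<close> and \<open>t\<close> split the fork:
    \<open>?r \<cdot> t\<close> is the identity and \<open>?l \<cdot> t\<close> is
    \<open>sg \<cdot> q\<close>. So an arrow \<open>f\<close> with
    \<open>f \<cdot> ?l = f \<cdot> ?r\<close> equals
    \<open>(f \<cdot> sg) \<cdot> q\<close>.\<close>
  define sg where "sg = ?x \<star> u"
  have sty: "sg \<in> Arr C" "Dom C sg = X \<boxtimes> c" "Cod C sg = X \<boxtimes> (Ao \<boxtimes> c)" using ud ty by (auto simp: sg_def)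
  define t where "t = Inv C (Asc C X Ao (Ao \<boxtimes> c)) \<cdot> (?x \<star> (?A \<star> u))"
  have tty: "t \<in> Arr C" "Dom C t = X \<boxtimes> (Ao \<boxtimes> c)" "Cod C t = (X \<boxtimes> Ao) \<boxtimes> (Ao \<boxtimes> c)" using ud ty by (auto simp: t_def)
  have rt: "?r \<cdot> t = Ide C (X \<boxtimes> (Ao \<boxtimes> c))"
  proof -
    have "?r \<cdot> t = ?x \<star> (b \<cdot> (?A \<star> u))" using ud(1-3) ty bty by (simp add: t_def)
    then show ?thesis using ud(4) ty by simp
  qed
  have lt: "?l \<cdot> t = sg \<cdot> q"
  proof -
    have "?l \<cdot> t = ?l \<cdot> (((?x \<star> ?A) \<star> u) \<cdot> Inv C (Asc C X Ao c))"
      using Asc_Inv_nat[of ?x ?A u] ud(1-3) ty unfolding t_def by (simp del: TenA_Ide' TenA_fuse TenA_fuse')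
    also have "\<dots> = sg \<cdot> q" using ud(1-3) ty ra(1-3) by (simp add: sg_def q_def)
    finally show ?thesis .
  qed
  \<comment> \<open>Invertibility of \<open>q \<cdot> sg\<close> is enough for factorizations
    through \<open>q\<close> to be unique; identifying it with the identity would require the
    compatibility of the unitors with the symmetry.\<close>
  have qs: "q \<cdot> sg \<in> Iso C (X \<boxtimes> c) (X \<boxtimes> c)"
  proof -
    have "q \<cdot> sg = (r \<star> ?c) \<cdot> (Inv C (Asc C X Ao c) \<cdot> (?x \<star> (Unt A \<star> ?c))) \<cdot> (?x \<star> Inv C (Lun C c))"
      using ty ra(1-3) by (simp add: q_def sg_def u_def)
    also have "\<dots> = (r \<star> ?c) \<cdot> (((?x \<star> Unt A) \<star> ?c) \<cdot> Inv C (Asc C X (Uni C) c)) \<cdot> (?x \<star> Inv C (Lun C c))"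
      using Asc_Inv_nat[of ?x "Unt A" ?c] ty by simp
    also have "\<dots> = ((r \<cdot> (?x \<star> Unt A)) \<star> ?c) \<cdot> Inv C (Asc C X (Uni C) c) \<cdot> (?x \<star> Inv C (Lun C c))"
      using ty ra(1-3) by simp
    also have "r \<cdot> (?x \<star> Unt A) = Lun C X \<cdot> Swp C X (Uni C)"
    proof -
      have "Swp C X Ao \<cdot> (?x \<star> Unt A) = (Unt A \<star> ?x) \<cdot> Swp C X (Uni C)"
        by (rule Swp_natural) (use ty in \<open>auto simp: Hom_iff\<close>)
      then have "r \<cdot> (?x \<star> Unt A) = a \<cdot> ((Unt A \<star> ?x) \<cdot> Swp C X (Uni C))" using ty by (simp add: r_def)
      also have "\<dots> = (a \<cdot> (Unt A \<star> ?x)) \<cdot> Swp C X (Uni C)" using ty by simp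
      finally show ?thesis by (simp only: modulesD(6)[OF X])
    qed
    finally have eq: "q \<cdot> sg = ((Lun C X \<cdot> Swp C X (Uni C)) \<star> ?c) \<cdot> Inv C (Asc C X (Uni C) c) \<cdot> (?x \<star> Inv C (Lun C c))" .
    have i1: "?x \<star> Inv C (Lun C c) \<in> Iso C (X \<boxtimes> c) (X \<boxtimes> (Uni C \<boxtimes> c))"
      using ty by (intro TenA_Iso Ide_Iso Inv_Iso Lun_Iso)
    have i2: "Inv C (Asc C X (Uni C) c) \<in> Iso C (X \<boxtimes> (Uni C \<boxtimes> c)) ((X \<boxtimes> Uni C) \<boxtimes> c)"
      using ty by (intro Inv_Iso Asc_Iso) auto
    have i3: "(Lun C X \<cdot> Swp C X (Uni C)) \<star> ?c \<in> Iso C ((X \<boxtimes> Uni C) \<boxtimes> c) (X \<boxtimes> c)"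
      using ty by (intro TenA_Iso Ide_Iso Comp_Iso[OF Swp_Iso Lun_Iso]) auto
    show ?thesis unfolding eq by (rule Comp_Iso[OF Comp_Iso[OF i1 i2] i3])
  qed
  have act: "?t \<cdot> (?A \<star> q) = q \<cdot> (a \<star> ?Ac) \<cdot> Inv C (Asc C Ao X (Ao \<boxtimes> c))"
  proof -
    have pent: "Inv C (Asc C Ao (X \<boxtimes> Ao) c) \<cdot> (?A \<star> Inv C (Asc C X Ao c))
      = (Asc C Ao X Ao \<star> ?c) \<cdot> Inv C (Asc C (Ao \<boxtimes> X) Ao c) \<cdot> Inv C (Asc C Ao X (Ao \<boxtimes> c))"
    proof -
      have "Inv C (Asc C Ao (X \<boxtimes> Ao) c) \<cdot> (?A \<star> Inv C (Asc C X Ao c))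
         = Inv C (Asc C Ao (X \<boxtimes> Ao) c) \<cdot> ((?A \<star> Inv C (Asc C X Ao c)) \<cdot> Asc C Ao X (Ao \<boxtimes> c)) \<cdot> Inv C (Asc C Ao X (Ao \<boxtimes> c))"
        using ty by simp
      also have "\<dots> = Inv C (Asc C Ao (X \<boxtimes> Ao) c) \<cdot> (Asc C Ao (X \<boxtimes> Ao) c \<cdot> (Asc C Ao X Ao \<star> ?c) \<cdot> Inv C (Asc C (Ao \<boxtimes> X) Ao c))
         \<cdot> Inv C (Asc C Ao X (Ao \<boxtimes> c))"
        using pentagon_inv(1)[of Ao X Ao c] ty by simp
      also have "\<dots> = (Asc C Ao X Ao \<star> ?c) \<cdot> Inv C (Asc C (Ao \<boxtimes> X) Ao c) \<cdot> Inv C (Asc C Ao X (Ao \<boxtimes> c))" using ty by simp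
      finally show ?thesis .
    qed
    have "?t \<cdot> (?A \<star> q) = (a \<star> ?c) \<cdot> (Inv C (Asc C Ao X c) \<cdot> (?A \<star> (r \<star> ?c))) \<cdot> (?A \<star> Inv C (Asc C X Ao c))"
      using ty ra(1-3) by (simp add: q_def)
    also have "\<dots> = (a \<star> ?c) \<cdot> (((?A \<star> r) \<star> ?c) \<cdot> Inv C (Asc C Ao (X \<boxtimes> Ao) c)) \<cdot> (?A \<star> Inv C (Asc C X Ao c))"
      using Asc_Inv_nat[of ?A r ?c] ty ra(1-3) by simp
    also have "\<dots> = (a \<star> ?c) \<cdot> ((?A \<star> r) \<star> ?c) \<cdot> (Inv C (Asc C Ao (X \<boxtimes> Ao) c) \<cdot> (?A \<star> Inv C (Asc C X Ao c)))"
      using ty ra(1-3) by simp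
    also have "\<dots> = (a \<star> ?c) \<cdot> ((?A \<star> r) \<star> ?c) \<cdot> (Asc C Ao X Ao \<star> ?c) \<cdot> Inv C (Asc C (Ao \<boxtimes> X) Ao c) \<cdot> Inv C (Asc C Ao X (Ao \<boxtimes> c))"
      by (simp only: pent)
    also have "\<dots> = ((a \<cdot> (?A \<star> r) \<cdot> Asc C Ao X Ao) \<star> ?c) \<cdot> Inv C (Asc C (Ao \<boxtimes> X) Ao c) \<cdot> Inv C (Asc C Ao X (Ao \<boxtimes> c))"
      using ty ra(1-3) by simp
    also have "\<dots> = ((r \<cdot> (a \<star> ?A)) \<star> ?c) \<cdot> Inv C (Asc C (Ao \<boxtimes> X) Ao c) \<cdot> Inv C (Asc C Ao X (Ao \<boxtimes> c))" by (simp only: ra(5))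
    also have "\<dots> = (r \<star> ?c) \<cdot> (((a \<star> ?A) \<star> ?c) \<cdot> Inv C (Asc C (Ao \<boxtimes> X) Ao c)) \<cdot> Inv C (Asc C Ao X (Ao \<boxtimes> c))"
      using ty ra(1-3) by simp
    also have "\<dots> = (r \<star> ?c) \<cdot> (Inv C (Asc C X Ao c) \<cdot> (a \<star> (?A \<star> ?c))) \<cdot> Inv C (Asc C Ao X (Ao \<boxtimes> c))"
      using Asc_Inv_nat[of a ?A ?c] ty by simp
    also have "\<dots> = q \<cdot> (a \<star> ?Ac) \<cdot> Inv C (Asc C Ao X (Ao \<boxtimes> c))" using ty ra(1-3) by (simp add: q_def)
    finally show ?thesis .
  qed
  have univ: "\<exists>!h. h \<in> Hom C (X \<boxtimes> c) W \<and> h \<cdot> q = f"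
    if f: "f \<in> Hom C (X \<boxtimes> (Ao \<boxtimes> c)) W" and fl: "f \<cdot> ?l = f \<cdot> ?r" for f W
  proof (rule ex1I)
    note fty = HomD[OF f]
    have "f = f \<cdot> (?r \<cdot> t)" unfolding rt using fty by simp
    also have "\<dots> = (f \<cdot> ?r) \<cdot> t" by (rule Comp_assoc'[symmetric]) (use fty tty ty bty in auto)
    also have "\<dots> = (f \<cdot> ?l) \<cdot> t" by (simp only: fl)
    also have "\<dots> = f \<cdot> (?l \<cdot> t)" by (rule Comp_assoc') (use fty tty ty ra in auto)
    also have "\<dots> = (f \<cdot> sg) \<cdot> q" unfolding lt using fty sty qty by simp
    finally show "f \<cdot> sg \<in> Hom C (X \<boxtimes> c) W \<and> (f \<cdot> sg) \<cdot> q = f" using fty sty by (simp add: Hom_iff)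
    then have fs: "(f \<cdot> sg) \<cdot> q = f" by blast
    fix h assume h: "h \<in> Hom C (X \<boxtimes> c) W \<and> h \<cdot> q = f"
    have hty: "h \<in> Arr C" "Dom C h = X \<boxtimes> c" "Cod C h = W" using h by (auto simp: Hom_iff)
    have "h \<cdot> (q \<cdot> sg) = (h \<cdot> q) \<cdot> sg" using hty qty sty by simp
    also have "\<dots> = ((f \<cdot> sg) \<cdot> q) \<cdot> sg" using h fs by simp
    also have "\<dots> = (f \<cdot> sg) \<cdot> (q \<cdot> sg)" using fty qty sty by simp
    finally show "h = f \<cdot> sg" by (rule Iso_right_cancel[OF qs]) (use hty fty sty in auto)
  qed
  have "is_module_tensor C A (X, a) (free_module C A c) (X \<boxtimes> c, ?t) q"
    unfolding is_module_tensor_def fm prod.case Let_def r_def[symmetric]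
  proof (intro conjI ballI allI impI)
    show "(X \<boxtimes> c, ?t) \<in> modules C A" by (rule tensor_module[OF X c])
    show "q \<in> Hom C (X \<boxtimes> Ao \<boxtimes> c) (X \<boxtimes> c)" using qty by (simp add: Hom_iff)
    show "q \<cdot> ?l = q \<cdot> ?r" by (rule lr)
    show "?t \<cdot> (?A \<star> q) = q \<cdot> (a \<star> ?Ac) \<cdot> Inv C (Asc C Ao X (Ao \<boxtimes> c))" by (rule act)
    show "\<exists>!h. h \<in> Hom C (X \<boxtimes> c) W \<and> h \<cdot> q = f" if "W \<in> Obj C" "f \<in> Hom C (X \<boxtimes> Ao \<boxtimes> c) W" "f \<cdot> ?l = f \<cdot> ?r" for W f
      by (rule univ[OF that(2,3)])
  qed
  then show ?thesis by blast
qed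

text \<open>Needed because the equivalence matches the image of an object of \<open>C\<close> with a
  free module only up to an isomorphism of modules.\<close>

lemma module_tensor_iso:
  assumes X: "(X, a) \<in> modules C A" and Y: "(Y, b) \<in> modules C A" and Y': "(Y', b') \<in> modules C A"
    and n: "n \<in> Iso C Y Y'" "n \<cdot> b = b' \<cdot> (Ide C Ao \<star> n)"
    and T: "is_module_tensor C A (X, a) (Y', b') (Z, t) q"
  shows "is_module_tensor C A (X, a) (Y, b) (Z, t) (q \<cdot> (Ide C X \<star> n))"
proof -
  note ty = modulesD(1-4)[OF X] modulesD(1-4)[OF Y] modulesD(1-4)[OF Y'] IsoD[OF n(1)] Inv_typ[OF n(1)]
  let ?A = "Ide C Ao" and ?x = "Ide C X" and ?XA = "Ide C (X \<boxtimes> Ao)"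
  define r where "r = a \<cdot> Swp C X Ao"
  note ra = right_action(1-3)[OF X, folded r_def]
  let ?l = "r \<star> Ide C Y" and ?r = "(?x \<star> b) \<cdot> Asc C X Ao Y"
  let ?l' = "r \<star> Ide C Y'" and ?r' = "(?x \<star> b') \<cdot> Asc C X Ao Y'"
  have T': "(Z, t) \<in> modules C A" "q \<in> Hom C (X \<boxtimes> Y') Z" "q \<cdot> ?l' = q \<cdot> ?r'"
    "\<forall>W \<in> Obj C. \<forall>f \<in> Hom C (X \<boxtimes> Y') W. f \<cdot> ?l' = f \<cdot> ?r' \<longrightarrow> (\<exists>!h. h \<in> Hom C Z W \<and> h \<cdot> q = f)"
    "t \<cdot> (?A \<star> q) = q \<cdot> (a \<star> Ide C Y') \<cdot> Inv C (Asc C Ao X Y')"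
    using T unfolding is_module_tensor_def prod.case Let_def r_def by auto
  note zty = modulesD(1-4)[OF T'(1)] and qty = HomD[OF T'(2)]
  have l: "(?x \<star> n) \<cdot> ?l = ?l' \<cdot> (?XA \<star> n)" using ty ra by simp
  have r: "(?x \<star> n) \<cdot> ?r = ?r' \<cdot> (?XA \<star> n)"
  proof -
    have "(?x \<star> n) \<cdot> ?r = (?x \<star> (n \<cdot> b)) \<cdot> Asc C X Ao Y" using ty by simp
    also have "\<dots> = (?x \<star> b') \<cdot> ((?x \<star> (?A \<star> n)) \<cdot> Asc C X Ao Y)" unfolding n(2) using ty by simp
    also have "\<dots> = (?x \<star> b') \<cdot> (Asc C X Ao Y' \<cdot> ((?x \<star> ?A) \<star> n))"
      using Asc_nat[of ?x ?A n] ty by (simp del: TenA_Ide' TenA_fuse TenA_fuse')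
    also have "\<dots> = ?r' \<cdot> (?XA \<star> n)" using ty by simp
    finally show ?thesis .
  qed
  have xn: "?x \<star> n \<in> Iso C (X \<boxtimes> Y) (X \<boxtimes> Y')" "?XA \<star> n \<in> Iso C ((X \<boxtimes> Ao) \<boxtimes> Y) ((X \<boxtimes> Ao) \<boxtimes> Y')"
    using TenA_Iso[OF Ide_Iso n(1)] ty by auto
  have lty: "?l \<in> Arr C" "Dom C ?l = (X \<boxtimes> Ao) \<boxtimes> Y" "Cod C ?l = X \<boxtimes> Y"
    "?l' \<in> Arr C" "Dom C ?l' = (X \<boxtimes> Ao) \<boxtimes> Y'" "Cod C ?l' = X \<boxtimes> Y'"
    "?r \<in> Arr C" "Dom C ?r = (X \<boxtimes> Ao) \<boxtimes> Y" "Cod C ?r = X \<boxtimes> Y"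
    "?r' \<in> Arr C" "Dom C ?r' = (X \<boxtimes> Ao) \<boxtimes> Y'" "Cod C ?r' = X \<boxtimes> Y'" using ty ra by auto
  have fl: "(f \<cdot> (?x \<star> n)) \<cdot> ?l = (f \<cdot> ?l') \<cdot> (?XA \<star> n)" "(f \<cdot> (?x \<star> n)) \<cdot> ?r = (f \<cdot> ?r') \<cdot> (?XA \<star> n)"
    if "f \<in> Hom C (X \<boxtimes> Y') W" for f W
  proof -
    note fty = HomD[OF that]
    have nty: "?x \<star> n \<in> Arr C" "Dom C (?x \<star> n) = X \<boxtimes> Y" "Cod C (?x \<star> n) = X \<boxtimes> Y'"
      "?XA \<star> n \<in> Arr C" "Dom C (?XA \<star> n) = (X \<boxtimes> Ao) \<boxtimes> Y" "Cod C (?XA \<star> n) = (X \<boxtimes> Ao) \<boxtimes> Y'" using ty by auto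
    have "(f \<cdot> (?x \<star> n)) \<cdot> ?l = f \<cdot> ((?x \<star> n) \<cdot> ?l)" by (rule Comp_assoc') (use fty nty lty in auto)
    also have "\<dots> = (f \<cdot> ?l') \<cdot> (?XA \<star> n)" unfolding l by (rule Comp_assoc'[symmetric]) (use fty nty lty in auto)
    finally show "(f \<cdot> (?x \<star> n)) \<cdot> ?l = (f \<cdot> ?l') \<cdot> (?XA \<star> n)" .
    have "(f \<cdot> (?x \<star> n)) \<cdot> ?r = f \<cdot> ((?x \<star> n) \<cdot> ?r)" by (rule Comp_assoc') (use fty nty lty in auto)
    also have "\<dots> = (f \<cdot> ?r') \<cdot> (?XA \<star> n)" unfolding r by (rule Comp_assoc'[symmetric]) (use fty nty lty in auto)
    finally show "(f \<cdot> (?x \<star> n)) \<cdot> ?r = (f \<cdot> ?r') \<cdot> (?XA \<star> n)" .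
  qed
  show ?thesis
    unfolding is_module_tensor_def prod.case Let_def r_def[symmetric]
  proof (intro conjI ballI allI impI)
    show "(Z, t) \<in> modules C A" by (rule T')
    show "q \<cdot> (?x \<star> n) \<in> Hom C (X \<boxtimes> Y) Z" using qty ty by (simp add: Hom_iff)
    show "(q \<cdot> (?x \<star> n)) \<cdot> ?l = (q \<cdot> (?x \<star> n)) \<cdot> ?r" unfolding fl[OF T'(2)] by (simp only: T'(3))
    have "t \<cdot> (?A \<star> (q \<cdot> (?x \<star> n))) = (t \<cdot> (?A \<star> q)) \<cdot> (?A \<star> (?x \<star> n))" using zty qty ty by simp
    also have "\<dots> = q \<cdot> (a \<star> Ide C Y') \<cdot> (Inv C (Asc C Ao X Y') \<cdot> (?A \<star> (?x \<star> n)))" unfolding T'(5) using qty ty by simp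
    also have "\<dots> = q \<cdot> (a \<star> Ide C Y') \<cdot> (((?A \<star> ?x) \<star> n) \<cdot> Inv C (Asc C Ao X Y))"
      using Asc_Inv_nat[of ?A ?x n] ty by (simp del: TenA_Ide' TenA_fuse TenA_fuse')
    also have "\<dots> = (q \<cdot> (?x \<star> n)) \<cdot> (a \<star> Ide C Y) \<cdot> Inv C (Asc C Ao X Y)" using qty ty by simp
    finally show "t \<cdot> (?A \<star> (q \<cdot> (?x \<star> n))) = (q \<cdot> (?x \<star> n)) \<cdot> (a \<star> Ide C Y) \<cdot> Inv C (Asc C Ao X Y)" .
    fix W f assume W: "W \<in> Obj C" and f: "f \<in> Hom C (X \<boxtimes> Y) W" and eq: "f \<cdot> ?l = f \<cdot> ?r"
    note fty = HomD[OF f]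
    let ?n = "?x \<star> n"
    note nt = IsoD[OF xn(1)] Inv_typ[OF xn(1)] Inv_props(2,3)[OF xn(1)]
    define g where "g = f \<cdot> Inv C ?n"
    have g: "g \<in> Hom C (X \<boxtimes> Y') W" "g \<cdot> ?n = f" using fty nt by (auto simp: g_def Hom_iff)
    have "(g \<cdot> ?l') \<cdot> (?XA \<star> n) = (g \<cdot> ?r') \<cdot> (?XA \<star> n)" unfolding fl[OF g(1), symmetric] g(2) by (rule eq)
    then have "g \<cdot> ?l' = g \<cdot> ?r'" by (rule Iso_right_cancel[OF xn(2)]) (use HomD[OF g(1)] lty in auto)
    then have ex: "\<exists>!h. h \<in> Hom C Z W \<and> h \<cdot> q = g" using T'(4) W g(1) by blast
    have "h \<cdot> q = g \<longleftrightarrow> h \<cdot> q \<cdot> ?n = f" if "h \<in> Hom C Z W" for h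
    proof
      assume "h \<cdot> q = g"
      then have "(h \<cdot> q) \<cdot> ?n = f" using g(2) by simp
      then show "h \<cdot> q \<cdot> ?n = f" using HomD[OF that] qty nt(1-3) by (simp del: TenA_fuse TenA_fuse')
    next
      assume "h \<cdot> q \<cdot> ?n = f"
      then have "(h \<cdot> q) \<cdot> ?n = g \<cdot> ?n" using HomD[OF that] qty nt(1-3) g(2) by (simp del: TenA_fuse TenA_fuse')
      then show "h \<cdot> q = g" by (rule Iso_right_cancel[OF xn(1)]) (use HomD[OF that] qty HomD[OF g(1)] in auto)
    qed
    then show "\<exists>!h. h \<in> Hom C Z W \<and> h \<cdot> q \<cdot> ?n = f" using ex by blast
  qed
qed

lemma module_tensor_unique:
  assumes "is_module_tensor C A N L T q" "is_module_tensor C A N L T' q'"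
  shows "isomorphic C (fst T) (fst T')"
proof -
  obtain X a Y b Z t Z' t' where e: "N = (X, a)" "L = (Y, b)" "T = (Z, t)" "T' = (Z', t')" by (metis prod.exhaust)
  let ?l = "(a \<cdot> Swp C X Ao) \<star> Ide C Y" and ?r = "(Ide C X \<star> b) \<cdot> Asc C X Ao Y"
  have T: "(Z, t) \<in> modules C A" "q \<in> Hom C (X \<boxtimes> Y) Z" "q \<cdot> ?l = q \<cdot> ?r"
    "\<And>W f. W \<in> Obj C \<Longrightarrow> f \<in> Hom C (X \<boxtimes> Y) W \<Longrightarrow> f \<cdot> ?l = f \<cdot> ?r \<Longrightarrow> \<exists>!h. h \<in> Hom C Z W \<and> h \<cdot> q = f"
    using assms(1) unfolding is_module_tensor_def e prod.case Let_def by auto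
  have T': "(Z', t') \<in> modules C A" "q' \<in> Hom C (X \<boxtimes> Y) Z'" "q' \<cdot> ?l = q' \<cdot> ?r"
    "\<And>W f. W \<in> Obj C \<Longrightarrow> f \<in> Hom C (X \<boxtimes> Y) W \<Longrightarrow> f \<cdot> ?l = f \<cdot> ?r \<Longrightarrow> \<exists>!h. h \<in> Hom C Z' W \<and> h \<cdot> q' = f"
    using assms(2) unfolding is_module_tensor_def e prod.case Let_def by auto
  have O: "Z \<in> Obj C" "Z' \<in> Obj C" using Hom_Obj T(2) T'(2) by blast+
  obtain h where h: "h \<in> Hom C Z Z'" "h \<cdot> q = q'" using T(4)[OF O(2) T'(2,3)] by auto
  obtain k where k: "k \<in> Hom C Z' Z" "k \<cdot> q' = q" using T'(4)[OF O(1) T(2,3)] by auto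
  note ty = HomD[OF h(1)] HomD[OF k(1)] HomD[OF T(2)] HomD[OF T'(2)]
  have "(k \<cdot> h) \<cdot> q = k \<cdot> (h \<cdot> q)" "(h \<cdot> k) \<cdot> q' = h \<cdot> (k \<cdot> q')" using ty by simp_all
  then have 1: "(k \<cdot> h) \<cdot> q = q" "(h \<cdot> k) \<cdot> q' = q'" by (simp_all only: h(2) k(2))
  have H: "k \<cdot> h \<in> Hom C Z Z" "h \<cdot> k \<in> Hom C Z' Z'" "Ide C Z \<in> Hom C Z Z" "Ide C Z' \<in> Hom C Z' Z'"
    "Ide C Z \<cdot> q = q" "Ide C Z' \<cdot> q' = q'" using ty by (auto simp: Hom_iff)
  have "k \<cdot> h = Ide C Z" using T(4)[OF O(1) T(2,3)] 1(1) H(1,3,5) by blast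
  moreover have "h \<cdot> k = Ide C Z'" using T'(4)[OF O(2) T'(2,3)] 1(2) H(2,4,6) by blast
  ultimately have "h \<in> Iso C Z Z'" by (rule IsoI[OF h(1) k(1)])
  then show ?thesis unfolding e by (simp add: isomorphicI)
qed

text \<open>\<open>ModTen\<close> is a choice among coequalizers, so it can be evaluated only once
  one is known to exist. The split coequalizer provides one, and \<open>module_tensor_unique\<close>
  compares it with the chosen one.\<close>

lemma ModTen_free:
  assumes N: "N \<in> modules C A" and L: "L \<in> modules C A" and c: "c \<in> Obj C"
    and iso: "isomorphic M L (free_module C A c)"
  shows "isomorphic C (fst (ModTen C A N L)) (fst N \<boxtimes> c)"
proof -
  obtain X a where X: "N = (X, a)" by (metis prod.exhaust)
  obtain Y b where Y: "L = (Y, b)" by (metis prod.exhaust)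
  obtain Y' b' where Y': "free_module C A c = (Y', b')" by (metis prod.exhaust)
  obtain n where n: "n \<in> Iso M L (free_module C A c)" using iso by (auto simp: isomorphic_def)
  have un: "und n \<in> Iso C Y Y'" using functor_Iso[OF forget_functor n Modules_category] Y Y' by simp
  have "n \<in> module_Hom C A L (free_module C A c)" using Iso_Hom[OF n] by (simp add: Modules_Hom_iff)
  then have nb: "und n \<cdot> b = b' \<cdot> (Ide C Ao \<star> und n)" using module_HomD(6)[of n L "free_module C A c"] Y Y' by simp
  obtain q where q: "is_module_tensor C A (X, a) (Y', b') (X \<boxtimes> c, (a \<star> Ide C c) \<cdot> Inv C (Asc C Ao X c)) q"
    using free_module_tensor[OF N[unfolded X] c] Y' by auto
  have ten: "is_module_tensor C A N L (X \<boxtimes> c, (a \<star> Ide C c) \<cdot> Inv C (Asc C Ao X c)) (q \<cdot> (Ide C X \<star> und n))"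
    unfolding X Y
    by (rule module_tensor_iso[OF N[unfolded X] L[unfolded Y] _ un nb q]) (use free_module_mem[OF c] Y' in simp)
  have "is_module_tensor C A N L (fst (module_tensor C A N L)) (snd (module_tensor C A N L))"
    unfolding module_tensor_def
    by (rule someI[of "\<lambda>Tq. is_module_tensor C A N L (fst Tq) (snd Tq)" "((X \<boxtimes> c, (a \<star> Ide C c) \<cdot> Inv C (Asc C Ao X c)), q \<cdot> (Ide C X \<star> und n))"])
      (use ten in simp)
  from module_tensor_unique[OF this ten] show ?thesis by (simp add: ModTen_def X)
qed

text \<open>Half of the adjunction between free modules and underlying objects: \<open>be\<close> is
  \<open>k\<close> precomposed with the unit \<open>u\<close>.\<close>

lemma free_arrow:
  assumes k: "k \<in> module_Hom C A (free_module C A c) (X, a)" and X: "(X, a) \<in> modules C A" and c: "c \<in> Obj C"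
  obtains be where "be \<in> Hom C c X" "und k = a \<cdot> (Ide C Ao \<star> be)"
proof -
  define b where "b = (Mul A \<star> Ide C c) \<cdot> Inv C (Asc C Ao Ao c)"
  have fm: "free_module C A c = (Ao \<boxtimes> c, b)" by (simp add: free_module_def b_def)
  have bty: "b \<in> Arr C" "Dom C b = Ao \<boxtimes> (Ao \<boxtimes> c)" "Cod C b = Ao \<boxtimes> c" using c by (auto simp: b_def)
  define u where "u = (Unt A \<star> Ide C c) \<cdot> Inv C (Lun C c)"
  note ud = free_unit[OF c, folded u_def, unfolded fm, simplified]
  note kd = module_HomD[OF k, unfolded fm, simplified] and xd = modulesD(1-4)[OF X]
  have "a \<cdot> (Ide C Ao \<star> (und k \<cdot> u)) = (a \<cdot> (Ide C Ao \<star> und k)) \<cdot> (Ide C Ao \<star> u)" using ud(1-3) kd(3-5) xd by simp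
  also have "\<dots> = und k \<cdot> (b \<cdot> (Ide C Ao \<star> u))" unfolding kd(6)[symmetric] using ud(1-3) kd(3-5) bty by simp
  also have "\<dots> = und k" unfolding ud(4) using kd(3-5) by simp
  finally show ?thesis using that[of "und k \<cdot> u"] ud(1-3) kd(3-5) by (simp add: Hom_iff)
qed

text \<open>Left linearity of the section \<open>s\<close> makes it a module map into the free
  module on \<open>Ao\<close>; the multiplication is a module map back.\<close>

lemma separable_retract:
  assumes "separable C A" shows "retract M (Ao, Mul A) (free_module C A Ao)"
proof -
  obtain s where s: "s \<in> Hom C Ao (Ao \<boxtimes> Ao)" "Mul A \<cdot> s = Ide C Ao"
    "(Mul A \<star> Ide C Ao) \<cdot> Inv C (Asc C Ao Ao Ao) \<cdot> (Ide C Ao \<star> s) = s \<cdot> Mul A"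
    using assms unfolding separable_def by blast
  note sty = HomD[OF s(1)]
  let ?F = "free_module C A Ao"
  have F: "?F = (Ao \<boxtimes> Ao, (Mul A \<star> Ide C Ao) \<cdot> Inv C (Asc C Ao Ao Ao))" by (simp add: free_module_def)
  have m: "?F \<in> modules C A" "(Ao, Mul A) \<in> modules C A" using free_module_mem unit_module by auto
  have "((Ao, Mul A), s, ?F) \<in> Hom M (Ao, Mul A) ?F"
    unfolding Modules_Hom_iff using m s(1,3) sty by (auto simp: F intro!: module_HomI)
  moreover have "(?F, Mul A, (Ao, Mul A)) \<in> Hom M ?F (Ao, Mul A)"
  proof -
    have "Mul A \<cdot> (Mul A \<star> Ide C Ao) \<cdot> Inv C (Asc C Ao Ao Ao) = (Mul A \<cdot> (Mul A \<star> Ide C Ao)) \<cdot> Inv C (Asc C Ao Ao Ao)" by simp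
    also have "\<dots> = Mul A \<cdot> (Ide C Ao \<star> Mul A)" unfolding Mul_assoc by simp
    finally show ?thesis unfolding Modules_Hom_iff using m Mul_Hom by (auto simp: F intro!: module_HomI)
  qed
  ultimately show ?thesis unfolding retract_def
    by (intro bexI[of _ "((Ao, Mul A), s, ?F)"] bexI[of _ "(?F, Mul A, (Ao, Mul A))"]) (auto simp: s(2))
qed

end

section \<open>Descent of minimality\<close>

context rigidly_compactly_generated_universe
begin

lemma colon_localizing_ideal:
  assumes L: "localizing_ideal U C L" and T: "T \<in> Obj C"
  shows "localizing_ideal U C {X \<in> Obj C. X \<boxtimes> T \<in> L}"
proof (rule localizing_idealI)
  note LD = localizing_idealD[OF L]
  show "localizing_subcategory U C {X \<in> Obj C. X \<boxtimes> T \<in> L}" by (rule TenO_preimage_localizing[OF LD(1) T])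
  show "X \<boxtimes> Y \<in> {X \<in> Obj C. X \<boxtimes> T \<in> L}" if X: "X \<in> Obj C" and Y: "Y \<in> {X \<in> Obj C. X \<boxtimes> T \<in> L}" for X Y
  proof -
    have YO: "Y \<in> Obj C" and YT: "Y \<boxtimes> T \<in> L" using Y by auto
    have "(X \<boxtimes> Y) \<boxtimes> T \<in> L" by (rule LD(6)[OF LD(3)[OF X YT] isomorphic_sym[OF isomorphic_Asc[OF X YO T]]])
    then show ?thesis using X YO by simp
  qed
qed

text \<open>If some \<open>y\<close> supported inside the support of \<open>x\<close> were missing
  from \<open>L\<close>, there would be a prime containing the compact objects of \<open>L\<close>,
  hence \<open>x\<close>, but not \<open>y\<close>, against the inclusion of supports.\<close>

lemma Loc_supp_subset:
  assumes L: "localizing_ideal U C L" and x: "x \<in> compact_objects U C" "x \<in> L"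
  shows "Loc U C (compact_supported U C (supp U C x)) \<subseteq> L"
proof (rule Loc_minimal)
  note LD = localizing_idealD[OF L]
  show "localizing_subcategory U C L" by (rule LD(1))
  show "compact_supported U C (supp U C x) \<subseteq> L"
  proof
    fix y assume "y \<in> compact_supported U C (supp U C x)"
    then have y: "y \<in> compact_objects U C" "supp U C y \<subseteq> supp U C x" by (auto simp: compact_supported_def)
    have "y \<boxtimes> Uni C \<in> L"
    proof (rule ccontr)
      assume "y \<boxtimes> Uni C \<notin> L"
      then obtain R where R: "R \<in> Spc U C" "\<And>y. y \<in> compact_objects U C \<Longrightarrow> y \<boxtimes> Uni C \<in> L \<Longrightarrow> y \<in> R" "y \<notin> R"
        by (rule prime_over_annihilator[OF L Uni_Obj y(1)]) blast
      have "x \<in> R" by (rule R(2)[OF x(1) LD(4)[OF Uni_Obj x(2)]])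
      then show False using y(2) R(1,3) by (auto simp: supp_def)
    qed
    then show "y \<in> L" by (rule LD(6)[OF _ isomorphic_Run[OF compact_Obj[OF y(1)]]])
  qed
qed

lemma Uni_not_in_prime: "P \<in> Spc U C \<Longrightarrow> Uni C \<notin> P"
proof
  assume P: "P \<in> Spc U C" and "Uni C \<in> P"
  note PD = thick_tensor_idealD[OF Spc_thick[OF P]]
  have "y \<in> P" if "y \<in> compact_objects U C" for y
    by (rule triangulated_iso[OF PD(2) PD(3)[OF that \<open>Uni C \<in> P\<close>] isomorphic_Run[OF compact_Obj[OF that]]])
  then show False using PD(1) Spc_proper[OF P] by blast
qed

end

section \<open>Descent along an abstract etale adjunction\<close>

lemma exact_on_objectsD:
  assumes "exact_on_objects U C D Fo"
  shows "X \<in> Obj C \<Longrightarrow> Fo X \<in> Obj D" "X \<in> Obj C \<Longrightarrow> isomorphic D (Fo (ShO C X)) (ShO D (Fo X))"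
    "zero_object C Z \<Longrightarrow> zero_object D (Fo Z)" "isomorphic C X Y \<Longrightarrow> isomorphic D (Fo X) (Fo Y)"
    "(f, g, h) \<in> Tri C \<Longrightarrow> \<exists>f' g' h'. (f', g', h') \<in> Tri D \<and> Dom D f' = Fo (Dom C f) \<and>
      Cod D f' = Fo (Cod C f) \<and> Cod D g' = Fo (Cod C g)"
  using assms unfolding exact_on_objects_def by blast+

text \<open>
  All that descent needs to know about a finite etale functor \<open>Fo\<close> and its right adjoint \<open>Go\<close>; \<open>a\<close>
  is the object underlying the algebra.
\<close>

locale etale_adjunction =
  C: rigidly_compactly_generated_universe U C + D: rigidly_compactly_generated_universe U D
  for U :: "'u set" and C :: "('o, 'm, 'z) ttcat_scheme" (structure) and D :: "('p, 'n, 'y) ttcat_scheme" +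
  fixes Fo :: "'o \<Rightarrow> 'p" and Go :: "'p \<Rightarrow> 'o" and a :: 'o
  assumes F_exact: "exact_on_objects U C D Fo"
    and G_exact: "exact_on_objects U D C Go"
    and F_retract: "retract C X Y \<Longrightarrow> retract D (Fo X) (Fo Y)"
    and F_Uni: "isomorphic D (Uni D) (Fo (Uni C))"
    and F_TenO: "\<lbrakk>X \<in> Obj C; Y \<in> Obj C\<rbrakk> \<Longrightarrow> isomorphic D (Fo X \<boxtimes>\<^bsub>D\<^esub> Fo Y) (Fo (X \<boxtimes> Y))"
    and F_compact: "c \<in> compact_objects U C \<Longrightarrow> Fo c \<in> compact_objects U D"
    and projection: "\<lbrakk>d \<in> Obj D; c \<in> Obj C\<rbrakk> \<Longrightarrow> isomorphic C (Go (d \<boxtimes>\<^bsub>D\<^esub> Fo c)) (Go d \<boxtimes> c)"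
    and G_F: "c \<in> Obj C \<Longrightarrow> isomorphic C (Go (Fo c)) (a \<boxtimes> c)"
    and a_compact: "a \<in> compact_objects U C"
    and Uni_retract: "retract D (Uni D) (Fo a)"
begin

abbreviation tensor_D (infixr "\<otimes>\<^sub>D" 80) where "X \<otimes>\<^sub>D Y \<equiv> X \<boxtimes>\<^bsub>D\<^esub> Y"

lemmas FD = exact_on_objectsD[OF F_exact]
lemmas GD = exact_on_objectsD[OF G_exact]

text \<open>\<open>Spc_map\<close> in the setting of this locale, where only the object part of the
  functor is fixed.\<close>

definition pull :: "'p set \<Rightarrow> 'o set" where
  "pull R = {X \<in> compact_objects U C. Fo X \<in> R}"

lemma pull_thick:
  assumes R: "thick_tensor_ideal U D R"
  shows "thick_tensor_ideal U C (pull R)"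
proof (rule C.thick_tensor_idealI)
  note RD = D.thick_tensor_idealD[OF R]
  note tr = D.triangulated_iso[OF RD(2)]
  show "pull R \<subseteq> compact_objects U C" by (auto simp: pull_def)
  show "triangulated_subcategory C (pull R)"
  proof (rule triangulated_subcategoryI)
    show "pull R \<subseteq> Obj C" using C.compact_Obj by (auto simp: pull_def)
    show "Z \<in> pull R" if "zero_object C Z" for Z
    proof -
      have "zero_object D (Fo Z)" by (rule FD(3)[OF that])
      then show ?thesis using triangulated_subcategoryD(2)[OF C.compact_triangulated that] triangulated_subcategoryD(2)[OF RD(2)] by (simp add: pull_def)
    qed
    show "Y \<in> pull R" if "X \<in> pull R" "Y \<in> Obj C" "isomorphic C X Y" for X Y
      using C.triangulated_iso[OF C.compact_triangulated _ that(3)] tr[OF _ FD(4)[OF that(3)]] that(1) by (auto simp: pull_def)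
    show "ShO C X \<in> pull R" if "X \<in> pull R" for X
    proof -
      have X: "X \<in> compact_objects U C" "Fo X \<in> R" using that by (auto simp: pull_def)
      note XO = C.compact_Obj[OF X(1)]
      have "ShO D (Fo X) \<in> R" using triangulated_subcategoryD(4)[OF RD(2) FD(1)[OF XO]] X(2) by blast
      then show ?thesis using tr[OF _ D.isomorphic_sym[OF FD(2)[OF XO]]] C.Sh_compact[OF X(1)] by (simp add: pull_def)
    qed
    show "X \<in> pull R" if XO: "X \<in> Obj C" and "ShO C X \<in> pull R" for X
    proof -
      have X: "ShO C X \<in> compact_objects U C" "Fo (ShO C X) \<in> R" using that by (auto simp: pull_def)
      have "ShO D (Fo X) \<in> R" by (rule tr[OF X(2) FD(2)[OF XO]])
      then have "Fo X \<in> R" using triangulated_subcategoryD(4)[OF RD(2) FD(1)[OF XO]] by blast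
      then show ?thesis using C.compact_desuspend[OF X(1) XO] by (simp add: pull_def)
    qed
    show "Cod C g \<in> pull R" if T: "(f, g, h) \<in> Tri C" and "Dom C f \<in> pull R" "Cod C f \<in> pull R" for f g h
    proof -
      obtain f' g' h' where T': "(f', g', h') \<in> Tri D" "Dom D f' = Fo (Dom C f)" "Cod D f' = Fo (Cod C f)" "Cod D g' = Fo (Cod C g)"
        using FD(5)[OF T] by blast
      show ?thesis
        using triangulated_subcategoryD(5)[OF RD(2) T'(1)] triangulated_subcategoryD(5)[OF C.compact_triangulated T] that T'(2-4)
        by (auto simp: pull_def)
    qed
  qed
  show "X \<boxtimes> Y \<in> pull R" if X: "X \<in> compact_objects U C" and "Y \<in> pull R" for X Y
  proof -
    have Y: "Y \<in> compact_objects U C" "Fo Y \<in> R" using that by (auto simp: pull_def)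
    have "Fo (X \<boxtimes> Y) \<in> R"
      by (rule tr[OF RD(3)[OF F_compact[OF X] Y(2)] F_TenO[OF C.compact_Obj[OF X] C.compact_Obj[OF Y(1)]]])
    then show ?thesis using C.compact_TenO[OF X Y(1)] by (simp add: pull_def)
  qed
  show "X \<in> pull R" if "retract C X S" "S \<in> pull R" for X S
    using C.compact_retract[OF that(1), of U] RD(5)[OF F_retract[OF that(1)]] that(2) by (auto simp: pull_def)
qed

lemma pull_prime:
  assumes R: "R \<in> Spc U D" shows "pull R \<in> Spc U C"
proof -
  note RT = D.Spc_thick[OF R]
  note RD = D.thick_tensor_idealD[OF RT]
  note tr = D.triangulated_iso[OF RD(2)]
  have "Uni C \<notin> pull R" using tr[OF _ D.isomorphic_sym[OF F_Uni]] D.Uni_not_in_prime[OF R] by (auto simp: pull_def)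
  then have ne: "pull R \<noteq> compact_objects U C" using C.Uni_compact by blast
  have "X \<in> pull R \<or> Y \<in> pull R" if XY: "X \<in> compact_objects U C" "Y \<in> compact_objects U C" "X \<boxtimes> Y \<in> pull R" for X Y
  proof -
    have "Fo (X \<boxtimes> Y) \<in> R" using XY(3) by (simp add: pull_def)
    then have "Fo X \<otimes>\<^sub>D Fo Y \<in> R"
      by (rule tr[OF _ D.isomorphic_sym[OF F_TenO[OF C.compact_Obj[OF XY(1)] C.compact_Obj[OF XY(2)]]]])
    then show ?thesis using D.Spc_prime[OF R F_compact[OF XY(1)] F_compact[OF XY(2)]] XY(1,2) by (auto simp: pull_def)
  qed
  then show ?thesis using pull_thick[OF RT] ne unfolding Spc_def by blast
qed

lemma preimage_ideal:
  assumes L: "localizing_ideal U D L"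
  shows "localizing_ideal U C {c \<in> Obj C. Fo c \<in> L}"
proof (rule C.localizing_idealI)
  note LD = D.localizing_idealD[OF L]
  show "localizing_subcategory U C {c \<in> Obj C. Fo c \<in> L}"
    by (rule preimage_localizing[OF F_exact LD(1) C.triangulated_category_axioms D.triangulated_category_axioms])
  show "X \<boxtimes> Y \<in> {c \<in> Obj C. Fo c \<in> L}" if X: "X \<in> Obj C" and Y: "Y \<in> {c \<in> Obj C. Fo c \<in> L}" for X Y
  proof -
    have YO: "Y \<in> Obj C" and YL: "Fo Y \<in> L" using Y by auto
    have "Fo (X \<boxtimes> Y) \<in> L" by (rule LD(6)[OF LD(3)[OF FD(1)[OF X] YL] F_TenO[OF X YO]])
    then show ?thesis using X YO by simp
  qed
qed

text \<open>Membership of \<open>Go d\<close> in \<open>L\<close> is visibly stable only under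
  tensoring with images of \<open>Fo\<close>, by the projection formula. Quantifying over all
  \<open>d'\<close> gives the largest ideal of \<open>D\<close> inside that class.\<close>

lemma restriction_ideal:
  assumes L: "localizing_ideal U C L"
  shows "localizing_ideal U D {d \<in> Obj D. \<forall>d' \<in> Obj D. Go (d \<otimes>\<^sub>D d') \<in> L}"
proof (rule D.localizing_idealI)
  note LD = C.localizing_idealD[OF L]
  have L1: "localizing_subcategory U D {d \<in> Obj D. Go d \<in> L}"
    by (rule preimage_localizing[OF G_exact LD(1) D.triangulated_category_axioms C.triangulated_category_axioms])
  have "localizing_subcategory U D (\<Inter>((\<lambda>d'. {d \<in> Obj D. d \<otimes>\<^sub>D d' \<in> {d \<in> Obj D. Go d \<in> L}}) ` Obj D))"
    by (rule D.Inter_localizing) (use D.TenO_preimage_localizing[OF L1] D.Uni_Obj in blast)+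
  moreover have "(\<Inter>((\<lambda>d'. {d \<in> Obj D. d \<otimes>\<^sub>D d' \<in> {d \<in> Obj D. Go d \<in> L}}) ` Obj D))
    = {d \<in> Obj D. \<forall>d' \<in> Obj D. Go (d \<otimes>\<^sub>D d') \<in> L}" using D.Uni_Obj D.TenO_Obj by blast
  ultimately show "localizing_subcategory U D {d \<in> Obj D. \<forall>d' \<in> Obj D. Go (d \<otimes>\<^sub>D d') \<in> L}" by simp
  show "X \<otimes>\<^sub>D Y \<in> {d \<in> Obj D. \<forall>d' \<in> Obj D. Go (d \<otimes>\<^sub>D d') \<in> L}"
    if X: "X \<in> Obj D" and Y: "Y \<in> {d \<in> Obj D. \<forall>d' \<in> Obj D. Go (d \<otimes>\<^sub>D d') \<in> L}" for X Y
  proof -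
    have YO: "Y \<in> Obj D" using Y by simp
    have "Go ((X \<otimes>\<^sub>D Y) \<otimes>\<^sub>D d') \<in> L" if d': "d' \<in> Obj D" for d'
    proof -
      have "Go (Y \<otimes>\<^sub>D (X \<otimes>\<^sub>D d')) \<in> L" using Y X d' by simp
      moreover have "isomorphic D (Y \<otimes>\<^sub>D (X \<otimes>\<^sub>D d')) ((X \<otimes>\<^sub>D Y) \<otimes>\<^sub>D d')"
        by (rule D.isomorphic_trans[OF D.isomorphic_left_commute[OF YO X d'] D.isomorphic_sym[OF D.isomorphic_Asc[OF X YO d']]])
      ultimately show ?thesis using LD(6) GD(4) by blast
    qed
    then show ?thesis using X YO by simp
  qed
qed

theorem minimality_descends:
  assumes N: "noetherian_space (Spc_topology U C)" and P: "P \<in> Spc U D"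
    and fibre: "\<And>R. R \<in> Spc U D \<Longrightarrow> pull R = pull P \<Longrightarrow> R = P"
    and min: "minimality_at U D P"
  shows "minimality_at U C (pull P)"
proof -
  define Q where "Q = pull P"
  have Q: "Q \<in> Spc U C" unfolding Q_def by (rule pull_prime[OF P])
  note PD = D.thick_tensor_idealD[OF D.Spc_thick[OF P]] and QD = C.thick_tensor_idealD[OF C.Spc_thick[OF Q]]
  obtain x e1 f1 e2 f2 Y1 Y2 where x: "x \<in> compact_objects U C" "x \<notin> Q" "supp U C x = Y1"
      "\<And>R. R \<in> Spc U C \<Longrightarrow> x \<notin> R \<longleftrightarrow> R \<subseteq> Q"
    and i1: "is_idempotent_triangle U C Y1 e1 f1" and i2: "is_idempotent_triangle U C Y2 e2 f2"
    and K2: "compact_supported U C Y2 = Q" and ga: "is_gamma U C Q (e1 \<boxtimes> f2)"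
    by (rule C.gamma_at_point[OF N Q]) blast
  note I1 = C.idempotent_triangleD[OF i1] and I2 = C.idempotent_triangleD[OF i2]
  define g where "g = e1 \<boxtimes> f2"
  have O: "x \<in> Obj C" "e1 \<in> Obj C" "f1 \<in> Obj C" "f2 \<in> Obj C" "g \<in> Obj C" "a \<in> Obj C"
    using C.compact_Obj[OF x(1)] C.compact_Obj[OF a_compact] I1 I2 by (auto simp: g_def)
  have FO: "Fo x \<in> Obj D" "Fo e1 \<in> Obj D" "Fo f2 \<in> Obj D" "Fo g \<in> Obj D" using FD(1) O by auto
  \<comment> \<open>The hypothesis supplies some representative of g(P); about its Thomason sets
    \<open>Z1\<close> and \<open>Z2\<close> it is only known that they cut out
    \<open>P\<close>.\<close>
  obtain g' where g': "is_gamma U D P g'" "minimal_localizing_ideal U D (Loc_tensor U D {g'})"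
    using min unfolding minimality_at_def by blast
  then obtain Z1 Z2 d1 h1 d2 h2 where Z: "Thomason (Spc_topology U D) Z1" "{P} = Z1 \<inter> (Spc U D - Z2)"
    and j1: "is_idempotent_triangle U D Z1 d1 h1" and j2: "is_idempotent_triangle U D Z2 d2 h2" and g'_eq: "g' = d1 \<otimes>\<^sub>D h2"
    unfolding is_gamma_def by blast
  note J1 = D.idempotent_triangleD[OF j1] and J2 = D.idempotent_triangleD[OF j2]
  have g'O: "g' \<in> Obj D" unfolding g'_eq using J1 J2 by auto
  have gmin: "\<And>L. localizing_ideal U D L \<Longrightarrow> L \<subseteq> Loc_tensor U D {g'} \<Longrightarrow> L = {Z. zero_object D Z} \<or> L = Loc_tensor U D {g'}"
    using g'(2) unfolding minimal_localizing_ideal_def by blast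
  have aQ: "a \<notin> Q"
  proof
    assume "a \<in> Q"
    then have "Uni D \<in> P" using PD(5)[OF Uni_retract] by (simp add: Q_def pull_def)
    then show False using D.Uni_not_in_prime[OF P] by blast
  qed
  have e1_mem: "e1 \<in> L" if "localizing_ideal U C L" "x \<in> L" for L
    using C.Loc_supp_subset[OF that(1) x(1) that(2)] I1(3) x(3) by blast
  \<comment> \<open>A prime containing the annihilator of \<open>T\<close> modulo \<open>L\<close>
    but not \<open>x\<close> lies inside \<open>Q\<close> by the choice of \<open>x\<close>; yet it
    contains \<open>a\<close>, which is not in \<open>Q\<close>.\<close>
  have x_mem: "x \<boxtimes> T \<in> L" if L: "localizing_ideal U C L" and T: "T \<in> Obj C" and aT: "a \<boxtimes> T \<in> L" for L T
  proof (rule ccontr)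
    assume "x \<boxtimes> T \<notin> L"
    then obtain R where R: "R \<in> Spc U C" "\<And>y. y \<in> compact_objects U C \<Longrightarrow> y \<boxtimes> T \<in> L \<Longrightarrow> y \<in> R" "x \<notin> R"
      by (rule C.prime_over_annihilator[OF L T x(1)]) blast
    then show False using x(4)[OF R(1)] R(2)[OF a_compact aT] aQ by blast
  qed
  \<comment> \<open>Serves both absorptions of \<open>Fo g\<close>. With \<open>V\<close> the unit
    and \<open>z\<close> in \<open>P\<close> it will show that \<open>d2\<close> annihilates
    \<open>Fo g\<close>; with \<open>z\<close> the unit and \<open>V = h1\<close> it will show the
    same for \<open>h1\<close>. The condition \<open>zV\<close> is what rules out that the prime
    found below is \<open>P\<close>.\<close>
  have vanish: "zero_object D ((z \<otimes>\<^sub>D V) \<otimes>\<^sub>D Fo g)"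
    if z: "z \<in> compact_objects U D" and V: "V \<in> Obj D"
      and zV: "z \<in> P \<or> (\<exists>w \<in> compact_objects U D. w \<notin> P \<and> zero_object D (w \<otimes>\<^sub>D V))" for z V
  proof -
    let ?T = "V \<otimes>\<^sub>D Fo f2"
    have zO: "z \<in> Obj D" using D.compact_Obj[OF z] .
    have TO: "?T \<in> Obj D" "z \<otimes>\<^sub>D ?T \<in> Obj D" "z \<otimes>\<^sub>D V \<in> Obj D" using V FO zO by auto
    have xz: "Fo x \<otimes>\<^sub>D z \<in> compact_objects U D" by (rule D.compact_TenO[OF F_compact[OF x(1)] z])
    have "(Fo x \<otimes>\<^sub>D z) \<otimes>\<^sub>D ?T \<in> {Z. zero_object D Z}"
    proof (rule ccontr)
      assume "(Fo x \<otimes>\<^sub>D z) \<otimes>\<^sub>D ?T \<notin> {Z. zero_object D Z}"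
      then obtain R where R: "R \<in> Spc U D" "\<And>y. y \<in> compact_objects U D \<Longrightarrow> y \<otimes>\<^sub>D ?T \<in> {Z. zero_object D Z} \<Longrightarrow> y \<in> R"
          "Fo x \<otimes>\<^sub>D z \<notin> R"
        by (rule D.prime_over_annihilator[OF D.zero_localizing_ideal TO(1) xz]) blast
      note RD = D.thick_tensor_idealD[OF D.Spc_thick[OF R(1)]]
      have xR: "Fo x \<notin> R" and zR: "z \<notin> R" using R(3) RD(3)[OF F_compact[OF x(1)]] RD(4)[OF z] by blast+
      \<comment> \<open>The prime \<open>R\<close> avoids \<open>Fo x\<close>, so it lies over a
        subset of \<open>Q\<close>. Since \<open>f2\<close> annihilates \<open>Q\<close>, it also
        contains every \<open>Fo q\<close>, so it lies over \<open>Q\<close> exactly and the fibre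
        condition gives \<open>R = P\<close>.\<close>
      have "q \<in> pull R" if q: "q \<in> Q" for q
      proof -
        have qc: "q \<in> compact_objects U C" using QD(1) q by blast
        note qO = C.compact_Obj[OF qc]
        have "zero_object C (f2 \<boxtimes> q)" by (rule I2(4)) (simp add: K2 q)
        then have "zero_object C (q \<boxtimes> f2)" by (rule C.zero_object_iso[OF _ C.isomorphic_Swp[OF O(4) qO]])
        then have "zero_object D (Fo (q \<boxtimes> f2))" by (rule FD(3))
        then have "zero_object D (Fo q \<otimes>\<^sub>D Fo f2)" by (rule D.zero_object_iso[OF _ D.isomorphic_sym[OF F_TenO[OF qO O(4)]]])
        then have "zero_object D (V \<otimes>\<^sub>D (Fo q \<otimes>\<^sub>D Fo f2))" by (rule D.TenO_zero(2)[OF _ V])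
        then have "zero_object D (Fo q \<otimes>\<^sub>D ?T)" by (rule D.zero_object_iso[OF _ D.isomorphic_left_commute[OF V FD(1)[OF qO] FO(3)]])
        then have "Fo q \<in> R" using R(2)[OF F_compact[OF qc]] by blast
        then show ?thesis using qc by (simp add: pull_def)
      qed
      then have "Q \<subseteq> pull R" by blast
      moreover have "pull R \<subseteq> Q" using x(4)[OF pull_prime[OF R(1)]] xR by (auto simp: pull_def)
      ultimately have RP: "R = P" using fibre[OF R(1)] unfolding Q_def by blast
      then obtain w where w: "w \<in> compact_objects U D" "w \<notin> P" "zero_object D (w \<otimes>\<^sub>D V)" using zV zR by blast
      have "zero_object D ((w \<otimes>\<^sub>D V) \<otimes>\<^sub>D Fo f2)" by (rule D.TenO_zero(1)[OF w(3) FO(3)])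
      then have "zero_object D (w \<otimes>\<^sub>D ?T)" by (rule D.zero_object_iso[OF _ D.isomorphic_Asc[OF D.compact_Obj[OF w(1)] V FO(3)]])
      then show False using R(2)[OF w(1)] w(2) RP by blast
    qed
    then have "zero_object D ((Fo x \<otimes>\<^sub>D z) \<otimes>\<^sub>D ?T)" by simp
    then have x0: "zero_object D (Fo x \<otimes>\<^sub>D (z \<otimes>\<^sub>D ?T))" by (rule D.zero_object_iso[OF _ D.isomorphic_Asc[OF FO(1) zO TO(1)]])
    \<comment> \<open>So far \<open>Fo x\<close> annihilates the product. The objects of
      \<open>C\<close> whose image does so form a localizing ideal, and \<open>e1\<close> lies in
      every localizing ideal containing \<open>x\<close>.\<close>
    have LI: "localizing_ideal U C {c \<in> Obj C. Fo c \<in> {W \<in> Obj D. W \<otimes>\<^sub>D (z \<otimes>\<^sub>D ?T) \<in> {Z. zero_object D Z}}}"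
      by (rule preimage_ideal[OF D.colon_localizing_ideal[OF D.zero_localizing_ideal TO(2)]])
    have "e1 \<in> {c \<in> Obj C. Fo c \<in> {W \<in> Obj D. W \<otimes>\<^sub>D (z \<otimes>\<^sub>D ?T) \<in> {Z. zero_object D Z}}}"
      by (rule e1_mem[OF LI]) (use O(1) FO(1) x0 in simp)
    then have e0: "zero_object D (Fo e1 \<otimes>\<^sub>D (z \<otimes>\<^sub>D ?T))" by simp
    note [trans] = D.isomorphic_trans
    have "isomorphic D (Fo e1 \<otimes>\<^sub>D (z \<otimes>\<^sub>D ?T)) (Fo e1 \<otimes>\<^sub>D ((z \<otimes>\<^sub>D V) \<otimes>\<^sub>D Fo f2))"
      by (rule D.isomorphic_TenO[OF D.isomorphic_refl[OF FO(2)] D.isomorphic_sym[OF D.isomorphic_Asc[OF zO V FO(3)]]])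
    also have "isomorphic D \<dots> ((z \<otimes>\<^sub>D V) \<otimes>\<^sub>D (Fo e1 \<otimes>\<^sub>D Fo f2))" by (rule D.isomorphic_left_commute[OF FO(2) TO(3) FO(3)])
    also have "isomorphic D \<dots> ((z \<otimes>\<^sub>D V) \<otimes>\<^sub>D Fo g)"
      unfolding g_def by (rule D.isomorphic_TenO[OF D.isomorphic_refl[OF TO(3)] F_TenO[OF O(2,4)]])
    finally show ?thesis by (rule D.zero_object_iso[OF e0])
  qed
  have d2: "zero_object D (d2 \<otimes>\<^sub>D Fo g)"
  proof -
    have LI: "localizing_ideal U D {W \<in> Obj D. W \<otimes>\<^sub>D Fo g \<in> {Z. zero_object D Z}}"
      by (rule D.colon_localizing_ideal[OF D.zero_localizing_ideal FO(4)])
    have "y \<in> {W \<in> Obj D. W \<otimes>\<^sub>D Fo g \<in> {Z. zero_object D Z}}" if y: "y \<in> compact_supported U D Z2" for y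
    proof -
      have yc: "y \<in> compact_objects U D" and "supp U D y \<subseteq> Z2" using y by (auto simp: compact_supported_def)
      then have "y \<in> P" using Z(2) by (auto simp: supp_def)
      then have "zero_object D ((y \<otimes>\<^sub>D Uni D) \<otimes>\<^sub>D Fo g)" using vanish[OF yc D.Uni_Obj] by blast
      then have "zero_object D (y \<otimes>\<^sub>D Fo g)"
        by (rule D.zero_object_iso[OF _ D.isomorphic_TenO[OF D.isomorphic_Run[OF D.compact_Obj[OF yc]] D.isomorphic_refl[OF FO(4)]]])
      then show ?thesis using D.compact_Obj[OF yc] by simp
    qed
    then have "Loc U D (compact_supported U D Z2) \<subseteq> {W \<in> Obj D. W \<otimes>\<^sub>D Fo g \<in> {Z. zero_object D Z}}"
      by (intro Loc_minimal D.localizing_idealD(1)[OF LI]) blast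
    then show ?thesis using J2(3) by blast
  qed
  have h1: "zero_object D (h1 \<otimes>\<^sub>D Fo g)"
  proof -
    \<comment> \<open>One of the closed sets making up \<open>Z1\<close> contains \<open>P\<close>
      and is the support of a compact \<open>w\<close>. Then \<open>w\<close> is outside
      \<open>P\<close> and annihilated by \<open>h1\<close>, because its support lies in
      \<open>Z1\<close>.\<close>
    obtain K where K: "\<And>Y. Y \<in> K \<Longrightarrow> closedin (Spc_topology U D) Y \<and>
        compactin (Spc_topology U D) (topspace (Spc_topology U D) - Y)" "Z1 = \<Union>K"
      using Z(1) unfolding Thomason_def by blast
    have "P \<in> \<Union>K" using Z(2) K(2) by blast
    then obtain Y where Y: "closedin (Spc_topology U D) Y" "compactin (Spc_topology U D) (topspace (Spc_topology U D) - Y)" "P \<in> Y" "Y \<subseteq> Z1"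
      using K by blast
    obtain w where w: "w \<in> compact_objects U D" "supp U D w = Y" by (rule D.closed_qc_supp[OF Y(1,2)])
    have "w \<notin> P" using w(2) Y(3) by (auto simp: supp_def)
    moreover have "zero_object D (h1 \<otimes>\<^sub>D w)" by (rule J1(4)) (use w Y(4) in \<open>simp add: compact_supported_def\<close>)
    then have "zero_object D (w \<otimes>\<^sub>D h1)" by (rule D.zero_object_iso[OF _ D.isomorphic_Swp[OF J1(2) D.compact_Obj[OF w(1)]]])
    ultimately have "zero_object D ((Uni D \<otimes>\<^sub>D h1) \<otimes>\<^sub>D Fo g)" using vanish[OF D.Uni_compact J1(2)] w(1) by blast
    then show ?thesis by (rule D.zero_object_iso[OF _ D.isomorphic_TenO[OF D.isomorphic_Lun[OF J1(2)] D.isomorphic_refl[OF FO(4)]]])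
  qed
  have LI': "localizing_ideal U D (Loc_tensor U D {g'})" by (rule D.Loc_tensor_ideal) (use g'O in simp)
  note LD' = D.localizing_idealD[OF LI']
  \<comment> \<open>As \<open>d2\<close> and \<open>h1\<close> annihilate \<open>Fo g\<close>, the
    complementary idempotents \<open>h2\<close> and \<open>d1\<close> act on it as the identity, so
    \<open>Fo g\<close> is isomorphic to \<open>g' \<otimes>\<^sub>D Fo g\<close>.\<close>
  have Fg: "Fo g \<in> Loc_tensor U D {g'}"
  proof -
    note [trans] = D.isomorphic_trans
    have "isomorphic D (g' \<otimes>\<^sub>D Fo g) (d1 \<otimes>\<^sub>D (h2 \<otimes>\<^sub>D Fo g))" unfolding g'_eq by (rule D.isomorphic_Asc[OF J1(1) J2(2) FO(4)])
    also have "isomorphic D \<dots> (d1 \<otimes>\<^sub>D Fo g)" by (rule D.isomorphic_TenO[OF D.isomorphic_refl[OF J1(1)] J2(6)[OF FO(4) d2]])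
    also have "isomorphic D \<dots> (Fo g)" by (rule J1(5)[OF FO(4) h1])
    finally show ?thesis by (rule LD'(6)[OF LD'(4)[OF FO(4) D.Loc_tensor_mem[of g' "{g'}", simplified]]])
  qed
  have gI: "localizing_ideal U C (Loc_tensor U C {g})" by (rule C.Loc_tensor_ideal) (use O in simp)
  have gm: "g \<in> Loc_tensor U C {g}" by (rule C.Loc_tensor_mem) simp
  \<comment> \<open>If \<open>g\<close> were zero, then so would be \<open>f2 \<boxtimes> x\<close>,
    since \<open>e1\<close> acts on \<open>x\<close> as the identity. Hence \<open>x\<close> would
    lie in the localizing subcategory generated by \<open>Q\<close> and, being compact, would be a
    retract of an object of \<open>Q\<close>.\<close>
  have g0: "\<not> zero_object C g"
  proof
    assume g0: "zero_object C g"
    have "zero_object C (f1 \<boxtimes> x)" by (rule I1(4)) (use x in \<open>simp add: compact_supported_def\<close>)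
    note e1x = I1(5)[OF O(1) this]
    note [trans] = C.isomorphic_trans
    have "isomorphic C (g \<boxtimes> x) (e1 \<boxtimes> (f2 \<boxtimes> x))" unfolding g_def by (rule C.isomorphic_Asc[OF O(2,4,1)])
    also have "isomorphic C \<dots> (f2 \<boxtimes> (e1 \<boxtimes> x))" by (rule C.isomorphic_left_commute[OF O(2,4,1)])
    also have "isomorphic C \<dots> (f2 \<boxtimes> x)" by (rule C.isomorphic_TenO[OF C.isomorphic_refl[OF O(4)] e1x])
    finally have "zero_object C (f2 \<boxtimes> x)" by (rule C.zero_object_iso[OF C.TenO_zero(1)[OF g0 O(1)]])
    then have "x \<in> Loc U C Q" using I2(7)[OF O(1)] K2 by simp
    then obtain k where "k \<in> Q" "retract C x k" by (rule C.compact_in_Loc[OF QD(2,1) x(1)]) blast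
    then show False using QD(5) x(2) by blast
  qed
  \<comment> \<open>The localizing subcategory on which \<open>e1\<close> acts as the identity is an
    ideal and contains \<open>e1\<close>, hence \<open>g\<close>.\<close>
  have e1g: "isomorphic C (e1 \<boxtimes> t) t" if t: "t \<in> Loc_tensor U C {g}" for t
  proof -
    note KD = C.thick_tensor_idealD[OF C.compact_supported_thick[of Y1]]
    have LI: "localizing_ideal U C (Loc U C (compact_supported U C Y1))" by (rule C.Loc_ideal[OF KD(1,3)])
    note LD = C.localizing_idealD[OF LI]
    have "g \<in> Loc U C (compact_supported U C Y1)" unfolding g_def by (rule LD(4)[OF O(4) I1(3)])
    then have tL: "t \<in> Loc U C (compact_supported U C Y1)" using C.Loc_tensor_least[OF LI, of "{g}"] t by blast
    note tO = LD(5)[OF tL]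
    show ?thesis by (rule I1(5)[OF tO]) (use I1(7)[OF tO] tL in blast)
  qed
  have minL: "L = Loc_tensor U C {g}"
    if L: "localizing_ideal U C L" and sub: "L \<subseteq> Loc_tensor U C {g}" and ne: "L \<noteq> {Z. zero_object C Z}" for L
  proof -
    note LD = C.localizing_idealD[OF L]
    have "{Z. zero_object C Z} \<subseteq> L" using triangulated_subcategoryD(2)[OF LD(2)] by blast
    then obtain t where t: "t \<in> L" "\<not> zero_object C t" using ne by blast
    have tO: "t \<in> Obj C" by (rule LD(5)[OF t(1)])
    have tg: "t \<in> Loc_tensor U C {g}" using sub t(1) by blast
    \<comment> \<open>Conservativity of \<open>Fo\<close> on the ideal generated by
      \<open>g\<close>: \<open>Go (Fo t)\<close> is \<open>a \<boxtimes> t\<close>, and if that is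
      zero, then \<open>x\<close>, hence \<open>e1\<close>, annihilates \<open>t\<close>, although
      \<open>e1 \<boxtimes> t\<close> is \<open>t\<close>.\<close>
    have at0: "\<not> zero_object C (a \<boxtimes> t)"
    proof
      assume "zero_object C (a \<boxtimes> t)"
      then have xt: "x \<boxtimes> t \<in> {Z. zero_object C Z}" by (intro x_mem[OF C.zero_localizing_ideal tO]) simp
      have "e1 \<in> {c \<in> Obj C. c \<boxtimes> t \<in> {Z. zero_object C Z}}"
        by (rule e1_mem[OF C.colon_localizing_ideal[OF C.zero_localizing_ideal tO]]) (use O(1) xt in simp)
      then have "zero_object C (e1 \<boxtimes> t)" by simp
      then have "zero_object C t" by (rule C.zero_object_iso[OF _ e1g[OF tg]])
      then show False using t(2) by blast
    qed
    have Ft0: "\<not> zero_object D (Fo t)" using C.zero_object_iso[OF GD(3) G_F[OF tO]] at0 by blast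
    have FtO: "Fo t \<in> Obj D" by (rule FD(1)[OF tO])
    have "Loc_tensor U C {g} \<subseteq> {c \<in> Obj C. Fo c \<in> Loc_tensor U D {g'}}"
      by (rule C.Loc_tensor_least[OF preimage_ideal[OF LI']]) (use O(5) Fg in simp)
    then have Ftg: "Fo t \<in> Loc_tensor U D {g'}" using tg by blast
    have FtI: "localizing_ideal U D (Loc_tensor U D {Fo t})" by (rule D.Loc_tensor_ideal) (use FtO in simp)
    have "Loc_tensor U D {Fo t} \<subseteq> Loc_tensor U D {g'}" by (rule D.Loc_tensor_least[OF LI']) (use Ftg in simp)
    moreover have "Fo t \<in> Loc_tensor U D {Fo t}" by (rule D.Loc_tensor_mem) simp
    ultimately have "Loc_tensor U D {Fo t} = Loc_tensor U D {g'}" using gmin[OF FtI] Ft0 by blast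
    then have Fgt: "Fo g \<in> Loc_tensor U D {Fo t}" using Fg by simp
    \<comment> \<open>\<open>Go\<close> carries the whole ideal generated by \<open>Fo t\<close>
      into \<open>L\<close>, because \<open>Go (Fo t \<otimes>\<^sub>D d')\<close> is
      \<open>Go d' \<boxtimes> t\<close> by the projection formula.\<close>
    let ?N = "{d \<in> Obj D. \<forall>d' \<in> Obj D. Go (d \<otimes>\<^sub>D d') \<in> L}"
    have "Go (Fo t \<otimes>\<^sub>D d') \<in> L" if d': "d' \<in> Obj D" for d'
    proof -
      have i: "isomorphic C (Go d' \<boxtimes> t) (Go (Fo t \<otimes>\<^sub>D d'))"
        by (rule C.isomorphic_trans[OF C.isomorphic_sym[OF projection[OF d' tO]] GD(4)[OF D.isomorphic_Swp[OF d' FtO]]])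
      show ?thesis by (rule LD(6)[OF LD(3)[OF GD(1)[OF d'] t(1)] i])
    qed
    then have "Loc_tensor U D {Fo t} \<subseteq> ?N" by (intro D.Loc_tensor_least[OF restriction_ideal[OF L]]) (use FtO in simp)
    then have "Go (Fo g \<otimes>\<^sub>D Uni D) \<in> L" using Fgt D.Uni_Obj by blast
    then have "Go (Fo g) \<in> L" by (rule LD(6)[OF _ GD(4)[OF D.isomorphic_Run[OF FO(4)]]])
    then have "a \<boxtimes> g \<in> L" by (rule LD(6)[OF _ G_F[OF O(5)]])
    then have xg: "x \<boxtimes> g \<in> L" by (rule x_mem[OF L O(5)])
    have "e1 \<in> {c \<in> Obj C. c \<boxtimes> g \<in> L}" by (rule e1_mem[OF C.colon_localizing_ideal[OF L O(5)]]) (use O(1) xg in simp)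
    then have "e1 \<boxtimes> g \<in> L" by simp
    then have "g \<in> L" by (rule LD(6)[OF _ e1g[OF gm]])
    then have "Loc_tensor U C {g} \<subseteq> L" by (intro C.Loc_tensor_least[OF L]) simp
    then show ?thesis using sub by blast
  qed
  have "Loc_tensor U C {g} \<noteq> {Z. zero_object C Z}" using gm g0 by blast
  then have "minimal_localizing_ideal U C (Loc_tensor U C {g})"
    unfolding minimal_localizing_ideal_def using gI minL by blast
  then show ?thesis using ga unfolding minimality_at_def Q_def g_def by blast
qed

end

section \<open>Finite etale functors\<close>

lemma functor_comp:
  assumes "is_functor C D Fo Fa" "is_functor D E Go Ga"
  shows "is_functor C E (Go \<circ> Fo) (Ga \<circ> Fa)"
proof -
  note F = assms(1)[unfolded is_functor_def] and G = assms(2)[unfolded is_functor_def]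
  show ?thesis unfolding is_functor_def
  proof (intro conjI ballI allI)
    fix X Y f assume f: "f \<in> Hom C X Y"
    then have Ff: "Fa f \<in> Hom D (Fo X) (Fo Y)" using F by blast
    then show "(Ga \<circ> Fa) f \<in> Hom E ((Go \<circ> Fo) X) ((Go \<circ> Fo) Y)" using G by simp
    fix Z g assume g: "g \<in> Hom C Y Z"
    then have Fg: "Fa g \<in> Hom D (Fo Y) (Fo Z)" using F by blast
    have "Fa (g \<cdot>\<^bsub>C\<^esub> f) = Fa g \<cdot>\<^bsub>D\<^esub> Fa f" using F f g by blast
    moreover have "Ga (Fa g \<cdot>\<^bsub>D\<^esub> Fa f) = Ga (Fa g) \<cdot>\<^bsub>E\<^esub> Ga (Fa f)" using G Ff Fg by blast
    ultimately show "(Ga \<circ> Fa) (g \<cdot>\<^bsub>C\<^esub> f) = (Ga \<circ> Fa) g \<cdot>\<^bsub>E\<^esub> (Ga \<circ> Fa) f" by simp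
  qed (use F G in auto)
qed

lemma functor_retract:
  assumes "is_functor C D Fo Fa" "retract C X Y" "category C"
  shows "retract D (Fo X) (Fo Y)"
proof -
  interpret C: category C by fact
  note FD = functorD[OF assms(1)]
  obtain i p where ip: "i \<in> Hom C X Y" "p \<in> Hom C Y X" "p \<cdot>\<^bsub>C\<^esub> i = Ide C X"
    using assms(2) unfolding retract_def by blast
  have "Fa p \<cdot>\<^bsub>D\<^esub> Fa i = Fa (p \<cdot>\<^bsub>C\<^esub> i)" using FD(7)[of i p] HomD[OF ip(1)] HomD[OF ip(2)] by simp
  also have "\<dots> = Ide D (Fo X)" unfolding ip(3) by (rule FD(2)[OF C.Hom_Obj(1)[OF ip(1)]])
  finally show ?thesis unfolding retract_def using FD(3)[OF ip(1)] FD(3)[OF ip(2)] by blast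
qed

lemma equivalence_retractD:
  assumes E: "is_equivalence C D Fo Fa" and X: "X \<in> Obj C" and Y: "Y \<in> Obj C" and r: "retract D (Fo X) (Fo Y)"
    and "category C"
  shows "retract C X Y"
proof -
  interpret C: category C by fact
  have FD: "is_functor C D Fo Fa" using E by (simp add: is_equivalence_def)
  note FD = functorD[OF FD]
  obtain i p where ip: "i \<in> Hom D (Fo X) (Fo Y)" "p \<in> Hom D (Fo Y) (Fo X)" "p \<cdot>\<^bsub>D\<^esub> i = Ide D (Fo X)"
    using r unfolding retract_def by blast
  obtain i' where i': "i' \<in> Hom C X Y" "Fa i' = i" by (rule equivalence_lift[OF E X Y ip(1)])
  obtain p' where p': "p' \<in> Hom C Y X" "Fa p' = p" by (rule equivalence_lift[OF E Y X ip(2)])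
  have "Fa (p' \<cdot>\<^bsub>C\<^esub> i') = Fa (Ide C X)"
    using FD(7)[of i' p'] HomD[OF i'(1)] HomD[OF p'(1)] i'(2) p'(2) ip(3) FD(2)[OF X] by simp
  then have "p' \<cdot>\<^bsub>C\<^esub> i' = Ide C X"
    by (rule equivalence_faithful[OF E C.Comp_Hom[OF i'(1) p'(1)] C.Ide_Hom[OF X] _ assms(5)])
  then show ?thesis unfolding retract_def using i' p' by blast
qed

section \<open>The adjunction of a finite etale functor\<close>

locale finite_etale_model =
  algebra_modules C A + C: rigidly_compactly_generated_universe U C +
  D: rigidly_compactly_generated_universe U D + F: tensor_triangulated_functor C D F +
  E: tensor_triangulated_functor D "Modules C A" E
  for U :: "'u set" and C :: "('o, 'm, 'z) ttcat_scheme" (structure) and D :: "('p, 'n, 'y) ttcat_scheme"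
    and A :: "('o, 'm) alg" and F :: "('o, 'm, 'p, 'n) ttfun"
    and E :: "('p, 'n, 'o \<times> 'm, ('o, 'm) module_arrow) ttfun" +
  assumes F_coproducts: "preserves_small_coproducts U C D F"
    and separable: "separable C A"
    and Und_compact: "Und A \<in> compact_objects U C"
    and E_equivalence: "is_equivalence D (Modules C A) (FunO E) (FunA E)"
    and EF: "c \<in> Obj C \<Longrightarrow> isomorphic (Modules C A) (FunO E (FunO F c)) (free_module C A c)"
begin

abbreviation "Go \<equiv> fst \<circ> FunO E"
abbreviation "Ga \<equiv> und \<circ> FunA E"

lemma E_functor: "is_functor D M (FunO E) (FunA E)"
  using E.Fun_additive by (simp add: is_additive_functor_def)

lemma G_functor: "is_functor D C Go Ga"
  by (rule functor_comp[OF E_functor forget_functor])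

text \<open>An arrow equal to its own double is zero. Arguing in \<open>C\<close> with the
  underlying arrows, one need not know that the arrows of \<open>Modules C A\<close> form
  groups.\<close>

lemma G_Zer: "X \<in> Obj D \<Longrightarrow> Y \<in> Obj D \<Longrightarrow> Ga (Zer D X Y) = Zer C (Go X) (Go Y)"
proof -
  assume X: "X \<in> Obj D" and Y: "Y \<in> Obj D"
  let ?z = "Zer D X Y"
  note ty = D.Zer_typ[OF X Y]
  have z: "?z \<in> Hom D X Y" using ty by (simp add: Hom_iff)
  have "FunA E \<in> hom (hom_group D X Y) (hom_group M (FunO E X) (FunO E Y))"
    using E.Fun_additive X Y by (simp add: is_additive_functor_def)
  from hom_mult[OF this, of ?z ?z] z have "FunA E (Add D ?z ?z) = Add M (FunA E ?z) (FunA E ?z)" by (simp add: hom_group_def)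
  moreover have "Add D ?z ?z = ?z" using ty by simp
  ultimately have "Add C (Ga ?z) (Ga ?z) = Ga ?z" by (metis Modules_simps(8) und_simp comp_apply)
  moreover note HomD[OF functorD(3)[OF G_functor z]]
  ultimately show "Ga ?z = Zer C (Go X) (Go Y)" using Add_self_Zer[of "Ga ?z"] by simp
qed

text \<open>The equivalence takes the coproduct to one of modules, and forgetting the action
  preserves it; the coproduct of underlying objects that this requires exists because the index set
  is small.\<close>

lemma G_coproduct:
  assumes I: "I \<subseteq> U" "small U I" and X: "\<And>i. i \<in> I \<Longrightarrow> X i \<in> Obj D" and S: "is_coproduct D I X S inc"
  shows "is_coproduct C I (Go \<circ> X) (Go S) (Ga \<circ> inc)"
proof -
  have m: "(FunO E \<circ> X) i \<in> modules C A" if "i \<in> I" for i using functorD(1)[OF E_functor X[OF that]] by simp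
  have cop: "is_coproduct M I (FunO E \<circ> X) (FunO E S) (FunA E \<circ> inc)"
    by (rule equivalence_coproduct[OF E_equivalence D.category_axioms Modules_category S X])
  have "\<forall>i\<in>I. (fst \<circ> (FunO E \<circ> X)) i \<in> Obj C" using functorD(1)[OF G_functor X] by simp
  then obtain S0 inc0 where "is_coproduct C I (fst \<circ> (FunO E \<circ> X)) S0 inc0"
    using C.ex_small_coproduct[OF I] by blast
  from modules_coproduct[OF cop m this] show ?thesis by (simp add: comp_assoc)
qed

text \<open>A triangle of modules is distinguished exactly if its underlying triangle is, so
  exactness of \<open>Go\<close> is read off from that of \<open>E\<close>; likewise the shift of a
  module has the shifted underlying object.\<close>

lemma G_exact: "exact_on_objects U D C Go"
  unfolding exact_on_objects_def
proof (intro conjI ballI allI impI)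
  fix X assume X: "X \<in> Obj D"
  show "Go X \<in> Obj C" by (rule functorD(1)[OF G_functor X])
  have "und (FunSh E X) \<in> Iso C (fst (FunO E (ShO D X))) (fst (ShO M (FunO E X)))"
    by (rule functor_Iso[OF forget_functor E.FunSh_Iso[OF X] Modules_category])
  then show "isomorphic C (Go (ShO D X)) (ShO C (Go X))" by (auto intro: isomorphicI simp: ModSh_def)
next
  fix Z assume "zero_object D Z"
  then have Z: "Z \<in> Obj D" "Ide D Z = Zer D Z Z" by (auto simp: D.zero_object_iff)
  have "Ide C (Go Z) = Ga (Ide D Z)" using functorD(2)[OF G_functor Z(1)] by simp
  also have "\<dots> = Zer C (Go Z) (Go Z)" unfolding Z(2) by (rule G_Zer[OF Z(1) Z(1)])
  finally show "zero_object C (Go Z)" using functorD(1)[OF G_functor Z(1)] by (simp add: zero_object_iff)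
next
  fix X Y assume "isomorphic D X Y"
  then show "isomorphic C (Go X) (Go Y)" by (rule functor_isomorphic[OF G_functor _ D.category_axioms])
next
  fix f g h assume T: "(f, g, h) \<in> Tri D"
  note ty = D.TriE[OF T]
  have "(FunA E f, FunA E g, FunSh E (Dom D f) \<cdot>\<^bsub>M\<^esub> FunA E h) \<in> Tri M"
    by (rule E.Fun_Tri[OF T]) (use ty in \<open>simp add: Hom_iff\<close>)
  then have "(Ga f, Ga g, und (FunSh E (Dom D f) \<cdot>\<^bsub>M\<^esub> FunA E h)) \<in> Tri C" by (auto simp: Modules_def)
  moreover have "Dom C (Ga f) = Go (Dom D f)" "Cod C (Ga f) = Go (Cod D f)" "Cod C (Ga g) = Go (Cod D g)"
    using functorD(5,6)[OF G_functor] ty(1,2) by auto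
  ultimately show "\<exists>f' g' h'. (f', g', h') \<in> Tri C \<and> Dom C f' = Go (Dom D f) \<and> Cod C f' = Go (Cod D f) \<and> Cod C g' = Go (Cod D g)"
    by blast
next
  fix I X S inc assume "I \<subseteq> U \<and> small U I \<and> (\<forall>i\<in>I. X i \<in> Obj D) \<and> is_coproduct D I X S inc"
  then show "\<exists>inc'. is_coproduct C I (Go \<circ> X) (Go S) inc'" using G_coproduct[of I X S inc] by blast
qed

lemma F_functor: "is_functor C D (FunO F) (FunA F)"
  using F.Fun_additive by (simp add: is_additive_functor_def)

lemma F_exact: "exact_on_objects U C D (FunO F)"
  unfolding exact_on_objects_def
proof (intro conjI ballI allI impI)
  fix X assume X: "X \<in> Obj C"
  show "FunO F X \<in> Obj D" by (rule functorD(1)[OF F_functor X])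
  show "isomorphic D (FunO F (ShO C X)) (ShO D (FunO F X))" by (rule isomorphicI[OF F.FunSh_Iso[OF X]])
next
  fix Z assume "zero_object C Z"
  then show "zero_object D (FunO F Z)"
    by (rule additive_functorD(5)[OF F.Fun_additive additive_category_axioms D.additive_category_axioms])
next
  fix X Y assume "isomorphic C X Y"
  then show "isomorphic D (FunO F X) (FunO F Y)" by (rule functor_isomorphic[OF F_functor _ category_axioms])
next
  fix f g h assume T: "(f, g, h) \<in> Tri C"
  note ty = TriE[OF T]
  have "(FunA F f, FunA F g, FunSh F (Dom C f) \<cdot>\<^bsub>D\<^esub> FunA F h) \<in> Tri D"
    by (rule F.Fun_Tri[OF T]) (use ty in \<open>simp add: Hom_iff\<close>)
  moreover have "Dom D (FunA F f) = FunO F (Dom C f)" "Cod D (FunA F f) = FunO F (Cod C f)" "Cod D (FunA F g) = FunO F (Cod C g)"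
    using functorD(5,6)[OF F_functor] ty(1,2) by auto
  ultimately show "\<exists>f' g' h'. (f', g', h') \<in> Tri D \<and> Dom D f' = FunO F (Dom C f) \<and> Cod D f' = FunO F (Cod C f) \<and> Cod D g' = FunO F (Cod C g)"
    by blast
next
  fix I X S inc assume "I \<subseteq> U \<and> small U I \<and> (\<forall>i\<in>I. X i \<in> Obj C) \<and> is_coproduct C I X S inc"
  then show "\<exists>inc'. is_coproduct D I (FunO F \<circ> X) (FunO F S) inc'"
    using F_coproducts unfolding preserves_small_coproducts_def by blast
qed

text \<open>
  An arrow from \<open>F c\<close> to a coproduct amounts to an arrow from \<open>c\<close> to the underlying coproduct, so
  it meets only finitely many summands.
\<close>

lemma F_compact:
  assumes c: "c \<in> compact_objects U C"
  shows "FunO F c \<in> compact_objects U D"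
proof (rule D.compact_objectsI)
  have cO: "c \<in> Obj C" by (rule compact_Obj[OF c])
  show FcO: "FunO F c \<in> Obj D" by (rule functorD(1)[OF F_functor cO])
  fix I Y S inc h
  assume I: "I \<subseteq> U" "small U I" and Y: "\<And>i. i \<in> I \<Longrightarrow> Y i \<in> Obj D" and S: "is_coproduct D I Y S inc"
    and h: "h \<in> Hom D (FunO F c) S"
  have GS: "is_coproduct C I (Go \<circ> Y) (Go S) (Ga \<circ> inc)" by (rule G_coproduct[OF I Y S])
  have SO: "S \<in> Obj D" by (rule D.coproduct_Obj[OF S])
  obtain X a where Xa: "FunO E S = (X, a)" by (metis prod.exhaust)
  have Xm: "(X, a) \<in> modules C A" using functorD(1)[OF E_functor SO] Xa by simp
  note xd = modulesD(1-4)[OF Xm]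
  obtain n where n: "n \<in> Iso M (FunO E (FunO F c)) (free_module C A c)" using EF[OF cO] by (auto simp: isomorphic_def)
  have Eh: "FunA E h \<in> Hom M (FunO E (FunO F c)) (X, a)" using functorD(3)[OF E_functor h] Xa by simp
  \<comment> \<open>\<open>h\<close> transported to the free module on \<open>c\<close>; its adjoint
    \<open>be\<close> goes from \<open>c\<close> to the underlying coproduct, where compactness of
    \<open>c\<close> applies.\<close>
  define k where "k = FunA E h \<cdot>\<^bsub>M\<^esub> Inv M n"
  have kH: "k \<in> Hom M (free_module C A c) (X, a)" unfolding k_def by (rule Mod.Comp_Hom[OF Mod.Inv_props(1)[OF n] Eh])
  have kn: "k \<cdot>\<^bsub>M\<^esub> n = FunA E h"
  proof -
    have "k \<cdot>\<^bsub>M\<^esub> n = FunA E h \<cdot>\<^bsub>M\<^esub> (Inv M n \<cdot>\<^bsub>M\<^esub> n)"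
      unfolding k_def by (rule Mod.Comp_assoc[OF Iso_Hom[OF n] Mod.Inv_props(1)[OF n] Eh, symmetric])
    also have "\<dots> = FunA E h" unfolding Mod.Inv_props(2)[OF n] by (rule Mod.Comp_Ide[OF Eh])
    finally show ?thesis .
  qed
  have km: "k \<in> module_Hom C A (free_module C A c) (X, a)" using kH unfolding Modules_Hom_iff by blast
  obtain be where be: "be \<in> Hom C c X" "und k = a \<cdot> (Ide C Ao \<star> be)" by (rule free_arrow[OF km Xm cO])
  have GoS: "Go S = X" using Xa by simp
  obtain J where J: "finite J" "J \<subseteq> I" "coproduct_part C I (Go \<circ> Y) (Go S) (Ga \<circ> inc) J \<cdot> be = be"
  proof -
    have "\<exists>J. finite J \<and> J \<subseteq> I \<and> coproduct_part C I (Go \<circ> Y) (Go S) (Ga \<circ> inc) J \<cdot> be = be"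
      by (rule compact_objectsD[OF c I _ GS]) (use functorD(1)[OF G_functor Y] be(1) GoS in auto)
    then show ?thesis using that by blast
  qed
  let ?p = "coproduct_part D I Y S inc J"
  note pH = D.coproduct_part(1)[OF S, of J] and p_inc = D.coproduct_part(2)[OF S, of _ J]
  have GpH: "Ga ?p \<in> Hom C (Go S) (Go S)" by (rule functorD(3)[OF G_functor pH])
  have "Ga ?p = coproduct_part C I (Go \<circ> Y) (Go S) (Ga \<circ> inc) J"
  proof (rule coproduct_part_unique[OF GS GpH])
    fix i assume i: "i \<in> I"
    have "Ga ?p \<cdot> (Ga \<circ> inc) i = Ga (?p \<cdot>\<^bsub>D\<^esub> inc i)"
      using functorD(7)[OF G_functor, of "inc i" ?p] HomD[OF pH] HomD[OF D.coproduct_inc[OF S i]] by simp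
    also have "\<dots> = Ga (if i \<in> J then inc i else Zer D (Y i) S)" by (simp only: p_inc[OF i])
    also have "\<dots> = (if i \<in> J then (Ga \<circ> inc) i else Zer C ((Go \<circ> Y) i) (Go S))"
      using G_Zer[OF Y[OF i] SO] by simp
    finally show "Ga ?p \<cdot> (Ga \<circ> inc) i = (if i \<in> J then (Ga \<circ> inc) i else Zer C ((Go \<circ> Y) i) (Go S))" .
  qed
  then have pb: "Ga ?p \<cdot> be = be" using J(3) by simp
  have Ep: "FunA E ?p \<in> Hom M (X, a) (X, a)" using functorD(3)[OF E_functor pH] Xa by simp
  then have Epm: "FunA E ?p \<in> module_Hom C A (X, a) (X, a)" unfolding Modules_Hom_iff by blast
  note pd = module_HomD[OF Epm, simplified] and kd = module_HomD[OF km, simplified]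
  have pb': "und (FunA E ?p) \<cdot> be = be" using pb by simp
  \<comment> \<open>The idempotent is a module map, so fixing \<open>be\<close> makes it fix
    \<open>k\<close>; it then fixes the image of \<open>h\<close> under \<open>E\<close>, and by
    faithfulness \<open>h\<close> itself.\<close>
  have "und (FunA E ?p) \<cdot> und k = (und (FunA E ?p) \<cdot> a) \<cdot> (Ide C Ao \<star> be)"
    unfolding be(2) using pd(3-5) xd HomD[OF be(1)] by simp
  also have "\<dots> = a \<cdot> (Ide C Ao \<star> (und (FunA E ?p) \<cdot> be))"
    unfolding pd(6) using pd(3-5) xd HomD[OF be(1)] by simp
  also have "\<dots> = und k" unfolding pb' be(2) ..
  finally have "FunA E ?p \<cdot>\<^bsub>M\<^esub> k = k" using pd(2) kd(1,2,7) by simp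
  then have "(FunA E ?p \<cdot>\<^bsub>M\<^esub> k) \<cdot>\<^bsub>M\<^esub> n = FunA E h" by (simp only: kn)
  then have "FunA E ?p \<cdot>\<^bsub>M\<^esub> FunA E h = FunA E h"
    unfolding Mod.Comp_assoc[OF Iso_Hom[OF n] kH Ep, symmetric] kn .
  then have "FunA E (?p \<cdot>\<^bsub>D\<^esub> h) = FunA E h"
    using functorD(7)[OF E_functor, of h ?p] HomD[OF h] HomD[OF pH] by simp
  then have "?p \<cdot>\<^bsub>D\<^esub> h = h"
    by (rule equivalence_faithful[OF E_equivalence D.Comp_Hom[OF h pH] h _ D.category_axioms])
  then show "\<exists>J. finite J \<and> J \<subseteq> I \<and> coproduct_part D I Y S inc J \<cdot>\<^bsub>D\<^esub> h = h" using J by blast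
qed

text \<open>\<open>E\<close> is monoidal and takes \<open>FunO F c\<close> to a free module up to
  isomorphism, so the product is computed by the split coequalizer.\<close>

lemma projection_formula:
  assumes d: "d \<in> Obj D" and c: "c \<in> Obj C"
  shows "isomorphic C (Go (d \<boxtimes>\<^bsub>D\<^esub> FunO F c)) (Go d \<boxtimes> c)"
proof -
  have Fc: "FunO F c \<in> Obj D" by (rule functorD(1)[OF F_functor c])
  have m: "FunO E d \<in> modules C A" "FunO E (FunO F c) \<in> modules C A"
    using functorD(1)[OF E_functor d] functorD(1)[OF E_functor Fc] by simp_all
  have 1: "isomorphic C (fst (ModTen C A (FunO E d) (FunO E (FunO F c)))) (Go (d \<boxtimes>\<^bsub>D\<^esub> FunO F c))"
    using forget_isomorphic[OF isomorphicI[OF E.FunTen_Iso[OF d Fc]]] by simp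
  have 2: "isomorphic C (fst (ModTen C A (FunO E d) (FunO E (FunO F c)))) (Go d \<boxtimes> c)"
    using ModTen_free[OF m c EF[OF c]] by simp
  show ?thesis by (rule isomorphic_trans[OF isomorphic_sym[OF 1] 2])
qed

text \<open>Separability gives the retraction among modules; the equivalence, being full and
  faithful, reflects it.\<close>

lemma Uni_retract: "retract D (Uni D) (FunO F Ao)"
proof (rule equivalence_retractD[OF E_equivalence D.Uni_Obj _ _ D.category_axioms])
  show "FunO F Ao \<in> Obj D" by (rule functorD(1)[OF F_functor alg_typ(1)])
  have 1: "isomorphic M (FunO E (Uni D)) (Ao, Mul A)"
    using Mod.isomorphic_sym[OF isomorphicI[OF E.FunUni_Iso]] by simp
  have 2: "isomorphic M (free_module C A Ao) (FunO E (FunO F Ao))" by (rule Mod.isomorphic_sym[OF EF[OF alg_typ(1)]])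
  show "retract M (FunO E (Uni D)) (FunO E (FunO F Ao))"
    by (rule Mod.retract_trans[OF Mod.isomorphic_retract[OF 1] Mod.retract_trans[OF separable_retract[OF separable] Mod.isomorphic_retract[OF 2]]])
qed

lemma etale_adjunction: "etale_adjunction U C D (FunO F) Go Ao"
proof unfold_locales
  show "isomorphic C (Go (FunO F c)) (Ao \<boxtimes> c)" if "c \<in> Obj C" for c
    using forget_isomorphic[OF EF[OF that]] by (simp add: free_module_def)
  show "retract D (FunO F X) (FunO F Y)" if "retract C X Y" for X Y
    by (rule functor_retract[OF F_functor that category_axioms])
qed (use F_exact G_exact F_compact projection_formula Uni_retract Und_compact isomorphicI[OF F.FunUni_Iso]
      isomorphicI[OF F.FunTen_Iso] in blast)+

end

theorem theoremF:
  fixes U :: "'u set"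
    and C :: "('o, 'm) ttcat"
    and D :: "('p, 'n) ttcat"
    and F :: "('o, 'm, 'p, 'n) ttfun"
    and P :: "'p set"
  assumes "inaccessible U"
    and "rigidly_compactly_generated U C"
    and "rigidly_compactly_generated U D"
    and "finite_etale U C D F"
    and "noetherian_space (Spc_topology U C)"
    and "noetherian_space (Spc_topology U D)"
    and "P \<in> Spc U D"
    and "Spc_map U C F -` {Spc_map U C F P} \<inter> Spc U D = {P}"
    and "minimality_at U D P"
  shows "minimality_at U C (Spc_map U C F P)"
proof -
  interpret C: rigidly_compactly_generated U C by fact
  interpret D: rigidly_compactly_generated U D by fact
  obtain A E where A: "commutative_algebra C A" "separable C A" "Und A \<in> compact_objects U C"
    and E: "tensor_triangulated_equivalence D (Modules C A) E"
    and iso: "ttfun_isomorphic C (Modules C A) (ttfun_comp (Modules C A) E F) (extension_of_scalars C A)"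
    and F: "tensor_triangulated_functor C D F" "preserves_small_coproducts U C D F"
    using assms(4) unfolding finite_etale_def by blast
  have universe: "compactly_generated_universe_axioms U" using assms(1) by (simp add: compactly_generated_universe_axioms_def)
  have "finite_etale_model U C D A F E"
  proof (intro finite_etale_model.intro finite_etale_model_axioms.intro algebra_modules.intro
      rigidly_compactly_generated_universe.intro compactly_generated_universe.intro)
    show "tensor_triangulated_functor D (Modules C A) E" "is_equivalence D (Modules C A) (FunO E) (FunA E)"
      using E unfolding tensor_triangulated_equivalence_def by auto
    \<comment> \<open>Of the monoidal natural isomorphism the components are retained: they identify
      the image of \<open>c\<close> with the free module on it.\<close>
    show "isomorphic (Modules C A) (FunO E (FunO F c)) (free_module C A c)" if "c \<in> Obj C" for c
      using iso that by (auto simp: ttfun_isomorphic_def ttfun_comp_def extension_of_scalars_def intro: isomorphicI)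
  qed (use assms A F universe C.tensor_triangulated_category_axioms C.compactly_generated_axioms D.compactly_generated_axioms in auto)
  then interpret etale_adjunction U C D "FunO F" "fst \<circ> FunO E" "Und A"
    by (rule finite_etale_model.etale_adjunction)
  have pull: "pull R = Spc_map U C F R" for R unfolding pull_def Spc_map_def ..
  have "R = P" if "R \<in> Spc U D" "pull R = pull P" for R
    using that assms(8) unfolding pull by blast
  then show ?thesis using minimality_descends[OF assms(5,7) _ assms(9)] unfolding pull by blast
qed

end
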